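(* Let $t\mapsto u(t)$ be a solution in $\mathcal{V}(4)$ of \[ i\partial_t u=2J(u)\,\Pi(|u|^2)+\overline{J(u)}\,u^2 .\] Then $u$ is unbounded in some $H^s$, $s>\frac12$, if and only if $K_{u(t)}^2$ has two distinct nonzero eigenvalues of multiplicity $1$, $\sigma_1^2>\sigma_2^2$, and $\ell_1(u)=0$, or equivalently (to $\ell_1(u)=0$) \[ |J|^2=Q^2(Q+\sigma_2^2).\] In that case, for all $s>\frac12$ there exist constants $C_s,C_s'>0$ such that \[\frac1{C_s}e^{C_s'|t|}\le\|u(t)\|_{H^s}\le C_se^{C'_s|t|}\qquad\text{as }t\to\pm\infty .\]
   Context: $\mathbb{T}=\mathbb{R}/2\pi\mathbb{Z}$ carries the normalized measure $dx/2\pi$, and $(f|g)=\int_{\mathbb{T}} f\bar g$. $L^2_+$ is the closed subspace of $L^2(\mathbb{T})$ of functions whose Fourier series is supported on nonnegative frequencies; $\Pi:L^2\to L^2_+$ is the orthogonal projection; $H^s_+:=H^s(\mathbb{T})\cap L^2_+$. Set $J=J(u)=\int_{\mathbb{T}}|u|^2u$ and $Q=Q(u)=\int_{\mathbb{T}}|u|^2$; $|J|$ and $Q$ are conserved by the equation, whose flow is globally well defined on every $H^s_+$, $s>1/2$. For $u\in H^{1/2}_+$, $H_u:L^2_+\to L^2_+$, $H_u(h)=\Pi(u\bar h)$, is the ($\mathbb{C}$-antilinear) Hankel operator, $S$ is multiplication by $e^{ix}$, and $K_u=H_uS$; $K_u^2$ is compact, selfadjoint, nonnegative. $\mathcal{V}(4)$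 is the set of $u\in H^{1/2}_+$ with $\operatorname{rk}(H_u)+\operatorname{rk}(K_u)=4$ (then both ranks equal $2$); it consists of rational functions of $z=e^{ix}$ and is invariant under the flow. Let $\sigma_1^2(u)>\sigma_2^2(u)>\cdots$ be the distinct nonzero eigenvalues of $K_u^2$ (conserved by the flow). Let $u_k^K$ (resp. $w_k^K$) be the orthogonal projection of $u$ (resp. of $\Pi(|u|^2)$) onto $\ker(K_u^2-\sigma_k^2 I)$. The quantity \[\ell_k(u):=(2Q+\sigma_k^2)\|u_k^K\|_{L^2}^2-\|w_k^K\|_{L^2}^2\] is conserved by the flow. *)

theory Defs
  imports "HOL-Analysis.Analysis"
begin

section \<open>Measurable functions on the circle modulo null sets\<close>

text \<open>The circle is modelled by the fundamental domain \<open>[0, 2\<pi>)\<close>. The measure lives on all of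
  \<open>real\<close>, but everything outside the fundamental domain is a null set.\<close>

definition circ :: "real measure" where
  "circ = uniform_measure lborel {0..<2 * pi}"

lemma sets_circ [measurable_cong]: "sets circ = sets borel"
  by (simp add: circ_def)

text \<open>All complex measurable functions, rather than only the square integrable ones, so that
  products such as \<open>u\<^sup>2\<close> or \<open>u * cnj h\<close> stay inside the type.\<close>

quotient_type circ_fun = "real \<Rightarrow> complex" / partial:
  "\<lambda>f g. f \<in> borel_measurable circ \<and> g \<in> borel_measurable circ \<and> (AE x in circ. f x = g x)"
proof (rule part_equivpI)
  show "\<exists>f::real \<Rightarrow> complex. f \<in> borel_measurable circ \<and> f \<in> borel_measurable circ \<and> (AE x in circ. f x = f x)"
    by (rule exI[of _ "\<lambda>_. 0"]) simp
  show "symp (\<lambda>f g :: real \<Rightarrow> complex. f \<in> borel_measurable circ \<and> g \<in> borel_measurable circ \<and> (AE x in circ. f x = g x))"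
    by (auto simp: symp_def elim!: eventually_mono)
  show "transp (\<lambda>f g :: real \<Rightarrow> complex. f \<in> borel_measurable circ \<and> g \<in> borel_measurable circ \<and> (AE x in circ. f x = g x))"
    by (rule transpI, elim conjE, intro conjI) (assumption, assumption, erule (1) eventually_elim2, simp)
qed

instantiation circ_fun :: comm_ring_1
begin

lift_definition zero_circ_fun :: circ_fun is "\<lambda>_. 0" by simp
lift_definition one_circ_fun :: circ_fun is "\<lambda>_. 1" by simp
lift_definition plus_circ_fun :: "circ_fun \<Rightarrow> circ_fun \<Rightarrow> circ_fun" is "\<lambda>f g x. f x + g x"
  by (auto elim: AE_mp)
lift_definition minus_circ_fun :: "circ_fun \<Rightarrow> circ_fun \<Rightarrow> circ_fun" is "\<lambda>f g x. f x - g x"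
  by (auto elim: AE_mp)
lift_definition uminus_circ_fun :: "circ_fun \<Rightarrow> circ_fun" is "\<lambda>f x. - f x"
  by auto
lift_definition times_circ_fun :: "circ_fun \<Rightarrow> circ_fun \<Rightarrow> circ_fun" is "\<lambda>f g x. f x * g x"
  by (auto elim: AE_mp)

lemma circ_not_null: "\<not> (AE x in circ. (0::complex) = 1)"
proof
  have total: "emeasure circ (space circ) = 1"
    unfolding circ_def by (subst emeasure_uniform_measure) (auto simp: ennreal_divide_self)
  assume "AE x in circ. (0::complex) = 1"
  then have "AE x in circ. False" by simp
  then have "emeasure circ (space circ) = 0"
    by (auto simp: AE_iff_null)
  with total show False by simp
qed

instance
proof
  show "(0::circ_fun) \<noteq> 1" by transfer (use circ_not_null in simp)
qed (transfer; auto simp: algebra_simps)+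

end

lift_definition scaleC :: "complex \<Rightarrow> circ_fun \<Rightarrow> circ_fun" (infixr "*\<^sub>C" 75)
  is "\<lambda>c f x. c * f x" by auto

lift_definition circ_cnj :: "circ_fun \<Rightarrow> circ_fun" is "\<lambda>f x. cnj (f x)"
  by (auto intro!: borel_measurable_continuous_on[where f = cnj] continuous_intros)

lift_definition circ_exp :: "int \<Rightarrow> circ_fun" is "\<lambda>n x. cis (of_int n * x)"
  by (simp add: cis_conv_exp)

lift_definition circ_integrable :: "circ_fun \<Rightarrow> bool" is "integrable circ"
  by (elim conjE, rule integrable_cong_AE)

lift_definition circ_integral :: "circ_fun \<Rightarrow> complex" is "integral\<^sup>L circ"
  by (auto intro!: integral_cong_AE)

interpretation circ_fun: vector_space scaleC
  by unfold_locales (transfer; auto simp: algebra_simps)+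

definition inner_circ :: "circ_fun \<Rightarrow> circ_fun \<Rightarrow> complex" where
  "inner_circ f g = circ_integral (f * circ_cnj g)"

definition L2 :: "circ_fun set" where
  "L2 = {f. circ_integrable (f * circ_cnj f)}"

definition norm_L2 :: "circ_fun \<Rightarrow> real" where
  "norm_L2 f = sqrt (Re (inner_circ f f))"

definition fourier :: "circ_fun \<Rightarrow> int \<Rightarrow> complex" where
  "fourier f n = inner_circ f (circ_exp n)"

definition L2_plus :: "circ_fun set" where
  "L2_plus = {f \<in> L2. \<forall>n<0. fourier f n = 0}"

definition Hs :: "real \<Rightarrow> circ_fun set" where
  "Hs s = {f \<in> L2. (\<lambda>n. (1 + (real_of_int n)\<^sup>2) powr s * (cmod (fourier f n))\<^sup>2) summable_on UNIV}"

text \<open>Meaningful on \<open>Hs s\<close> only: an infinite sum that does not converge is \<open>0\<close> by convention.\<close>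

definition norm_Hs :: "real \<Rightarrow> circ_fun \<Rightarrow> real" where
  "norm_Hs s f = sqrt (\<Sum>\<^sub>\<infinity>n. (1 + (real_of_int n)\<^sup>2) powr s * (cmod (fourier f n))\<^sup>2)"

definition Hs_plus :: "real \<Rightarrow> circ_fun set" where
  "Hs_plus s = Hs s \<inter> L2_plus"

definition orth_proj :: "circ_fun set \<Rightarrow> circ_fun \<Rightarrow> circ_fun" where
  "orth_proj V f = (THE g. g \<in> V \<and> (\<forall>h\<in>V. inner_circ (f - g) h = 0))"

text \<open>Orthogonality to \<open>L2_plus\<close> is tested on its orthonormal basis \<open>(circ_exp n)\<close>, \<open>n \<ge> 0\<close>.
  On \<open>L2\<close> this is the orthogonal projection. Unlike \<open>orth_proj L2_plus\<close> it also makes sense for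
  those integrable \<open>f\<close> whose nonnegative Fourier coefficients are square summable; this is needed
  for \<open>u * circ_cnj h\<close> with \<open>u \<in> Hs_plus (1/2)\<close> and \<open>h \<in> L2_plus\<close>, which is in \<open>L\<^sup>1\<close> but
  in general not in \<open>L\<^sup>2\<close>.\<close>

definition szego_proj :: "circ_fun \<Rightarrow> circ_fun" where
  "szego_proj f = (THE g. g \<in> L2_plus \<and> (\<forall>n\<ge>0. inner_circ (f - g) (circ_exp n) = 0))"


section \<open>Hankel operators\<close>

definition hankel :: "circ_fun \<Rightarrow> circ_fun \<Rightarrow> circ_fun" where
  "hankel u h = szego_proj (u * circ_cnj h)"

definition shift :: "circ_fun \<Rightarrow> circ_fun" where
  "shift h = circ_exp 1 * h"

definition shifted_hankel :: "circ_fun \<Rightarrow> circ_fun \<Rightarrow> circ_fun" where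
  "shifted_hankel u h = hankel u (shift h)"

text \<open>The range of an antilinear operator is a complex subspace as well. \<open>circ_fun.dim\<close> is \<open>0\<close> on
  infinite-dimensional spaces, so finiteness of the rank is a separate condition.\<close>

definition finite_rank :: "(circ_fun \<Rightarrow> circ_fun) \<Rightarrow> bool" where
  "finite_rank T \<longleftrightarrow> (\<exists>B. finite B \<and> T ` L2_plus \<subseteq> circ_fun.span B)"

definition rk :: "(circ_fun \<Rightarrow> circ_fun) \<Rightarrow> nat" where
  "rk T = circ_fun.dim (T ` L2_plus)"

definition V_rk :: "nat \<Rightarrow> circ_fun set" where
  "V_rk d = {u \<in> Hs_plus (1/2). finite_rank (hankel u) \<and> finite_rank (shifted_hankel u) \<and>
                rk (hankel u) + rk (shifted_hankel u) = d}"

definition eigenspace_K2 :: "circ_fun \<Rightarrow> real \<Rightarrow> circ_fun set" where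
  "eigenspace_K2 u \<mu> =
     {h \<in> L2_plus. shifted_hankel u (shifted_hankel u h) = of_real \<mu> *\<^sub>C h}"

definition nonzero_eigenvalues_K2 :: "circ_fun \<Rightarrow> real set" where
  "nonzero_eigenvalues_K2 u = {\<mu>. \<mu> \<noteq> 0 \<and> (\<exists>h\<in>eigenspace_K2 u \<mu>. h \<noteq> 0)}"

definition multiplicity_K2 :: "circ_fun \<Rightarrow> real \<Rightarrow> nat" where
  "multiplicity_K2 u \<mu> = circ_fun.dim (eigenspace_K2 u \<mu>)"

text \<open>\<open>sigma_sq u k\<close> is the \<open>k\<close>-th largest (\<open>k \<ge> 1\<close>) nonzero eigenvalue, not counting
  multiplicities; it is the number \<open>\<sigma>\<^sub>k\<^sup>2\<close> itself, not its square root.\<close>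

definition sigma_sq :: "circ_fun \<Rightarrow> nat \<Rightarrow> real" where
  "sigma_sq u k = (THE \<mu>. \<mu> \<in> nonzero_eigenvalues_K2 u \<and>
      finite {\<nu> \<in> nonzero_eigenvalues_K2 u. \<nu> > \<mu>} \<and>
      card {\<nu> \<in> nonzero_eigenvalues_K2 u. \<nu> > \<mu>} + 1 = k)"


section \<open>The quadratic Szego equation\<close>

definition szego_J :: "circ_fun \<Rightarrow> complex" where
  "szego_J u = circ_integral (u * circ_cnj u * u)"

definition szego_Q :: "circ_fun \<Rightarrow> real" where
  "szego_Q u = Re (circ_integral (u * circ_cnj u))"

definition ell :: "nat \<Rightarrow> circ_fun \<Rightarrow> real" where
  "ell k u = (2 * szego_Q u + sigma_sq u k) * (norm_L2 (orth_proj (eigenspace_K2 u (sigma_sq u k)) u))\<^sup>2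
     - (norm_L2 (orth_proj (eigenspace_K2 u (sigma_sq u k)) (szego_proj (u * circ_cnj u))))\<^sup>2"

definition has_Hs_derivative :: "real \<Rightarrow> (real \<Rightarrow> circ_fun) \<Rightarrow> circ_fun \<Rightarrow> real \<Rightarrow> bool" where
  "has_Hs_derivative s u v t \<longleftrightarrow> v \<in> Hs s \<and>
     ((\<lambda>h. norm_Hs s (of_real (1 / h) *\<^sub>C (u (t + h) - u t) - v)) \<longlongrightarrow> 0) (at 0)"

text \<open>Global solutions at regularity \<open>s > 1/2\<close>, the equation holding in \<open>H\<^sup>s\<close>. As \<open>H\<^sup>s\<close> is then an
  algebra, the derivative is automatically continuous in time.\<close>

definition szego_solution :: "real \<Rightarrow> (real \<Rightarrow> circ_fun) \<Rightarrow> bool" where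
  "szego_solution s u \<longleftrightarrow> (\<forall>t. u t \<in> Hs_plus s) \<and>
     (\<forall>t. \<exists>v. has_Hs_derivative s u v t \<and>
        \<i> *\<^sub>C v = (2 * szego_J (u t)) *\<^sub>C szego_proj (u t * circ_cnj (u t)) + cnj (szego_J (u t)) *\<^sub>C (u t)\<^sup>2)"

definition unbounded_Hs :: "real \<Rightarrow> (real \<Rightarrow> circ_fun) \<Rightarrow> bool" where
  "unbounded_Hs s u \<longleftrightarrow> \<not> bounded (range (\<lambda>t. norm_Hs s (u t)))"

definition two_simple_eigenvalues :: "circ_fun \<Rightarrow> bool" where
  "two_simple_eigenvalues u \<longleftrightarrow> card (nonzero_eigenvalues_K2 u) = 2 \<and>
     (\<forall>\<mu>\<in>nonzero_eigenvalues_K2 u. multiplicity_K2 u \<mu> = 1)"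

end

theory Submission
  imports Defs
begin

text \<open>For \<open>u\<close> in \<open>V(4)\<close> the range \<open>V\<close> of \<open>H\<^sub>u\<close> is a plane, invariant under the backward shift
  \<open>S\<^sup>*\<close>, and \<open>K\<^sub>u\<close> acts on it antilinearly; let \<open>e\<^sub>1, e\<^sub>2\<close> be an orthonormal basis with
  \<open>K\<^sub>u e\<^sub>k = \<sigma>\<^sub>k e\<^sub>k\<close>, \<open>a\<^sub>k = (u | e\<^sub>k)\<close> and \<open>b\<^sub>k = (1 | e\<^sub>k)\<close>. The square of \<open>S\<^sup>*\<close> contracts \<open>V\<close> by
  \<open>1 - \<lambda>\<close>, where \<open>\<lambda>\<close> is comparable to \<open>|\<kappa>|\<^sup>2\<close> with \<open>\<kappa> = \<sigma>\<^sub>1 cnj b\<^sub>1 a\<^sub>2 - \<sigma>\<^sub>2 cnj b\<^sub>2 a\<^sub>1\<close>. Hence all Sobolev norms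
  stay bounded as long as \<open>\<kappa>\<close> stays away from \<open>0\<close>.

  If \<open>\<sigma>\<^sub>1 > \<sigma>\<^sub>2\<close> and \<open>\<ell>\<^sub>1 \<noteq> 0\<close>, the algebraic relations between the \<open>a\<^sub>k\<close>, \<open>b\<^sub>k\<close> and the conserved quantities
  exclude \<open>\<kappa> = 0\<close> on a compact set. If \<open>\<sigma>\<^sub>1 = \<sigma>\<^sub>2\<close>, then \<open>|\<kappa>|\<close> is constant. If \<open>\<sigma>\<^sub>1 > \<sigma>\<^sub>2\<close> and \<open>\<ell>\<^sub>1 = 0\<close>, all
  these quantities are rational functions of \<open>x = |a\<^sub>1|\<^sup>2\<close>, and \<open>1/x\<close> solves a linear second order equation,
  so that \<open>x\<close> decays like \<open>exp (- k |t|)\<close>. Then \<open>|\<kappa>|\<^sup>2\<close> is at least of order \<open>x\<close>, while all Fourier coefficients of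
  \<open>e\<^sub>1\<close> have squares at most of order \<open>x\<close>; a fixed part of the momentum \<open>\<Sum> n |u\<^sub>n|\<^sup>2 = \<sigma>\<^sub>1\<^sup>2 + \<sigma>\<^sub>2\<^sup>2\<close> therefore sits at
  frequencies comparable to \<open>1/x\<close>, and the square of the \<open>H\<^sup>s\<close> norm is comparable to \<open>x\<close> to the power \<open>1 - 2s\<close>.\<close>

section \<open>Completeness of the trigonometric system\<close>

text \<open>The equation is posed in Sobolev spaces above 1/2, so every symbol has an absolutely
  convergent Fourier series; the analysis takes place in that algebra, where Parseval and the
  convolution formula follow from uniform convergence. Eigenvectors are chosen separately at each
  time, without continuity in \<open>t\<close>. Only quantities insensitive to the choice are
  differentiated: the mean \<open>c\<close>, \<open>J\<close>, the momentum, and the determinant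
  \<open>d\<close> of the backward shift on the plane, the last as a quotient of minors of Fourier
  coefficients. The system closes because the derivatives of the squared moduli of \<open>d\<close>
  and \<open>c\<close> and of \<open>Re (cnj c * J)\<close> are all multiples of
  \<open>Im (cnj c * J)\<close>. That a vanishing \<open>ell 1\<close> amounts to the equation for
  \<open>J\<close> is a static fact: two norm identities are linear equations for the quantities
  belonging to the two eigenvalues. The obstacle in the bounded case is that \<open>\<kappa>\<close>
  is nonzero at each time but might tend to zero. The delicate limit is \<open>A2 = 0\<close>, where
  the second of these quantities vanishes; it is excluded by an inequality derived while
  \<open>\<kappa>\<close> is nonzero and stable under limits.\<close>

lemma finite_measure_circ: "finite_measure circ"
proof
  have "emeasure circ (space circ) = 1"
    unfolding circ_def by (subst emeasure_uniform_measure) (auto simp: ennreal_divide_self)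
  then show "emeasure circ (space circ) \<noteq> \<infinity>" by simp
qed

lemma measure_circ_space: "measure circ (space circ) = 1"
proof -
  have "emeasure circ (space circ) = 1"
    unfolding circ_def by (subst emeasure_uniform_measure) (auto simp: ennreal_divide_self)
  then show ?thesis by (simp add: measure_def)
qed

interpretation circ: finite_measure circ by (rule finite_measure_circ)

lemma AE_circ_fundamental: "AE x in circ. x \<in> {0..<2*pi}"
  unfolding circ_def by (rule AE_uniform_measureI) auto

lemma measurable_cis [measurable]: "(\<lambda>x. cis (of_int n * x)) \<in> borel_measurable borel"
  by (intro borel_measurable_continuous_onI continuous_intros)

lemma integrable_circ_cis_mult:
  fixes f :: "real \<Rightarrow> complex"
  assumes "integrable circ f" "g \<in> borel_measurable borel" "\<And>x. norm (g x) \<le> B"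
  shows "integrable circ (\<lambda>x. g x * f x)"
proof (rule Bochner_Integration.integrable_bound[of _ "\<lambda>x. B * norm (f x)"])
  show "integrable circ (\<lambda>x. B * norm (f x))"
    using assms(1) by auto
  have "f \<in> borel_measurable circ" using assms(1) by auto
  then show "(\<lambda>x. g x * f x) \<in> borel_measurable circ"
    using assms(2) measurable_cong_sets[OF sets_circ refl] by (intro borel_measurable_times) auto
  have "B \<ge> 0" using assms(3)[of 0] norm_ge_zero order_trans by blast
  then show "AE x in circ. norm (g x * f x) \<le> norm (B * norm (f x))"
    using assms(3) by (auto simp: norm_mult intro!: mult_right_mono)
qed

text \<open>The class of functions with vanishing Fourier coefficients is a module over the
  trigonometric polynomials, hence by Stone--Weierstrass over the continuous functions.\<close>

lemma fourier_zero_continuous: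
  fixes f :: "real \<Rightarrow> complex" and g :: "complex \<Rightarrow> real"
  assumes f: "integrable circ f" "\<And>n::int. (LINT x|circ. cis (of_int n * x) * f x) = 0"
    and g: "continuous_on UNIV g"
  shows "(LINT x|circ. of_real (g (cis x)) * f x) = 0"
proof -
  define Z where "Z = {f. integrable circ f \<and> (\<forall>n::int. (LINT x|circ. cis (of_int n * x) * f x) = (0::complex))}"
  define P where "P = (\<lambda>r::complex\<Rightarrow>real. continuous_on UNIV r \<and> (\<forall>f\<in>Z. (\<lambda>x. of_real (r (cis x)) * f x) \<in> Z))"
  have Zadd: "(\<lambda>x. p x + q x) \<in> Z" if "p \<in> Z" "q \<in> Z" for p q
  proof -
    have "integrable circ (\<lambda>x. cis (of_int n * x) * p x)" "integrable circ (\<lambda>x. cis (of_int n * x) * q x)" for n :: int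
      using that by (auto simp: Z_def intro!: integrable_circ_cis_mult[where B=1])
    then show ?thesis using that by (auto simp: Z_def distrib_left)
  qed
  have Zscale: "(\<lambda>x. c * p x) \<in> Z" if "p \<in> Z" for p c
    using that by (auto simp: Z_def mult.left_commute)
  have Zcis: "(\<lambda>x. cis (of_int k * x) * p x) \<in> Z" if "p \<in> Z" for p and k :: int
  proof -
    have eq: "(\<lambda>x. cis (of_int n * x) * (cis (of_int k * x) * p x)) = (\<lambda>x. cis (of_int (n+k) * x) * p x)" for n
      by (simp add: cis_mult distrib_right flip: mult.assoc)
    show ?thesis
      unfolding Z_def mem_Collect_eq eq
      using that by (auto simp: Z_def intro!: integrable_circ_cis_mult[where B=1] simp del: of_int_add)
  qed
  \<comment> \<open>On the unit circle real and imaginary part are combinations of \<open>z\<close>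
    and its inverse, that is, of two frequency shifts, under which \<open>Z\<close> is stable.
    Together they separate points, as Stone--Weierstrass demands.\<close>
  have PRe: "P Re"
    unfolding P_def
  proof (intro conjI ballI continuous_intros)
    fix p assume p: "p \<in> Z"
    have "of_real (Re (cis x)) * p x = (1/2) * (cis (of_int 1 * x) * p x) + (1/2) * (cis (of_int (-1) * x) * p x)" for x
      by (simp add: complex_eq_iff field_simps)
    then show "(\<lambda>x. complex_of_real (Re (cis x)) * p x) \<in> Z"
      using Zadd[OF Zscale[OF Zcis[OF p, of 1]] Zscale[OF Zcis[OF p, of "-1"]]] by presburger
  qed
  have PIm: "P Im"
    unfolding P_def
  proof (intro conjI ballI continuous_intros)
    fix p assume p: "p \<in> Z"
    have "of_real (Im (cis x)) * p x = (-\<i>/2) * (cis (of_int 1 * x) * p x) + (\<i>/2) * (cis (of_int (-1) * x) * p x)" for x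
      by (simp add: complex_eq_iff field_simps)
    then show "(\<lambda>x. complex_of_real (Im (cis x)) * p x) \<in> Z"
      using Zadd[OF Zscale[OF Zcis[OF p, of 1]] Zscale[OF Zcis[OF p, of "-1"]]] by presburger
  qed
  have f_Z: "f \<in> Z" using f by (simp add: Z_def)
  have mz: "(\<lambda>x. g (cis x)) \<in> borel_measurable borel" if "continuous_on UNIV g" for g :: "complex \<Rightarrow> real"
    by (intro borel_measurable_continuous_onI continuous_on_compose2[OF that] continuous_intros) auto
  have gint: "integrable circ (\<lambda>x. of_real (g (cis x)) * f x)" if "continuous_on UNIV g" for g :: "complex \<Rightarrow> real"
  proof -
    have "compact (g ` sphere 0 1)"
      by (intro compact_continuous_image continuous_on_subset[OF that]) auto
    then obtain B where "\<forall>x\<in>g ` sphere 0 1. norm x \<le> B"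
      using compact_imp_bounded bounded_iff by metis
    then have "norm (complex_of_real (g (cis x))) \<le> B" for x by auto
    then show ?thesis using f(1) mz[OF that]
      by (intro integrable_circ_cis_mult) auto
  qed
  have small: "norm (LINT x|circ. of_real (g (cis x)) * f x) \<le> e * (LINT x|circ. norm (f x))" if e: "e > 0" for e
  proof -
    have "\<exists>r. P r \<and> (\<forall>x\<in>sphere 0 1. \<bar>g x - r x\<bar> < e)"
    proof (rule Stone_Weierstrass_HOL)
      show "P (\<lambda>x. c)" for c using Zscale by (auto simp: P_def)
      show "continuous_on (sphere 0 1) f" if "P f" for f
        using that continuous_on_subset unfolding P_def by blast
      show "P (\<lambda>x. f x + g x)" if "P f \<and> P g" for f g
        using that Zadd by (auto simp: P_def distrib_right intro!: continuous_intros)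
      show "P (\<lambda>x. f x * g x)" if "P f \<and> P g" for f g
        using that by (auto simp: P_def mult.assoc intro!: continuous_intros)
      show "\<exists>f. P f \<and> f x \<noteq> f y" if "x \<in> sphere 0 1 \<and> y \<in> sphere 0 1 \<and> x \<noteq> y" for x y
        using that PRe PIm complex_eq_iff by blast
    qed (use e continuous_on_subset[OF g] in auto)
    then obtain r where r: "P r" "\<And>x. x\<in>sphere 0 1 \<Longrightarrow> \<bar>g x - r x\<bar> < e" by auto
    have "(\<lambda>x. of_real (r (cis x)) * f x) \<in> Z" using r f_Z by (auto simp: P_def)
    then have r0: "(LINT x|circ. of_real (r (cis x)) * f x) = 0"
      unfolding Z_def by (auto dest!: spec[of _ 0])
    have "(LINT x|circ. of_real (g (cis x)) * f x) = (LINT x|circ. of_real (g (cis x)) * f x) - (LINT x|circ. of_real (r (cis x)) * f x)"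
      by (simp add: r0)
    also have "\<dots> = (LINT x|circ. of_real (g (cis x)) * f x - of_real (r (cis x)) * f x)"
      using gint[OF g] gint[of r] r(1) by (subst Bochner_Integration.integral_diff) (auto simp: P_def)
    also have "\<dots> = (LINT x|circ. of_real (g (cis x) - r (cis x)) * f x)"
      by (simp add: algebra_simps)
    also have "norm \<dots> \<le> (LINT x|circ. norm (of_real (g (cis x) - r (cis x)) * f x))"
      by (rule integral_norm_bound)
    also have "\<dots> \<le> (LINT x|circ. e * norm (f x))"
    proof (rule integral_mono)
      show "norm (complex_of_real (g (cis x) - r (cis x)) * f x) \<le> e * norm (f x)" for x
        using r(2)[of "cis x", THEN less_imp_le] by (auto simp: norm_mult simp del: of_real_diff intro!: mult_right_mono)
      show "integrable circ (\<lambda>x. norm (complex_of_real (g (cis x) - r (cis x)) * f x))"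
        using gint[of "\<lambda>x. g x - r x"] g r(1) by (auto simp: P_def intro!: continuous_intros integrable_norm)
    qed (use f(1) in auto)
    finally show ?thesis by simp
  qed
  have "norm (LINT x|circ. of_real (g (cis x)) * f x) \<le> 0"
  proof (rule field_le_epsilon)
    fix e :: real assume "e > 0"
    define I where "I = (LINT x|circ. norm (f x))"
    have p: "I \<ge> 0" by (simp add: I_def)
    then have "e / (I + 1) > 0" using \<open>e > 0\<close> by simp
    from small[OF this] have "norm (LINT x|circ. of_real (g (cis x)) * f x) \<le> e / (I + 1) * I"
      by (simp only: I_def)
    also have "\<dots> = e * (I / (I + 1))" by simp
    also have "\<dots> \<le> e * 1"
      using p \<open>e > 0\<close> by (intro mult_left_mono) (auto simp: divide_simps)
    finally show "norm (LINT x|circ. of_real (g (cis x)) * f x) \<le> 0 + e" by simp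
  qed
  then show ?thesis by simp
qed

text \<open>Continuous functions of \<open>cis x\<close> approximate indicators of arcs, so the
  integral of \<open>f\<close> over each half line vanishes. Half lines form a pi-system generating
  the Borel sets, and \<open>density_zero\<close> concludes.\<close>

lemma fourier_zero_AE:
  fixes f :: "real \<Rightarrow> complex"
  assumes f: "integrable circ f" "\<And>n::int. (LINT x|circ. cis (of_int n * x) * f x) = 0"
  shows "AE x in circ. f x = 0"
proof (rule circ.density_zero[OF f(1)])
  have fm[measurable]: "f \<in> borel_measurable circ" using f(1) by auto
  have full: "(LINT x|circ. f x) = 0" using f(2)[of 0] by simp
  have atMost: "(LINT x:{..a}|circ. f x) = 0" for a
  proof -
    \<comment> \<open>The measure charges only \<open>{0..<2 * pi}\<close>: in the first two cases
      the half line is null or of full measure. In the last it is, up to a null set, the preimage of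
      a closed arc.\<close>
    consider "a < 0" | "a \<ge> 2 * pi" | "0 \<le> a" "a < 2 * pi" by linarith
    then show ?thesis
    proof cases
      case 1
      have "(LINT x:{..a}|circ. f x) = (LINT x|circ. 0)"
        unfolding set_lebesgue_integral_def
        by (rule integral_cong_AE) (use AE_circ_fundamental 1 in \<open>auto split: split_indicator\<close>)
      then show ?thesis by simp
    next
      case 2
      have "(LINT x:{..a}|circ. f x) = (LINT x|circ. f x)"
        unfolding set_lebesgue_integral_def
        by (rule integral_cong_AE) (use AE_circ_fundamental 2 in \<open>auto split: split_indicator\<close>)
      then show ?thesis using full by simp
    next
      case 3
      define C where "C = cis ` {0..a}"
      have "compact C" unfolding C_def by (intro compact_continuous_image continuous_intros) auto
      then have C: "closed C" "C \<noteq> {}" using 3 by (auto simp: compact_imp_closed C_def)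
      have mem: "cis x \<in> C \<longleftrightarrow> x \<le> a" if "x \<in> {0..<2*pi}" for x
      proof
        assume "cis x \<in> C"
        then obtain y where y: "y \<in> {0..a}" "cis x = cis y" unfolding C_def by auto
        then have "x = y"
          using that 3 Arg2pi_unique[of 1 x "cis x"] Arg2pi_unique[of 1 y "cis x"] by (auto simp: cis_conv_exp)
        then show "x \<le> a" using y by simp
      qed (use that in \<open>auto simp: C_def\<close>)
      \<comment> \<open>Tent functions of the distance to the arc; they decrease to its indicator
        because the arc is closed.\<close>
      define g where "g = (\<lambda>k::nat. \<lambda>z. max 0 (1 - real k * infdist z C))"
      have g0: "(LINT x|circ. of_real (g k (cis x)) * f x) = 0" for k
        by (rule fourier_zero_continuous[OF f]) (auto simp: g_def intro!: continuous_intros)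
      have "(\<lambda>k. LINT x|circ. of_real (g k (cis x)) * f x) \<longlonglongrightarrow> (LINT x|circ. indicator {..a} x *\<^sub>R f x)"
      proof (rule integral_dominated_convergence[of _ _ _ "\<lambda>x. norm (f x)"])
        have gm: "(\<lambda>x. g k (cis x)) \<in> borel_measurable borel" for k
          unfolding g_def by (intro borel_measurable_continuous_onI continuous_intros)
        then have [measurable]: "(\<lambda>x. g k (cis x)) \<in> borel_measurable circ" for k
          using measurable_cong_sets[OF sets_circ refl] by blast
        show "(\<lambda>x. complex_of_real (g k (cis x)) * f x) \<in> borel_measurable circ" for k
          by (intro borel_measurable_times borel_measurable_of_real) measurable
        show "AE x in circ. (\<lambda>k. complex_of_real (g k (cis x)) * f x) \<longlonglongrightarrow> indicator {..a} x *\<^sub>R f x"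
          using AE_circ_fundamental
        proof eventually_elim
          case (elim x)
          have "(\<lambda>k. g k (cis x)) \<longlonglongrightarrow> indicator {..a} x"
          proof (cases "cis x \<in> C")
            case True
            then show ?thesis using mem[OF elim] by (simp add: g_def)
          next
            case False
            then have pos: "infdist (cis x) C > 0"
              using C by (metis in_closed_iff_infdist_zero infdist_nonneg less_eq_real_def)
            obtain N where N: "1 < real N * infdist (cis x) C"
              using reals_Archimedean3[OF pos] by blast
            have "g k (cis x) = 0" if "k \<ge> N" for k
            proof -
              have "real N * infdist (cis x) C \<le> real k * infdist (cis x) C"
                using that pos by (intro mult_right_mono) auto
              then show ?thesis using N by (simp add: g_def)
            qed
            then show ?thesis using False mem[OF elim]
              by (intro tendsto_eventually) (auto simp: eventually_at_top_linorder)
          qed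
          then have "(\<lambda>k. complex_of_real (g k (cis x)) * f x) \<longlonglongrightarrow> of_real (indicator {..a} x) * f x"
            by (intro tendsto_intros)
          then show ?case by (simp add: scaleR_conv_of_real)
        qed
        show "AE x in circ. norm (complex_of_real (g k (cis x)) * f x) \<le> norm (f x)" for k
          by (auto simp: norm_mult g_def max_def mult_left_le_one_le infdist_nonneg)
      qed (use f(1) in auto)
      then show ?thesis
        unfolding g0 set_lebesgue_integral_def by (metis LIMSEQ_unique tendsto_const)
    qed
  qed
  show "(LINT x:A|circ. f x) = 0" if A: "A \<in> sets circ" for A
  proof -
    have "Int_stable (range (\<lambda>a. {..a::real}))"
      by (auto simp: Int_stable_def)
    moreover have "range (\<lambda>a. {..a::real}) \<subseteq> Pow UNIV" by simp
    moreover have "A \<in> sigma_sets UNIV (range (\<lambda>a. {..a::real}))"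
      using A by (simp add: sets_circ borel_eq_atMost)
    ultimately show ?thesis
    proof (induction A rule: sigma_sets_induct_disjoint)
      case (basic A)
      then show ?case using atMost by auto
    next
      case (compl A)
      have "A \<in> sets circ" using compl by (simp add: sets_circ borel_eq_atMost)
      then have "(LINT x:UNIV|circ. f x) = (LINT x:A|circ. f x) + (LINT x:UNIV - A|circ. f x)"
        using f(1) sets.top[of circ]
        by (subst set_integral_Un[symmetric])
          (auto simp: set_integrable_def sets_circ intro!: integrable_mult_indicator)
      then show ?case using compl full by (simp add: set_lebesgue_integral_def)
    next
      case (union A)
      have "range A \<subseteq> sets circ" using union by (simp add: sets_circ borel_eq_atMost)
      then have "(LINT x:(\<Union>i. A i)|circ. f x) = (\<Sum>i. (LINT x:A i|circ. f x))"
        using f(1) union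
        by (intro lebesgue_integral_countable_add)
          (auto simp: set_integrable_def disjoint_family_on_def intro!: integrable_mult_indicator sets.countable_UN)
      then show ?case using union by simp
    qed (auto simp: set_lebesgue_integral_def)
  qed
qed

section \<open>The algebra of functions on the circle\<close>

lemma borel_measurable_cnj' [simp, measurable (raw)]:
  "f \<in> borel_measurable M \<Longrightarrow> (\<lambda>x. cnj (f x)) \<in> borel_measurable M"
  by (auto intro!: borel_measurable_continuous_on[where f = cnj] continuous_intros)

lemma circ_cnj_mult [simp]: "circ_cnj (f * g) = circ_cnj f * circ_cnj g"
  by transfer simp

lemma circ_cnj_add [simp]: "circ_cnj (f + g) = circ_cnj f + circ_cnj g"
  by transfer simp

lemma circ_cnj_diff [simp]: "circ_cnj (f - g) = circ_cnj f - circ_cnj g"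
  by transfer simp

lemma circ_cnj_uminus [simp]: "circ_cnj (- f) = - circ_cnj f"
  by transfer simp

lemma circ_cnj_circ_cnj [simp]: "circ_cnj (circ_cnj f) = f"
  by transfer simp

lemma circ_cnj_0 [simp]: "circ_cnj 0 = 0"
  by transfer simp

lemma circ_cnj_1 [simp]: "circ_cnj 1 = 1"
  by transfer simp

lemma circ_cnj_scaleC [simp]: "circ_cnj (c *\<^sub>C f) = cnj c *\<^sub>C circ_cnj f"
  by transfer simp

lemma continuous_imp_measurable_circ:
  "continuous_on UNIV f \<Longrightarrow> f \<in> borel_measurable circ"
  using borel_measurable_continuous_onI measurable_cong_sets[OF sets_circ refl] by blast

lemma circ_cnj_exp [simp]: "circ_cnj (circ_exp n) = circ_exp (-n)"
  by transfer (auto simp: cis_cnj intro!: continuous_imp_measurable_circ continuous_intros)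

lemma circ_exp_mult: "circ_exp m * circ_exp n = circ_exp (m + n)"
  by transfer (auto simp: cis_mult distrib_right intro!: continuous_imp_measurable_circ continuous_intros)

lemma circ_exp_mult_left: "circ_exp m * (circ_exp n * f) = circ_exp (m + n) * f"
  by (simp add: circ_exp_mult flip: mult.assoc)

lemma circ_exp_0 [simp]: "circ_exp 0 = 1"
  by transfer simp

lemma scaleC_mult_left [simp]: "(c *\<^sub>C f) * g = c *\<^sub>C (f * g)"
  by transfer (simp add: mult_ac)

lemma scaleC_mult_right [simp]: "f * (c *\<^sub>C g) = c *\<^sub>C (f * g)"
  by transfer (simp add: mult_ac)

lemma scaleC_simps [simp]:
  "c *\<^sub>C (d *\<^sub>C f) = (c * d) *\<^sub>C f" "1 *\<^sub>C f = f" "0 *\<^sub>C f = 0" "c *\<^sub>C 0 = 0"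
  by simp_all

lemma scaleC_uminus [simp]: "(- c) *\<^sub>C f = - (c *\<^sub>C f)" "c *\<^sub>C (- f) = - (c *\<^sub>C f)"
  by simp_all

lemma circ_integrable_add [intro]: "circ_integrable f \<Longrightarrow> circ_integrable g \<Longrightarrow> circ_integrable (f + g)"
  by transfer simp

lemma circ_integrable_diff [intro]: "circ_integrable f \<Longrightarrow> circ_integrable g \<Longrightarrow> circ_integrable (f - g)"
  by transfer simp

lemma circ_integrable_scaleC [intro]: "circ_integrable f \<Longrightarrow> circ_integrable (c *\<^sub>C f)"
  by transfer simp

lemma circ_integrable_cnj [intro]: "circ_integrable f \<Longrightarrow> circ_integrable (circ_cnj f)"
  by transfer simp

lemma circ_integrable_0 [simp, intro]: "circ_integrable 0"
  by transfer simp

lemma circ_integral_add: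
  "circ_integrable f \<Longrightarrow> circ_integrable g \<Longrightarrow> circ_integral (f + g) = circ_integral f + circ_integral g"
  by transfer simp

lemma circ_integral_diff:
  "circ_integrable f \<Longrightarrow> circ_integrable g \<Longrightarrow> circ_integral (f - g) = circ_integral f - circ_integral g"
  by transfer simp

lemma circ_integral_scaleC [simp]: "circ_integral (c *\<^sub>C f) = c * circ_integral f"
  by transfer simp

lemma circ_integral_0 [simp]: "circ_integral 0 = 0"
  by transfer simp

lemma circ_integral_cnj: "circ_integral (circ_cnj f) = cnj (circ_integral f)"
  by transfer simp

subsection \<open>Essentially bounded functions\<close>

text \<open>A relation with an explicit bound instead of an essential supremum, since the bounds
  that occur come with the function: 1 for exponentials, sums of moduli of Fourier coefficients
  otherwise.\<close>

lift_definition ess_bounded_by :: "circ_fun \<Rightarrow> real \<Rightarrow> bool"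
  is "\<lambda>f B. AE x in circ. norm (f x) \<le> B"
  by (intro ext iffI; elim conjE; erule (1) eventually_elim2; simp)

lemma circ_not_AE_False: "\<not> (AE x in circ. False)"
  using circ_not_null by (metis (mono_tags, lifting) eventually_mono)

lemma ess_bounded_by_nonneg:
  assumes "ess_bounded_by f B" shows "0 \<le> B"
proof (rule ccontr)
  assume "\<not> 0 \<le> B"
  with assms have "AE x in circ. False"
  proof transfer
    fix f :: "real \<Rightarrow> complex" and B
    assume "AE x in circ. norm (f x) \<le> B" "\<not> 0 \<le> B"
    then show "AE x in circ. False"
      by (auto elim!: eventually_mono dest: order_trans[OF norm_ge_zero])
  qed
  then show False using circ_not_AE_False by simp
qed

lemma ess_bounded_by_mult:
  "ess_bounded_by f A \<Longrightarrow> ess_bounded_by g B \<Longrightarrow> ess_bounded_by (f * g) (A * B)"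
proof -
  assume *: "ess_bounded_by f A" "ess_bounded_by g B"
  then have "A \<ge> 0" using ess_bounded_by_nonneg by blast
  then show ?thesis using *
    by transfer (elim conjE, erule (1) eventually_elim2, auto simp: norm_mult intro!: mult_mono)
qed

lemma ess_bounded_by_cnj [simp]: "ess_bounded_by (circ_cnj f) A \<longleftrightarrow> ess_bounded_by f A"
  by transfer simp

lemma ess_bounded_by_exp: "ess_bounded_by (circ_exp n) 1"
  by transfer simp

lemma circ_integrable_mult_bounded:
  assumes "ess_bounded_by f B" "circ_integrable g"
  shows "circ_integrable (f * g)" 
  using assms
proof transfer
  fix f g :: "real \<Rightarrow> complex" and B
  assume *: "f \<in> borel_measurable circ \<and> f \<in> borel_measurable circ \<and> (AE x in circ. f x = f x)"
    "AE x in circ. cmod (f x) \<le> B" "integrable circ g"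
  show "integrable circ (\<lambda>x. f x * g x)"
  proof (rule Bochner_Integration.integrable_bound[of _ "\<lambda>x. B * norm (g x)"])
    show "(\<lambda>x. f x * g x) \<in> borel_measurable circ"
      using * by (intro borel_measurable_times) auto
    show "AE x in circ. cmod (f x * g x) \<le> norm (B * cmod (g x))"
      using *(2) by eventually_elim (auto simp: norm_mult abs_mult intro!: mult_right_mono)
  qed (use * in auto)
qed

lemma circ_integrable_1 [simp, intro]: "circ_integrable 1"
  by transfer simp

lemma circ_integrable_bounded: "ess_bounded_by f B \<Longrightarrow> circ_integrable f"
  using circ_integrable_mult_bounded[of f B 1] by simp

lemma circ_integral_1 [simp]: "circ_integral 1 = 1"
  by transfer (simp add: measure_circ_space)

lift_definition circ_L1 :: "circ_fun \<Rightarrow> real" is "\<lambda>f. LINT x|circ. norm (f x)"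
  by (auto intro!: integral_cong_AE elim: AE_mp)

lemma norm_circ_integral_mult_le:
  assumes "ess_bounded_by f B" "circ_integrable g"
  shows "norm (circ_integral (f * g)) \<le> B * circ_L1 g"
proof -
  have "circ_integrable (f * g)" using assms by (rule circ_integrable_mult_bounded)
  with assms show ?thesis
  proof transfer
    fix f g :: "real \<Rightarrow> complex" and B
    assume *: "f \<in> borel_measurable circ \<and> f \<in> borel_measurable circ \<and> (AE x in circ. f x = f x)"
      "AE x in circ. cmod (f x) \<le> B" "integrable circ g" "integrable circ (\<lambda>x. f x * g x)"
    have "norm (LINT x|circ. f x * g x) \<le> (LINT x|circ. norm (f x * g x))"
      by (rule integral_norm_bound)
    also have "\<dots> \<le> (LINT x|circ. B * norm (g x))"
    proof (rule integral_mono_AE)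
      show "AE x in circ. norm (f x * g x) \<le> B * norm (g x)"
        using *(2) by eventually_elim (auto simp: norm_mult intro!: mult_right_mono)
    qed (use * in \<open>auto intro!: integrable_norm\<close>)
    finally show "norm (LINT x|circ. f x * g x) \<le> B * (LINT x|circ. norm (g x))" by simp
  qed
qed

subsection \<open>Square integrable functions\<close>

lemma L2_mult_integrable:
  assumes "f \<in> L2" "g \<in> L2" shows "circ_integrable (f * g)"
  using assms unfolding L2_def mem_Collect_eq
proof transfer
  fix f g :: "real \<Rightarrow> complex"
  assume f: "f \<in> borel_measurable circ \<and> f \<in> borel_measurable circ \<and> (AE x in circ. f x = f x)"
   and g: "g \<in> borel_measurable circ \<and> g \<in> borel_measurable circ \<and> (AE x in circ. g x = g x)"
   and i: "integrable circ (\<lambda>x. f x * cnj (f x))" "integrable circ (\<lambda>x. g x * cnj (g x))"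
  show "integrable circ (\<lambda>x. f x * g x)"
  proof (rule Bochner_Integration.integrable_bound)
    show "integrable circ (\<lambda>x. norm (f x * cnj (f x)) + norm (g x * cnj (g x)))"
      by (intro Bochner_Integration.integrable_add integrable_norm i)
    show "(\<lambda>x. f x * g x) \<in> borel_measurable circ"
      using f g by (intro borel_measurable_times) auto
    have "norm (f x * g x) \<le> norm (norm (f x * cnj (f x)) + norm (g x * cnj (g x)))" for x
    proof -
      have "2 * (norm (f x) * norm (g x)) \<le> norm (f x)^2 + norm (g x)^2"
        using zero_le_power2[of "norm (f x) - norm (g x)"] by (simp add: power2_diff)
      moreover have "0 \<le> norm (f x) * norm (g x)" by simp
      ultimately have "norm (f x) * norm (g x) \<le> norm (f x)^2 + norm (g x)^2" by linarith
      then show ?thesis by (simp add: norm_mult power2_eq_square)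
    qed
    then show "AE x in circ. norm (f x * g x) \<le> norm (norm (f x * cnj (f x)) + norm (g x * cnj (g x)))" by simp
  qed
qed

lemma L2_cnj [simp]: "circ_cnj f \<in> L2 \<longleftrightarrow> f \<in> L2"
  by (simp add: L2_def mult.commute)

lemma L2_bounded: "ess_bounded_by f B \<Longrightarrow> f \<in> L2"
  using circ_integrable_bounded[OF ess_bounded_by_mult[of f B "circ_cnj f" B]] by (simp add: L2_def)

lemma L2_exp [simp]: "circ_exp n \<in> L2"
  by (rule L2_bounded[OF ess_bounded_by_exp])

lemma L2_1 [simp]: "1 \<in> L2"
  using L2_exp[of 0] by simp

lemma L2_inner_integrable [intro]: "f \<in> L2 \<Longrightarrow> g \<in> L2 \<Longrightarrow> circ_integrable (f * circ_cnj g)"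
  by (rule L2_mult_integrable) auto

lemma L2_integrable: "f \<in> L2 \<Longrightarrow> circ_integrable f"
  using L2_mult_integrable[of f 1] by simp

lemma L2_add [intro]:
  assumes "f \<in> L2" "g \<in> L2" shows "f + g \<in> L2"
proof -
  have "circ_integrable ((f * circ_cnj f + f * circ_cnj g) + (g * circ_cnj f + g * circ_cnj g))"
    by (intro circ_integrable_add L2_inner_integrable assms)
  also have "(f * circ_cnj f + f * circ_cnj g) + (g * circ_cnj f + g * circ_cnj g) = (f + g) * circ_cnj (f + g)"
    by (simp only: circ_cnj_add distrib_left distrib_right add_ac)
  finally show ?thesis by (simp only: L2_def mem_Collect_eq)
qed

lemma L2_scaleC [intro]: "f \<in> L2 \<Longrightarrow> c *\<^sub>C f \<in> L2"
  by (simp add: L2_def circ_integrable_scaleC)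

lemma L2_uminus [intro]: "f \<in> L2 \<Longrightarrow> - f \<in> L2"
  using L2_scaleC[of f "-1"] by simp

lemma L2_diff [intro]: "f \<in> L2 \<Longrightarrow> g \<in> L2 \<Longrightarrow> f - g \<in> L2"
  using L2_add[of f "- g"] L2_uminus[of g] by simp

lemma L2_0 [simp, intro]: "0 \<in> L2"
  by (simp add: L2_def)

lemma L2_sum [intro]: "(\<And>i. i \<in> A \<Longrightarrow> f i \<in> L2) \<Longrightarrow> sum f A \<in> L2"
  by (induction A rule: infinite_finite_induct) auto

lemma L2_mult_bounded:
  assumes "ess_bounded_by f B" "g \<in> L2" shows "f * g \<in> L2"
proof -
  have "ess_bounded_by (f * circ_cnj f) (B * B)"
    using assms by (intro ess_bounded_by_mult) auto
  then have "circ_integrable ((f * circ_cnj f) * (g * circ_cnj g))"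
    by (rule circ_integrable_mult_bounded) (use assms in auto)
  then show ?thesis by (simp add: L2_def mult_ac)
qed

lemma L2_exp_mult [intro]: "g \<in> L2 \<Longrightarrow> circ_exp n * g \<in> L2"
  by (rule L2_mult_bounded[OF ess_bounded_by_exp])

lemma inner_add_left: "f \<in> L2 \<Longrightarrow> g \<in> L2 \<Longrightarrow> h \<in> L2 \<Longrightarrow> inner_circ (f + g) h = inner_circ f h + inner_circ g h"
  by (auto simp: inner_circ_def distrib_right intro!: circ_integral_add)

lemma inner_diff_left: "f \<in> L2 \<Longrightarrow> g \<in> L2 \<Longrightarrow> h \<in> L2 \<Longrightarrow> inner_circ (f - g) h = inner_circ f h - inner_circ g h"
  by (auto simp: inner_circ_def left_diff_distrib intro!: circ_integral_diff)

lemma inner_scaleC_left [simp]: "inner_circ (c *\<^sub>C f) h = c * inner_circ f h"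
  by (simp add: inner_circ_def)

lemma inner_cnj: "inner_circ g f = cnj (inner_circ f g)"
  unfolding inner_circ_def by (simp flip: circ_integral_cnj add: mult.commute)

lemma inner_add_right: "f \<in> L2 \<Longrightarrow> g \<in> L2 \<Longrightarrow> h \<in> L2 \<Longrightarrow> inner_circ h (f + g) = inner_circ h f + inner_circ h g"
  by (metis complex_cnj_add inner_add_left inner_cnj)

lemma inner_diff_right: "f \<in> L2 \<Longrightarrow> g \<in> L2 \<Longrightarrow> h \<in> L2 \<Longrightarrow> inner_circ h (f - g) = inner_circ h f - inner_circ h g"
  by (metis complex_cnj_diff inner_diff_left inner_cnj)

lemma inner_scaleC_right [simp]: "inner_circ h (c *\<^sub>C f) = cnj c * inner_circ h f"
  by (simp add: inner_circ_def)

lemma inner_0_left [simp]: "inner_circ 0 h = 0" and inner_0_right [simp]: "inner_circ h 0 = 0"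
  by (simp_all add: inner_circ_def)

lemma inner_sum_left: "(\<And>i. i \<in> A \<Longrightarrow> f i \<in> L2) \<Longrightarrow> h \<in> L2 \<Longrightarrow> inner_circ (sum f A) h = (\<Sum>i\<in>A. inner_circ (f i) h)"
  by (induction A rule: infinite_finite_induct) (auto simp: inner_add_left L2_sum)

lemma inner_mult_swap: "inner_circ (f * circ_cnj g) h = inner_circ (f * circ_cnj h) g"
  by (simp add: inner_circ_def mult_ac)

lemma inner_self_real: "Im (inner_circ f f) = 0" "Re (inner_circ f f) \<ge> 0"
proof -
  have "inner_circ f f = of_real (Re (inner_circ f f)) \<and> Re (inner_circ f f) \<ge> 0"
    unfolding inner_circ_def
  proof transfer
    fix f :: "real \<Rightarrow> complex"
    have "(LINT x|circ. f x * cnj (f x)) = complex_of_real (LINT x|circ. (norm (f x))\<^sup>2)"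
      unfolding complex_norm_square[symmetric] integral_complex_of_real ..
    then show "(LINT x|circ. f x * cnj (f x)) = complex_of_real (Re (LINT x|circ. f x * cnj (f x)))
       \<and> 0 \<le> Re (LINT x|circ. f x * cnj (f x))"
      by simp
  qed
  then show "Im (inner_circ f f) = 0" "Re (inner_circ f f) \<ge> 0" by (metis Im_complex_of_real, simp)
qed

lemma norm_L2_square: "(norm_L2 f)\<^sup>2 = Re (inner_circ f f)"
  by (simp add: norm_L2_def inner_self_real)

lemma inner_self: "inner_circ f f = of_real ((norm_L2 f)\<^sup>2)"
  by (simp add: norm_L2_square complex_eq_iff inner_self_real)

subsection \<open>Fourier coefficients\<close>

lemma circ_integral_exp: "circ_integral (circ_exp n) = (if n = 0 then 1 else 0)"
proof (cases "n = 0")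
  case False
  have "circ_integral (circ_exp n) = 0" using False
  proof transfer
    fix n :: int
    assume n: "n \<noteq> 0"
    define F where "F = (\<lambda>x::real. cis (of_int n * x) / (\<i> * of_int n))"
    have dens: "circ = density lborel (\<lambda>x. ennreal (indicator {0..<2*pi} x / (2*pi)))"
      unfolding circ_def uniform_measure_def
      by (intro arg_cong2[where f=density] ext refl)
        (auto split: split_indicator simp: divide_ennreal simp flip: ennreal_1)
    have "(LINT x|circ. cis (of_int n * x)) = (LINT x|lborel. (indicator {0..<2*pi} x / (2*pi)) *\<^sub>R cis (of_int n * x))"
      unfolding dens by (intro integral_density) auto
    also have "\<dots> = (LINT x|lborel. (1/(2*pi)) *\<^sub>R (indicator {0..2*pi} x *\<^sub>R cis (of_int n * x)))"
      using AE_lborel_singleton[of "2*pi"]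
      by (intro integral_cong_AE) (auto elim!: eventually_mono split: split_indicator)
    also have "\<dots> = (1/(2*pi)) *\<^sub>R (LINT x|lborel. indicator {0..2*pi} x *\<^sub>R cis (of_int n * x))"
      by (rule integral_scaleR_right)
    also have "(LINT x|lborel. indicator {0..2*pi} x *\<^sub>R cis (of_int n * x)) = F (2*pi) - F 0"
    proof (rule integral_FTC_Icc)
      show "(F has_vector_derivative cis (of_int n * x)) (at x within {0..2*pi})" for x
      proof -
        have "((\<lambda>z. exp (\<i> * of_int n * z) / (\<i> * of_int n)) has_field_derivative exp (\<i> * of_int n * of_real x)) (at (of_real x))"
          using n by (auto intro!: derivative_eq_intros)
        from has_vector_derivative_real_field[OF this] show ?thesis
          by (simp add: F_def cis_conv_exp mult.assoc o_def)
      qed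
    qed (auto intro!: continuous_intros)
    also have "F (2*pi) = F 0"
    proof -
      have "cis (of_int n * (2*pi)) = 1"
        using cis_multiple_2pi[of "of_int n"] by (simp add: mult_ac)
      then show ?thesis by (simp add: F_def)
    qed
    finally show "(LINT x|circ. cis (of_int n * x)) = 0" by simp
  qed
  with False show ?thesis by simp
qed simp


lemma inner_exp_exp: "inner_circ (circ_exp m) (circ_exp n) = (if m = n then 1 else 0)"
  by (simp add: inner_circ_def circ_exp_mult circ_integral_exp)

lemma fourier_add: "f \<in> L2 \<Longrightarrow> g \<in> L2 \<Longrightarrow> fourier (f + g) n = fourier f n + fourier g n"
  by (simp add: fourier_def inner_add_left)

lemma fourier_diff: "f \<in> L2 \<Longrightarrow> g \<in> L2 \<Longrightarrow> fourier (f - g) n = fourier f n - fourier g n"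
  by (simp add: fourier_def inner_diff_left)

lemma fourier_scaleC [simp]: "fourier (c *\<^sub>C f) n = c * fourier f n"
  by (simp add: fourier_def)

lemma fourier_0 [simp]: "fourier 0 n = 0"
  by (simp add: fourier_def)

lemma fourier_exp: "fourier (circ_exp m) n = (if m = n then 1 else 0)"
  by (simp add: fourier_def inner_exp_exp)

lemma fourier_1: "fourier 1 n = (if n = 0 then 1 else 0)"
  using fourier_exp[of 0 n] by auto

lemma fourier_sum: "(\<And>i. i \<in> A \<Longrightarrow> f i \<in> L2) \<Longrightarrow> fourier (sum f A) n = (\<Sum>i\<in>A. fourier (f i) n)"
  by (simp add: fourier_def inner_sum_left)

lemma fourier_exp_mult [simp]: "fourier (circ_exp k * f) n = fourier f (n - k)"
  by (simp add: fourier_def inner_circ_def mult_ac circ_exp_mult circ_exp_mult_left)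

lemma fourier_cnj [simp]: "fourier (circ_cnj f) n = cnj (fourier f (- n))"
  by (simp add: fourier_def inner_circ_def flip: circ_integral_cnj)

text \<open>This injectivity is the form in which completeness of the exponentials is used. The
  measure is finite, so \<open>L2\<close> functions are integrable and
  \<open>fourier_zero_AE\<close> applies to the difference.\<close>

lemma L2_eqI:
  assumes "f \<in> L2" "g \<in> L2" "\<And>n. fourier f n = fourier g n"
  shows "f = g"
proof -
  have "fourier (f - g) n = 0" for n
    using assms by (simp add: fourier_diff)
  moreover have "circ_integrable (f - g)" using assms by (intro L2_integrable L2_diff)
  ultimately have "f - g = 0"
    unfolding fourier_def inner_circ_def
  proof transfer
    fix f g :: "real \<Rightarrow> complex"
    assume int: "integrable circ (\<lambda>x. f x - g x)"
      and zero: "\<And>n::int. (LINT x|circ. (f x - g x) * cnj (cis (of_int n * x))) = 0"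
      and "f \<in> borel_measurable circ \<and> f \<in> borel_measurable circ \<and> (AE x in circ. f x = f x)"
      and "g \<in> borel_measurable circ \<and> g \<in> borel_measurable circ \<and> (AE x in circ. g x = g x)"
    have "(LINT x|circ. cis (of_int n * x) * (f x - g x)) = 0" for n :: int
      using zero[of "-n"] by (simp add: cis_cnj mult.commute)
    from fourier_zero_AE[OF int this] int
    show "(\<lambda>x. f x - g x) \<in> borel_measurable circ \<and> (\<lambda>_. 0) \<in> borel_measurable circ \<and> (AE x in circ. f x - g x = 0)"
      by auto
  qed
  then show ?thesis by simp
qed

lemma inner_self_eq_0:
  assumes "f \<in> L2" "inner_circ f f = 0"
  shows "f = 0"
proof -
  have "circ_integrable (f * circ_cnj f)" using assms by auto
  with assms(2) show ?thesis
    unfolding inner_circ_def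
  proof transfer
    fix f :: "real \<Rightarrow> complex"
    assume f: "f \<in> borel_measurable circ \<and> f \<in> borel_measurable circ \<and> (AE x in circ. f x = f x)"
      and 0: "(LINT x|circ. f x * cnj (f x)) = 0" and i: "integrable circ (\<lambda>x. f x * cnj (f x))"
    have eq: "f x * cnj (f x) = complex_of_real ((norm (f x))\<^sup>2)" for x
      by (rule complex_norm_square[symmetric])
    have i': "integrable circ (\<lambda>x. (norm (f x))\<^sup>2)"
      using integrable_norm[OF i] by (simp add: norm_mult power2_eq_square)
    have "(LINT x|circ. (norm (f x))\<^sup>2) = 0"
      using 0 unfolding eq by (simp only: integral_complex_of_real of_real_eq_0_iff)
    then have "AE x in circ. (norm (f x))\<^sup>2 = 0"
      by (subst (asm) integral_nonneg_eq_0_iff_AE[OF i']) auto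
    then show "f \<in> borel_measurable circ \<and> (\<lambda>_. 0) \<in> borel_measurable circ \<and> (AE x in circ. f x = 0)"
      using f by auto
  qed
qed

lemma norm_L2_nonneg: "norm_L2 f \<ge> 0"
  by (simp add: norm_L2_def inner_self_real)

lemma norm_L2_scaleC: "norm_L2 (c *\<^sub>C f) = norm c * norm_L2 f"
proof -
  have "c * (cnj c * inner_circ f f) = of_real ((norm c)\<^sup>2) * of_real ((norm_L2 f)\<^sup>2)"
    unfolding inner_self complex_norm_square by (simp add: mult_ac)
  then have "c * (cnj c * inner_circ f f) = of_real ((norm c * norm_L2 f)\<^sup>2)"
    by (simp add: power_mult_distrib)
  then have "(norm_L2 (c *\<^sub>C f))\<^sup>2 = (norm c * norm_L2 f)\<^sup>2"
    by (simp only: norm_L2_square inner_scaleC_left inner_scaleC_right Re_complex_of_real mult.left_commute[of "cnj c"])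
  then show ?thesis by (simp add: norm_L2_nonneg power2_eq_iff_nonneg)
qed

lemma inner_Cauchy_Schwarz:
  assumes "f \<in> L2" "g \<in> L2"
  shows "norm (inner_circ f g) \<le> norm_L2 f * norm_L2 g"
proof (cases "norm_L2 g = 0")
  case True
  then have "g = 0" using inner_self_eq_0[OF assms(2)] by (simp add: inner_self)
  then show ?thesis by (simp add: norm_L2_nonneg)
next
  case False
  define N where "N = (norm_L2 g)\<^sup>2"
  have N: "N > 0" using False by (simp add: N_def)
  define c where "c = inner_circ f g / of_real N"
  define h where "h = f - c *\<^sub>C g"
  have "inner_circ h h = inner_circ f f - cnj c * inner_circ f g - c * inner_circ g f + c * cnj c * of_real N"
    using assms by (simp add: h_def inner_diff_left inner_diff_right L2_diff L2_scaleC N_def algebra_simps inner_self[of g])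
  also have "\<dots> = of_real ((norm_L2 f)\<^sup>2 - (norm (inner_circ f g))\<^sup>2 / N)"
    using N by (simp add: c_def inner_self[of f] inner_cnj[of f g] divide_simps power2_eq_square complex_norm_square
        flip: of_real_mult)
       (simp add: complex_norm_square[symmetric] algebra_simps power2_eq_square)
  finally have "(norm (inner_circ f g))\<^sup>2 / N \<le> (norm_L2 f)\<^sup>2"
    using inner_self_real(2)[of h] by simp
  then have "(norm (inner_circ f g))\<^sup>2 \<le> (norm_L2 f * norm_L2 g)\<^sup>2"
    using N by (simp add: divide_simps N_def power_mult_distrib)
  then show ?thesis
    by (rule power2_le_imp_le) (simp add: norm_L2_nonneg)
qed

section \<open>Absolutely convergent Fourier series\<close>

text \<open>The Wiener algebra. Its elements are bounded and are uniform limits of their partial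
  Fourier sums, which yields Parseval and the convolution formula against any \<open>L2\<close>
  function.\<close>

definition wiener :: "circ_fun set" where
  "wiener = {f \<in> L2. (\<lambda>n. norm (fourier f n)) summable_on UNIV}"

definition wiener_norm :: "circ_fun \<Rightarrow> real" where
  "wiener_norm f = (\<Sum>\<^sub>\<infinity>n. norm (fourier f n))"

text \<open>The enumeration \<open>int_decode\<close> turns the two-sided series into an ordinary
  one, whose sum is measurable, bounded by the sum of the moduli, and integrable term by term
  against exponentials.\<close>

lemma fourier_series_exists:
  fixes c :: "int \<Rightarrow> complex"
  assumes c: "(\<lambda>n. norm (c n)) summable_on UNIV"
  obtains f where "f \<in> L2" "\<And>n. fourier f n = c n" "ess_bounded_by f (\<Sum>\<^sub>\<infinity>n. norm (c n))"
proof -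
  define d where "d = (\<lambda>k. c (int_decode k))"
  have "(\<lambda>k. norm (d k)) summable_on UNIV"
    using summable_on_reindex_bij_betw[of int_decode UNIV UNIV "\<lambda>n. norm (c n)"] c bij_int_decode
    by (simp add: d_def)
  then have d: "summable (\<lambda>k. norm (d k))"
    by (rule summable_on_imp_summable)
  have d_eq: "(\<Sum>\<^sub>\<infinity>n. norm (c n)) = (\<Sum>k. norm (d k))"
  proof -
    have "(\<Sum>\<^sub>\<infinity>n. norm (c n)) = (\<Sum>\<^sub>\<infinity>k. norm (d k))"
      using infsum_reindex_bij_betw[of int_decode UNIV UNIV "\<lambda>n. norm (c n)"] bij_int_decode
      by (simp add: d_def)
    then show ?thesis
      using has_sum_imp_sums[OF has_sum_infsum[OF \<open>(\<lambda>k. norm (d k)) summable_on UNIV\<close>]]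
      by (simp add: sums_unique)
  qed
  define F where "F = (\<lambda>x. \<Sum>k. d k * cis (of_int (int_decode k) * x))"
  have F_meas: "F \<in> borel_measurable circ"
    unfolding F_def
    by (intro borel_measurable_suminf continuous_imp_measurable_circ continuous_intros)
  have sF: "summable (\<lambda>k. norm (d k * cis (of_int (int_decode k) * x)))" for x
    using d by (simp add: norm_mult)
  have F_bd: "norm (F x) \<le> (\<Sum>k. norm (d k))" for x
    using summable_norm[OF sF] by (simp add: F_def norm_mult)
  have Fc: "(LINT x|circ. F x * cis (of_int (- n) * x)) = c n" for n
  proof -
    have F_eq: "F x * cis (of_int (- n) * x) = (\<Sum>k. d k * cis (of_int (int_decode k - n) * x))" for x
    proof -
      have "F x * cis (of_int (- n) * x) = (\<Sum>k. d k * cis (of_int (int_decode k) * x) * cis (of_int (- n) * x))"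
        unfolding F_def by (intro suminf_mult2 summable_norm_cancel[OF sF])
      also have "\<dots> = (\<Sum>k. d k * cis (of_int (int_decode k - n) * x))"
        by (simp add: cis_mult mult.assoc algebra_simps)
      finally show ?thesis .
    qed
    have i: "integrable circ (\<lambda>x. d k * cis (of_int m * x))" for k m
      using integrable_circ_cis_mult[of "\<lambda>_. 1" "\<lambda>x. d k * cis (of_int m * x)" "norm (d k)"]
      by (simp add: norm_mult)
    have "(LINT x|circ. F x * cis (of_int (- n) * x)) = (\<Sum>k. LINT x|circ. d k * cis (of_int (int_decode k - n) * x))"
      unfolding F_eq
      by (intro integral_suminf i) (use d in \<open>simp_all add: norm_mult measure_circ_space\<close>)
    also have "\<dots> = (\<Sum>k. if k = int_encode n then d k else 0)"
    proof -
      have "(LINT x|circ. cis (of_int m * x)) = (if m = 0 then 1 else 0)" for m :: int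
        using circ_integral_exp[of m] by transfer
      then have "(LINT x|circ. d k * cis (of_int (int_decode k - n) * x)) = (if k = int_encode n then d k else 0)" for k
        by (auto simp del: of_int_diff simp: int_decode_inverse)
      then show ?thesis by presburger
    qed
    also have "\<dots> = c n"
      using sums_single[of "int_encode n" d] by (simp add: sums_iff d_def)
    finally show ?thesis .
  qed
  have "\<exists>f. ess_bounded_by f (\<Sum>k. norm (d k)) \<and> (\<forall>n. circ_integral (f * circ_exp (- n)) = c n)"
    by (transfer fixing: c d) (rule bexI[of _ F], use F_meas F_bd Fc in \<open>auto simp: in_respects\<close>)
  then obtain f where f: "ess_bounded_by f (\<Sum>k. norm (d k))" "\<And>n. circ_integral (f * circ_exp (- n)) = c n"
    by blast
  show thesis
    by (rule that[of f]) (use f in \<open>simp_all add: L2_bounded fourier_def inner_circ_def d_eq\<close>)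
qed

lemma wiener_L2: "f \<in> wiener \<Longrightarrow> f \<in> L2"
  by (simp add: wiener_def)

lemma wiener_summable: "f \<in> wiener \<Longrightarrow> (\<lambda>n. norm (fourier f n)) summable_on UNIV"
  by (simp add: wiener_def)

lemma wiener_norm_nonneg: "0 \<le> wiener_norm f"
  unfolding wiener_norm_def by (rule infsum_nonneg) simp

text \<open>The sum of the Fourier series has the coefficients of \<open>f\<close>, hence equals
  \<open>f\<close> by \<open>L2_eqI\<close>; this transfers the bound.\<close>

lemma wiener_bounded: "f \<in> wiener \<Longrightarrow> ess_bounded_by f (wiener_norm f)"
proof -
  assume f: "f \<in> wiener"
  obtain g where "g \<in> L2" "\<And>n. fourier g n = fourier f n" "ess_bounded_by g (wiener_norm f)"
    using fourier_series_exists[OF wiener_summable[OF f]] unfolding wiener_norm_def by metis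
  then show ?thesis using L2_eqI[of g f] wiener_L2[OF f] by metis
qed

lemma wiener_exists:
  fixes c :: "int \<Rightarrow> complex"
  assumes c: "(\<lambda>n. norm (c n)) summable_on UNIV"
  obtains f where "f \<in> wiener" "\<And>n. fourier f n = c n"
  by (rule fourier_series_exists[OF c]) (use c in \<open>auto simp: wiener_def\<close>)

lemma wiener_dominated:
  assumes "f \<in> L2" "g summable_on UNIV" "\<And>n. norm (fourier f n) \<le> g n"
  shows "f \<in> wiener"
  unfolding wiener_def using assms by (auto intro: summable_on_comparison_test)

lemma wiener_add [intro]: "f \<in> wiener \<Longrightarrow> g \<in> wiener \<Longrightarrow> f + g \<in> wiener"
  by (rule wiener_dominated[of _ "\<lambda>n. norm (fourier f n) + norm (fourier g n)"])
    (auto simp: wiener_def fourier_add norm_triangle_ineq intro: summable_on_add)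

lemma wiener_scaleC [intro]: "f \<in> wiener \<Longrightarrow> c *\<^sub>C f \<in> wiener"
  by (rule wiener_dominated[of _ "\<lambda>n. norm c * norm (fourier f n)"])
    (auto simp: wiener_def norm_mult intro: summable_on_cmult_right)

lemma wiener_uminus [intro]: "f \<in> wiener \<Longrightarrow> - f \<in> wiener"
  using wiener_scaleC[of f "-1"] by simp

lemma wiener_diff [intro]: "f \<in> wiener \<Longrightarrow> g \<in> wiener \<Longrightarrow> f - g \<in> wiener"
  using wiener_add[of f "- g"] wiener_uminus[of g] by simp

lemma wiener_exp [simp, intro]: "circ_exp n \<in> wiener"
proof -
  have "(\<lambda>k. norm (fourier (circ_exp n) k)) summable_on UNIV"
    by (rule finite_nonzero_values_imp_summable_on) (simp add: fourier_exp)
  then show ?thesis by (simp add: wiener_def)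
qed

lemma wiener_1 [simp, intro]: "1 \<in> wiener"
  using wiener_exp[of 0] by simp

lemma wiener_0 [simp, intro]: "0 \<in> wiener"
  by (simp add: wiener_def)

lemma wiener_sum [intro]: "(\<And>i. i \<in> A \<Longrightarrow> f i \<in> wiener) \<Longrightarrow> sum f A \<in> wiener"
  by (induction A rule: infinite_finite_induct) auto

lemma wiener_cnj [intro]: "f \<in> wiener \<Longrightarrow> circ_cnj f \<in> wiener"
  using summable_on_reindex_bij_witness[of UNIV uminus uminus UNIV "\<lambda>n. norm (fourier f n)" "\<lambda>n. norm (fourier f (- n))"]
  by (auto simp: wiener_def)

lemma wiener_norm_tail:
  assumes f: "f \<in> wiener" and S: "finite S"
  shows "ess_bounded_by (f - (\<Sum>n\<in>S. fourier f n *\<^sub>C circ_exp n)) (wiener_norm f - (\<Sum>n\<in>S. norm (fourier f n)))"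
proof -
  let ?g = "f - (\<Sum>n\<in>S. fourier f n *\<^sub>C circ_exp n)"
  have g: "?g \<in> wiener" using f by auto
  have fg: "fourier ?g n = (if n \<in> S then 0 else fourier f n)" for n
  proof -
    have "fourier (\<Sum>n\<in>S. fourier f n *\<^sub>C circ_exp n) n = (\<Sum>i\<in>S. if i = n then fourier f i else 0)"
      by (subst fourier_sum) (auto simp: fourier_exp intro!: sum.cong)
    then show ?thesis
      using f S by (subst fourier_diff) (auto simp: wiener_L2 intro!: L2_sum L2_scaleC)
  qed
  have "wiener_norm ?g = (\<Sum>\<^sub>\<infinity>n\<in>UNIV - S. norm (fourier f n))"
    unfolding wiener_norm_def by (rule infsum_cong_neutral) (auto simp: fg)
  also have "\<dots> = wiener_norm f - (\<Sum>n\<in>S. norm (fourier f n))"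
    unfolding wiener_norm_def using S wiener_summable[OF f]
    by (subst infsum_Diff) auto
  finally show ?thesis using wiener_bounded[OF g] by simp
qed

text \<open>The uniform tail estimate \<open>wiener_norm_tail\<close> is tested against the
  integrable function \<open>circ_cnj g\<close>. This explains the asymmetry of the hypotheses: all
  the convergence comes from \<open>f\<close>.\<close>

lemma parseval:
  assumes f: "f \<in> wiener" and g: "g \<in> L2"
  shows "((\<lambda>n. fourier f n * cnj (fourier g n)) has_sum inner_circ f g) UNIV"
proof -
  have *: "norm (inner_circ f g - (\<Sum>n\<in>S. fourier f n * cnj (fourier g n))) \<le>
     (wiener_norm f - (\<Sum>n\<in>S. norm (fourier f n))) * circ_L1 (circ_cnj g)" if S: "finite S" for S
  proof -
    let ?p = "\<Sum>n\<in>S. fourier f n *\<^sub>C circ_exp n"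
    have "inner_circ ?p g = (\<Sum>n\<in>S. fourier f n * cnj (fourier g n))"
      using g by (subst inner_sum_left) (auto simp: fourier_def inner_cnj[of _ g] intro!: sum.cong)
    then have "inner_circ f g - (\<Sum>n\<in>S. fourier f n * cnj (fourier g n)) = circ_integral ((f - ?p) * circ_cnj g)"
      using inner_diff_left[of f ?p g] f g by (simp add: wiener_L2 L2_sum L2_scaleC inner_circ_def)
    then show ?thesis
      using norm_circ_integral_mult_le[OF wiener_norm_tail[OF f S], of "circ_cnj g"] g
      by (simp add: L2_integrable)
  qed
  have "((\<lambda>S. wiener_norm f - (\<Sum>n\<in>S. norm (fourier f n))) \<longlongrightarrow> wiener_norm f - wiener_norm f) (finite_subsets_at_top UNIV)"
    unfolding wiener_norm_def
    by (intro tendsto_diff tendsto_const infsum_tendsto wiener_summable f)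
  from tendsto_mult_right[OF this, of "circ_L1 (circ_cnj g)"]
  have lim: "((\<lambda>S. (wiener_norm f - (\<Sum>n\<in>S. norm (fourier f n))) * circ_L1 (circ_cnj g)) \<longlongrightarrow> 0) (finite_subsets_at_top UNIV)"
    by simp
  have "((\<lambda>S. inner_circ f g - (\<Sum>n\<in>S. fourier f n * cnj (fourier g n))) \<longlongrightarrow> 0) (finite_subsets_at_top UNIV)"
    by (rule Lim_null_comparison[OF _ lim]) (auto intro!: eventually_finite_subsets_at_top_weakI *)
  from tendsto_diff[OF tendsto_const this, of "inner_circ f g"]
  show ?thesis by (simp add: has_sum_def)
qed

lemma parseval_norm:
  assumes f: "f \<in> wiener"
  shows "((\<lambda>n. (norm (fourier f n))\<^sup>2) has_sum (norm_L2 f)\<^sup>2) UNIV"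
proof -
  have "((\<lambda>n. Re (fourier f n * cnj (fourier f n))) has_sum Re (inner_circ f f)) UNIV"
    by (intro has_sum_Re parseval f wiener_L2)
  then show ?thesis
    by (simp add: norm_L2_square complex_mult_cnj cmod_power2)
qed

text \<open>Parseval for \<open>f\<close> and \<open>circ_exp n * circ_cnj g\<close>, whose
  coefficient at \<open>j\<close> is the conjugate of that of \<open>g\<close> at
  \<open>n - j\<close>.\<close>

lemma fourier_mult:
  assumes f: "f \<in> wiener" and g: "g \<in> L2"
  shows "((\<lambda>j. fourier f j * fourier g (n - j)) has_sum fourier (f * g) n) UNIV"
proof -
  have "inner_circ f (circ_exp n * circ_cnj g) = fourier (f * g) n"
    by (simp add: fourier_def inner_circ_def mult_ac)
  then show ?thesis
    using parseval[OF f, of "circ_exp n * circ_cnj g"] g by (simp add: L2_exp_mult)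
qed

lemma wiener_mult [intro]:
  assumes f: "f \<in> wiener" and g: "g \<in> wiener"
  shows "f * g \<in> wiener"
proof -
  let ?a = "\<lambda>n. norm (fourier f n)" and ?b = "\<lambda>n. norm (fourier g n)"
  have "(\<lambda>(j, m). ?a j * ?b m) summable_on UNIV \<times> UNIV"
  proof (rule summable_on_SigmaI[where g = "\<lambda>j. ?a j * wiener_norm g"])
    show "((\<lambda>m. case (j, m) of (j, m) \<Rightarrow> ?a j * ?b m) has_sum ?a j * wiener_norm g) UNIV" for j
      unfolding prod.case wiener_norm_def by (intro has_sum_cmult_right has_sum_infsum wiener_summable g)
    show "(\<lambda>j. ?a j * wiener_norm g) summable_on UNIV"
      by (intro summable_on_cmult_left wiener_summable f)
  qed auto
  then have "(\<lambda>(n, j). ?a j * ?b (n - j)) summable_on UNIV \<times> UNIV"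
    by (subst summable_on_reindex_bij_witness[of _ "\<lambda>(j,m). (j + m, j)" "\<lambda>(n,j). (j, n - j)" _ "\<lambda>(j, m). ?a j * ?b m"]) auto
  from summable_on_Sigma_banach[OF this]
  have s: "(\<lambda>n. \<Sum>\<^sub>\<infinity>j. ?a j * ?b (n - j)) summable_on UNIV" .
  have "norm (fourier (f * g) n) \<le> (\<Sum>\<^sub>\<infinity>j. ?a j * ?b (n - j))" for n
  proof -
    have "(\<lambda>j. ?a j * ?b (n - j)) summable_on UNIV"
      using summable_on_SigmaD1[OF \<open>(\<lambda>(n, j). ?a j * ?b (n - j)) summable_on UNIV \<times> UNIV\<close>, of n] by simp
    then show ?thesis
      using infsumI[OF fourier_mult[OF f wiener_L2[OF g], of n]]
        norm_infsum_bound[of "\<lambda>j. fourier f j * fourier g (n - j)" UNIV]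
      by (simp add: norm_mult)
  qed
  moreover have "f * g \<in> L2"
    using wiener_bounded[OF f] wiener_L2[OF g] by (rule L2_mult_bounded)
  ultimately show ?thesis using s by (intro wiener_dominated)
qed

section \<open>Hardy space, projection and backward shift\<close>

lemma L2_plusD: "f \<in> L2_plus \<Longrightarrow> f \<in> L2" "f \<in> L2_plus \<Longrightarrow> n < 0 \<Longrightarrow> fourier f n = 0"
  by (simp_all add: L2_plus_def)

lemma L2_plus_add [intro]: "f \<in> L2_plus \<Longrightarrow> g \<in> L2_plus \<Longrightarrow> f + g \<in> L2_plus"
  by (auto simp: L2_plus_def fourier_add)

lemma L2_plus_scaleC [intro]: "f \<in> L2_plus \<Longrightarrow> c *\<^sub>C f \<in> L2_plus"
  by (auto simp: L2_plus_def)

lemma L2_plus_diff [intro]: "f \<in> L2_plus \<Longrightarrow> g \<in> L2_plus \<Longrightarrow> f - g \<in> L2_plus"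
  by (auto simp: L2_plus_def fourier_diff)

lemma L2_plus_0 [simp, intro]: "0 \<in> L2_plus"
  by (simp add: L2_plus_def)

lemma L2_plus_exp [simp, intro]: "n \<ge> 0 \<Longrightarrow> circ_exp n \<in> L2_plus"
  by (auto simp: L2_plus_def fourier_exp)

lemma L2_plus_1 [simp, intro]: "1 \<in> L2_plus"
  using L2_plus_exp[of 0] by simp

lemma L2_plus_sum [intro]: "(\<And>i. i \<in> A \<Longrightarrow> f i \<in> L2_plus) \<Longrightarrow> sum f A \<in> L2_plus"
  by (induction A rule: infinite_finite_induct) auto

lemma L2_plus_eqI:
  assumes "f \<in> L2_plus" "g \<in> L2_plus" "\<And>n. n \<ge> 0 \<Longrightarrow> fourier f n = fourier g n"
  shows "f = g"
proof (rule L2_eqI)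
  show "fourier f n = fourier g n" for n
    using assms by (cases "n \<ge> 0") (auto simp: L2_plusD)
qed (use assms in \<open>auto simp: L2_plusD\<close>)

text \<open>Valid whether or not the projection exists: both definite descriptions are taken over
  the same predicate. \<open>shifted_hankel_eq_hankel_bshift\<close> relies on this.\<close>

lemma szego_proj_cong:
  assumes "f \<in> L2" "g \<in> L2" "\<And>n. n \<ge> 0 \<Longrightarrow> fourier f n = fourier g n"
  shows "szego_proj f = szego_proj g"
proof -
  have "inner_circ (f - h) (circ_exp n) = inner_circ (g - h) (circ_exp n)" if "h \<in> L2_plus" "n \<ge> 0" for h n
    using assms that by (simp add: fourier_diff L2_plusD flip: fourier_def)
  then have "(\<lambda>h. h \<in> L2_plus \<and> (\<forall>n\<ge>0. inner_circ (f - h) (circ_exp n) = 0)) =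
      (\<lambda>h. h \<in> L2_plus \<and> (\<forall>n\<ge>0. inner_circ (g - h) (circ_exp n) = 0))"
    by (intro ext) (simp cong: conj_cong)
  then show ?thesis unfolding szego_proj_def by (rule arg_cong)
qed

lemma szego_proj_eqI:
  assumes "f \<in> L2" "g \<in> L2_plus" "\<And>n. n \<ge> 0 \<Longrightarrow> fourier f n = fourier g n"
  shows "szego_proj f = g"
  unfolding szego_proj_def
proof (rule the_equality)
  show "g \<in> L2_plus \<and> (\<forall>n\<ge>0. inner_circ (f - g) (circ_exp n) = 0)"
    using assms by (simp add: fourier_diff L2_plusD flip: fourier_def)
next
  fix h assume h: "h \<in> L2_plus \<and> (\<forall>n\<ge>0. inner_circ (f - h) (circ_exp n) = 0)"
  have "fourier f n = fourier h n" if "n \<ge> 0" for n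
  proof -
    have "fourier (f - h) n = 0" using h that by (simp add: fourier_def)
    then show ?thesis using assms(1) h by (simp add: fourier_diff L2_plusD)
  qed
  then show "h = g" using h assms by (intro L2_plus_eqI) auto
qed

lemma szego_proj_wiener:
  assumes "f \<in> wiener"
  shows "szego_proj f \<in> wiener" "szego_proj f \<in> L2_plus"
    "fourier (szego_proj f) n = (if n \<ge> 0 then fourier f n else 0)"
proof -
  have "(\<lambda>n. norm (if n \<ge> 0 then fourier f n else 0)) summable_on UNIV"
    by (rule summable_on_comparison_test[OF wiener_summable[OF assms]]) auto
  then obtain g where g: "g \<in> wiener" "\<And>n. fourier g n = (if n \<ge> 0 then fourier f n else 0)"
    by (rule wiener_exists) (rule that)
  have g': "g \<in> L2_plus" using g by (auto simp: L2_plus_def wiener_L2)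
  have "szego_proj f = g"
    using assms g by (intro szego_proj_eqI g') (auto simp: wiener_L2)
  with g g' show "szego_proj f \<in> wiener" "szego_proj f \<in> L2_plus"
    "fourier (szego_proj f) n = (if n \<ge> 0 then fourier f n else 0)" by auto
qed

lemma inner_eq_0_wiener:
  assumes "f \<in> wiener" "g \<in> L2" "\<And>n. fourier f n = 0 \<or> fourier g n = 0"
  shows "inner_circ f g = 0"
proof -
  have "(\<lambda>n. fourier f n * cnj (fourier g n)) = (\<lambda>_. 0)"
    using assms(3) by auto
  then show ?thesis using has_sum_unique[OF parseval[OF assms(1,2)]] by simp
qed

lemma inner_szego_proj_right:
  assumes "f \<in> wiener" "g \<in> L2_plus"
  shows "inner_circ (szego_proj f) g = inner_circ f g"
proof -
  have "inner_circ (f - szego_proj f) g = 0"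
    using assms by (intro inner_eq_0_wiener)
      (auto simp: fourier_diff szego_proj_wiener wiener_L2 L2_plus_def intro!: wiener_diff)
  then show ?thesis
    using assms by (simp add: inner_diff_left szego_proj_wiener wiener_L2 L2_plusD)
qed

text \<open>The backward shift, adjoint of \<open>shift\<close> on the Hardy space. Removing the
  mean first keeps the frequency -1 from appearing.\<close>

definition bshift :: "circ_fun \<Rightarrow> circ_fun" where
  "bshift g = circ_exp (-1) * (g - fourier g 0 *\<^sub>C 1)"

lemma L2_plus_shift: "h \<in> L2_plus \<Longrightarrow> circ_exp 1 * h \<in> L2_plus"
  by (auto simp: L2_plus_def)

lemma shift_bshift: "circ_exp 1 * bshift g = g - fourier g 0 *\<^sub>C 1"
  by (simp add: bshift_def circ_exp_mult_left)

lemma bshift_wiener [intro]: "f \<in> wiener \<Longrightarrow> bshift f \<in> wiener"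
  unfolding bshift_def by auto

lemma bshift_L2: "f \<in> L2 \<Longrightarrow> bshift f \<in> L2"
  unfolding bshift_def by (intro L2_exp_mult L2_diff L2_scaleC L2_1)

lemma fourier_bshift:
  assumes "f \<in> L2" shows "fourier (bshift f) n = (if n = -1 then 0 else fourier f (n + 1))"
  using assms by (auto simp: bshift_def fourier_diff fourier_1 L2_scaleC)

lemma bshift_L2_plus [intro]: "f \<in> L2_plus \<Longrightarrow> bshift f \<in> L2_plus"
  using fourier_bshift[of f] bshift_L2[of f] by (auto simp: L2_plus_def)

lemma bshift_add: "f \<in> L2 \<Longrightarrow> g \<in> L2 \<Longrightarrow> bshift (f + g) = bshift f + bshift g"
  by (simp add: bshift_def fourier_add circ_fun.scale_left_distrib algebra_simps)

lemma bshift_scaleC: "f \<in> L2 \<Longrightarrow> bshift (c *\<^sub>C f) = c *\<^sub>C bshift f"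
  by (simp add: bshift_def right_diff_distrib circ_fun.scale_right_diff_distrib)

lemma bshift_diff: "f \<in> L2 \<Longrightarrow> g \<in> L2 \<Longrightarrow> bshift (f - g) = bshift f - bshift g"
  by (simp add: bshift_def fourier_diff circ_fun.scale_left_diff_distrib algebra_simps)

lemma bshift_0 [simp]: "bshift 0 = 0"
  by (simp add: bshift_def)

lemma inner_1_left: "inner_circ 1 f = cnj (fourier f 0)"
  using inner_cnj[of 1 f] by (simp add: fourier_def)

lemma inner_1_right: "inner_circ f 1 = fourier f 0"
  by (simp add: fourier_def)

lemma inner_bshift_left:
  assumes "f \<in> L2" "h \<in> L2_plus"
  shows "inner_circ (bshift f) h = inner_circ f (circ_exp 1 * h)"
proof -
  have "inner_circ (bshift f) h = inner_circ (f - fourier f 0 *\<^sub>C 1) (circ_exp 1 * h)"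
    by (simp add: bshift_def inner_circ_def mult_ac)
  also have "\<dots> = inner_circ f (circ_exp 1 * h) - fourier f 0 * cnj (fourier h (-1))"
    using assms by (subst inner_diff_left) (auto simp: L2_plusD inner_1_left L2_exp_mult)
  also have "fourier h (-1) = 0" using assms by (simp add: L2_plusD)
  finally show ?thesis by simp
qed

lemma inner_bshift_bshift:
  assumes "f \<in> L2" "g \<in> L2"
  shows "inner_circ (bshift f) (bshift g) = inner_circ f g - fourier f 0 * cnj (fourier g 0)"
proof -
  have "inner_circ (bshift f) (bshift g) = inner_circ (f - fourier f 0 *\<^sub>C 1) (g - fourier g 0 *\<^sub>C 1)"
    by (simp add: bshift_def inner_circ_def mult_ac circ_exp_mult_left)
  also have "\<dots> = inner_circ f g - fourier f 0 * cnj (fourier g 0)"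
    using assms by (simp add: inner_diff_left inner_diff_right L2_scaleC L2_diff inner_1_left inner_1_right fourier_1 fourier_diff algebra_simps)
  finally show ?thesis .
qed

lemma bshift_pow_wiener: "f \<in> wiener \<Longrightarrow> (bshift ^^ m) f \<in> wiener"
  by (induction m) auto

lemma bshift_pow_L2_plus: "f \<in> L2_plus \<Longrightarrow> (bshift ^^ m) f \<in> L2_plus"
  by (induction m) auto

lemma fourier_bshift_pow: "f \<in> L2_plus \<Longrightarrow> n \<ge> 0 \<Longrightarrow> fourier ((bshift ^^ m) f) n = fourier f (n + int m)"
proof (induction m arbitrary: n)
  case (Suc m)
  then show ?case using fourier_bshift[of "(bshift ^^ m) f" n] L2_plusD(1)[OF bshift_pow_L2_plus[of f m]]
    by (simp add: algebra_simps)
qed simp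

section \<open>Hankel operators with symbol in the Wiener algebra\<close>

definition orthonormal :: "circ_fun set \<Rightarrow> bool" where
  "orthonormal E \<longleftrightarrow> finite E \<and> E \<subseteq> wiener \<inter> L2_plus \<and> (\<forall>e\<in>E. \<forall>f\<in>E. inner_circ e f = (if e = f then 1 else 0))"

lemma orthonormal_span_coeff:
  assumes "orthonormal E" "x \<in> circ_fun.span E"
  shows "x = (\<Sum>e\<in>E. inner_circ x e *\<^sub>C e)"
proof -
  have E: "finite E" "\<And>e. e \<in> E \<Longrightarrow> e \<in> L2" "\<And>e f. e \<in> E \<Longrightarrow> f \<in> E \<Longrightarrow> inner_circ e f = (if e = f then 1 else 0)"
    using assms(1) by (auto simp: orthonormal_def wiener_L2)
  obtain r where r: "x = (\<Sum>e\<in>E. r e *\<^sub>C e)"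
    using assms(2) E(1) by (auto simp: circ_fun.span_finite)
  have "inner_circ x f = r f" if "f \<in> E" for f
  proof -
    have "inner_circ x f = (\<Sum>e\<in>E. r e * inner_circ e f)"
      unfolding r using E that by (subst inner_sum_left) auto
    also have "\<dots> = (\<Sum>e\<in>E. if e = f then r e else 0)"
      using E that by (intro sum.cong) auto
    finally show ?thesis using E that by simp
  qed
  then have "(\<Sum>e\<in>E. inner_circ x e *\<^sub>C e) = (\<Sum>e\<in>E. r e *\<^sub>C e)"
    by (intro sum.cong) auto
  with r show ?thesis by (rule trans[OF _ sym])
qed

text \<open>No completeness of \<open>L\<^sup>2\<close> is needed for the existence of the projection: for \<open>u\<close> of finite
  rank it can be written down in an orthonormal basis of the span of the backward shifts of \<open>u\<close>.\<close>

lemma hankel_orthonormal_aux: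
  assumes u: "u \<in> wiener" "u \<in> L2_plus" and E: "orthonormal E"
    and span: "\<And>m. (bshift ^^ m) u \<in> circ_fun.span E" and h: "h \<in> L2_plus" and n: "n \<ge> 0"
  shows "fourier (u * circ_cnj h) n = fourier (\<Sum>e\<in>E. inner_circ (u * circ_cnj h) e *\<^sub>C e) n"
proof -
  have E': "finite E" "\<And>e. e \<in> E \<Longrightarrow> e \<in> wiener" "\<And>e. e \<in> E \<Longrightarrow> e \<in> L2_plus" "\<And>e. e \<in> E \<Longrightarrow> e \<in> L2"
    "\<And>e f. e \<in> E \<Longrightarrow> f \<in> E \<Longrightarrow> inner_circ e f = (if e = f then 1 else 0)"
    using E by (auto simp: orthonormal_def wiener_L2)
  have L2: "u * circ_cnj h \<in> L2"
    using L2_mult_bounded[OF wiener_bounded[OF u(1)], of "circ_cnj h"] h by (simp add: L2_plusD)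
  let ?g = "\<Sum>e\<in>E. inner_circ (u * circ_cnj h) e *\<^sub>C e"
  define v where "v = (\<Sum>e\<in>E. inner_circ (circ_exp n) e *\<^sub>C e)"
  \<comment> \<open>The part of the exponential orthogonal to \<open>E\<close>. It remains to see
    that \<open>u * circ_cnj h\<close> is orthogonal to it.\<close>
  define r where "r = circ_exp n - v"
  have v: "v \<in> wiener" "v \<in> L2_plus" unfolding v_def using E' by auto
  have r: "r \<in> wiener" "r \<in> L2_plus" unfolding r_def using v n by auto
  have r_orth: "inner_circ r e = 0" if "e \<in> E" for e
  proof -
    have "inner_circ v e = (\<Sum>f\<in>E. inner_circ (circ_exp n) f * inner_circ f e)"
      unfolding v_def using E' that by (subst inner_sum_left) auto
    also have "\<dots> = (\<Sum>f\<in>E. if f = e then inner_circ (circ_exp n) f else 0)"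
      using E' that by (intro sum.cong) auto
    finally have "inner_circ v e = inner_circ (circ_exp n) e" using E' that by simp
    then show ?thesis unfolding r_def using E' that v by (simp add: inner_diff_left wiener_L2)
  qed
  have r_orth': "inner_circ x r = 0" if "x \<in> circ_fun.span E" for x
  proof -
    have "inner_circ x r = (\<Sum>e\<in>E. inner_circ x e * inner_circ e r)"
      using arg_cong[OF orthonormal_span_coeff[OF E that], of "\<lambda>y. inner_circ y r"]
        inner_sum_left[of E "\<lambda>e. inner_circ x e *\<^sub>C e" r] E' r
      by (simp add: wiener_L2 L2_scaleC)
    also have "\<dots> = 0"
    proof (intro sum.neutral ballI)
      fix e assume "e \<in> E"
      then show "inner_circ x e * inner_circ e r = 0"
        using r_orth[of e] inner_cnj[of e r] by simp
    qed
    finally show ?thesis .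
  qed
  \<comment> \<open>The \<open>m\<close>-th coefficient is the inner product of the
    \<open>m\<close>-th backward shift of \<open>u\<close> with \<open>r\<close>, and those shifts
    lie in the span of \<open>E\<close>.\<close>
  have ur: "fourier (u * circ_cnj r) m = 0" if "m \<ge> 0" for m
  proof -
    have "fourier (u * circ_cnj r) m = inner_circ (circ_exp (- m) * u) r"
      by (simp add: fourier_def inner_circ_def mult_ac)
    also have "\<dots> = inner_circ (circ_exp (- m) * u - (bshift ^^ nat m) u) r + inner_circ ((bshift ^^ nat m) u) r"
      using u r bshift_pow_wiener[OF u(1)] by (simp add: inner_diff_left wiener_L2 L2_exp_mult)
    also have "inner_circ (circ_exp (- m) * u - (bshift ^^ nat m) u) r = 0"
    proof (rule inner_eq_0_wiener)
      show "circ_exp (- m) * u - (bshift ^^ nat m) u \<in> wiener"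
        using u bshift_pow_wiener by auto
      show "fourier (circ_exp (- m) * u - (bshift ^^ nat m) u) k = 0 \<or> fourier r k = 0" for k
        using u r bshift_pow_L2_plus[OF u(2)] fourier_bshift_pow[OF u(2), of k "nat m"] that
        by (cases "k \<ge> 0") (auto simp: fourier_diff wiener_L2 L2_plusD L2_exp_mult)
    qed (use r in \<open>simp add: wiener_L2\<close>)
    finally show ?thesis using r_orth' span by simp
  qed
  \<comment> \<open>Exchanging \<open>h\<close> and \<open>r\<close> under the integral leaves a
    function with only negative frequencies against \<open>h\<close>, which has none.\<close>
  have "inner_circ (u * circ_cnj h) r = inner_circ (u * circ_cnj r) h"
    by (rule inner_mult_swap)
  also have "\<dots> = 0"
  proof (rule inner_eq_0_wiener)
    show "fourier (u * circ_cnj r) m = 0 \<or> fourier h m = 0" for m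
      using ur[of m] h by (cases "m \<ge> 0") (auto simp: L2_plusD)
  qed (use u r h in \<open>auto simp: L2_plusD\<close>)
  finally have "inner_circ (u * circ_cnj h) (circ_exp n) = inner_circ (u * circ_cnj h) v"
    using L2 v unfolding r_def by (simp add: inner_diff_right wiener_L2)
  also have "\<dots> = cnj (inner_circ v (u * circ_cnj h))" by (rule inner_cnj)
  also have "inner_circ v (u * circ_cnj h) = (\<Sum>e\<in>E. inner_circ (circ_exp n) e * inner_circ e (u * circ_cnj h))"
    unfolding v_def using E' L2 by (subst inner_sum_left) auto
  also have "cnj \<dots> = (\<Sum>e\<in>E. inner_circ (u * circ_cnj h) e * inner_circ e (circ_exp n))"
    unfolding cnj_sum complex_cnj_mult inner_cnj[of "u * circ_cnj h", symmetric] inner_cnj[of _ "circ_exp n", symmetric]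
    by (simp only: mult.commute)
  also have "\<dots> = inner_circ ?g (circ_exp n)"
    using E' by (subst inner_sum_left) auto
  finally show ?thesis by (simp add: fourier_def)
qed

text \<open>By \<open>hankel_exp\<close> the iterated backward shifts of \<open>u\<close> are the
  values of its Hankel operator on exponentials; the last assumption thus places the range of the
  operator in the span of \<open>E\<close>.\<close>

locale hankel_finite =
  fixes u :: circ_fun and E :: "circ_fun set"
  assumes u: "u \<in> wiener" "u \<in> L2_plus" and E: "orthonormal E"
    and span: "\<And>m. (bshift ^^ m) u \<in> circ_fun.span E"
begin

lemma finite_E: "finite E" and E_wiener: "e \<in> E \<Longrightarrow> e \<in> wiener" and E_L2_plus: "e \<in> E \<Longrightarrow> e \<in> L2_plus"
  using E by (auto simp: orthonormal_def)

lemma mult_cnj_L2: "h \<in> L2_plus \<Longrightarrow> u * circ_cnj h \<in> L2"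
  using L2_mult_bounded[OF wiener_bounded[OF u(1)], of "circ_cnj h"] by (simp add: L2_plusD)

lemma hankel_eq:
  assumes "h \<in> L2_plus"
  shows "hankel u h = (\<Sum>e\<in>E. inner_circ (u * circ_cnj h) e *\<^sub>C e)"
  unfolding hankel_def
  by (intro szego_proj_eqI mult_cnj_L2 assms L2_plus_sum L2_plus_scaleC E_L2_plus hankel_orthonormal_aux u E span)

lemma hankel_wiener: "h \<in> L2_plus \<Longrightarrow> hankel u h \<in> wiener"
  using E_wiener by (auto simp: hankel_eq)

lemma hankel_L2_plus: "h \<in> L2_plus \<Longrightarrow> hankel u h \<in> L2_plus"
  using E_L2_plus by (auto simp: hankel_eq)

lemma hankel_span: "h \<in> L2_plus \<Longrightarrow> hankel u h \<in> circ_fun.span E"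
  unfolding hankel_eq by (intro circ_fun.span_sum circ_fun.span_scale circ_fun.span_base)

lemma fourier_hankel:
  assumes "h \<in> L2_plus" "n \<ge> 0"
  shows "fourier (hankel u h) n = fourier (u * circ_cnj h) n"
  using hankel_orthonormal_aux[OF u E span assms] hankel_eq[OF assms(1)] by simp

lemma inner_hankel:
  assumes "h \<in> L2_plus" "x \<in> wiener" "x \<in> L2_plus"
  shows "inner_circ (hankel u h) x = inner_circ (u * circ_cnj h) x"
proof -
  have L2: "hankel u h \<in> L2" using hankel_L2_plus[OF assms(1)] by (simp add: L2_plusD)
  have "fourier x n = 0 \<or> fourier (u * circ_cnj h - hankel u h) n = 0" for n
    using assms L2 mult_cnj_L2[OF assms(1)]
    by (cases "n \<ge> 0") (auto simp: fourier_diff fourier_hankel L2_plusD)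
  then have "inner_circ x (u * circ_cnj h - hankel u h) = 0"
    using assms L2 mult_cnj_L2[OF assms(1)] by (intro inner_eq_0_wiener) auto
  then have "inner_circ x (u * circ_cnj h) = inner_circ x (hankel u h)"
    using assms L2 mult_cnj_L2[OF assms(1)] by (simp add: inner_diff_right L2_plusD)
  then show ?thesis using inner_cnj[of "hankel u h" x] inner_cnj[of "u * circ_cnj h" x] by simp
qed

text \<open>The substitute for selfadjointness of an antilinear operator: \<open>h\<close> and
  \<open>x\<close> play the same role in the integral of
  \<open>u * circ_cnj h * circ_cnj x\<close>.\<close>

lemma hankel_sym:
  assumes "h \<in> L2_plus" "x \<in> wiener" "x \<in> L2_plus"
  shows "inner_circ (hankel u h) x = inner_circ (hankel u x) h"
proof -
  have "inner_circ (hankel u x) h = inner_circ (u * circ_cnj x) h"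
    unfolding hankel_def using u assms by (intro inner_szego_proj_right) auto
  then show ?thesis using inner_hankel[OF assms] inner_mult_swap[of u h x] by simp
qed

lemma hankel_add: "g \<in> L2_plus \<Longrightarrow> h \<in> L2_plus \<Longrightarrow> hankel u (g + h) = hankel u g + hankel u h"
proof (rule L2_plus_eqI)
  assume *: "g \<in> L2_plus" "h \<in> L2_plus"
  then have "g + h \<in> L2_plus" by auto
  with * show "hankel u (g + h) \<in> L2_plus" "hankel u g + hankel u h \<in> L2_plus"
    using hankel_L2_plus by auto
  show "fourier (hankel u (g + h)) n = fourier (hankel u g + hankel u h) n" if "n \<ge> 0" for n
    using * \<open>g + h \<in> L2_plus\<close> that mult_cnj_L2 hankel_L2_plus
    by (simp add: fourier_hankel fourier_add distrib_left L2_plusD)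
qed

lemma hankel_scaleC: "h \<in> L2_plus \<Longrightarrow> hankel u (c *\<^sub>C h) = cnj c *\<^sub>C hankel u h"
proof (rule L2_plus_eqI)
  assume *: "h \<in> L2_plus"
  then have "c *\<^sub>C h \<in> L2_plus" by auto
  with * show "hankel u (c *\<^sub>C h) \<in> L2_plus" "cnj c *\<^sub>C hankel u h \<in> L2_plus"
    using hankel_L2_plus by auto
  show "fourier (hankel u (c *\<^sub>C h)) n = fourier (cnj c *\<^sub>C hankel u h) n" if "n \<ge> 0" for n
    using * \<open>c *\<^sub>C h \<in> L2_plus\<close> that by (simp add: fourier_hankel)
qed

text \<open>The commutation rule of Hankel operators: shifting the argument forward amounts to
  shifting the value backward.\<close>

lemma bshift_hankel:
  assumes h: "h \<in> L2_plus"
  shows "bshift (hankel u h) = shifted_hankel u h"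
proof (rule L2_plus_eqI)
  have h': "circ_exp 1 * h \<in> L2_plus" using h by (rule L2_plus_shift)
  show "bshift (hankel u h) \<in> L2_plus" using hankel_L2_plus[OF h] by auto
  show "shifted_hankel u h \<in> L2_plus"
    unfolding shifted_hankel_def shift_def using h' by (rule hankel_L2_plus)
  show "fourier (bshift (hankel u h)) n = fourier (shifted_hankel u h) n" if n: "n \<ge> 0" for n
  proof -
    have "fourier (shifted_hankel u h) n = fourier (u * circ_cnj (circ_exp 1 * h)) n"
      unfolding shifted_hankel_def shift_def using h' n by (rule fourier_hankel)
    also have "u * circ_cnj (circ_exp 1 * h) = circ_exp (-1) * (u * circ_cnj h)" by (simp add: mult_ac)
    finally show ?thesis
      using n h hankel_L2_plus[OF h] by (simp add: fourier_bshift fourier_hankel L2_plusD)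
  qed
qed

end

lemma hankel_exp:
  assumes "u \<in> L2_plus" "m \<ge> 0"
  shows "hankel u (circ_exp m) = (bshift ^^ nat m) u"
  unfolding hankel_def
  by (rule szego_proj_eqI)
    (use assms in \<open>auto simp: mult.commute[of u] L2_plusD fourier_bshift_pow bshift_pow_L2_plus intro!: L2_exp_mult\<close>)

lemma shifted_hankel_exp:
  assumes "u \<in> L2_plus" "m \<ge> 0"
  shows "shifted_hankel u (circ_exp m) = (bshift ^^ (nat m + 1)) u"
  using hankel_exp[OF assms(1), of "m + 1"] assms(2)
  by (simp add: shifted_hankel_def shift_def circ_exp_mult add.commute nat_add_distrib)

text \<open>Makes the rank bounds for Hankel operators available for
  \<open>shifted_hankel u\<close>, with symbol \<open>bshift u\<close>.\<close>

lemma shifted_hankel_eq_hankel_bshift: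
  assumes "u \<in> wiener" "h \<in> L2_plus"
  shows "shifted_hankel u h = hankel (bshift u) h"
  unfolding shifted_hankel_def shift_def hankel_def
proof (rule szego_proj_cong)
  have eq: "u * circ_cnj (circ_exp 1 * h) = circ_exp (-1) * (u * circ_cnj h)"
    "bshift u * circ_cnj h = circ_exp (-1) * (u * circ_cnj h) - fourier u 0 *\<^sub>C (circ_exp (-1) * circ_cnj h)"
    by (simp_all add: bshift_def mult_ac algebra_simps)
  have L: "u * circ_cnj h \<in> L2"
    using L2_mult_bounded[OF wiener_bounded[OF assms(1)], of "circ_cnj h"] assms by (simp add: L2_plusD)
  have L': "circ_cnj h \<in> L2" using assms by (simp add: L2_plusD)
  show "u * circ_cnj (circ_exp 1 * h) \<in> L2" "bshift u * circ_cnj h \<in> L2"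
    unfolding eq by (intro L2_exp_mult L2_diff L2_scaleC L L')+
  show "fourier (u * circ_cnj (circ_exp 1 * h)) n = fourier (bshift u * circ_cnj h) n" if "n \<ge> 0" for n
    unfolding eq using that assms
    by (subst fourier_diff) (auto simp: L2_plusD intro!: L2_exp_mult L2_scaleC L L')
qed

section \<open>Symbols with two Hankel operators of rank two\<close>

text \<open>\<open>circ_fun.dim\<close> is the cardinality of some basis of the range;
  \<open>finite_rank\<close> makes that basis finite, so that it dominates every independent
  family.\<close>

lemma card_le_rk:
  assumes "finite_rank T" "circ_fun.independent C" "C \<subseteq> T ` L2_plus"
  shows "card C \<le> rk T"
proof -
  obtain B where B: "finite B" "T ` L2_plus \<subseteq> circ_fun.span B"
    using assms(1) by (auto simp: finite_rank_def)
  obtain b where b: "b \<subseteq> T ` L2_plus" "circ_fun.independent b" "T ` L2_plus \<subseteq> circ_fun.span b"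
    "card b = circ_fun.dim (T ` L2_plus)"
    using circ_fun.basis_exists by blast
  have "finite b" using circ_fun.independent_span_bound[OF B(1) b(2)] b(1) B(2) by auto
  then have "card C \<le> card b"
    using circ_fun.independent_span_bound[OF _ assms(2)] assms(3) b(3) by auto
  then show ?thesis using b(4) by (simp add: rk_def)
qed

lemma rk_le_card: "T ` L2_plus \<subseteq> circ_fun.span W \<Longrightarrow> finite W \<Longrightarrow> rk T \<le> card W"
  unfolding rk_def by (rule circ_fun.dim_le_card)

definition circ_normalize :: "circ_fun \<Rightarrow> circ_fun" where
  "circ_normalize f = of_real (1 / norm_L2 f) *\<^sub>C f"

lemma norm_L2_pos: "f \<in> L2 \<Longrightarrow> f \<noteq> 0 \<Longrightarrow> norm_L2 f > 0"
  using inner_self_eq_0[of f] norm_L2_nonneg[of f] by (auto simp: inner_self less_le)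

lemma inner_normalize: "f \<in> L2 \<Longrightarrow> f \<noteq> 0 \<Longrightarrow> inner_circ (circ_normalize f) (circ_normalize f) = 1"
  using norm_L2_pos[of f] unfolding circ_normalize_def inner_self norm_L2_scaleC
  by (simp add: norm_divide)

lemma normalize_scale: "f \<in> L2 \<Longrightarrow> f \<noteq> 0 \<Longrightarrow> f = of_real (norm_L2 f) *\<^sub>C circ_normalize f"
  using norm_L2_pos[of f] by (simp add: circ_normalize_def)

lemma normalize_in [intro]: "f \<in> wiener \<Longrightarrow> circ_normalize f \<in> wiener" "f \<in> L2_plus \<Longrightarrow> circ_normalize f \<in> L2_plus"
  unfolding circ_normalize_def by auto

lemma hankel_finite_line:
  assumes u: "u \<in> wiener" "u \<in> L2_plus" "u \<noteq> 0" and eig: "bshift u = l *\<^sub>C u"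
  shows "hankel_finite u {circ_normalize u}"
proof
  have "(bshift ^^ m) u \<in> circ_fun.span {u} \<and> bshift ((bshift ^^ m) u) = l *\<^sub>C (bshift ^^ m) u" for m
  proof (induction m)
    case (Suc m)
    then show ?case using bshift_pow_wiener[OF u(1), of m] eig
      by (auto simp: bshift_scaleC wiener_L2 circ_fun.span_base intro!: circ_fun.span_scale)
  qed (use eig in \<open>auto simp: circ_fun.span_base\<close>)
  moreover have "circ_fun.span {u} \<subseteq> circ_fun.span {circ_normalize u}"
  proof (intro circ_fun.span_minimal)
    have "of_real (norm_L2 u) *\<^sub>C circ_normalize u \<in> circ_fun.span {circ_normalize u}"
      by (intro circ_fun.span_scale circ_fun.span_base) auto
    then show "{u} \<subseteq> circ_fun.span {circ_normalize u}"
      using normalize_scale[of u] u by (simp add: wiener_L2)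
  qed auto
  ultimately show "(bshift ^^ m) u \<in> circ_fun.span {circ_normalize u}" for m by blast
  show "orthonormal {circ_normalize u}"
    using u by (auto simp: orthonormal_def inner_normalize wiener_L2)
qed (use u in auto)

lemma rk_line_le:
  assumes u: "u \<in> wiener" "u \<in> L2_plus" and eig: "bshift u = l *\<^sub>C u"
  shows "rk (hankel u) \<le> 1" "\<And>h. h \<in> L2_plus \<Longrightarrow> hankel u h \<in> circ_fun.span {circ_normalize u}"
proof -
  show *: "hankel u h \<in> circ_fun.span {circ_normalize u}" if h: "h \<in> L2_plus" for h
  proof (cases "u = 0")
    case True
    then have "hankel u h = 0"
      unfolding hankel_def by (intro szego_proj_eqI) auto
    then show ?thesis by (simp add: circ_fun.span_zero)
  next
    case False
    then interpret hankel_finite u "{circ_normalize u}" using u eig hankel_finite_line by blast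
    show ?thesis by (rule hankel_span[OF h])
  qed
  have "hankel u ` L2_plus \<subseteq> circ_fun.span {circ_normalize u}" using * by auto
  from rk_le_card[OF this] show "rk (hankel u) \<le> 1" by simp
qed

text \<open>Gram--Schmidt on \<open>u\<close> and \<open>bshift u\<close>; the recurrence keeps all
  further backward shifts in their span.\<close>

lemma hankel_finite_plane:
  assumes u: "u \<in> wiener" "u \<in> L2_plus" "u \<noteq> 0" and nl: "\<And>l. bshift u \<noteq> l *\<^sub>C u"
    and rec: "bshift (bshift u) = s *\<^sub>C bshift u - d *\<^sub>C u"
  obtains f1 f2 where "f1 \<noteq> f2" "hankel_finite u {f1, f2}" "circ_fun.span {f1, f2} = circ_fun.span {u, bshift u}"
proof -
  define f1 where "f1 = circ_normalize u"
  define v where "v = bshift u - inner_circ (bshift u) f1 *\<^sub>C f1"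
  define f2 where "f2 = circ_normalize v"
  have f1: "f1 \<in> wiener" "f1 \<in> L2_plus" "inner_circ f1 f1 = 1"
    using u by (auto simp: f1_def inner_normalize wiener_L2)
  have f1_eq: "u = of_real (norm_L2 u) *\<^sub>C f1"
    unfolding f1_def using u by (intro normalize_scale wiener_L2)
  have v: "v \<in> wiener" "v \<in> L2_plus" using u f1 by (auto simp: v_def)
  have "v \<noteq> 0"
  proof
    assume "v = 0"
    then have "bshift u = (inner_circ (bshift u) f1 * of_real (1 / norm_L2 u)) *\<^sub>C u"
      by (simp add: v_def f1_def circ_normalize_def)
    then show False using nl by blast
  qed
  have f2: "f2 \<in> wiener" "f2 \<in> L2_plus" "inner_circ f2 f2 = 1"
    using v \<open>v \<noteq> 0\<close> by (auto simp: f2_def inner_normalize wiener_L2)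
  have f2_eq: "v = of_real (norm_L2 v) *\<^sub>C f2"
    unfolding f2_def using v \<open>v \<noteq> 0\<close> by (intro normalize_scale wiener_L2)
  have "inner_circ v f1 = 0"
    using u f1 unfolding v_def by (subst inner_diff_left) (auto simp: wiener_L2 bshift_L2 intro!: L2_scaleC)
  then have o21: "inner_circ f2 f1 = 0" by (simp add: f2_def circ_normalize_def)
  then have o12: "inner_circ f1 f2 = 0" using inner_cnj[of f1 f2] by simp
  have "f1 \<noteq> f2" using o12 f1(3) by auto
  have orth: "orthonormal {f1, f2}"
    using f1 f2 o12 o21 by (auto simp: orthonormal_def)
  have in1: "f1 \<in> circ_fun.span {u, bshift u}"
    unfolding f1_def circ_normalize_def by (intro circ_fun.span_scale circ_fun.span_base) auto
  have in2: "f2 \<in> circ_fun.span {u, bshift u}"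
    unfolding f2_def circ_normalize_def v_def
    by (intro circ_fun.span_scale circ_fun.span_diff in1) (auto intro: circ_fun.span_base)
  have in3: "u \<in> circ_fun.span {f1, f2}"
    by (subst f1_eq) (intro circ_fun.span_scale circ_fun.span_base, auto)
  have "bshift u = of_real (norm_L2 v) *\<^sub>C f2 + inner_circ (bshift u) f1 *\<^sub>C f1"
    unfolding f2_eq[symmetric] by (simp add: v_def)
  also have "\<dots> \<in> circ_fun.span {f1, f2}"
    by (intro circ_fun.span_add circ_fun.span_scale circ_fun.span_base) auto
  finally have in4: "bshift u \<in> circ_fun.span {f1, f2}" .
  have span: "circ_fun.span {f1, f2} = circ_fun.span {u, bshift u}"
    using in1 in2 in3 in4 by (intro antisym circ_fun.span_minimal) auto
  have "(bshift ^^ m) u \<in> circ_fun.span {u, bshift u} \<and> (bshift ^^ Suc m) u \<in> circ_fun.span {u, bshift u}" for m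
  proof (induction m)
    case (Suc m)
    have "(bshift ^^ (m + 2)) u = s *\<^sub>C (bshift ^^ (m + 1)) u - d *\<^sub>C (bshift ^^ m) u" for m
    proof (induction m)
      case (Suc m)
      then show ?case using bshift_pow_wiener[OF u(1), of m] bshift_pow_wiener[OF u(1), of "Suc m"]
          bshift_diff[of "s *\<^sub>C (bshift ^^ (m + 1)) u" "d *\<^sub>C (bshift ^^ m) u"]
        by (simp add: wiener_L2 bshift_scaleC L2_scaleC bshift_L2)
    qed (use rec in simp)
    from this[of m] Suc show ?case
      by (auto intro!: circ_fun.span_diff circ_fun.span_scale)
  qed (auto intro: circ_fun.span_base)
  then have "hankel_finite u {f1, f2}"
    unfolding span[symmetric] using u orth by (unfold_locales) auto
  with that \<open>f1 \<noteq> f2\<close> span show ?thesis by blast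
qed

text \<open>The rank sum 4 is contradicted in three ways: if \<open>u\<close> is an eigenvector of
  the backward shift, the ranks are at most 1 and 1; if the first three iterates of \<open>u\<close>
  are independent, they are at least 3 and 2; if \<open>d = 0\<close>, then \<open>bshift u\<close>
  is an eigenvector and they are at most 2 and 1.\<close>

lemma V_rk_4_structure:
  assumes "u \<in> V_rk 4" "u \<in> wiener"
  obtains s d where "d \<noteq> 0" "bshift (bshift u) = s *\<^sub>C bshift u - d *\<^sub>C u" "u \<noteq> 0" "\<And>l. bshift u \<noteq> l *\<^sub>C u"
proof -
  have u: "u \<in> wiener" "u \<in> L2_plus" and fr: "finite_rank (hankel u)" "finite_rank (shifted_hankel u)"
    and rk: "rk (hankel u) + rk (shifted_hankel u) = 4"
    using assms by (auto simp: V_rk_def Hs_plus_def)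
  have H: "(bshift ^^ m) u \<in> hankel u ` L2_plus" for m
    using hankel_exp[OF u(2), of "int m"] imageI[OF L2_plus_exp, of "int m" "hankel u"] by simp
  have K: "(bshift ^^ (Suc m)) u \<in> shifted_hankel u ` L2_plus" for m
    using shifted_hankel_exp[OF u(2), of "int m"] imageI[OF L2_plus_exp, of "int m" "shifted_hankel u"]
    by simp
  have nl: "bshift u \<noteq> l *\<^sub>C u" for l
  proof
    assume l: "bshift u = l *\<^sub>C u"
    have "shifted_hankel u h \<in> circ_fun.span {circ_normalize u}" if "h \<in> L2_plus" for h
      unfolding shifted_hankel_def shift_def by (intro rk_line_le(2)[OF u l] L2_plus_shift that)
    then have "shifted_hankel u ` L2_plus \<subseteq> circ_fun.span {circ_normalize u}"
      by (rule image_subsetI)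
    from rk_le_card[OF this] rk_line_le(1)[OF u l] rk show False by simp
  qed
  have u0: "u \<noteq> 0" using nl[of 0] by auto
  have ind: "circ_fun.independent {bshift u, u}"
      using nl u0 by (intro circ_fun.independent_insertI circ_fun.independent_empty) (auto simp: circ_fun.span_singleton)
  have neq: "bshift u \<noteq> u" using nl[of 1] by auto
  have "bshift (bshift u) \<in> circ_fun.span {bshift u, u}"
  proof (rule ccontr)
    assume n: "bshift (bshift u) \<notin> circ_fun.span {bshift u, u}"
    have ind3: "circ_fun.independent {bshift (bshift u), bshift u, u}"
      by (rule circ_fun.independent_insertI[OF n ind])
    have neq3: "bshift (bshift u) \<noteq> bshift u" "bshift (bshift u) \<noteq> u"
      using n by (auto intro: circ_fun.span_base)
    have "card {bshift (bshift u), bshift u, u} \<le> rk (hankel u)"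
      using H[of 0] H[of 1] H[of 2] by (intro card_le_rk fr ind3) (auto simp: numeral_2_eq_2)
    moreover have "card {bshift (bshift u), bshift u} \<le> rk (shifted_hankel u)"
      using K[of 0] K[of 1] ind3 by (intro card_le_rk fr circ_fun.independent_mono[OF ind3]) auto
    ultimately show False using rk neq neq3 by simp
  qed
  then obtain s where "bshift (bshift u) - s *\<^sub>C bshift u \<in> circ_fun.span {u}"
    unfolding circ_fun.span_insert[of "bshift u"] by auto
  then obtain d' where "bshift (bshift u) - s *\<^sub>C bshift u = d' *\<^sub>C u"
    by (auto simp: circ_fun.span_singleton)
  then have rec: "bshift (bshift u) = s *\<^sub>C bshift u - (- d') *\<^sub>C u" by (simp add: algebra_simps)
  have "- d' \<noteq> 0"
  proof
    assume "- d' = 0"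
    then have "bshift (bshift u) = s *\<^sub>C bshift u" using rec by simp
    from rk_line_le(2)[OF bshift_wiener[OF u(1)] bshift_L2_plus[OF u(2)] this]
    have "shifted_hankel u h \<in> circ_fun.span {circ_normalize (bshift u)}" if "h \<in> L2_plus" for h
      using that shifted_hankel_eq_hankel_bshift[OF u(1) that] by (simp only:)
    then have "shifted_hankel u ` L2_plus \<subseteq> circ_fun.span {circ_normalize (bshift u)}"
      by (rule image_subsetI)
    from rk_le_card[OF this] have 1: "rk (shifted_hankel u) \<le> 1" by simp
    obtain f1 f2 where f: "f1 \<noteq> f2" "hankel_finite u {f1, f2}"
      by (rule hankel_finite_plane[OF u u0 nl rec])
    interpret hankel_finite u "{f1, f2}" by fact
    have "hankel u ` L2_plus \<subseteq> circ_fun.span {f1, f2}" by (rule image_subsetI) (rule hankel_span)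
    from rk_le_card[OF this] f(1) 1 rk show False by simp
  qed
  then show ?thesis by (rule that[OF _ rec u0 nl])
qed

section \<open>Takagi factorization in dimension two\<close>

text \<open>\<open>v \<mapsto> M (cnj v)\<close> is an antilinear map whose square is a positive matrix; an eigenvector \<open>v\<close> of
  the square for \<open>\<sigma>\<^sup>2\<close> gives the fixed direction \<open>M (cnj v) + \<sigma> v\<close>, or \<open>\<i> v\<close> if this vanishes.\<close>

lemma takagi_vector:
  fixes A B C :: complex
  obtains x y :: complex and \<sigma> :: real
  where "(norm x)\<^sup>2 + (norm y)\<^sup>2 = 1" "\<sigma> \<ge> 0" "A * cnj x + B * cnj y = \<sigma> * x" "B * cnj x + C * cnj y = \<sigma> * y"
proof -
  define p q where "p = (norm A)\<^sup>2 + (norm B)\<^sup>2" and "q = (norm B)\<^sup>2 + (norm C)\<^sup>2"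
  define r where "r = A * cnj B + B * cnj C"
  \<comment> \<open>The larger eigenvalue of the Hermitian matrix with diagonal \<open>p\<close>,
    \<open>q\<close> and upper entry \<open>r\<close>, the square of the antilinear map;
    \<open>prod\<close> below is its characteristic equation.\<close>
  define \<mu> where "\<mu> = (p + q + sqrt ((p - q)\<^sup>2 + 4 * (norm r)\<^sup>2)) / 2"
  have pq: "p \<ge> 0" "q \<ge> 0" by (auto simp: p_def q_def)
  then have "\<mu> \<ge> 0" by (simp add: \<mu>_def)
  have "2 * \<mu> - p - q = sqrt ((p - q)\<^sup>2 + 4 * (norm r)\<^sup>2)"
    by (simp add: \<mu>_def field_simps)
  then have "(2 * \<mu> - p - q)\<^sup>2 = (p - q)\<^sup>2 + 4 * (norm r)\<^sup>2"
    by simp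
  then have prod: "(\<mu> - p) * (\<mu> - q) = (norm r)\<^sup>2"
    by (simp add: power2_eq_square algebra_simps)
  have P: "of_real p = A * cnj A + B * cnj B" and Q: "of_real q = B * cnj B + C * cnj C"
    by (simp_all add: p_def q_def complex_norm_square[symmetric])
  \<comment> \<open>The vector \<open>(r, \<mu> - p)\<close> is an eigenvector by
    \<open>prod\<close>; if it vanishes, the matrix is diagonal and the first unit vector
    serves.\<close>
  obtain v1 v2 where v: "v1 \<noteq> 0 \<or> v2 \<noteq> 0" "of_real p * v1 + r * v2 = of_real \<mu> * v1" "cnj r * v1 + of_real q * v2 = of_real \<mu> * v2"
  proof (cases "r = 0 \<and> \<mu> = p")
    case True
    then show ?thesis by (intro that[of 1 0]) auto
  next
    case False
    have "cnj r * r + of_real q * of_real (\<mu> - p) = of_real ((norm r)\<^sup>2 + q * (\<mu> - p))"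
      unfolding of_real_add of_real_mult complex_norm_square by simp
    also have "(norm r)\<^sup>2 + q * (\<mu> - p) = \<mu> * (\<mu> - p)"
      unfolding prod[symmetric] by (simp add: algebra_simps)
    finally show ?thesis using False by (intro that[of r "of_real (\<mu> - p)"]) (auto simp: algebra_simps)
  qed
  define \<sigma> where "\<sigma> = sqrt \<mu>"
  have \<sigma>: "\<sigma> \<ge> 0" "of_real \<mu> = of_real \<sigma> * (of_real \<sigma> :: complex)" 
    using \<open>\<mu> \<ge> 0\<close> by (simp_all add: \<sigma>_def flip: of_real_mult)
  define k1 k2 where "k1 = A * cnj v1 + B * cnj v2" and "k2 = B * cnj v1 + C * cnj v2"
  have K: "A * cnj k1 + B * cnj k2 = of_real \<mu> * v1" "B * cnj k1 + C * cnj k2 = of_real \<mu> * v2"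
    unfolding v(2)[symmetric] v(3)[symmetric] P Q by (simp_all add: k1_def k2_def r_def algebra_simps)
  obtain x y where xy: "x \<noteq> 0 \<or> y \<noteq> 0" "A * cnj x + B * cnj y = of_real \<sigma> * x" "B * cnj x + C * cnj y = of_real \<sigma> * y"
  proof (cases "k1 + of_real \<sigma> * v1 = 0 \<and> k2 + of_real \<sigma> * v2 = 0")
    case True
    then have "k1 = - of_real \<sigma> * v1" "k2 = - of_real \<sigma> * v2" by (auto simp: add_eq_0_iff)
    moreover have "A * cnj (\<i> * v1) + B * cnj (\<i> * v2) = - \<i> * k1" "B * cnj (\<i> * v1) + C * cnj (\<i> * v2) = - \<i> * k2"
      by (simp_all add: k1_def k2_def algebra_simps)
    ultimately show ?thesis
      using v(1) by (intro that[of "\<i> * v1" "\<i> * v2"]) auto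
  next
    case False
    have "A * cnj (k1 + of_real \<sigma> * v1) + B * cnj (k2 + of_real \<sigma> * v2) = (A * cnj k1 + B * cnj k2) + of_real \<sigma> * k1"
      "B * cnj (k1 + of_real \<sigma> * v1) + C * cnj (k2 + of_real \<sigma> * v2) = (B * cnj k1 + C * cnj k2) + of_real \<sigma> * k2"
      by (simp_all add: k1_def k2_def algebra_simps)
    then show ?thesis using False K \<sigma>
      by (intro that[of "k1 + of_real \<sigma> * v1" "k2 + of_real \<sigma> * v2"]) (auto simp: algebra_simps)
  qed
  define N where "N = sqrt ((norm x)\<^sup>2 + (norm y)\<^sup>2)"
  have N2: "N\<^sup>2 = (norm x)\<^sup>2 + (norm y)\<^sup>2" by (simp add: N_def)
  have N: "N > 0" using xy(1) by (auto simp: N_def add_pos_nonneg add_nonneg_pos)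
  show ?thesis
  proof (rule that[of "x / N" "y / N" \<sigma>])
    show "(norm (x / N))\<^sup>2 + (norm (y / N))\<^sup>2 = 1"
      using N N2 xy(1) by (simp add: norm_divide power_divide flip: add_divide_distrib)
    show "A * cnj (x / N) + B * cnj (y / N) = \<sigma> * (x / N)" "B * cnj (x / N) + C * cnj (y / N) = \<sigma> * (y / N)"
      using xy by (simp_all flip: add_divide_distrib)
  qed (use \<sigma> in auto)
qed

text \<open>The complement of \<open>(x, y)\<close> is spanned by \<open>(- cnj y, cnj x)\<close>
  and is invariant because the matrix is symmetric. On it the antilinear map acts by a complex
  number, and a unimodular factor \<open>w\<close> makes that number real and nonnegative.\<close>

lemma takagi_2x2:
  fixes A B C :: complex
  obtains x y w :: complex and \<sigma> \<tau> :: real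
  where "(norm x)\<^sup>2 + (norm y)\<^sup>2 = 1" "norm w = 1" "\<sigma> \<ge> 0" "\<tau> \<ge> 0"
    "A * cnj x + B * cnj y = \<sigma> * x" "B * cnj x + C * cnj y = \<sigma> * y"
    "cnj w * (B * x - A * y) = - (\<tau> * w * cnj y)" "cnj w * (C * x - B * y) = \<tau> * w * cnj x"
proof -
  obtain x y \<sigma> where x: "(norm x)\<^sup>2 + (norm y)\<^sup>2 = 1" "\<sigma> \<ge> 0"
    "A * cnj x + B * cnj y = of_real \<sigma> * x" "B * cnj x + C * cnj y = of_real \<sigma> * y"
    by (rule takagi_vector)
  have 1: "x * cnj x + y * cnj y = 1"
    using arg_cong[OF x(1), of complex_of_real] by (simp add: complex_norm_square[symmetric])
  define z where "z = x * (C * x - B * y) - y * (B * x - A * y)"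
  have orth: "cnj x * (B * x - A * y) + cnj y * (C * x - B * y) = 0"
  proof -
    have "cnj x * (B * x - A * y) + cnj y * (C * x - B * y) =
      x * (B * cnj x + C * cnj y) - y * (A * cnj x + B * cnj y)" by (simp add: algebra_simps)
    then show ?thesis unfolding x(3,4) by simp
  qed
  have z1: "B * x - A * y = - z * cnj y"
  proof -
    have "B * x - A * y + z * cnj y = (B * x - A * y) * (1 - (x * cnj x + y * cnj y)) + x * (cnj x * (B * x - A * y) + cnj y * (C * x - B * y))"
      by (simp add: z_def algebra_simps)
    then have "B * x - A * y + z * cnj y = 0" unfolding 1 orth by simp
    then show ?thesis by (simp add: add_eq_0_iff)
  qed
  have z2: "C * x - B * y = z * cnj x"
  proof -
    have "C * x - B * y - z * cnj x = (C * x - B * y) * (1 - (x * cnj x + y * cnj y)) + y * (cnj x * (B * x - A * y) + cnj y * (C * x - B * y))"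
      by (simp add: z_def algebra_simps)
    then show ?thesis unfolding 1 orth by simp
  qed
  obtain w where w: "norm w = 1" "cnj w * z = of_real (norm z) * w"
  proof (cases "z = 0")
    case False
    \<comment> \<open>An antilinear map sees the factor \<open>w\<close> conjugated, so its square
      must absorb the phase of \<open>z\<close>.\<close>
    define w where "w = csqrt (z / of_real (norm z))"
    have w2: "w\<^sup>2 = z / of_real (norm z)" by (simp add: w_def)
    have "(norm w)\<^sup>2 = 1" using False arg_cong[OF w2, of norm] by (simp add: norm_power norm_divide)
    then have n: "norm w = 1" by (simp add: abs_square_eq_1)
    have "z = of_real (norm z) * w\<^sup>2" using False w2 by simp
    then have "cnj w * z = of_real (norm z) * w * (w * cnj w)" by (metis mult.assoc mult.commute power2_eq_square)
    also have "w * cnj w = 1" using n complex_norm_square[of w] by simp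
    finally show ?thesis using n by (intro that[of w]) auto
  qed (auto intro: that[of 1])
  have "cnj w * (B * x - A * y) = - (cnj w * z) * cnj y" "cnj w * (C * x - B * y) = (cnj w * z) * cnj x"
    unfolding z1 z2 by simp_all
  then have "cnj w * (B * x - A * y) = - (of_real (norm z) * w * cnj y)" "cnj w * (C * x - B * y) = of_real (norm z) * w * cnj x"
    unfolding w by simp_all
  with x w show ?thesis by (intro that[of x y w \<sigma> "norm z"]) auto
qed


section \<open>Spectral data of the shifted Hankel operator\<close>

lemma (in hankel_finite) shifted_hankel_props:
  assumes "h \<in> L2_plus"
  shows "shifted_hankel u h \<in> wiener" "shifted_hankel u h \<in> L2_plus" "shifted_hankel u h \<in> circ_fun.span E"
  unfolding shifted_hankel_def shift_def
  using L2_plus_shift[OF assms] by (auto intro: hankel_wiener hankel_L2_plus hankel_span)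

lemma (in hankel_finite) shifted_hankel_sym:
  assumes "h \<in> L2_plus" "x \<in> wiener" "x \<in> L2_plus"
  shows "inner_circ (shifted_hankel u h) x = inner_circ (shifted_hankel u x) h"
proof -
  have "inner_circ (shifted_hankel u h) x = inner_circ (hankel u x) (circ_exp 1 * h)"
    unfolding shifted_hankel_def shift_def using assms by (intro hankel_sym L2_plus_shift)
  also have "\<dots> = inner_circ (bshift (hankel u x)) h"
    using assms hankel_L2_plus[of x] by (intro inner_bshift_left[symmetric]) (auto simp: L2_plusD)
  finally show ?thesis using bshift_hankel[OF assms(3)] by simp
qed

lemma (in hankel_finite) shifted_hankel_add:
  "g \<in> L2_plus \<Longrightarrow> h \<in> L2_plus \<Longrightarrow> shifted_hankel u (g + h) = shifted_hankel u g + shifted_hankel u h"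
  by (simp add: shifted_hankel_def shift_def distrib_left hankel_add L2_plus_shift)

lemma (in hankel_finite) shifted_hankel_scaleC:
  "h \<in> L2_plus \<Longrightarrow> shifted_hankel u (c *\<^sub>C h) = cnj c *\<^sub>C shifted_hankel u h"
  by (simp add: shifted_hankel_def shift_def hankel_scaleC L2_plus_shift)

text \<open>The data at one time. As \<open>K\<close> is antilinear with positive
  \<open>\<sigma>1\<close>, \<open>\<sigma>2\<close>, unit eigenvectors are fixed up to sign if the
  two differ, and up to a real orthogonal change of basis if they agree. \<open>s\<close> and
  \<open>d\<close> turn out to be trace and determinant of the backward shift on the plane.\<close>

locale hankel_pair = hankel_finite u "{e1, e2}" for u e1 e2 +
  fixes \<sigma>1 \<sigma>2 :: real and s d :: complex
  assumes neq: "e1 \<noteq> e2"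
    and K_e: "shifted_hankel u e1 = of_real \<sigma>1 *\<^sub>C e1" "shifted_hankel u e2 = of_real \<sigma>2 *\<^sub>C e2"
    and \<sigma>: "\<sigma>1 \<ge> \<sigma>2" "\<sigma>2 > 0"
    and rec: "bshift (bshift u) = s *\<^sub>C bshift u - d *\<^sub>C u"
    and not_parallel: "bshift u \<noteq> l *\<^sub>C u"
    and d_nonzero: "d \<noteq> 0"

lemma hankel_pair_exists:
  assumes "u \<in> V_rk 4" "u \<in> wiener"
  obtains e1 e2 \<sigma>1 \<sigma>2 s d where "hankel_pair u e1 e2 \<sigma>1 \<sigma>2 s d"
proof -
  obtain s d where sd: "d \<noteq> 0" "bshift (bshift u) = s *\<^sub>C bshift u - d *\<^sub>C u" "u \<noteq> 0" "\<And>l. bshift u \<noteq> l *\<^sub>C u"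
    by (rule V_rk_4_structure[OF assms]) (rule that)
  have u: "u \<in> wiener" "u \<in> L2_plus" using assms by (auto simp: V_rk_def Hs_plus_def)
  obtain f1 f2 where f: "f1 \<noteq> f2" "hankel_finite u {f1, f2}"
    by (rule hankel_finite_plane[OF u sd(3,4,2)])
  interpret F: hankel_finite u "{f1, f2}" by fact
  have fw: "f1 \<in> wiener" "f2 \<in> wiener" "f1 \<in> L2_plus" "f2 \<in> L2_plus" "f1 \<in> L2" "f2 \<in> L2"
    using F.E_wiener F.E_L2_plus by (auto simp: wiener_L2)
  have fo: "inner_circ f1 f1 = 1" "inner_circ f2 f2 = 1" "inner_circ f1 f2 = 0" "inner_circ f2 f1 = 0"
    using F.E f(1) by (auto simp: orthonormal_def)
  \<comment> \<open>By \<open>shifted_hankel_sym\<close> the matrix of \<open>K\<close> in an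
    orthonormal basis is symmetric, so \<open>B\<close> is both off-diagonal entries and the Takagi
    factorization applies.\<close>
  define A B C where "A = inner_circ (shifted_hankel u f1) f1" and "B = inner_circ (shifted_hankel u f1) f2"
    and "C = inner_circ (shifted_hankel u f2) f2"
  have Kf: "shifted_hankel u f1 = A *\<^sub>C f1 + B *\<^sub>C f2" "shifted_hankel u f2 = B *\<^sub>C f1 + C *\<^sub>C f2"
    using orthonormal_span_coeff[OF F.E F.shifted_hankel_props(3)[OF fw(3)]]
      orthonormal_span_coeff[OF F.E F.shifted_hankel_props(3)[OF fw(4)]] f(1)
      F.shifted_hankel_sym[of f1 f2] fw by (simp_all add: A_def B_def C_def)
  obtain x y w \<sigma> \<tau> where t: "(norm x)\<^sup>2 + (norm y)\<^sup>2 = 1" "norm w = 1" "\<sigma> \<ge> 0" "\<tau> \<ge> 0"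
    "A * cnj x + B * cnj y = of_real \<sigma> * x" "B * cnj x + C * cnj y = of_real \<sigma> * y"
    "cnj w * (B * x - A * y) = - (of_real \<tau> * w * cnj y)" "cnj w * (C * x - B * y) = of_real \<tau> * w * cnj x"
    by (rule takagi_2x2)
  have xy: "x * cnj x + y * cnj y = 1"
    using arg_cong[OF t(1), of complex_of_real] by (simp add: complex_norm_square[symmetric])
  have ww: "w * cnj w = 1" using t(2) complex_norm_square[of w] by simp
  define e1 e2 where "e1 = x *\<^sub>C f1 + y *\<^sub>C f2" and "e2 = (- w * cnj y) *\<^sub>C f1 + (w * cnj x) *\<^sub>C f2"
  have ew: "e1 \<in> wiener" "e2 \<in> wiener" "e1 \<in> L2_plus" "e2 \<in> L2_plus"
    unfolding e1_def e2_def using fw by (blast intro: wiener_add wiener_scaleC L2_plus_add L2_plus_scaleC)+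
  have inner_lin: "inner_circ (p *\<^sub>C f1 + q *\<^sub>C f2) (p' *\<^sub>C f1 + q' *\<^sub>C f2) = p * cnj p' + q * cnj q'" for p q p' q'
    using fw fo by (simp add: inner_add_left inner_add_right L2_scaleC L2_add)
  have eo: "inner_circ e1 e1 = 1" "inner_circ e2 e2 = 1" "inner_circ e1 e2 = 0" "inner_circ e2 e1 = 0"
  proof -
    show "inner_circ e1 e1 = 1" unfolding e1_def inner_lin using xy by simp
    have "inner_circ e2 e2 = (w * cnj w) * (x * cnj x + y * cnj y)"
      unfolding e2_def inner_lin by (simp add: algebra_simps)
    then show "inner_circ e2 e2 = 1" using xy ww by simp
  qed (simp_all only: e1_def e2_def inner_lin, simp_all add: algebra_simps)
  have "e1 \<noteq> e2" using eo by auto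
  have f_in: "f1 \<in> circ_fun.span {e1, e2}" "f2 \<in> circ_fun.span {e1, e2}"
  proof -
    have "cnj x *\<^sub>C e1 + (- y * cnj w) *\<^sub>C e2 = (x * cnj x + (w * cnj w) * (y * cnj y)) *\<^sub>C f1 + (cnj x * y - (w * cnj w) * (y * cnj x)) *\<^sub>C f2"
      by (simp add: e1_def e2_def circ_fun.scale_right_distrib circ_fun.scale_left_distrib circ_fun.scale_left_diff_distrib algebra_simps)
    also have "\<dots> = f1" using xy by (simp add: ww algebra_simps)
    finally have 1: "f1 = cnj x *\<^sub>C e1 + (- y * cnj w) *\<^sub>C e2" ..
    have "cnj y *\<^sub>C e1 + (x * cnj w) *\<^sub>C e2 = (x * cnj y - (w * cnj w) * (x * cnj y)) *\<^sub>C f1 + (y * cnj y + (w * cnj w) * (x * cnj x)) *\<^sub>C f2"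
      by (simp add: e1_def e2_def circ_fun.scale_right_distrib circ_fun.scale_left_distrib circ_fun.scale_left_diff_distrib algebra_simps)
    also have "\<dots> = f2" using xy by (simp add: ww algebra_simps)
    finally have 2: "f2 = cnj y *\<^sub>C e1 + (x * cnj w) *\<^sub>C e2" ..
    have "p *\<^sub>C e1 + q *\<^sub>C e2 \<in> circ_fun.span {e1, e2}" for p q
      by (intro circ_fun.span_add circ_fun.span_scale circ_fun.span_base) auto
    then show "f1 \<in> circ_fun.span {e1, e2}" "f2 \<in> circ_fun.span {e1, e2}"
      by (subst 1 2, blast)+
  qed
  then have "circ_fun.span {f1, f2} \<subseteq> circ_fun.span {e1, e2}"
    by (intro circ_fun.span_minimal) auto
  moreover have orth: "orthonormal {e1, e2}" using ew eo by (auto simp: orthonormal_def)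
  ultimately interpret E: hankel_finite u "{e1, e2}"
    using u F.span by unfold_locales auto
  have K1: "shifted_hankel u e1 = of_real \<sigma> *\<^sub>C e1"
  proof -
    have "shifted_hankel u e1 = cnj x *\<^sub>C shifted_hankel u f1 + cnj y *\<^sub>C shifted_hankel u f2"
      unfolding e1_def using fw by (subst F.shifted_hankel_add) (auto simp: F.shifted_hankel_scaleC)
    also have "\<dots> = (A * cnj x + B * cnj y) *\<^sub>C f1 + (B * cnj x + C * cnj y) *\<^sub>C f2"
      by (simp add: Kf circ_fun.scale_right_distrib circ_fun.scale_left_distrib algebra_simps)
    finally show ?thesis unfolding t e1_def by (simp add: circ_fun.scale_right_distrib)
  qed
  have K2: "shifted_hankel u e2 = of_real \<tau> *\<^sub>C e2"
  proof -
    have "shifted_hankel u e2 = cnj (- w * cnj y) *\<^sub>C shifted_hankel u f1 + cnj (w * cnj x) *\<^sub>C shifted_hankel u f2"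
      unfolding e2_def using fw
      by (subst F.shifted_hankel_add) (auto simp only: F.shifted_hankel_scaleC L2_plus_scaleC)
    also have "\<dots> = (cnj w * (B * x - A * y)) *\<^sub>C f1 + (cnj w * (C * x - B * y)) *\<^sub>C f2"
      by (simp add: Kf circ_fun.scale_right_distrib circ_fun.scale_left_distrib circ_fun.scale_left_diff_distrib algebra_simps)
    finally show ?thesis unfolding t e2_def by (simp add: circ_fun.scale_right_distrib circ_fun.scale_right_diff_distrib mult_ac)
  qed
  \<comment> \<open>If \<open>K\<close> annihilates \<open>g'\<close>, its range lies on the line of
    \<open>g\<close>. Then the first two backward shifts of \<open>u\<close> are multiples of
    \<open>g\<close>, and since \<open>d\<close> is nonzero the recurrence makes \<open>u\<close>
    one too.\<close>
  have pos: "\<rho> \<noteq> 0" if K0: "shifted_hankel u g' = of_real \<rho> *\<^sub>C g'" and g: "{e1, e2} = {g, g'}" "g \<noteq> g'" for g g' \<rho>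
  proof
    assume "\<rho> = 0"
    have g': "g' \<in> wiener" "g' \<in> L2_plus" using g ew by auto
    have "\<exists>c. shifted_hankel u h = c *\<^sub>C g" if h: "h \<in> L2_plus" for h
    proof -
      have "inner_circ (shifted_hankel u h) g' = 0"
        using E.shifted_hankel_sym[OF h g'] K0 \<open>\<rho> = 0\<close> by simp
      then show ?thesis
        using orthonormal_span_coeff[OF E.E E.shifted_hankel_props(3)[OF h]] g by auto
    qed
    note range = this
    obtain p where p: "bshift u = p *\<^sub>C g"
      using range[of 1] shifted_hankel_exp[OF u(2), of 0] by auto
    obtain q where q: "bshift (bshift u) = q *\<^sub>C g"
      using range[of "circ_exp 1"] shifted_hankel_exp[OF u(2), of 1] by (auto simp: numeral_2_eq_2)
    have "q *\<^sub>C g = (s * p) *\<^sub>C g - d *\<^sub>C u" using sd(2) unfolding q by (simp add: p)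
    then have "d *\<^sub>C u = (s * p - q) *\<^sub>C g" by (simp add: circ_fun.scale_left_diff_distrib algebra_simps)
    then have "(1 / d) *\<^sub>C d *\<^sub>C u = (1 / d) *\<^sub>C (s * p - q) *\<^sub>C g" by (rule arg_cong)
    then have ug: "u = ((s * p - q) / d) *\<^sub>C g" using sd(1) by simp
    then have "(s * p - q) / d \<noteq> 0" using sd(3) by auto
    then have "bshift u = (p / ((s * p - q) / d)) *\<^sub>C u"
      by (subst ug) (simp add: p)
    then show False using sd(4) by blast
  qed
  have "\<sigma> \<noteq> 0" using pos[OF K1, of e2] \<open>e1 \<noteq> e2\<close> by auto
  moreover have "\<tau> \<noteq> 0" using pos[OF K2, of e1] \<open>e1 \<noteq> e2\<close> by auto
  ultimately have pos: "\<sigma> > 0" "\<tau> > 0" using t by auto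
  show thesis
  proof (cases "\<sigma> \<ge> \<tau>")
    case True
    then have "hankel_pair u e1 e2 \<sigma> \<tau> s d"
      using pos K1 K2 \<open>e1 \<noteq> e2\<close> sd by unfold_locales auto
    then show ?thesis by (rule that)
  next
    case False
    interpret E': hankel_finite u "{e2, e1}" using E.hankel_finite_axioms by (simp add: insert_commute)
    have "hankel_pair u e2 e1 \<tau> \<sigma> s d"
      using pos K1 K2 \<open>e1 \<noteq> e2\<close> sd False by unfold_locales auto
    then show ?thesis by (rule that)
  qed
qed

section \<open>Coordinates in the eigenbasis and norm identities\<close>

context hankel_pair
begin

definition "a1 = inner_circ u e1"
definition "a2 = inner_circ u e2"
definition "b1 = inner_circ 1 e1"
definition "b2 = inner_circ 1 e2"
definition "c = fourier u 0"
definition "w = szego_proj (u * circ_cnj u)"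

abbreviation "\<mu>1 \<equiv> \<sigma>1\<^sup>2"
abbreviation "\<mu>2 \<equiv> \<sigma>2\<^sup>2"
abbreviation "K \<equiv> shifted_hankel u"
abbreviation "H \<equiv> hankel u"
abbreviation "V \<equiv> circ_fun.span {e1, e2}"

lemma e_in: "e1 \<in> wiener" "e2 \<in> wiener" "e1 \<in> L2_plus" "e2 \<in> L2_plus" "e1 \<in> L2" "e2 \<in> L2"
  using E_wiener E_L2_plus by (auto simp: wiener_L2)

lemma e_inner: "inner_circ e1 e1 = 1" "inner_circ e2 e2 = 1" "inner_circ e1 e2 = 0" "inner_circ e2 e1 = 0"
  using E neq by (auto simp: orthonormal_def)

lemma norm_e: "norm_L2 e1 = 1" "norm_L2 e2 = 1"
  by (simp_all add: norm_L2_def e_inner)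

lemma u_L2: "u \<in> L2"
  using u wiener_L2 by blast

lemma V_expand: "x \<in> V \<Longrightarrow> x = inner_circ x e1 *\<^sub>C e1 + inner_circ x e2 *\<^sub>C e2"
  using orthonormal_span_coeff[OF E, of x] neq by simp

lemma V_wiener: "x \<in> V \<Longrightarrow> x \<in> wiener" and V_L2_plus: "x \<in> V \<Longrightarrow> x \<in> L2_plus" and V_L2: "x \<in> V \<Longrightarrow> x \<in> L2"
proof -
  assume x: "x \<in> V"
  show "x \<in> wiener" by (subst V_expand[OF x]) (intro wiener_add wiener_scaleC e_in)
  then show "x \<in> L2" by (rule wiener_L2)
  show "x \<in> L2_plus" by (subst V_expand[OF x]) (intro L2_plus_add L2_plus_scaleC e_in)
qed

lemma V_inner:
  assumes "x \<in> V" "y \<in> L2"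
  shows "inner_circ x y = inner_circ x e1 * cnj (inner_circ y e1) + inner_circ x e2 * cnj (inner_circ y e2)"
proof -
  have "inner_circ x y = inner_circ (inner_circ x e1 *\<^sub>C e1 + inner_circ x e2 *\<^sub>C e2) y"
    using V_expand[OF assms(1)] by (rule arg_cong)
  also have "\<dots> = inner_circ x e1 * inner_circ e1 y + inner_circ x e2 * inner_circ e2 y"
    using assms(2) e_in by (simp add: inner_add_left L2_scaleC)
  finally show ?thesis using inner_cnj[of e1 y] inner_cnj[of e2 y] by simp
qed

lemma V_norm:
  assumes "x \<in> V"
  shows "(norm_L2 x)\<^sup>2 = (norm (inner_circ x e1))\<^sup>2 + (norm (inner_circ x e2))\<^sup>2"
  using V_inner[OF assms V_L2[OF assms]]
  by (simp add: norm_L2_square cmod_power2 flip: power2_eq_square)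

lemma V_eqI:
  assumes "x \<in> V" "y \<in> V" "inner_circ x e1 = inner_circ y e1" "inner_circ x e2 = inner_circ y e2"
  shows "x = y"
  using V_expand[OF assms(1)] V_expand[OF assms(2)] assms(3,4) by simp

lemma V_fourier_0: "x \<in> V \<Longrightarrow> fourier x 0 = inner_circ x e1 * cnj b1 + inner_circ x e2 * cnj b2"
  using V_inner[of x 1] by (simp add: inner_1_right b1_def b2_def)

lemma V_diff: "x \<in> V \<Longrightarrow> y \<in> V \<Longrightarrow> x - y \<in> V" and V_scaleC: "x \<in> V \<Longrightarrow> k *\<^sub>C x \<in> V"
  and V_add: "x \<in> V \<Longrightarrow> y \<in> V \<Longrightarrow> x + y \<in> V" and e_V: "e1 \<in> V" "e2 \<in> V"
  by (auto intro: circ_fun.span_diff circ_fun.span_scale circ_fun.span_add circ_fun.span_base)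

lemma K_V: "h \<in> L2_plus \<Longrightarrow> K h \<in> V" and H_V: "h \<in> L2_plus \<Longrightarrow> H h \<in> V"
  by (rule shifted_hankel_props, assumption) (rule hankel_span)

lemma K_coeff:
  assumes "h \<in> L2_plus"
  shows "inner_circ (K h) e1 = of_real \<sigma>1 * cnj (inner_circ h e1)" "inner_circ (K h) e2 = of_real \<sigma>2 * cnj (inner_circ h e2)"
  using shifted_hankel_sym[OF assms e_in(1,3)] shifted_hankel_sym[OF assms e_in(2,4)] K_e
    inner_cnj[of e1 h] inner_cnj[of e2 h] by simp_all

lemma H_1: "H 1 = u"
  using hankel_exp[OF u(2), of 0] by simp

lemma K_1: "K 1 = bshift u"
  using shifted_hankel_exp[OF u(2), of 0] by simp

lemma K_exp: "n \<ge> 0 \<Longrightarrow> K (circ_exp n) = (bshift ^^ (nat n + 1)) u"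
  by (rule shifted_hankel_exp[OF u(2)])

lemma u_V: "u \<in> V"
  using span[of 0] by simp

lemma w_eq: "w = H u"
  by (simp add: w_def hankel_def)

lemma w_V: "w \<in> V"
  unfolding w_eq using u(2) by (rule H_V)

text \<open>Since \<open>\<sigma>1\<close> and \<open>\<sigma>2\<close> are nonzero,
  \<open>e1\<close> and \<open>e2\<close> are values of \<open>K\<close>, and the backward shift
  sends values of \<open>K\<close> to values of \<open>K\<close>.\<close>

lemma bshift_V:
  assumes "x \<in> V" shows "bshift x \<in> V"
proof -
  have e: "bshift e1 \<in> V" "bshift e2 \<in> V"
  proof -
    have "bshift (K e1) \<in> V" "bshift (K e2) \<in> V"
      unfolding shifted_hankel_def shift_def using bshift_hankel[OF L2_plus_shift] e_in K_V L2_plus_shift by metis+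
    then have "of_real (1 / \<sigma>1) *\<^sub>C bshift (of_real \<sigma>1 *\<^sub>C e1) \<in> V" "of_real (1 / \<sigma>2) *\<^sub>C bshift (of_real \<sigma>2 *\<^sub>C e2) \<in> V"
      unfolding K_e by (blast intro: V_scaleC)+
    then show "bshift e1 \<in> V" "bshift e2 \<in> V"
      using \<sigma> e_in by (simp_all add: bshift_scaleC)
  qed
  have "bshift x = bshift (inner_circ x e1 *\<^sub>C e1 + inner_circ x e2 *\<^sub>C e2)"
    using V_expand[OF assms] by (rule arg_cong)
  also have "\<dots> = inner_circ x e1 *\<^sub>C bshift e1 + inner_circ x e2 *\<^sub>C bshift e2"
    using e_in by (simp add: bshift_add bshift_scaleC L2_scaleC)
  also have "\<dots> \<in> V" using e by (intro V_add V_scaleC)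
  finally show ?thesis .
qed

lemma bshift_norm: "x \<in> L2 \<Longrightarrow> (norm_L2 (bshift x))\<^sup>2 = (norm_L2 x)\<^sup>2 - (norm (fourier x 0))\<^sup>2"
  using inner_bshift_bshift[of x x] by (simp add: norm_L2_square cmod_power2 flip: power2_eq_square)

text \<open>\<open>K (S\<^sup>* x) = H (S S\<^sup>* x)\<close>, where \<open>S S\<^sup>* x = x - (x | 1)\<close>.\<close>

lemma K_bshift:
  assumes "x \<in> L2_plus"
  shows "K (bshift x) = H x - cnj (fourier x 0) *\<^sub>C u"
proof -
  have "H (x - fourier x 0 *\<^sub>C 1) = H x - cnj (fourier x 0) *\<^sub>C u"
    using hankel_add[of x "(- fourier x 0) *\<^sub>C 1"] assms hankel_scaleC[of 1 "- fourier x 0"] H_1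
      L2_plus_scaleC[of 1 "- fourier x 0"] by simp
  then show ?thesis by (simp add: shifted_hankel_def shift_def shift_bshift)
qed

lemma Q_eq: "szego_Q u = (norm a1)\<^sup>2 + (norm a2)\<^sup>2"
  using V_norm[OF u_V] by (simp add: szego_Q_def norm_L2_square a1_def a2_def flip: inner_circ_def)

lemma Q_norm: "szego_Q u = (norm_L2 u)\<^sup>2"
  by (simp add: szego_Q_def norm_L2_square flip: inner_circ_def)

lemma c_eq: "c = a1 * cnj b1 + a2 * cnj b2"
  using V_fourier_0[OF u_V] by (simp add: c_def a1_def a2_def)

lemma bshift_u_coeff: "inner_circ (bshift u) e1 = \<sigma>1 * cnj b1" "inner_circ (bshift u) e2 = \<sigma>2 * cnj b2"
  using K_coeff[of 1] by (simp_all add: K_1 b1_def b2_def)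

text \<open>Both sides are the squared norm of \<open>bshift u = K 1\<close>, in coordinates and
  through the loss of the mean.\<close>

lemma mu_beta: "\<mu>1 * (norm b1)\<^sup>2 + \<mu>2 * (norm b2)\<^sup>2 = szego_Q u - (norm c)\<^sup>2"
  using V_norm[OF bshift_V[OF u_V]] bshift_norm[OF u_L2] unfolding bshift_u_coeff
  by (simp add: Q_norm c_def norm_mult power_mult_distrib)

text \<open>\<open>K_bshift\<close> at \<open>u\<close> reads
  \<open>w = K (K 1) + cnj c *\<^sub>C u\<close>.\<close>

lemma w_coeff: "inner_circ w e1 = \<mu>1 * b1 + cnj c * a1" "inner_circ w e2 = \<mu>2 * b2 + cnj c * a2"
proof -
  have "K (bshift u) = w - cnj c *\<^sub>C u"
    using K_bshift[OF u(2)] by (simp add: w_eq c_def)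
  then have "w = K (bshift u) + cnj c *\<^sub>C u" by simp
  moreover have "inner_circ (K (bshift u) + cnj c *\<^sub>C u) e = inner_circ (K (bshift u)) e + cnj c * inner_circ u e" if "e \<in> L2" for e
    using that u_L2 V_L2[OF K_V[OF bshift_L2_plus[OF u(2)]]] by (simp add: inner_add_left L2_scaleC)
  ultimately show "inner_circ w e1 = \<mu>1 * b1 + cnj c * a1" "inner_circ w e2 = \<mu>2 * b2 + cnj c * a2"
    using K_coeff[OF bshift_L2_plus[OF u(2)]] e_in bshift_u_coeff
    by (simp_all add: a1_def a2_def power2_eq_square)
qed

lemma fourier_w_0: "fourier w 0 = szego_Q u"
  using fourier_hankel[OF u(2), of 0] inner_self[of u]
  by (simp add: w_eq Q_norm fourier_def inner_circ_def)

lemma bshift_w: "bshift w = K u"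
  unfolding w_eq using u(2) by (rule bshift_hankel)

text \<open>The squared norm of \<open>bshift w = K u\<close>; the mean of \<open>w\<close> is
  \<open>szego_Q u\<close>.\<close>

lemma h2_eq: "(norm_L2 w)\<^sup>2 = (szego_Q u)\<^sup>2 + \<mu>1 * (norm a1)\<^sup>2 + \<mu>2 * (norm a2)\<^sup>2"
  using V_norm[OF K_V[OF u(2)]] bshift_norm[OF V_L2[OF w_V]] unfolding bshift_w K_coeff[OF u(2)] fourier_w_0
  by (simp add: norm_mult power_mult_distrib a1_def a2_def)

lemma w_norm: "(norm_L2 w)\<^sup>2 = (norm (\<mu>1 * b1 + cnj c * a1))\<^sup>2 + (norm (\<mu>2 * b2 + cnj c * a2))\<^sup>2"
  using V_norm[OF w_V] by (simp add: w_coeff)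

lemma J_inner: "szego_J u = inner_circ u w"
proof -
  have "inner_circ w u = inner_circ (u * circ_cnj u) u"
    unfolding w_eq using u by (intro inner_hankel)
  then have "inner_circ u w = cnj (circ_integral (u * circ_cnj u * circ_cnj u))"
    using inner_cnj[of u w] by (simp add: inner_circ_def)
  also have "\<dots> = szego_J u"
    by (simp add: szego_J_def mult_ac flip: circ_integral_cnj)
  finally show ?thesis ..
qed

lemma J_eq: "szego_J u = a1 * cnj (\<mu>1 * b1 + cnj c * a1) + a2 * cnj (\<mu>2 * b2 + cnj c * a2)"
  using V_inner[OF u_V V_L2[OF w_V]] by (simp add: J_inner w_coeff a1_def a2_def)

text \<open>With \<open>v = H w\<close> one has \<open>bshift v = K w\<close>, the mean of
  \<open>v\<close> is \<open>szego_J u\<close>, and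
  \<open>v = K (K u) + szego_Q u *\<^sub>C u\<close> by \<open>K_bshift\<close> at \<open>w\<close>.
  Comparing norms gives the identity.\<close>

lemma mu_w:
  "\<mu>1 * (norm (\<mu>1 * b1 + cnj c * a1))\<^sup>2 + \<mu>2 * (norm (\<mu>2 * b2 + cnj c * a2))\<^sup>2 + (norm (szego_J u))\<^sup>2
    = (\<mu>1 + szego_Q u)\<^sup>2 * (norm a1)\<^sup>2 + (\<mu>2 + szego_Q u)\<^sup>2 * (norm a2)\<^sup>2"
proof -
  define v where "v = H w"
  have v: "v \<in> V" "v \<in> L2" unfolding v_def using H_V V_L2_plus w_V V_L2 by blast+
  have v0: "fourier v 0 = szego_J u"
    using hankel_sym[OF V_L2_plus[OF w_V], of 1] H_1 by (simp add: J_inner v_def inner_1_right)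
  have bv: "bshift v = K w" unfolding v_def using V_L2_plus[OF w_V] by (rule bshift_hankel)
  have "K (K u) = v - szego_Q u *\<^sub>C u"
    using K_bshift[OF V_L2_plus[OF w_V]] unfolding bshift_w fourier_w_0 by (simp add: v_def)
  then have "v = K (K u) + szego_Q u *\<^sub>C u" by simp
  moreover have Ku: "K u \<in> L2_plus" using V_L2_plus[OF K_V[OF u(2)]] .
  moreover have "inner_circ (K (K u) + szego_Q u *\<^sub>C u) e = inner_circ (K (K u)) e + szego_Q u * inner_circ u e" if "e \<in> L2" for e
    using that u_L2 V_L2[OF K_V[OF Ku]] by (simp add: inner_add_left L2_scaleC)
  ultimately have vc: "inner_circ v e1 = (\<mu>1 + szego_Q u) * a1" "inner_circ v e2 = (\<mu>2 + szego_Q u) * a2"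
    using K_coeff[OF Ku] K_coeff[OF u(2)] e_in
    by (simp_all add: a1_def a2_def power2_eq_square algebra_simps)
  have "norm (complex_of_real (\<mu>1 + szego_Q u)) = \<mu>1 + szego_Q u" "norm (complex_of_real (\<mu>2 + szego_Q u)) = \<mu>2 + szego_Q u"
    unfolding norm_of_real by (simp_all add: Q_norm)
  then have nv: "(norm_L2 v)\<^sup>2 = (\<mu>1 + szego_Q u)\<^sup>2 * (norm a1)\<^sup>2 + (\<mu>2 + szego_Q u)\<^sup>2 * (norm a2)\<^sup>2"
    unfolding V_norm[OF v(1)] vc norm_mult power_mult_distrib by simp
  have "(norm_L2 (K w))\<^sup>2 = \<mu>1 * (norm (inner_circ w e1))\<^sup>2 + \<mu>2 * (norm (inner_circ w e2))\<^sup>2"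
    unfolding V_norm[OF K_V[OF V_L2_plus[OF w_V]]] K_coeff[OF V_L2_plus[OF w_V]]
    by (simp add: norm_mult power_mult_distrib)
  then show ?thesis
    using bshift_norm[OF v(2)] unfolding bv v0 nv w_coeff by simp
qed


section \<open>The matrix of the backward shift in the eigenbasis\<close>

definition "s11 = inner_circ (bshift e1) e1"
definition "s21 = inner_circ (bshift e1) e2"
definition "s12 = inner_circ (bshift e2) e1"
definition "s22 = inner_circ (bshift e2) e2"

lemma bshift_coeff:
  assumes "x \<in> V"
  shows "inner_circ (bshift x) e1 = s11 * inner_circ x e1 + s12 * inner_circ x e2"
    "inner_circ (bshift x) e2 = s21 * inner_circ x e1 + s22 * inner_circ x e2"
proof -
  have *: "bshift x = inner_circ x e1 *\<^sub>C bshift e1 + inner_circ x e2 *\<^sub>C bshift e2"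
    using arg_cong[OF V_expand[OF assms], of bshift] e_in by (simp add: bshift_add bshift_scaleC L2_scaleC)
  show "inner_circ (bshift x) e1 = s11 * inner_circ x e1 + s12 * inner_circ x e2"
    "inner_circ (bshift x) e2 = s21 * inner_circ x e1 + s22 * inner_circ x e2"
    unfolding * s11_def s12_def s21_def s22_def using e_in
    by (simp_all add: inner_add_left L2_scaleC bshift_L2)
qed

lemma fourier_e_0: "fourier e1 0 = cnj b1" "fourier e2 0 = cnj b2"
  using inner_cnj[of e1 1] inner_cnj[of e2 1] by (simp_all add: b1_def b2_def inner_1_right)

lemma s_norm:
  "(norm s11)\<^sup>2 + (norm s21)\<^sup>2 = 1 - (norm b1)\<^sup>2"
  "(norm s12)\<^sup>2 + (norm s22)\<^sup>2 = 1 - (norm b2)\<^sup>2"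
  "s11 * cnj s12 + s21 * cnj s22 = - (cnj b1 * b2)"
proof -
  show "(norm s11)\<^sup>2 + (norm s21)\<^sup>2 = 1 - (norm b1)\<^sup>2"
    using V_norm[OF bshift_V[OF e_V(1)]] bshift_norm[OF e_in(5)] e_inner
    by (simp add: s11_def s21_def fourier_e_0 norm_L2_square[of e1])
  show "(norm s12)\<^sup>2 + (norm s22)\<^sup>2 = 1 - (norm b2)\<^sup>2"
    using V_norm[OF bshift_V[OF e_V(2)]] bshift_norm[OF e_in(6)] e_inner
    by (simp add: s12_def s22_def fourier_e_0 norm_L2_square[of e2])
  show "s11 * cnj s12 + s21 * cnj s22 = - (cnj b1 * b2)"
    using V_inner[OF bshift_V[OF e_V(1)] V_L2[OF bshift_V[OF e_V(2)]]] inner_bshift_bshift[OF e_in(5,6)] e_inner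
    by (simp add: s11_def s12_def s21_def s22_def fourier_e_0)
qed

text \<open>Backward shift after \<open>K\<close> is \<open>K\<close> after the shift, a symmetric
  antilinear operator; these are its two off-diagonal entries.\<close>

lemma s_sym: "of_real \<sigma>1 * s21 = of_real \<sigma>2 * s12"
proof -
  have "of_real \<sigma>1 * s21 = inner_circ (bshift (K e1)) e2"
    using e_in by (simp add: K_e bshift_scaleC s21_def)
  also have "bshift (K e1) = K (circ_exp 1 * e1)"
    using bshift_hankel[OF L2_plus_shift[OF e_in(3)]] by (simp add: shifted_hankel_def shift_def)
  also have "inner_circ (K (circ_exp 1 * e1)) e2 = of_real \<sigma>2 * cnj (inner_circ (circ_exp 1 * e1) e2)"
    by (rule K_coeff(2)[OF L2_plus_shift[OF e_in(3)]])
  also have "cnj (inner_circ (circ_exp 1 * e1) e2) = s12"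
    using inner_cnj[of e2 "circ_exp 1 * e1"] inner_bshift_left[OF e_in(6,3)] by (simp add: s12_def)
  finally show ?thesis .
qed

lemma H_matrix:
  "inner_circ (H e1) e1 = of_real \<sigma>1 * cnj s11 + b1 * a1"
  "inner_circ (H e1) e2 = of_real \<sigma>2 * cnj s21 + b1 * a2"
  "inner_circ (H e2) e1 = of_real \<sigma>1 * cnj s12 + b2 * a1"
  "inner_circ (H e2) e2 = of_real \<sigma>2 * cnj s22 + b2 * a2"
proof -
  have *: "H e1 = K (bshift e1) + b1 *\<^sub>C u" "H e2 = K (bshift e2) + b2 *\<^sub>C u"
    using K_bshift[OF e_in(3)] K_bshift[OF e_in(4)] by (simp_all add: fourier_e_0)
  have L: "bshift e1 \<in> L2_plus" "bshift e2 \<in> L2_plus" using e_in by auto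
  have L': "K (bshift e1) \<in> L2" "K (bshift e2) \<in> L2" using L K_V V_L2 by auto
  show
  "inner_circ (H e1) e1 = of_real \<sigma>1 * cnj s11 + b1 * a1"
  "inner_circ (H e1) e2 = of_real \<sigma>2 * cnj s21 + b1 * a2"
  "inner_circ (H e2) e1 = of_real \<sigma>1 * cnj s12 + b2 * a1"
  "inner_circ (H e2) e2 = of_real \<sigma>2 * cnj s22 + b2 * a2"
    unfolding * using L L' e_in u_L2 K_coeff[OF L(1)] K_coeff[OF L(2)]
    by (simp_all add: inner_add_left L2_scaleC a1_def a2_def s11_def s12_def s21_def s22_def)
qed

text \<open>Symmetry of the matrix of \<open>H\<close> and \<open>s_sym\<close> are two linear
  equations for the off-diagonal entries. The outcome shows that \<open>e1\<close> nearly decouples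
  from \<open>e2\<close> when \<open>a1\<close> and \<open>b1\<close> are small.\<close>

lemma s21_eq: "cnj s21 * (\<mu>2 - \<mu>1) = \<sigma>2 * (b2 * a1 - b1 * a2)"
proof -
  have "inner_circ (H e1) e2 = inner_circ (H e2) e1"
    using hankel_sym[OF e_in(3) e_in(2,4)] .
  then have 1: "of_real \<sigma>2 * cnj s21 - of_real \<sigma>1 * cnj s12 = b2 * a1 - b1 * a2"
    unfolding H_matrix by (simp add: algebra_simps)
  have 2: "of_real \<sigma>1 * cnj s21 = of_real \<sigma>2 * cnj s12"
    using arg_cong[OF s_sym, of cnj] by simp
  have "of_real \<sigma>2 * (b2 * a1 - b1 * a2) = of_real \<sigma>2 * of_real \<sigma>2 * cnj s21 - of_real \<sigma>1 * (of_real \<sigma>2 * cnj s12)"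
    unfolding 1[symmetric] by (simp add: algebra_simps)
  then show ?thesis unfolding 2[symmetric] by (simp add: power2_eq_square algebra_simps)
qed

lemma bshift_u_s: "s11 * a1 + s12 * a2 = \<sigma>1 * cnj b1" "s21 * a1 + s22 * a2 = \<sigma>2 * cnj b2"
  using bshift_coeff[OF u_V] by (simp_all add: bshift_u_coeff a1_def a2_def)

text \<open>The recurrence \<open>rec\<close> concerns \<open>u\<close> alone. Subtracting
  Cayley--Hamilton for the matrix leaves a multiple of \<open>bshift u\<close> equal to a multiple
  of \<open>u\<close>; these vectors are not parallel, so both factors vanish.\<close>

lemma trace_det_s: "s = s11 + s22" "d = s11 * s22 - s12 * s21"
proof -
  define t1 t2 where "t1 = inner_circ (bshift u) e1" and "t2 = inner_circ (bshift u) e2"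
  have t: "t1 = s11 * a1 + s12 * a2" "t2 = s21 * a1 + s22 * a2"
    using bshift_coeff[OF u_V] by (simp_all add: t1_def t2_def a1_def a2_def)
  have bb: "inner_circ (bshift (bshift u)) e1 = s * t1 - d * a1" "inner_circ (bshift (bshift u)) e2 = s * t2 - d * a2"
    unfolding rec t1_def t2_def a1_def a2_def using u_L2 bshift_L2 e_in
    by (simp_all add: inner_diff_left L2_scaleC)
  have bb': "s11 * t1 + s12 * t2 = s * t1 - d * a1" "s21 * t1 + s22 * t2 = s * t2 - d * a2"
    using bshift_coeff[OF bshift_V[OF u_V]] unfolding bb t1_def t2_def by simp_all
  define D where "D = s11 * s22 - s12 * s21"
  have r: "(s - (s11 + s22)) * t1 = (d - D) * a1" "(s - (s11 + s22)) * t2 = (d - D) * a2"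
    using bb' unfolding t D_def by algebra+
  show 1: "s = s11 + s22"
  proof (rule ccontr)
    assume ne: "s \<noteq> s11 + s22"
    define l where "l = (d - D) / (s - (s11 + s22))"
    have "t1 = l * a1" "t2 = l * a2"
      using r ne by (simp_all add: l_def field_simps)
    then have "bshift u = l *\<^sub>C u"
      by (intro V_eqI bshift_V u_V V_scaleC) (simp_all add: t1_def t2_def a1_def a2_def)
    then show False using not_parallel by blast
  qed
  have "u \<noteq> 0" using not_parallel[of 0] by auto
  then have "a1 \<noteq> 0 \<or> a2 \<noteq> 0"
    using V_expand[OF u_V] by (auto simp: a1_def a2_def)
  then show "d = s11 * s22 - s12 * s21" using r 1 by (auto simp: D_def)
qed

text \<open>A Gram determinant: by \<open>s_norm\<close> the Gram matrix of
  \<open>bshift e1\<close>, \<open>bshift e2\<close> is the identity minus a matrix of rank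
  one.\<close>

lemma d_norm: "(norm d)\<^sup>2 = 1 - (norm b1)\<^sup>2 - (norm b2)\<^sup>2"
proof -
  have "complex_of_real ((norm d)\<^sup>2) = (s11 * cnj s11 + s21 * cnj s21) * (s12 * cnj s12 + s22 * cnj s22)
     - (s11 * cnj s12 + s21 * cnj s22) * cnj (s11 * cnj s12 + s21 * cnj s22)"
    unfolding complex_norm_square trace_det_s(2) by (simp add: algebra_simps)
  also have "s11 * cnj s11 + s21 * cnj s21 = of_real (1 - (norm b1)\<^sup>2)"
    unfolding s_norm(1)[symmetric] of_real_add complex_norm_square ..
  also have "s12 * cnj s12 + s22 * cnj s22 = of_real (1 - (norm b2)\<^sup>2)"
    unfolding s_norm(2)[symmetric] of_real_add complex_norm_square ..
  also have "(s11 * cnj s12 + s21 * cnj s22) * cnj (s11 * cnj s12 + s21 * cnj s22) = of_real ((norm b1)\<^sup>2 * (norm b2)\<^sup>2)"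
    unfolding s_norm(3) of_real_mult complex_norm_square by simp
  finally have "(norm d)\<^sup>2 = (1 - (norm b1)\<^sup>2) * (1 - (norm b2)\<^sup>2) - (norm b1)\<^sup>2 * (norm b2)\<^sup>2"
    unfolding of_real_mult[symmetric] of_real_diff[symmetric] of_real_eq_iff .
  then show ?thesis by (simp add: algebra_simps)
qed

text \<open>With \<open>\<tau> = (K\<^sup>-\<^sup>2 u | u)\<close> the element \<open>g = K\<^sup>-\<^sup>2 u\<close> satisfies \<open>H\<^sup>2 g = (1 + \<tau>) u\<close>, so that \<open>H g\<close> is
  \<open>1 + \<tau>\<close> times the projection of \<open>1\<close> to \<open>V\<close>.\<close>

lemma beta_sum:
  "((norm b1)\<^sup>2 + (norm b2)\<^sup>2) * (\<mu>1 * \<mu>2 + \<mu>1 * (norm a2)\<^sup>2 + \<mu>2 * (norm a1)\<^sup>2)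
    = \<mu>1 * (norm a2)\<^sup>2 + \<mu>2 * (norm a1)\<^sup>2"
proof -
  have pos: "\<sigma>1 \<noteq> 0" "\<sigma>2 \<noteq> 0" using \<sigma> by auto
  define \<tau> where "\<tau> = (norm a1)\<^sup>2 / \<mu>1 + (norm a2)\<^sup>2 / \<mu>2"
  have \<tau>: "of_real \<tau> = a1 * cnj a1 / of_real \<mu>1 + a2 * cnj a2 / of_real \<mu>2"
    unfolding \<tau>_def by (simp only: of_real_add of_real_divide complex_norm_square)
  define g where "g = (a1 / \<mu>1) *\<^sub>C e1 + (a2 / \<mu>2) *\<^sub>C e2"
  have gV: "g \<in> V" unfolding g_def by (intro V_add V_scaleC e_V)
  have gc: "inner_circ g e1 = a1 / \<mu>1" "inner_circ g e2 = a2 / \<mu>2"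
    using e_in e_inner by (simp_all add: g_def inner_add_left L2_scaleC)
  have Hg: "H g = (cnj a1 / \<mu>1) *\<^sub>C H e1 + (cnj a2 / \<mu>2) *\<^sub>C H e2"
    unfolding g_def using e_in by (subst hankel_add) (auto simp: hankel_scaleC)
  have HL: "H e1 \<in> L2" "H e2 \<in> L2" using e_in H_V V_L2 by auto
  have Hsym: "inner_circ (H e1) e2 = inner_circ (H e2) e1"
    using hankel_sym[OF e_in(3) e_in(2,4)] .
  have ss: "cnj s12 = of_real \<sigma>1 * cnj s21 / of_real \<sigma>2"
    using arg_cong[OF s_sym, of cnj] pos by (simp add: field_simps)
  have t: "\<sigma>1 * b1 = cnj (s11 * a1 + s12 * a2)" "\<sigma>2 * b2 = cnj (s21 * a1 + s22 * a2)"
    unfolding bshift_u_s by simp_all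
  have H1: "inner_circ (H g) e1 = (1 + \<tau>) * b1"
  proof -
    have "inner_circ (H g) e1 = cnj a1 / \<mu>1 * inner_circ (H e1) e1 + cnj a2 / \<mu>2 * inner_circ (H e1) e2"
      unfolding Hg using HL e_in Hsym by (simp add: inner_add_left L2_scaleC)
    also have "\<dots> = \<tau> * b1 + (cnj a1 * cnj s11 / \<sigma>1 + cnj a2 * cnj s21 / \<sigma>2)"
      unfolding H_matrix \<tau> using pos by (simp add: field_simps power2_eq_square)
    also have "cnj a1 * cnj s11 / \<sigma>1 + cnj a2 * cnj s21 / \<sigma>2 = (\<sigma>1 * b1) / \<sigma>1"
      unfolding t complex_cnj_add complex_cnj_mult ss using pos by (simp add: field_simps)
    finally show ?thesis using pos by (simp add: algebra_simps)
  qed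
  have H2: "inner_circ (H g) e2 = (1 + \<tau>) * b2"
  proof -
    have "inner_circ (H g) e2 = cnj a1 / \<mu>1 * inner_circ (H e2) e1 + cnj a2 / \<mu>2 * inner_circ (H e2) e2"
      unfolding Hg using HL e_in Hsym by (simp add: inner_add_left L2_scaleC)
    also have "\<dots> = \<tau> * b2 + (cnj a1 * cnj s12 / \<sigma>1 + cnj a2 * cnj s22 / \<sigma>2)"
      unfolding H_matrix \<tau> using pos by (simp add: field_simps power2_eq_square)
    also have "cnj a1 * cnj s12 / \<sigma>1 + cnj a2 * cnj s22 / \<sigma>2 = (\<sigma>2 * b2) / \<sigma>2"
      unfolding t complex_cnj_add complex_cnj_mult ss using pos by (simp add: field_simps)
    finally show ?thesis using pos by (simp add: algebra_simps)
  qed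
  \<comment> \<open>The mean of \<open>H g\<close> computed twice: by symmetry it is
    \<open>(u | g) = \<tau>\<close>, in coordinates it is \<open>1 + \<tau>\<close> times the sum of
    the squared moduli of \<open>b1\<close> and \<open>b2\<close>.\<close>
  have "fourier (H g) 0 = inner_circ u g"
    using hankel_sym[OF V_L2_plus[OF gV], of 1] H_1 by (simp add: inner_1_right)
  also have "inner_circ u g = \<tau>"
    using V_inner[OF u_V V_L2[OF gV]] by (simp add: gc \<tau> a1_def a2_def)
  finally have "\<tau> = (1 + \<tau>) * b1 * cnj b1 + (1 + \<tau>) * b2 * cnj b2"
    using V_fourier_0[OF H_V[OF V_L2_plus[OF gV]]] by (simp add: H1 H2)
  also have "\<dots> = of_real ((1 + \<tau>) * ((norm b1)\<^sup>2 + (norm b2)\<^sup>2))"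
    by (simp only: of_real_mult of_real_add complex_norm_square) (simp add: algebra_simps)
  finally have "\<tau> = (1 + \<tau>) * ((norm b1)\<^sup>2 + (norm b2)\<^sup>2)" unfolding of_real_eq_iff .
  moreover have "\<mu>1 * \<mu>2 * \<tau> = \<mu>1 * (norm a2)\<^sup>2 + \<mu>2 * (norm a1)\<^sup>2"
    using pos by (simp add: \<tau>_def field_simps)
  ultimately show ?thesis by algebra
qed

lemma bshift_bshift_V:
  assumes x: "x \<in> V"
  shows "bshift (bshift x) = s *\<^sub>C bshift x - d *\<^sub>C x"
proof (rule V_eqI)
  show "bshift (bshift x) \<in> V" "s *\<^sub>C bshift x - d *\<^sub>C x \<in> V"
    by (intro bshift_V V_diff V_scaleC x)+
  have L: "x \<in> L2" "bshift x \<in> L2" using x V_L2 bshift_V by auto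
  have *: "inner_circ (s *\<^sub>C bshift x - d *\<^sub>C x) e = s * inner_circ (bshift x) e - d * inner_circ x e" if "e \<in> L2" for e
    using L that by (simp add: inner_diff_left L2_scaleC)
  show "inner_circ (bshift (bshift x)) e1 = inner_circ (s *\<^sub>C bshift x - d *\<^sub>C x) e1"
    "inner_circ (bshift (bshift x)) e2 = inner_circ (s *\<^sub>C bshift x - d *\<^sub>C x) e2"
    unfolding *[OF e_in(5)] *[OF e_in(6)] bshift_coeff[OF x] bshift_coeff[OF bshift_V[OF x]]
    by (simp_all add: trace_det_s algebra_simps)
qed

lemma V_fourier_rec:
  assumes "x \<in> V" "n \<ge> 0"
  shows "fourier x (n + 2) = s * fourier x (n + 1) - d * fourier x n"
proof -
  have L: "x \<in> L2" "bshift x \<in> L2" using assms V_L2 bshift_V by auto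
  have "fourier (bshift (bshift x)) n = s * fourier (bshift x) n - d * fourier x n"
    unfolding bshift_bshift_V[OF assms(1)] using L by (simp add: fourier_diff L2_scaleC)
  then show ?thesis using L assms(2) by (simp add: fourier_bshift add.assoc)
qed

lemma fourier_u_1: "fourier u 1 = \<sigma>1 * (cnj b1)\<^sup>2 + \<sigma>2 * (cnj b2)\<^sup>2"
  using V_fourier_0[OF bshift_V[OF u_V]] fourier_bshift[OF u_L2, of 0]
  by (simp add: bshift_u_coeff power2_eq_square)

lemma fourier_w_1: "fourier w 1 = \<sigma>1 * cnj a1 * cnj b1 + \<sigma>2 * cnj a2 * cnj b2"
  using V_fourier_0[OF K_V[OF u(2)]] fourier_bshift[OF V_L2[OF w_V], of 0] K_coeff[OF u(2)]
  by (simp add: bshift_w a1_def a2_def)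

text \<open>The determinant of the coordinates of \<open>bshift u\<close> and \<open>u\<close>; it
  vanishes exactly when the two are linearly dependent.\<close>

definition "\<kappa> = \<sigma>1 * cnj b1 * a2 - \<sigma>2 * cnj b2 * a1"

lemma kappa_nonzero: "\<kappa> \<noteq> 0"
proof
  assume k: "\<kappa> = 0"
  have "\<exists>l. bshift u = l *\<^sub>C u"
  proof (cases "a1 = 0")
    case False
    have "bshift u = (\<sigma>1 * cnj b1 / a1) *\<^sub>C u"
      using k False by (intro V_eqI bshift_V u_V V_scaleC)
        (simp_all add: bshift_u_coeff flip: a1_def a2_def, simp add: \<kappa>_def field_simps)
    then show ?thesis by blast
  next
    case True
    have "u \<noteq> 0" using not_parallel[of 0] by auto
    then have "a2 \<noteq> 0" using V_expand[OF u_V] True by (auto simp: a1_def a2_def)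
    then have "bshift u = (\<sigma>2 * cnj b2 / a2) *\<^sub>C u"
      using k True \<sigma> by (intro V_eqI bshift_V u_V V_scaleC)
        (simp_all add: bshift_u_coeff flip: a1_def a2_def, simp add: \<kappa>_def)
    then show ?thesis by blast
  qed
  then show False using not_parallel by blast
qed


section \<open>Contraction by the iterated backward shift, and tails of Fourier series\<close>

lemma bessel:
  assumes "h \<in> L2"
  shows "(norm (inner_circ h e1))\<^sup>2 + (norm (inner_circ h e2))\<^sup>2 \<le> (norm_L2 h)\<^sup>2"
proof -
  define p where "p = inner_circ h e1 *\<^sub>C e1 + inner_circ h e2 *\<^sub>C e2"
  have p: "p \<in> V" unfolding p_def by (intro V_add V_scaleC e_V)
  have pc: "inner_circ p e1 = inner_circ h e1" "inner_circ p e2 = inner_circ h e2"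
    using e_in e_inner by (simp_all add: p_def inner_add_left L2_scaleC)
  have "inner_circ p h = inner_circ p p"
    using V_inner[OF p assms] V_inner[OF p V_L2[OF p]] by (simp add: pc)
  then have "(norm_L2 p)\<^sup>2 \<le> norm_L2 p * norm_L2 h"
    using inner_Cauchy_Schwarz[OF V_L2[OF p] assms] by (simp add: inner_self norm_power)
  then have "norm_L2 p \<le> norm_L2 h"
    using norm_L2_nonneg[of p] norm_L2_nonneg[of h] by (cases "norm_L2 p = 0") (auto simp: power2_eq_square)
  then have "(norm_L2 p)\<^sup>2 \<le> (norm_L2 h)\<^sup>2"
    by (intro power_mono norm_L2_nonneg)
  then show ?thesis using V_norm[OF p] by (simp add: pc)
qed

text \<open>Two backward shifts lose the first two Fourier coefficients of \<open>x\<close>. These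
  depend linearly on the coordinates of \<open>x\<close>, with determinant \<open>W\<close>
  proportional to \<open>d * \<kappa>\<close>; Cramer's rule bounds \<open>x\<close> by
  them.\<close>

lemma contraction:
  assumes x: "x \<in> V"
  shows "(norm_L2 (bshift (bshift x)))\<^sup>2 \<le> (1 - (norm d)\<^sup>2 * (norm \<kappa>)\<^sup>2 / (2 * \<mu>1 * \<mu>2)) * (norm_L2 x)\<^sup>2"
proof -
  define x1 x2 where "x1 = inner_circ x e1" and "x2 = inner_circ x e2"
  define z1 z2 where "z1 = inner_circ (circ_exp 1) e1" and "z2 = inner_circ (circ_exp 1) e2"
  define p q where "p = fourier x 0" and "q = fourier (bshift x) 0"
  have L: "x \<in> L2" "bshift x \<in> L2" using x V_L2 bshift_V by auto
  have p: "p = x1 * cnj b1 + x2 * cnj b2"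
    using V_fourier_0[OF x] by (simp add: p_def x1_def x2_def)
  have q: "q = x1 * cnj z1 + x2 * cnj z2"
    using V_inner[OF x, of "circ_exp 1"] fourier_bshift[OF L(1), of 0]
    by (simp add: q_def z1_def z2_def x1_def x2_def fourier_def)
  have Kz: "K (circ_exp 1) = s *\<^sub>C bshift u - d *\<^sub>C u"
    using K_exp[of 1] rec by (simp add: numeral_2_eq_2)
  have *: "inner_circ (s *\<^sub>C bshift u - d *\<^sub>C u) e = s * inner_circ (bshift u) e - d * inner_circ u e" if "e \<in> L2" for e
    using u_L2 bshift_L2 that by (simp add: inner_diff_left L2_scaleC)
  have z: "\<sigma>1 * cnj z1 = s * (\<sigma>1 * cnj b1) - d * a1" "\<sigma>2 * cnj z2 = s * (\<sigma>2 * cnj b2) - d * a2"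
    using K_coeff[of "circ_exp 1"] unfolding Kz *[OF e_in(5)] *[OF e_in(6)] bshift_u_coeff
    by (simp_all add: z1_def z2_def a1_def a2_def)
  \<comment> \<open>The determinant of the map from the coordinates \<open>x1\<close>,
    \<open>x2\<close> to the coefficients \<open>p\<close>, \<open>q\<close>.\<close>
  define W where "W = cnj b1 * cnj z2 - cnj b2 * cnj z1"
  have "of_real (\<sigma>1 * \<sigma>2) * W = \<sigma>1 * cnj b1 * (\<sigma>2 * cnj z2) - \<sigma>2 * cnj b2 * (\<sigma>1 * cnj z1)"
    by (simp add: W_def algebra_simps)
  also have "\<dots> = - d * \<kappa>" unfolding z by (simp add: \<kappa>_def algebra_simps)
  finally have "norm (of_real (\<sigma>1 * \<sigma>2) * W) = norm (- d * \<kappa>)" by (rule arg_cong)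
  then have "(\<sigma>1 * \<sigma>2 * norm W)\<^sup>2 = (norm d * norm \<kappa>)\<^sup>2" using \<sigma> by (simp add: norm_mult)
  then have W: "\<mu>1 * \<mu>2 * (norm W)\<^sup>2 = (norm d)\<^sup>2 * (norm \<kappa>)\<^sup>2" by (simp add: power_mult_distrib)
  have cs: "(norm (\<alpha> * \<beta> - \<gamma> * \<delta>))\<^sup>2 \<le> ((norm \<alpha>)\<^sup>2 + (norm \<gamma>)\<^sup>2) * ((norm \<beta>)\<^sup>2 + (norm \<delta>)\<^sup>2)" for \<alpha> \<beta> \<gamma> \<delta> :: complex
  proof -
    have "norm (\<alpha> * \<beta> - \<gamma> * \<delta>) \<le> norm \<alpha> * norm \<beta> + norm \<gamma> * norm \<delta>"
      by (metis norm_mult norm_triangle_ineq4)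
    then have "(norm (\<alpha> * \<beta> - \<gamma> * \<delta>))\<^sup>2 \<le> (norm \<alpha> * norm \<beta> + norm \<gamma> * norm \<delta>)\<^sup>2"
      by (intro power_mono) auto
    also have "\<dots> \<le> ((norm \<alpha>)\<^sup>2 + (norm \<gamma>)\<^sup>2) * ((norm \<beta>)\<^sup>2 + (norm \<delta>)\<^sup>2)"
      using zero_le_power2[of "norm \<alpha> * norm \<delta> - norm \<gamma> * norm \<beta>"]
      by (simp add: power2_eq_square algebra_simps)
    finally show ?thesis .
  qed
  \<comment> \<open>Cramer's rule.\<close>
  have "x1 * W = p * cnj z2 - q * cnj b2" "x2 * W = q * cnj b1 - p * cnj z1"
    by (simp_all add: p q W_def algebra_simps)
  then have "(norm x1)\<^sup>2 * (norm W)\<^sup>2 \<le> ((norm p)\<^sup>2 + (norm q)\<^sup>2) * ((norm z2)\<^sup>2 + (norm b2)\<^sup>2)"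
    "(norm x2)\<^sup>2 * (norm W)\<^sup>2 \<le> ((norm q)\<^sup>2 + (norm p)\<^sup>2) * ((norm b1)\<^sup>2 + (norm z1)\<^sup>2)"
    using cs[of p "cnj z2" q "cnj b2"] cs[of q "cnj b1" p "cnj z1"]
    by (simp_all flip: power_mult_distrib norm_mult)
  then have 1: "((norm x1)\<^sup>2 + (norm x2)\<^sup>2) * (norm W)\<^sup>2
     \<le> ((norm p)\<^sup>2 + (norm q)\<^sup>2) * (((norm b1)\<^sup>2 + (norm b2)\<^sup>2) + ((norm z1)\<^sup>2 + (norm z2)\<^sup>2))"
    by (simp add: algebra_simps)
  \<comment> \<open>Bessel for the exponentials 0 and 1; the two bounds add up to the 2 in the
    rate.\<close>
  have "(norm b1)\<^sup>2 + (norm b2)\<^sup>2 \<le> 1" "(norm z1)\<^sup>2 + (norm z2)\<^sup>2 \<le> 1"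
    using bessel[of 1] bessel[of "circ_exp 1"] inner_exp_exp[of 1 1] inner_exp_exp[of 0 0]
    by (simp_all add: b1_def b2_def z1_def z2_def norm_L2_square)
  then have "((norm p)\<^sup>2 + (norm q)\<^sup>2) * (((norm b1)\<^sup>2 + (norm b2)\<^sup>2) + ((norm z1)\<^sup>2 + (norm z2)\<^sup>2))
    \<le> ((norm p)\<^sup>2 + (norm q)\<^sup>2) * 2"
    by (intro mult_left_mono) auto
  with 1 have 2: "(norm_L2 x)\<^sup>2 * (norm W)\<^sup>2 \<le> ((norm p)\<^sup>2 + (norm q)\<^sup>2) * 2"
    using V_norm[OF x] by (simp add: x1_def x2_def)
  have "(norm_L2 (bshift (bshift x)))\<^sup>2 = (norm_L2 x)\<^sup>2 - (norm p)\<^sup>2 - (norm q)\<^sup>2"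
    using bshift_norm[OF L(1)] bshift_norm[OF L(2)] by (simp add: p_def q_def)
  also have "\<dots> \<le> (norm_L2 x)\<^sup>2 - (norm_L2 x)\<^sup>2 * (norm W)\<^sup>2 / 2"
    using 2 by simp
  also have "(norm W)\<^sup>2 = (norm d)\<^sup>2 * (norm \<kappa>)\<^sup>2 / (\<mu>1 * \<mu>2)"
    using W \<sigma> by (simp add: field_simps)
  finally show ?thesis by (simp add: algebra_simps)
qed

text \<open>By \<open>tail_has_sum\<close> this is the sum of the squared coefficients from
  frequency \<open>n\<close> on; written as a norm it is accessible to
  \<open>contraction\<close>.\<close>

definition "tail n = (norm_L2 ((bshift ^^ n) u))\<^sup>2"

lemma tail_contraction: "tail (n + 2) \<le> (1 - (norm d)\<^sup>2 * (norm \<kappa>)\<^sup>2 / (2 * \<mu>1 * \<mu>2)) * tail n"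
  using contraction[OF span[of n]] by (simp add: tail_def)

lemma fourier_norm_has_sum:
  assumes "x \<in> wiener" "x \<in> L2_plus"
  shows "((\<lambda>n::nat. (norm (fourier x (int n)))\<^sup>2) has_sum (norm_L2 x)\<^sup>2) UNIV"
proof -
  have "((\<lambda>n. (norm (fourier x n))\<^sup>2) has_sum (norm_L2 x)\<^sup>2) {0..}"
    using parseval_norm[OF assms(1)]
    by (subst (asm) has_sum_cong_neutral[of "{0..}" UNIV _ "\<lambda>n. (norm (fourier x n))\<^sup>2"])
      (use assms(2) in \<open>auto simp: L2_plusD\<close>)
  then show ?thesis
    by (subst (asm) has_sum_reindex_bij_witness[of "{0..}" int nat UNIV "\<lambda>n::nat. (norm (fourier x (int n)))\<^sup>2"]) auto
qed

lemma tail_has_sum: "((\<lambda>m. (norm (fourier u (int (n + m))))\<^sup>2) has_sum tail n) UNIV"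
  using fourier_norm_has_sum[OF bshift_pow_wiener[OF u(1)] bshift_pow_L2_plus[OF u(2)], of n]
  by (simp add: fourier_bshift_pow[OF u(2)] tail_def add.commute)

text \<open>Shifting \<open>u\<close> back \<open>n + 1\<close> times gives \<open>K\<close> of the
  \<open>n\<close>-th exponential, whose coordinates are conjugate Fourier coefficients of
  \<open>e1\<close> and \<open>e2\<close>.\<close>

lemma tail_Suc: "tail (Suc n) = \<mu>1 * (norm (fourier e1 (int n)))\<^sup>2 + \<mu>2 * (norm (fourier e2 (int n)))\<^sup>2"
proof -
  have "inner_circ (circ_exp (int n)) e = cnj (fourier e (int n))" for e
    using inner_cnj[of e "circ_exp (int n)"] by (simp add: fourier_def)
  then show ?thesis
    using V_norm[OF K_V[of "circ_exp (int n)"]] K_coeff[of "circ_exp (int n)"] K_exp[of "int n"]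
    by (simp add: tail_def norm_mult power_mult_distrib)
qed

lemma e_has_sum: "((\<lambda>n::nat. (norm (fourier e1 (int n)))\<^sup>2) has_sum 1) UNIV"
   "((\<lambda>n::nat. (norm (fourier e2 (int n)))\<^sup>2) has_sum 1) UNIV"
  using fourier_norm_has_sum[OF e_in(1,3)] fourier_norm_has_sum[OF e_in(2,4)] by (simp_all add: norm_L2_square e_inner)

text \<open>The trace of \<open>K\<close>-squared evaluated on the exponentials.\<close>

lemma tail_sum: "((\<lambda>n. tail (Suc n)) has_sum (\<mu>1 + \<mu>2)) UNIV"
  unfolding tail_Suc using has_sum_add[OF has_sum_cmult_right[OF e_has_sum(1), of \<mu>1] has_sum_cmult_right[OF e_has_sum(2), of \<mu>2]]
  by simp

text \<open>The coefficient is the mean of the iterated backward shift of \<open>e1\<close>. Its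
  \<open>e2\<close>-coordinate obeys a recursion with factor at most \<open>r\<close> and source at
  most \<open>norm s21\<close>, so it never exceeds the fixed point
  \<open>norm s21 / (1 - r)\<close>; its \<open>e1\<close>-coordinate is at most 1 and enters
  multiplied by \<open>cnj b1\<close>.\<close>

lemma e1_fourier_bound:
  assumes r: "norm s22 \<le> r" "r < 1"
  shows "norm (fourier e1 (int n)) \<le> norm b1 + norm s21 / (1 - r)"
proof -
  define x where "x = (\<lambda>n. (bshift ^^ n) e1)"
  have xV: "x n \<in> V" for n unfolding x_def by (induction n) (auto intro: bshift_V e_V)
  have xn: "norm_L2 (x n) \<le> 1" for n
  proof (induction n)
    case 0
    then show ?case by (simp add: x_def norm_e)
  next
    case (Suc n)
    have "(norm_L2 (x (Suc n)))\<^sup>2 \<le> (norm_L2 (x n))\<^sup>2"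
      using bshift_norm[OF V_L2[OF xV[of n]]] by (simp add: x_def)
    then have "norm_L2 (x (Suc n)) \<le> norm_L2 (x n)"
      by (rule power2_le_imp_le) (rule norm_L2_nonneg)
    with Suc show ?case by simp
  qed
  have x1: "norm (inner_circ (x n) e1) \<le> 1" for n
    using inner_Cauchy_Schwarz[OF V_L2[OF xV[of n]] e_in(5)] xn[of n] by (simp add: norm_e)
  have x2: "norm (inner_circ (x n) e2) \<le> norm s21 / (1 - r)" for n
  proof (induction n)
    case (Suc n)
    have "inner_circ (x (Suc n)) e2 = s21 * inner_circ (x n) e1 + s22 * inner_circ (x n) e2"
      using bshift_coeff(2)[OF xV[of n]] by (simp add: x_def)
    then have "norm (inner_circ (x (Suc n)) e2) \<le> norm s21 * norm (inner_circ (x n) e1) + norm s22 * norm (inner_circ (x n) e2)"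
      by (metis norm_mult norm_triangle_ineq)
    also have "\<dots> \<le> norm s21 * 1 + r * (norm s21 / (1 - r))"
      using Suc x1[of n] r order_trans[OF norm_ge_zero r(1)] by (intro add_mono mult_mono) auto
    also have "\<dots> = norm s21 / (1 - r)" using r by (simp add: field_simps)
    finally show ?case .
  qed (use r e_inner in \<open>simp add: x_def\<close>)
  have b2: "norm b2 \<le> 1"
  proof -
    have "(norm b2)\<^sup>2 \<le> 1" using s_norm(2) zero_le_power2[of "norm s12"] zero_le_power2[of "norm s22"] by linarith
    then show ?thesis using power2_le_imp_le[of "norm b2" 1] by simp
  qed
  have "fourier e1 (int n) = fourier (x n) 0"
    using fourier_bshift_pow[OF e_in(3), of 0 n] by (simp add: x_def)
  also have "\<dots> = inner_circ (x n) e1 * cnj b1 + inner_circ (x n) e2 * cnj b2"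
    by (rule V_fourier_0[OF xV])
  also have "norm \<dots> \<le> norm (inner_circ (x n) e1) * norm b1 + norm (inner_circ (x n) e2) * norm b2"
    by (metis complex_mod_cnj norm_mult norm_triangle_ineq)
  also have "\<dots> \<le> 1 * norm b1 + (norm s21 / (1 - r)) * 1"
    using x1[of n] x2[of n] b2 r by (intro add_mono mult_mono) auto
  finally show ?thesis by simp
qed

subsection \<open>Eigenspaces\<close>

lemma KK_coeff:
  assumes "h \<in> L2_plus"
  shows "K (K h) \<in> V" "inner_circ (K (K h)) e1 = \<mu>1 * inner_circ h e1" "inner_circ (K (K h)) e2 = \<mu>2 * inner_circ h e2"
  using K_V[OF V_L2_plus[OF K_V[OF assms]]] K_coeff[OF V_L2_plus[OF K_V[OF assms]]] K_coeff[OF assms]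
  by (simp_all add: power2_eq_square)

lemma eigen_V:
  assumes "\<mu> \<noteq> 0" "h \<in> eigenspace_K2 u \<mu>"
  shows "h \<in> V" "(\<mu>1 - \<mu>) * inner_circ h e1 = 0" "(\<mu>2 - \<mu>) * inner_circ h e2 = 0"
proof -
  have h: "h \<in> L2_plus" "K (K h) = of_real \<mu> *\<^sub>C h" using assms by (auto simp: eigenspace_K2_def)
  have "of_real (1 / \<mu>) *\<^sub>C K (K h) \<in> V" using KK_coeff(1)[OF h(1)] by (rule V_scaleC)
  then show "h \<in> V" using assms(1) h(2) by simp
  show "(\<mu>1 - \<mu>) * inner_circ h e1 = 0" "(\<mu>2 - \<mu>) * inner_circ h e2 = 0"
    using KK_coeff(2,3)[OF h(1)] unfolding h(2) by (auto simp: algebra_simps)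
qed

lemma e_eigen: "e1 \<in> eigenspace_K2 u \<mu>1" "e2 \<in> eigenspace_K2 u \<mu>2"
  using e_in K_e by (auto simp: eigenspace_K2_def shifted_hankel_scaleC power2_eq_square)

lemma e_nonzero: "e1 \<noteq> 0" "e2 \<noteq> 0"
  using e_inner by auto

lemma nonzero_eigenvalues: "nonzero_eigenvalues_K2 u = {\<mu>1, \<mu>2}"
proof (intro antisym subsetI)
  fix \<mu> assume "\<mu> \<in> nonzero_eigenvalues_K2 u"
  then obtain h where h: "\<mu> \<noteq> 0" "h \<in> eigenspace_K2 u \<mu>" "h \<noteq> 0" by (auto simp: nonzero_eigenvalues_K2_def)
  then have "inner_circ h e1 \<noteq> 0 \<or> inner_circ h e2 \<noteq> 0"
    using V_expand[OF eigen_V(1)[OF h(1,2)]] by auto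
  then show "\<mu> \<in> {\<mu>1, \<mu>2}" using eigen_V(2,3)[OF h(1,2)] by (auto simp flip: of_real_power of_real_diff)
next
  fix \<mu> assume "\<mu> \<in> {\<mu>1, \<mu>2}"
  then show "\<mu> \<in> nonzero_eigenvalues_K2 u"
    using e_eigen e_nonzero \<sigma> by (auto simp: nonzero_eigenvalues_K2_def)
qed

lemma eigenspace_simple:
  assumes "\<sigma>1 \<noteq> \<sigma>2"
  shows "eigenspace_K2 u \<mu>1 = circ_fun.span {e1}" "eigenspace_K2 u \<mu>2 = circ_fun.span {e2}"
proof -
  have ne: "\<mu>1 \<noteq> \<mu>2" "\<mu>1 \<noteq> 0" "\<mu>2 \<noteq> 0" using assms \<sigma> by (auto simp: power2_eq_iff)
  have sc: "k *\<^sub>C h \<in> eigenspace_K2 u \<mu>" if "h \<in> eigenspace_K2 u \<mu>" for h k \<mu>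
    using that V_L2_plus[OF K_V] by (auto simp: eigenspace_K2_def shifted_hankel_scaleC mult.commute)
  have 1: "h = inner_circ h e1 *\<^sub>C e1" if "h \<in> eigenspace_K2 u \<mu>1" for h
    using eigen_V[OF ne(2) that] V_expand[of h] ne by (simp flip: of_real_power of_real_diff)
  have 2: "h = inner_circ h e2 *\<^sub>C e2" if "h \<in> eigenspace_K2 u \<mu>2" for h
    using eigen_V[OF ne(3) that] V_expand[of h] ne by (simp flip: of_real_power of_real_diff)
  show "eigenspace_K2 u \<mu>1 = circ_fun.span {e1}"
  proof (intro antisym subsetI)
    fix h assume "h \<in> eigenspace_K2 u \<mu>1"
    then show "h \<in> circ_fun.span {e1}"
      by (subst 1, assumption) (intro circ_fun.span_scale circ_fun.span_base, simp)
  qed (use sc[OF e_eigen(1)] in \<open>auto simp: circ_fun.span_singleton\<close>)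
  show "eigenspace_K2 u \<mu>2 = circ_fun.span {e2}"
  proof (intro antisym subsetI)
    fix h assume "h \<in> eigenspace_K2 u \<mu>2"
    then show "h \<in> circ_fun.span {e2}"
      by (subst 2, assumption) (intro circ_fun.span_scale circ_fun.span_base, simp)
  qed (use sc[OF e_eigen(2)] in \<open>auto simp: circ_fun.span_singleton\<close>)
qed

lemma two_simple_iff: "two_simple_eigenvalues u \<longleftrightarrow> \<sigma>1 \<noteq> \<sigma>2"
proof
  assume "two_simple_eigenvalues u"
  then have "card {\<mu>1, \<mu>2} = 2" by (simp add: two_simple_eigenvalues_def nonzero_eigenvalues)
  then show "\<sigma>1 \<noteq> \<sigma>2" by auto
next
  assume ne: "\<sigma>1 \<noteq> \<sigma>2"
  then have "\<mu>1 \<noteq> \<mu>2" using \<sigma> by (auto simp: power2_eq_iff)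
  moreover have "circ_fun.dim (circ_fun.span {e}) = 1" if "e \<noteq> 0" for e
    using that circ_fun.dim_span_eq_card_independent[of "{e}"] by simp
  ultimately show "two_simple_eigenvalues u"
    using e_nonzero by (simp add: two_simple_eigenvalues_def nonzero_eigenvalues multiplicity_K2_def eigenspace_simple[OF ne])
qed

lemma sigma_sq_simple:
  assumes "\<sigma>1 \<noteq> \<sigma>2"
  shows "sigma_sq u 1 = \<mu>1" "sigma_sq u 2 = \<mu>2"
proof -
  have lt: "\<mu>2 < \<mu>1" using assms \<sigma> by (intro power_strict_mono) auto
  have s1: "{\<nu> \<in> {\<mu>1, \<mu>2}. \<nu> > \<mu>1} = {}" and s2: "{\<nu> \<in> {\<mu>1, \<mu>2}. \<nu> > \<mu>2} = {\<mu>1}" using lt by auto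
  show "sigma_sq u 1 = \<mu>1" unfolding sigma_sq_def nonzero_eigenvalues
  proof (rule the_equality)
    fix \<mu> assume *: "\<mu> \<in> {\<mu>1, \<mu>2} \<and> finite {\<nu> \<in> {\<mu>1, \<mu>2}. \<nu> > \<mu>} \<and> card {\<nu> \<in> {\<mu>1, \<mu>2}. \<nu> > \<mu>} + 1 = 1"
    have "\<mu> \<noteq> \<mu>2"
    proof
      assume eq: "\<mu> = \<mu>2"
      have "card {\<nu> \<in> {\<mu>1, \<mu>2}. \<nu> > \<mu>} + 1 = 1" using * by (elim conjE)
      then have "card {\<nu> \<in> {\<mu>1, \<mu>2}. \<nu> > \<mu>2} + 1 = 1" unfolding eq .
      then show False unfolding s2 by simp
    qed
    then show "\<mu> = \<mu>1" using * by blast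
  qed (unfold s1, simp)
  show "sigma_sq u 2 = \<mu>2" unfolding sigma_sq_def nonzero_eigenvalues
  proof (rule the_equality)
    fix \<mu> assume *: "\<mu> \<in> {\<mu>1, \<mu>2} \<and> finite {\<nu> \<in> {\<mu>1, \<mu>2}. \<nu> > \<mu>} \<and> card {\<nu> \<in> {\<mu>1, \<mu>2}. \<nu> > \<mu>} + 1 = 2"
    have "\<mu> \<noteq> \<mu>1"
    proof
      assume eq: "\<mu> = \<mu>1"
      have "card {\<nu> \<in> {\<mu>1, \<mu>2}. \<nu> > \<mu>} + 1 = 2" using * by (elim conjE)
      then have "card {\<nu> \<in> {\<mu>1, \<mu>2}. \<nu> > \<mu>1} + 1 = 2" unfolding eq .
      then show False unfolding s1 by simp
    qed
    then show "\<mu> = \<mu>2" using * by blast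
  qed (unfold s2, simp)
qed

lemma orth_proj_line:
  assumes "e = e1 \<or> e = e2" "f \<in> L2"
  shows "orth_proj (circ_fun.span {e}) f = inner_circ f e *\<^sub>C e"
proof -
  have e: "e \<in> L2" "inner_circ e e = 1" using assms e_in e_inner by auto
  have d: "inner_circ (f - k *\<^sub>C e) (l *\<^sub>C e) = cnj l * (inner_circ f e - k)" for k l
    using e assms(2) by (simp add: inner_diff_left L2_scaleC)
  show ?thesis unfolding orth_proj_def
  proof (rule the_equality)
    show "inner_circ f e *\<^sub>C e \<in> circ_fun.span {e} \<and> (\<forall>h\<in>circ_fun.span {e}. inner_circ (f - inner_circ f e *\<^sub>C e) h = 0)"
      unfolding circ_fun.span_singleton by (intro conjI ballI rangeI; elim imageE; simp only: d; simp)
  next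
    fix g assume g: "g \<in> circ_fun.span {e} \<and> (\<forall>h\<in>circ_fun.span {e}. inner_circ (f - g) h = 0)"
    then obtain k where k: "g = k *\<^sub>C e" unfolding circ_fun.span_singleton by auto
    have "inner_circ (f - k *\<^sub>C e) (1 *\<^sub>C e) = 0"
      using g unfolding k by (simp add: circ_fun.span_base)
    then have "inner_circ f e = k" unfolding d by simp
    then show "g = inner_circ f e *\<^sub>C e" using k by simp
  qed
qed

lemma ell_1:
  assumes "\<sigma>1 \<noteq> \<sigma>2"
  shows "ell 1 u = (2 * szego_Q u + \<mu>1) * (norm a1)\<^sup>2 - (norm (\<mu>1 * b1 + cnj c * a1))\<^sup>2"
proof -
  show ?thesis
    unfolding ell_def sigma_sq_simple[OF assms] eigenspace_simple[OF assms]
    using u_L2 V_L2[OF w_V]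
    by (simp add: orth_proj_line norm_L2_scaleC norm_e a1_def w_coeff[unfolded a1_def] flip: w_def)
qed

end

section \<open>Differentiation in the Wiener algebra\<close>

lemma norm_fourier_le_wiener_norm:
  assumes "f \<in> wiener" shows "norm (fourier f n) \<le> wiener_norm f"
proof -
  have "sum (\<lambda>k. norm (fourier f k)) {n} \<le> wiener_norm f"
    unfolding wiener_norm_def by (rule finite_sum_le_infsum) (use wiener_summable[OF assms] in auto)
  then show ?thesis by simp
qed

lemma wiener_norm_add_le:
  assumes "f \<in> wiener" "g \<in> wiener"
  shows "wiener_norm (f + g) \<le> wiener_norm f + wiener_norm g"
proof -
  have "wiener_norm (f + g) \<le> (\<Sum>\<^sub>\<infinity>n. norm (fourier f n) + norm (fourier g n))"
    unfolding wiener_norm_def using assms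
    by (intro infsum_mono wiener_summable wiener_add summable_on_add)
       (auto simp: fourier_add wiener_L2 norm_triangle_ineq)
  also have "\<dots> = wiener_norm f + wiener_norm g"
    unfolding wiener_norm_def using assms by (intro infsum_add wiener_summable)
  finally show ?thesis .
qed

lemma wiener_norm_scaleC: "wiener_norm (c *\<^sub>C f) = norm c * wiener_norm f"
  unfolding wiener_norm_def by (simp add: norm_mult infsum_cmult_right')

lemma wiener_norm_cnj: "wiener_norm (circ_cnj f) = wiener_norm f"
  unfolding wiener_norm_def
  by (rule infsum_reindex_bij_witness[of UNIV uminus uminus]) auto

lemma wiener_norm_mult_le:
  assumes f: "f \<in> wiener" and g: "g \<in> wiener"
  shows "wiener_norm (f * g) \<le> wiener_norm f * wiener_norm g"
proof -
  let ?a = "\<lambda>n. norm (fourier f n)" and ?b = "\<lambda>n. norm (fourier g n)"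
  have s1: "(\<lambda>(j, m). ?a j * ?b m) summable_on UNIV \<times> UNIV"
  proof (rule summable_on_SigmaI[where g = "\<lambda>j. ?a j * wiener_norm g"])
    show "((\<lambda>m. case (j, m) of (j, m) \<Rightarrow> ?a j * ?b m) has_sum ?a j * wiener_norm g) UNIV" for j
      unfolding prod.case wiener_norm_def by (intro has_sum_cmult_right has_sum_infsum wiener_summable g)
    show "(\<lambda>j. ?a j * wiener_norm g) summable_on UNIV"
      by (intro summable_on_cmult_left wiener_summable f)
  qed auto
  have s2: "(\<lambda>(n, j). ?a j * ?b (n - j)) summable_on UNIV \<times> UNIV"
    using s1 by (subst summable_on_reindex_bij_witness[of _ "\<lambda>(j,m). (j + m, j)" "\<lambda>(n,j). (j, n - j)" _ "\<lambda>(j, m). ?a j * ?b m"]) auto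
  have "norm (fourier (f * g) n) \<le> (\<Sum>\<^sub>\<infinity>j. ?a j * ?b (n - j))" for n
  proof -
    have "(\<lambda>j. ?a j * ?b (n - j)) summable_on UNIV"
      using summable_on_SigmaD1[OF s2, of n] by simp
    then show ?thesis
      using infsumI[OF fourier_mult[OF f wiener_L2[OF g], of n]]
        norm_infsum_bound[of "\<lambda>j. fourier f j * fourier g (n - j)" UNIV]
      by (simp add: norm_mult)
  qed
  then have "wiener_norm (f * g) \<le> (\<Sum>\<^sub>\<infinity>n. \<Sum>\<^sub>\<infinity>j. ?a j * ?b (n - j))"
    unfolding wiener_norm_def using summable_on_Sigma_banach[OF s2] f g
    by (intro infsum_mono wiener_summable) auto
  also have "\<dots> = (\<Sum>\<^sub>\<infinity>(n, j)\<in>UNIV \<times> UNIV. ?a j * ?b (n - j))"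
    by (rule infsum_Sigma'_banach[OF s2])
  also have "\<dots> = (\<Sum>\<^sub>\<infinity>(j, m)\<in>UNIV \<times> UNIV. ?a j * ?b m)"
    by (rule infsum_reindex_bij_witness[of _ "\<lambda>(j,m). (j + m, j)" "\<lambda>(n,j). (j, n - j)"]) auto
  also have "\<dots> = (\<Sum>\<^sub>\<infinity>j. \<Sum>\<^sub>\<infinity>m. ?a j * ?b m)"
    by (rule infsum_Sigma'_banach[OF s1, symmetric])
  also have "\<dots> = wiener_norm f * wiener_norm g"
    unfolding wiener_norm_def by (simp add: infsum_cmult_right' infsum_cmult_left')
  finally show ?thesis .
qed

text \<open>The remainder of the difference quotient, already diminished by \<open>v\<close>. At
  \<open>h = 0\<close> it is \<open>- v\<close>, as \<open>1 / 0 = 0\<close>; limits at 0 do not see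
  this value.\<close>

definition diff_quot :: "(real \<Rightarrow> circ_fun) \<Rightarrow> circ_fun \<Rightarrow> real \<Rightarrow> real \<Rightarrow> circ_fun" where
  "diff_quot f v t h = of_real (1 / h) *\<^sub>C (f (t + h) - f t) - v"

definition wiener_derivative :: "(real \<Rightarrow> circ_fun) \<Rightarrow> circ_fun \<Rightarrow> real \<Rightarrow> bool" where
  "wiener_derivative f v t \<longleftrightarrow> v \<in> wiener \<and> (\<forall>t. f t \<in> wiener) \<and> ((\<lambda>h. wiener_norm (diff_quot f v t h)) \<longlongrightarrow> 0) (at 0)"

lemma diff_quot_wiener: "wiener_derivative f v t \<Longrightarrow> diff_quot f v t h \<in> wiener"
  unfolding wiener_derivative_def diff_quot_def by (intro wiener_diff wiener_scaleC) auto

lemma diff_quot_expand: "h \<noteq> 0 \<Longrightarrow> f (t + h) = f t + of_real h *\<^sub>C (v + diff_quot f v t h)"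
  by (simp add: diff_quot_def circ_fun.scale_right_distrib circ_fun.scale_right_diff_distrib)

lemma has_vector_derivativeI_quot:
  fixes f :: "real \<Rightarrow> 'a::real_normed_vector"
  assumes "((\<lambda>h. (1 / h) *\<^sub>R (f (t + h) - f t) - D) \<longlongrightarrow> 0) (at 0)"
  shows "(f has_vector_derivative D) (at t)"
  unfolding has_vector_derivative_def has_derivative_at
proof (intro conjI bounded_linear_scaleR_left)
  have "((\<lambda>h. norm ((1 / h) *\<^sub>R (f (t + h) - f t) - D)) \<longlongrightarrow> 0) (at 0)"
    using assms by (rule tendsto_norm_zero)
  moreover have "norm ((1 / h) *\<^sub>R (f (t + h) - f t) - D) = norm (f (t + h) - f t - h *\<^sub>R D) / norm h" if "h \<noteq> 0" for h
  proof -
    have "(1 / h) *\<^sub>R (f (t + h) - f t) - D = (1 / h) *\<^sub>R (f (t + h) - f t - h *\<^sub>R D)"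
      using that by (simp add: scaleR_diff_right)
    then show ?thesis by simp
  qed
  ultimately show "((\<lambda>h. norm (f (t + h) - f t - h *\<^sub>R D) / norm h) \<longlongrightarrow> 0) (at 0)"
    by (subst (asm) tendsto_cong[of _ "\<lambda>h. norm (f (t + h) - f t - h *\<^sub>R D) / norm h"])
      (auto simp: eventually_at_filter)
qed

lemma wiener_derivative_fourier:
  assumes "wiener_derivative f v t"
  shows "((\<lambda>t. fourier (f t) n) has_vector_derivative fourier v n) (at t)"
proof (rule has_vector_derivativeI_quot, rule Lim_null_comparison)
  have w: "f t \<in> wiener" "v \<in> wiener" for t using assms by (auto simp: wiener_derivative_def)
  show "((\<lambda>h. wiener_norm (diff_quot f v t h)) \<longlongrightarrow> 0) (at 0)"
    using assms by (simp add: wiener_derivative_def)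
  have "(1 / h) *\<^sub>R (fourier (f (t + h)) n - fourier (f t) n) - fourier v n = fourier (diff_quot f v t h) n" for h
    using w by (simp add: diff_quot_def fourier_diff wiener_L2 L2_scaleC L2_diff scaleR_conv_of_real)
  then show "\<forall>\<^sub>F h in at 0. norm ((1 / h) *\<^sub>R (fourier (f (t + h)) n - fourier (f t) n) - fourier v n) \<le> wiener_norm (diff_quot f v t h)"
    using norm_fourier_le_wiener_norm[OF diff_quot_wiener[OF assms]] by simp
qed

lemma wiener_derivative_cnj:
  assumes "wiener_derivative f v t"
  shows "wiener_derivative (\<lambda>t. circ_cnj (f t)) (circ_cnj v) t"
proof -
  have "diff_quot (\<lambda>t. circ_cnj (f t)) (circ_cnj v) t h = circ_cnj (diff_quot f v t h)" for h
    by (simp add: diff_quot_def)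
  then show ?thesis using assms by (auto simp: wiener_derivative_def wiener_norm_cnj)
qed

lemma wiener_derivative_mult:
  assumes f: "wiener_derivative f v t" and g: "wiener_derivative g w t"
  shows "wiener_derivative (\<lambda>t. f t * g t) (v * g t + f t * w) t"
  unfolding wiener_derivative_def
proof (intro conjI allI)
  have fw: "f t \<in> wiener" "g t \<in> wiener" "v \<in> wiener" "w \<in> wiener" for t
    using f g by (auto simp: wiener_derivative_def)
  then show "v * g t + f t * w \<in> wiener" "f t * g t \<in> wiener" for t by auto
  define p q where "p = diff_quot f v t" and "q = diff_quot g w t"
  have pq: "p h \<in> wiener" "q h \<in> wiener" for h
    unfolding p_def q_def using f g by (auto intro: diff_quot_wiener)
  have lim: "((\<lambda>h. wiener_norm (p h)) \<longlongrightarrow> 0) (at 0)" "((\<lambda>h. wiener_norm (q h)) \<longlongrightarrow> 0) (at 0)"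
    unfolding p_def q_def using f g by (auto simp: wiener_derivative_def)
  have eq: "diff_quot (\<lambda>t. f t * g t) (v * g t + f t * w) t h
      = p h * g t + f t * q h + of_real h *\<^sub>C ((v + p h) * (w + q h))" if "h \<noteq> 0" for h
  proof -
    have "f (t + h) * g (t + h) - f t * g t = of_real h *\<^sub>C ((v + p h) * g t + f t * (w + q h) + of_real h *\<^sub>C ((v + p h) * (w + q h)))"
      unfolding diff_quot_expand[OF that, of f t v] diff_quot_expand[OF that, of g t w] p_def q_def
      by (simp add: distrib_left distrib_right circ_fun.scale_right_distrib mult_ac add_ac)
    then show ?thesis
      using that by (simp add: diff_quot_def distrib_left distrib_right circ_fun.scale_right_distrib)
  qed
  have le: "wiener_norm (diff_quot (\<lambda>t. f t * g t) (v * g t + f t * w) t h)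
    \<le> wiener_norm (p h) * wiener_norm (g t) + wiener_norm (f t) * wiener_norm (q h)
      + \<bar>h\<bar> * ((wiener_norm v + wiener_norm (p h)) * (wiener_norm w + wiener_norm (q h)))" if "h \<noteq> 0" for h
  proof -
    have "wiener_norm (diff_quot (\<lambda>t. f t * g t) (v * g t + f t * w) t h)
      \<le> wiener_norm (p h * g t) + wiener_norm (f t * q h) + \<bar>h\<bar> * wiener_norm ((v + p h) * (w + q h))"
      unfolding eq[OF that] using fw pq
        wiener_norm_add_le[of "p h * g t + f t * q h" "of_real h *\<^sub>C ((v + p h) * (w + q h))"]
        wiener_norm_add_le[of "p h * g t" "f t * q h"]
      by (simp add: wiener_norm_scaleC wiener_mult wiener_add wiener_scaleC)
    also have "\<dots> \<le> wiener_norm (p h) * wiener_norm (g t) + wiener_norm (f t) * wiener_norm (q h)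
      + \<bar>h\<bar> * (wiener_norm (v + p h) * wiener_norm (w + q h))"
      using fw pq by (intro add_mono mult_left_mono wiener_norm_mult_le wiener_add) auto
    also have "\<dots> \<le> wiener_norm (p h) * wiener_norm (g t) + wiener_norm (f t) * wiener_norm (q h)
      + \<bar>h\<bar> * ((wiener_norm v + wiener_norm (p h)) * (wiener_norm w + wiener_norm (q h)))"
      using fw pq
      by (intro add_mono mult_left_mono mult_mono wiener_norm_add_le order_refl)
        (auto intro!: wiener_norm_nonneg add_nonneg_nonneg)
    finally show ?thesis .
  qed
  have "((\<lambda>h. wiener_norm (p h) * wiener_norm (g t) + wiener_norm (f t) * wiener_norm (q h)
      + \<bar>h\<bar> * ((wiener_norm v + wiener_norm (p h)) * (wiener_norm w + wiener_norm (q h)))) \<longlongrightarrow>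
      0 * wiener_norm (g t) + wiener_norm (f t) * 0 + \<bar>0\<bar> * ((wiener_norm v + 0) * (wiener_norm w + 0))) (at 0)"
    by (intro tendsto_intros lim)
  then have "((\<lambda>h. wiener_norm (p h) * wiener_norm (g t) + wiener_norm (f t) * wiener_norm (q h)
      + \<bar>h\<bar> * ((wiener_norm v + wiener_norm (p h)) * (wiener_norm w + wiener_norm (q h)))) \<longlongrightarrow> 0) (at 0)"
    by simp
  then show "((\<lambda>h. wiener_norm (diff_quot (\<lambda>t. f t * g t) (v * g t + f t * w) t h)) \<longlongrightarrow> 0) (at 0)"
    by (rule tendsto_0_le[of _ _ _ 1])
      (use le wiener_norm_nonneg in \<open>auto simp: eventually_at_filter intro!: eventually_mono[OF eventually_True] order_trans[OF _ abs_ge_self]\<close>)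
qed

section \<open>Sobolev spaces\<close>

lemma summable_Hs_weight:
  fixes s :: real
  assumes "s > 1/2"
  shows "(\<lambda>n::nat. (1 + (real n)\<^sup>2) powr (- s)) summable_on UNIV"
proof -
  have "summable (\<lambda>n::nat. (1 + (real n)\<^sup>2) powr (- s))"
  proof (rule summable_comparison_test)
    show "summable (\<lambda>n::nat. real n powr (- 2 * s))"
      using assms by (subst summable_real_powr_iff) auto
    have "norm ((1 + (real n)\<^sup>2) powr (- s)) \<le> real n powr (- 2 * s)" if "n \<ge> 1" for n :: nat
    proof -
      have "(1 + (real n)\<^sup>2) powr (- s) \<le> ((real n)\<^sup>2) powr (- s)"
        using assms that by (intro powr_mono2') (auto simp: add_nonneg_eq_0_iff)
      also have "(real n)\<^sup>2 = real n powr 2"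
        using that by simp
      also have "(real n powr 2) powr (- s) = real n powr (- 2 * s)"
        unfolding powr_powr by simp
      finally show ?thesis by simp
    qed
    then show "\<exists>N. \<forall>n\<ge>N. norm ((1 + (real n)\<^sup>2) powr (- s)) \<le> real n powr (- 2 * s)" by blast
  qed
  then show ?thesis by (subst summable_on_UNIV_nonneg_real_iff) auto
qed

lemma int_has_sum_nat:
  fixes f :: "int \<Rightarrow> 'a::{comm_monoid_add,topological_space}"
  assumes "\<And>n. n < 0 \<Longrightarrow> f n = 0"
  shows "(f has_sum S) UNIV \<longleftrightarrow> ((\<lambda>n::nat. f (int n)) has_sum S) UNIV"
proof -
  have "(f has_sum S) UNIV \<longleftrightarrow> (f has_sum S) {0..}"
    using assms by (intro has_sum_cong_neutral) auto
  also have "\<dots> \<longleftrightarrow> ((\<lambda>n::nat. f (int n)) has_sum S) UNIV"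
    by (rule has_sum_reindex_bij_witness[of "{0..}" int nat]) auto
  finally show ?thesis .
qed

lemma int_summable_nat:
  fixes f :: "int \<Rightarrow> 'a::{comm_monoid_add,topological_space}"
  assumes "\<And>n. n < 0 \<Longrightarrow> f n = 0"
  shows "f summable_on UNIV \<longleftrightarrow> (\<lambda>n::nat. f (int n)) summable_on UNIV"
  using int_has_sum_nat[OF assms] by (simp add: summable_on_def)

lemma int_infsum_nat:
  fixes f :: "int \<Rightarrow> 'a::{comm_monoid_add,t2_space}"
  assumes "\<And>n. n < 0 \<Longrightarrow> f n = 0"
  shows "infsum f UNIV = (\<Sum>\<^sub>\<infinity>n::nat. f (int n))"
proof (cases "f summable_on UNIV")
  case True
  then have "((\<lambda>n::nat. f (int n)) has_sum infsum f UNIV) UNIV"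
    using has_sum_infsum[OF True] int_has_sum_nat[of f "infsum f UNIV", OF assms] by blast
  then show ?thesis by (rule infsumI[symmetric])
next
  case False
  then have "\<not> (\<lambda>n::nat. f (int n)) summable_on UNIV" using int_summable_nat[of f, OF assms] by blast
  with False show ?thesis by (simp add: infsum_not_exists)
qed

definition Hs_sum :: "real \<Rightarrow> circ_fun \<Rightarrow> real" where
  "Hs_sum s f = (\<Sum>\<^sub>\<infinity>n::nat. (1 + (real n)\<^sup>2) powr s * (norm (fourier f (int n)))\<^sup>2)"

lemma Hs_plusD:
  assumes "f \<in> Hs s" "f \<in> L2_plus"
  shows "(\<lambda>n::nat. (1 + (real n)\<^sup>2) powr s * (norm (fourier f (int n)))\<^sup>2) summable_on UNIV"
  using assms int_summable_nat[of "\<lambda>n. (1 + (real_of_int n)\<^sup>2) powr s * (cmod (fourier f n))\<^sup>2"]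
  by (simp add: Hs_def L2_plusD)

lemma norm_Hs_plus: "f \<in> L2_plus \<Longrightarrow> norm_Hs s f = sqrt (Hs_sum s f)"
  using int_infsum_nat[of "\<lambda>n. (1 + (real_of_int n)\<^sup>2) powr s * (cmod (fourier f n))\<^sup>2"]
  by (simp add: norm_Hs_def L2_plusD Hs_sum_def)

lemma Hs_sum_nonneg: "Hs_sum s f \<ge> 0"
  unfolding Hs_sum_def by (rule infsum_nonneg) auto

text \<open>A weighted arithmetic-geometric inequality with free parameter \<open>e\<close> does the
  work of Cauchy--Schwarz; the weights are summable since \<open>s > 1/2\<close>.\<close>

lemma Hs_wiener:
  assumes f: "f \<in> Hs s" "f \<in> L2_plus" and s: "s > 1/2"
  shows "f \<in> wiener"
    "2 * wiener_norm f \<le> norm_Hs s f * ((\<Sum>\<^sub>\<infinity>n::nat. (1 + (real n)\<^sup>2) powr (- s)) + 1)"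
proof -
  define A where "A = (\<Sum>\<^sub>\<infinity>n::nat. (1 + (real n)\<^sup>2) powr (- s))"
  let ?p = "\<lambda>n::nat. (1 + (real n)\<^sup>2) powr s * (norm (fourier f (int n)))\<^sup>2"
  let ?q = "\<lambda>n::nat. (1 + (real n)\<^sup>2) powr (- s)"
  have amgm: "2 * norm (fourier f (int n)) \<le> e * ?q n + (1 / e) * ?p n" if "e > 0" for e n
  proof -
    define a where "a = (1 + (real n)\<^sup>2) powr s"
    have a: "a > 0" "?q n = 1 / a" by (simp_all add: a_def powr_minus_divide add_nonneg_eq_0_iff)
    have "0 \<le> (e / a) * (1 - norm (fourier f (int n)) * a / e)\<^sup>2"
      using that a by simp
    also have "\<dots> = e * (1 / a) + (1 / e) * (a * (norm (fourier f (int n)))\<^sup>2) - 2 * norm (fourier f (int n))"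
      using that a by (simp add: power2_eq_square field_simps)
    finally show ?thesis unfolding a(2) unfolding a_def by simp
  qed
  have sp: "?p summable_on UNIV" by (rule Hs_plusD[OF f])
  have sq: "?q summable_on UNIV" by (rule summable_Hs_weight[OF s])
  have spq: "(\<lambda>n. e * ?q n + (1 / e) * ?p n) summable_on UNIV" for e
    by (intro summable_on_add summable_on_cmult_right sp sq)
  have sf2: "(\<lambda>n::nat. 2 * norm (fourier f (int n))) summable_on UNIV"
    by (rule summable_on_comparison_test[OF spq[of 1] amgm]) auto
  from summable_on_cmult_right[OF this, of "1/2"]
  have sf: "(\<lambda>n::nat. norm (fourier f (int n))) summable_on UNIV" by simp
  then have "(\<lambda>n. norm (fourier f n)) summable_on UNIV"
    by (subst int_summable_nat) (use f in \<open>auto simp: L2_plusD\<close>)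
  then show "f \<in> wiener" using f by (simp add: wiener_def L2_plusD)
  have wn: "wiener_norm f = (\<Sum>\<^sub>\<infinity>n::nat. norm (fourier f (int n)))"
    unfolding wiener_norm_def by (subst int_infsum_nat) (use f in \<open>auto simp: L2_plusD\<close>)
  have le: "2 * wiener_norm f \<le> e * A + (1 / e) * Hs_sum s f" if "e > 0" for e
  proof -
    have "2 * wiener_norm f = (\<Sum>\<^sub>\<infinity>n::nat. 2 * norm (fourier f (int n)))"
      unfolding wn by (simp add: infsum_cmult_right')
    also have "\<dots> \<le> (\<Sum>\<^sub>\<infinity>n. e * ?q n + (1 / e) * ?p n)"
      by (intro infsum_mono sf2 spq amgm that)
    also have "\<dots> = (\<Sum>\<^sub>\<infinity>n. e * ?q n) + (\<Sum>\<^sub>\<infinity>n. (1 / e) * ?p n)"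
      by (intro infsum_add summable_on_cmult_right sp sq)
    also have "\<dots> = e * A + (1 / e) * Hs_sum s f"
      unfolding A_def Hs_sum_def infsum_cmult_right' ..
    finally show ?thesis .
  qed
  \<comment> \<open>The choice \<open>e = N\<close> balances both terms; for \<open>N = 0\<close>
    the parameter is sent to 0 instead.\<close>
  define N where "N = norm_Hs s f"
  have N: "N \<ge> 0" "Hs_sum s f = N\<^sup>2"
    using f(2) Hs_sum_nonneg[of s f] by (simp_all add: N_def norm_Hs_plus)
  have "2 * wiener_norm f \<le> N * (A + 1)"
  proof (cases "N = 0")
    case False
    then show ?thesis using le[of N] N by (simp add: power2_eq_square algebra_simps)
  next
    case True
    have A: "A \<ge> 0" unfolding A_def by (rule infsum_nonneg) auto
    have "2 * wiener_norm f \<le> 0 + e" if "e > 0" for e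
    proof -
      have "2 * wiener_norm f \<le> (e / (A + 1)) * A" using le[of "e / (A + 1)"] that A N True by simp
      also have "\<dots> \<le> e" using that A by (simp add: field_simps)
      finally show ?thesis by simp
    qed
    then have "2 * wiener_norm f \<le> 0" by (rule field_le_epsilon)
    then show ?thesis using True by simp
  qed
  then show "2 * wiener_norm f \<le> norm_Hs s f * ((\<Sum>\<^sub>\<infinity>n::nat. (1 + (real n)\<^sup>2) powr (- s)) + 1)"
    by (simp add: N_def A_def)
qed

lemma (in hankel_pair) lambda_pos: "(norm d)\<^sup>2 * (norm \<kappa>)\<^sup>2 / (2 * \<mu>1 * \<mu>2) > 0"
  using d_nonzero kappa_nonzero \<sigma> by simp

lemma (in hankel_pair) tail_nonneg: "tail n \<ge> 0"
  by (simp add: tail_def)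

lemma (in hankel_pair) tail_antimono: "tail (Suc n) \<le> tail n"
  using bshift_norm[OF V_L2[OF span[of n]]] by (simp add: tail_def)

lemma (in hankel_pair) tail_0: "tail 0 = szego_Q u"
  by (simp add: tail_def Q_norm)

lemma (in hankel_pair) tail_geometric:
  assumes "l \<le> (norm d)\<^sup>2 * (norm \<kappa>)\<^sup>2 / (2 * \<mu>1 * \<mu>2)" "l \<le> 1"
  shows "tail (n + 2 * m) \<le> (1 - l) ^ m * tail n"
proof (induction m)
  case (Suc m)
  have "tail (n + 2 * Suc m) = tail ((n + 2 * m) + 2)" by simp
  also have "\<dots> \<le> (1 - (norm d)\<^sup>2 * (norm \<kappa>)\<^sup>2 / (2 * \<mu>1 * \<mu>2)) * tail (n + 2 * m)" by (rule tail_contraction)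
  also have "\<dots> \<le> (1 - l) * tail (n + 2 * m)"
    using assms tail_nonneg by (intro mult_right_mono) auto
  also have "\<dots> \<le> (1 - l) * ((1 - l) ^ m * tail n)"
    using assms Suc by (intro mult_left_mono) auto
  finally show ?case by simp
qed simp

lemma (in hankel_pair) fourier_le_tail: "(norm (fourier u (int n)))\<^sup>2 \<le> tail n"
proof -
  have "sum (\<lambda>m. (norm (fourier u (int (n + m))))\<^sup>2) {0} \<le> tail n"
    by (rule finite_sum_le_has_sum[OF tail_has_sum]) auto
  then show ?thesis by simp
qed

text \<open>Decay at a fixed time, with a constant depending on it. It provides the bound
  \<open>B\<close> of \<open>momentum_square\<close>, hence absolute convergence of the double
  series there.\<close>

lemma (in hankel_pair) fourier_decay: "\<exists>B. \<forall>n. real n * norm (fourier u (int n)) \<le> B"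
proof -
  define l where "l = min (1/2) ((norm d)\<^sup>2 * (norm \<kappa>)\<^sup>2 / (2 * \<mu>1 * \<mu>2))"
  have l: "l > 0" "l \<le> 1/2" "l \<le> (norm d)\<^sup>2 * (norm \<kappa>)\<^sup>2 / (2 * \<mu>1 * \<mu>2)" "l \<le> 1"
    using lambda_pos by (auto simp: l_def)
  \<comment> \<open>A fourth root: the factor \<open>1 - l\<close> is gained every two steps and for
    squared moduli. The quotient by \<open>r\<close> below absorbs odd \<open>n\<close>; the cap 1/2
    on \<open>l\<close> keeps \<open>r\<close> positive.\<close>
  define r where "r = sqrt (sqrt (1 - l))"
  have r: "0 < r" "r < 1" using l by (auto simp: r_def)
  have "r\<^sup>2 = sqrt (1 - l)" using l by (simp add: r_def)
  then have "(r\<^sup>2)\<^sup>2 = 1 - l" using l by simp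
  then have r4: "r ^ 4 = 1 - l" by (simp flip: power_mult)
  have "norm (fourier u (int n)) \<le> sqrt (szego_Q u) * (r ^ n / r)" for n
  proof -
    define m where "m = n div 2"
    have "tail n \<le> (1 - l) ^ m * tail (n - 2 * m)"
      using tail_geometric[OF l(3,4), of "n - 2 * m" m] by (simp add: m_def)
    also have "tail (n - 2 * m) \<le> szego_Q u"
    proof -
      have "n - 2 * m = 0 \<or> n - 2 * m = Suc 0" by (auto simp: m_def)
      then show ?thesis using tail_antimono[of 0] by (auto simp: tail_0)
    qed
    finally have "(norm (fourier u (int n)))\<^sup>2 \<le> (1 - l) ^ m * szego_Q u"
      using fourier_le_tail[of n] l by (simp add: mult_left_mono)
    also have "(1 - l) ^ m = (r ^ (2 * m))\<^sup>2"
      by (simp add: r4[symmetric] flip: power_mult)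
    also have "\<dots> \<le> (r ^ n / r)\<^sup>2"
    proof (intro power_mono)
      have "r ^ (2 * m) * r \<le> r ^ n"
        using r power_decreasing[of n "Suc (2 * m)" r] unfolding m_def by (simp add: mult.commute)
      then show "r ^ (2 * m) \<le> r ^ n / r" using r by (simp add: field_simps)
    qed (use r in auto)
    finally have "(norm (fourier u (int n)))\<^sup>2 \<le> (r ^ n / r)\<^sup>2 * szego_Q u"
      by (simp add: Q_norm mult_right_mono)
    also have "\<dots> = (sqrt (szego_Q u) * (r ^ n / r))\<^sup>2"
    proof -
      have "szego_Q u \<ge> 0" by (simp add: Q_norm)
      then show ?thesis by (simp only: power_mult_distrib real_sqrt_pow2 mult.commute)
    qed
    finally have "(norm (fourier u (int n)))\<^sup>2 \<le> (sqrt (szego_Q u) * (r ^ n / r))\<^sup>2" .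
    then show ?thesis by (rule power2_le_imp_le) (use r in \<open>simp add: Q_norm norm_L2_nonneg\<close>)
  qed
  then have le: "real n * norm (fourier u (int n)) \<le> sqrt (szego_Q u) / r * (real n * r ^ n)" for n
    using mult_left_mono[of "norm (fourier u (int n))" "sqrt (szego_Q u) * (r ^ n / r)" "real n"] by (simp add: mult_ac)
  have "(\<lambda>n. real n * r ^ n) \<longlonglongrightarrow> 0" using powser_times_n_limit_0[of r] r by simp
  then obtain B where B: "\<And>n. norm (real n * r ^ n) \<le> B"
    using convergent_imp_Bseq[of "\<lambda>n. real n * r ^ n"] by (auto simp: convergent_def Bseq_def)
  have "real n * norm (fourier u (int n)) \<le> sqrt (szego_Q u) / r * B" for n
    using B[of n] r by (intro order_trans[OF le] mult_left_mono) (auto simp: Q_norm norm_L2_nonneg)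
  then show ?thesis by blast
qed

section \<open>Products of functions in the Hardy space\<close>

lemma fourier_mult_hardy:
  assumes f: "f \<in> wiener" "f \<in> L2_plus" and g: "g \<in> L2_plus"
  shows "fourier (f * g) n = (\<Sum>j\<in>{0..n}. fourier f j * fourier g (n - j))"
proof -
  have "((\<lambda>j. fourier f j * fourier g (n - j)) has_sum fourier (f * g) n) UNIV"
    using f g by (intro fourier_mult) (auto simp: L2_plusD)
  moreover have "((\<lambda>j. fourier f j * fourier g (n - j)) has_sum (\<Sum>j\<in>{0..n}. fourier f j * fourier g (n - j))) UNIV"
    by (rule has_sum_finite_neutralI[of "{0..n}"]) (use f g in \<open>auto simp: L2_plusD not_le\<close>)
  ultimately show ?thesis by (rule has_sum_unique)
qed

lemma L2_plus_mult:
  assumes "f \<in> wiener" "f \<in> L2_plus" "g \<in> wiener" "g \<in> L2_plus"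
  shows "f * g \<in> L2_plus"
  using assms wiener_mult[of f g] fourier_mult_hardy[OF assms(1,2,4)]
  by (auto simp: L2_plus_def wiener_L2)

lemma circ_integral_fourier: "circ_integral f = fourier f 0"
  by (simp add: fourier_def inner_circ_def)

lemma fourier_hardy_mult_0:
  assumes f: "f \<in> wiener" "f \<in> L2_plus" and g: "g \<in> L2_plus"
  shows "fourier (f * g) 0 = fourier f 0 * fourier g 0"
  using fourier_mult_hardy[OF assms, of 0] by simp

lemma fourier_square:
  assumes f: "f \<in> wiener" "f \<in> L2_plus"
  shows "fourier (f * f) 0 = (fourier f 0)\<^sup>2" "fourier (f * f) 1 = 2 * fourier f 0 * fourier f 1"
    "fourier (f * f) 2 = 2 * fourier f 0 * fourier f 2 + (fourier f 1)\<^sup>2"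
    "fourier (f * f) 3 = 2 * fourier f 0 * fourier f 3 + 2 * fourier f 1 * fourier f 2"
proof -
  have "{0..1::int} = {0, 1}" "{0..2::int} = {0, 1, 2}" "{0..3::int} = {0, 1, 2, 3}" by auto
  then show "fourier (f * f) 0 = (fourier f 0)\<^sup>2" "fourier (f * f) 1 = 2 * fourier f 0 * fourier f 1"
    "fourier (f * f) 2 = 2 * fourier f 0 * fourier f 2 + (fourier f 1)\<^sup>2"
    "fourier (f * f) 3 = 2 * fourier f 0 * fourier f 3 + 2 * fourier f 1 * fourier f 2"
    unfolding fourier_mult_hardy[OF f f(2)] by (simp_all add: power2_eq_square)
qed

text \<open>The symmetrization behind the conservation of the momentum \<open>\<Sum> n |u\<^sub>n|\<^sup>2\<close>:
  the sum of \<open>(j + k) u\<^sub>j u\<^sub>k cnj u\<^sub>j\<^sub>+\<^sub>k\<close> is twice the sum of \<open>j u\<^sub>j u\<^sub>k cnj u\<^sub>j\<^sub>+\<^sub>k\<close>.\<close>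

lemma momentum_square:
  assumes u: "u \<in> wiener" "u \<in> L2_plus" and B: "\<And>n. real n * norm (fourier u (int n)) \<le> B"
  obtains X where
    "((\<lambda>n. of_nat n * fourier (szego_proj (u * circ_cnj u)) (int n) * cnj (fourier u (int n))) has_sum X) UNIV"
    "((\<lambda>n. of_nat n * fourier (u * u) (int n) * cnj (fourier u (int n))) has_sum 2 * cnj X) UNIV"
proof -
  define a where "a = (\<lambda>n::nat. fourier u (int n))"
  define w where "w = szego_proj (u * circ_cnj u)"
  have sa: "(\<lambda>n. norm (a n)) summable_on UNIV"
    unfolding a_def using wiener_summable[OF u(1)] by (subst (asm) int_summable_nat) (use u in \<open>auto simp: L2_plusD\<close>)
  have B0: "B \<ge> 0" using B[of 0] by simp
  have s0: "(\<lambda>(j, k). B * (norm (a j) * norm (a k))) summable_on UNIV \<times> UNIV"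
  proof (rule summable_on_SigmaI[where g = "\<lambda>j. B * (norm (a j) * (\<Sum>\<^sub>\<infinity>k. norm (a k)))"])
    show "((\<lambda>k. case (j, k) of (j, k) \<Rightarrow> B * (norm (a j) * norm (a k))) has_sum B * (norm (a j) * (\<Sum>\<^sub>\<infinity>k. norm (a k)))) UNIV" for j
      unfolding prod.case by (intro has_sum_cmult_right has_sum_infsum sa)
    show "(\<lambda>j. B * (norm (a j) * (\<Sum>\<^sub>\<infinity>k. norm (a k)))) summable_on UNIV"
      by (intro summable_on_cmult_right summable_on_cmult_left sa)
  qed (use B0 in auto)
  \<comment> \<open>\<open>F\<close> has weight \<open>j + k\<close>, \<open>G\<close> has weight
    \<open>j\<close>, and \<open>G\<close> plus its transpose is \<open>F\<close>. Summed over
    \<open>k\<close>, \<open>G\<close> produces the coefficients of \<open>w\<close>; summed along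
    \<open>j + k = n\<close>, \<open>F\<close> produces those of \<open>u * u\<close>.\<close>
  define F where "F = (\<lambda>(j, k). of_nat (j + k) * (a j * a k * cnj (a (j + k))))"
  define G where "G = (\<lambda>(j, k). of_nat j * (a j * a k * cnj (a (j + k))))"
  have bF: "norm (F (j, k)) \<le> B * (norm (a j) * norm (a k))" for j k
  proof -
    have "norm (F (j, k)) = (real (j + k) * norm (a (j + k))) * (norm (a j) * norm (a k))"
      by (simp add: F_def norm_mult mult_ac del: of_nat_add)
    also have "\<dots> \<le> B * (norm (a j) * norm (a k))"
      using B[of "j + k"] by (intro mult_right_mono) (auto simp: a_def)
    finally show ?thesis .
  qed
  have bG: "norm (G (j, k)) \<le> norm (F (j, k))" for j k
    by (simp add: F_def G_def norm_mult mult_right_mono del: of_nat_add)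
  have "(\<lambda>x. norm (F x)) summable_on UNIV \<times> UNIV"
    by (rule summable_on_comparison_test[OF s0]) (use bF in auto)
  then have sF: "F summable_on UNIV \<times> UNIV" by (rule abs_summable_summable)
  have "(\<lambda>x. norm (G x)) summable_on UNIV \<times> UNIV"
    by (rule summable_on_comparison_test[OF s0]) (use bG bF order_trans in \<open>auto, blast\<close>)
  then have sG: "G summable_on UNIV \<times> UNIV" by (rule abs_summable_summable)
  define Y where "Y = infsum G (UNIV \<times> UNIV)"
  have GY: "(G has_sum Y) (UNIV \<times> UNIV)" unfolding Y_def by (rule has_sum_infsum[OF sG])
  have GY': "((\<lambda>(j, k). G (k, j)) has_sum Y) (UNIV \<times> UNIV)"
    using GY by (subst has_sum_reindex_bij_witness[of _ prod.swap prod.swap _ G]) auto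
  have FY: "(F has_sum 2 * Y) (UNIV \<times> UNIV)"
  proof -
    have "(\<lambda>x. G x + (case x of (j, k) \<Rightarrow> G (k, j))) = F"
      by (auto simp: F_def G_def fun_eq_iff algebra_simps)
    then show ?thesis using has_sum_add[OF GY GY'] by simp
  qed
  have w_coeff: "((\<lambda>k. a (j + k) * cnj (a k)) has_sum fourier w (int j)) UNIV" for j
  proof -
    have "((\<lambda>n. fourier u n * fourier (circ_cnj u) (int j - n)) has_sum fourier (u * circ_cnj u) (int j)) UNIV"
      using u by (intro fourier_mult) (auto simp: L2_plusD)
    then have "((\<lambda>n. fourier u n * cnj (fourier u (n - int j))) has_sum fourier w (int j)) UNIV"
      using szego_proj_wiener(3)[of "u * circ_cnj u" "int j"] u by (simp add: w_def wiener_mult wiener_cnj)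
    then have "((\<lambda>n. fourier u (n + int j) * cnj (fourier u n)) has_sum fourier w (int j)) UNIV"
      by (subst has_sum_reindex_bij_witness[of _ "\<lambda>n. n - int j" "\<lambda>n. n + int j" UNIV "\<lambda>n. fourier u n * cnj (fourier u (n - int j))"]) auto
    then show ?thesis
      by (subst (asm) int_has_sum_nat) (use u in \<open>auto simp: L2_plusD a_def add.commute\<close>)
  qed
  have "((\<lambda>j. of_nat j * a j * cnj (fourier w (int j))) has_sum Y) UNIV"
  proof (rule has_sum_SigmaD[OF GY])
    fix j :: nat
    have "((\<lambda>k. cnj (a (j + k) * cnj (a k))) has_sum cnj (fourier w (int j))) UNIV"
      using w_coeff[of j] by (simp only: has_sum_cnj_iff)
    from has_sum_cmult_right[OF this, of "of_nat j * a j"]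
    show "((\<lambda>k. G (j, k)) has_sum of_nat j * a j * cnj (fourier w (int j))) UNIV"
      by (simp add: G_def mult_ac)
  qed
  then have "((\<lambda>j. cnj (of_nat j * a j * cnj (fourier w (int j)))) has_sum cnj Y) UNIV"
    by (simp only: has_sum_cnj_iff)
  then have 1: "((\<lambda>n. of_nat n * fourier w (int n) * cnj (fourier u (int n))) has_sum cnj Y) UNIV"
    by (simp add: a_def mult_ac)
  have F': "((\<lambda>(n, j). F (j, n - j)) has_sum 2 * Y) (SIGMA n:UNIV. {..n})"
    using FY by (subst has_sum_reindex_bij_witness[of _ "\<lambda>(j,k). (j + k, j)" "\<lambda>(n,j). (j, n - j)" "UNIV \<times> UNIV" F]) auto
  have "((\<lambda>n. of_nat n * fourier (u * u) (int n) * cnj (fourier u (int n))) has_sum 2 * Y) UNIV"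
  proof (rule has_sum_SigmaD[OF F'])
    fix n :: nat
    have "fourier (u * u) (int n) = (\<Sum>j\<in>{0..int n}. fourier u j * fourier u (int n - j))"
      using u by (intro fourier_mult_hardy)
    also have "\<dots> = (\<Sum>j\<in>{..n}. a j * a (n - j))"
      by (rule sum.reindex_bij_witness[of _ int nat]) (auto simp: a_def of_nat_diff)
    finally have "(\<Sum>j\<in>{..n}. F (j, n - j)) = of_nat n * fourier (u * u) (int n) * cnj (fourier u (int n))"
      by (auto simp: F_def a_def sum_distrib_left sum_distrib_right mult_ac intro!: sum.cong)
    then show "((\<lambda>j. case (n, j) of (n, j) \<Rightarrow> F (j, n - j)) has_sum of_nat n * fourier (u * u) (int n) * cnj (fourier u (int n))) {..n}"
      by (intro has_sum_finiteI) auto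
  qed
  then show ?thesis using that[of "cnj Y"] 1 by (simp add: w_def)
qed

section \<open>The momentum along differentiable curves\<close>

definition momentum :: "circ_fun \<Rightarrow> real" where
  "momentum f = (\<Sum>\<^sub>\<infinity>n::nat. real n * (norm (fourier f (int n)))\<^sup>2)"

definition momentum_form :: "circ_fun \<Rightarrow> circ_fun \<Rightarrow> real" where
  "momentum_form f g = (\<Sum>\<^sub>\<infinity>n::nat. real n * Re (fourier f (int n) * cnj (fourier g (int n))))"

lemma Hs_add:
  assumes "f \<in> Hs s" "g \<in> Hs s" shows "f + g \<in> Hs s"
proof -
  let ?w = "\<lambda>n. (1 + (real_of_int n)\<^sup>2) powr s"
  have "(\<lambda>n. 2 * (?w n * (norm (fourier f n))\<^sup>2) + 2 * (?w n * (norm (fourier g n))\<^sup>2)) summable_on UNIV"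
    using assms by (intro summable_on_add summable_on_cmult_right) (auto simp: Hs_def)
  moreover have "?w n * (norm (fourier (f + g) n))\<^sup>2 \<le> 2 * (?w n * (norm (fourier f n))\<^sup>2) + 2 * (?w n * (norm (fourier g n))\<^sup>2)" for n
  proof -
    have "(norm (fourier (f + g) n))\<^sup>2 \<le> (norm (fourier f n) + norm (fourier g n))\<^sup>2"
      using assms by (intro power_mono) (auto simp: Hs_def fourier_add norm_triangle_ineq)
    also have "\<dots> \<le> 2 * (norm (fourier f n))\<^sup>2 + 2 * (norm (fourier g n))\<^sup>2"
      using zero_le_power2[of "norm (fourier f n) - norm (fourier g n)"] by (simp add: power2_eq_square algebra_simps)
    finally show ?thesis using mult_left_mono[of _ _ "?w n"] by (fastforce simp: algebra_simps)
  qed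
  ultimately have "(\<lambda>n. ?w n * (norm (fourier (f + g) n))\<^sup>2) summable_on UNIV"
    by (rule summable_on_comparison_test) auto
  then show ?thesis using assms by (auto simp: Hs_def)
qed

lemma Hs_scaleC:
  assumes "f \<in> Hs s" shows "c *\<^sub>C f \<in> Hs s"
proof -
  have "(\<lambda>n. (norm c)\<^sup>2 * ((1 + (real_of_int n)\<^sup>2) powr s * (norm (fourier f n))\<^sup>2)) summable_on UNIV"
    using assms by (intro summable_on_cmult_right) (auto simp: Hs_def)
  then show ?thesis using assms by (auto simp: Hs_def norm_mult power_mult_distrib mult_ac)
qed

lemma Hs_diff: "f \<in> Hs s \<Longrightarrow> g \<in> Hs s \<Longrightarrow> f - g \<in> Hs s"
  using Hs_add[of f s "(-1) *\<^sub>C g"] Hs_scaleC[of g s "-1"] by simp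

lemma momentum_Hs:
  assumes f: "f \<in> Hs s" "f \<in> L2_plus" and s: "s > 1/2"
  shows "(\<lambda>n::nat. real n * (norm (fourier f (int n)))\<^sup>2) summable_on UNIV" "momentum f \<le> (norm_Hs s f)\<^sup>2" "0 \<le> momentum f"
proof -
  have le: "real n * (norm (fourier f (int n)))\<^sup>2 \<le> (1 + (real n)\<^sup>2) powr s * (norm (fourier f (int n)))\<^sup>2" for n
  proof (rule mult_right_mono)
    have "real n \<le> sqrt (1 + (real n)\<^sup>2)" by (rule real_le_rsqrt) simp
    also have "\<dots> = (1 + (real n)\<^sup>2) powr (1/2)" by (simp add: powr_half_sqrt)
    also have "\<dots> \<le> (1 + (real n)\<^sup>2) powr s" using s by (intro powr_mono) auto
    finally show "real n \<le> (1 + (real n)\<^sup>2) powr s" .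
  qed simp
  show sm: "(\<lambda>n::nat. real n * (norm (fourier f (int n)))\<^sup>2) summable_on UNIV"
    by (rule summable_on_comparison_test[OF Hs_plusD[OF f] le]) auto
  have "momentum f \<le> Hs_sum s f"
    unfolding momentum_def Hs_sum_def by (intro infsum_mono sm Hs_plusD f le)
  then show "momentum f \<le> (norm_Hs s f)\<^sup>2" using norm_Hs_plus[OF f(2)] Hs_sum_nonneg[of s f] by simp
  show "0 \<le> momentum f" unfolding momentum_def by (rule infsum_nonneg) auto
qed

lemma momentum_form_summable:
  assumes "(\<lambda>n::nat. real n * (norm (fourier f (int n)))\<^sup>2) summable_on UNIV"
    "(\<lambda>n::nat. real n * (norm (fourier g (int n)))\<^sup>2) summable_on UNIV" and e: "e > 0"
  shows "(\<lambda>n::nat. real n * Re (fourier f (int n) * cnj (fourier g (int n)))) summable_on UNIV"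
    "2 * \<bar>momentum_form f g\<bar> \<le> e * momentum f + momentum g / e"
proof -
  let ?a = "\<lambda>n::nat. norm (fourier f (int n))" and ?b = "\<lambda>n::nat. norm (fourier g (int n))"
  let ?F = "\<lambda>n::nat. real n * Re (fourier f (int n) * cnj (fourier g (int n)))"
  let ?D = "\<lambda>n. (e / 2) * (real n * (?a n)\<^sup>2) + (1 / (2 * e)) * (real n * (?b n)\<^sup>2)"
  have sD: "?D summable_on UNIV"
    by (intro summable_on_add summable_on_cmult_right assms)
  have le: "norm (?F n) \<le> ?D n" for n
  proof -
    have "norm (?F n) \<le> real n * (?a n * ?b n)"
      using abs_Re_le_cmod[of "fourier f (int n) * cnj (fourier g (int n))"]
      by (auto simp: abs_mult norm_mult intro!: mult_left_mono)
    also have "\<dots> \<le> real n * ((e / 2) * (?a n)\<^sup>2 + (1 / (2 * e)) * (?b n)\<^sup>2)"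
    proof (rule mult_left_mono)
      have "0 \<le> (e * ?a n - ?b n)\<^sup>2 / (2 * e)" using e by simp
      also have "\<dots> = (e / 2) * (?a n)\<^sup>2 + (1 / (2 * e)) * (?b n)\<^sup>2 - ?a n * ?b n"
        using e by (simp add: power2_eq_square field_simps)
      finally show "?a n * ?b n \<le> (e / 2) * (?a n)\<^sup>2 + (1 / (2 * e)) * (?b n)\<^sup>2" by simp
    qed simp
    finally show ?thesis by (simp add: algebra_simps)
  qed
  have "(\<lambda>n. norm (?F n)) summable_on UNIV"
    by (rule summable_on_comparison_test[OF sD le]) auto
  then show sF: "?F summable_on UNIV" by (rule abs_summable_summable)
  have "\<bar>momentum_form f g\<bar> \<le> (\<Sum>\<^sub>\<infinity>n. norm (?F n))"
    unfolding momentum_form_def using norm_infsum_bound[of ?F UNIV] \<open>(\<lambda>n. norm (?F n)) summable_on UNIV\<close> by simp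
  also have "\<dots> \<le> infsum ?D UNIV"
    by (intro infsum_mono sD le \<open>(\<lambda>n. norm (?F n)) summable_on UNIV\<close>)
  also have "\<dots> = (\<Sum>\<^sub>\<infinity>n. (e / 2) * (real n * (?a n)\<^sup>2)) + (\<Sum>\<^sub>\<infinity>n. (1 / (2 * e)) * (real n * (?b n)\<^sup>2))"
    by (intro infsum_add summable_on_cmult_right assms)
  also have "\<dots> = (e / 2) * momentum f + (1 / (2 * e)) * momentum g"
    unfolding momentum_def infsum_cmult_right' ..
  finally show "2 * \<bar>momentum_form f g\<bar> \<le> e * momentum f + momentum g / e" by simp
qed

lemma momentum_add_scale:
  assumes f: "(\<lambda>n::nat. real n * (norm (fourier f (int n)))\<^sup>2) summable_on UNIV" "f \<in> L2"
    and g: "(\<lambda>n::nat. real n * (norm (fourier g (int n)))\<^sup>2) summable_on UNIV" "g \<in> L2"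
  shows "momentum (f + of_real h *\<^sub>C g) = momentum f + 2 * h * momentum_form f g + h\<^sup>2 * momentum g"
proof -
  let ?F = "\<lambda>n::nat. real n * Re (fourier f (int n) * cnj (fourier g (int n)))"
  have sF: "?F summable_on UNIV" using momentum_form_summable(1)[OF f(1) g(1), of 1] by simp
  have "momentum (f + of_real h *\<^sub>C g) = (\<Sum>\<^sub>\<infinity>n::nat. (real n * (norm (fourier f (int n)))\<^sup>2 + (2 * h) * ?F n) + h\<^sup>2 * (real n * (norm (fourier g (int n)))\<^sup>2))"
    unfolding momentum_def
  proof (rule infsum_cong)
    fix n :: nat
    have "(norm (fourier f (int n) + of_real h * fourier g (int n)))\<^sup>2
      = (norm (fourier f (int n)))\<^sup>2 + 2 * h * Re (fourier f (int n) * cnj (fourier g (int n))) + h\<^sup>2 * (norm (fourier g (int n)))\<^sup>2"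
      unfolding cmod_power2 by (simp add: power2_eq_square algebra_simps)
    then show "real n * (norm (fourier (f + of_real h *\<^sub>C g) (int n)))\<^sup>2 =
       (real n * (norm (fourier f (int n)))\<^sup>2 + (2 * h) * ?F n) + h\<^sup>2 * (real n * (norm (fourier g (int n)))\<^sup>2)"
      using f g by (simp add: fourier_add L2_scaleC algebra_simps)
  qed
  also have "\<dots> = ((\<Sum>\<^sub>\<infinity>n::nat. real n * (norm (fourier f (int n)))\<^sup>2) + (\<Sum>\<^sub>\<infinity>n. (2 * h) * ?F n)) + (\<Sum>\<^sub>\<infinity>n::nat. h\<^sup>2 * (real n * (norm (fourier g (int n)))\<^sup>2))"
    by (subst infsum_add, (intro summable_on_add summable_on_cmult_right f g sF)+)+ simp
  also have "\<dots> = momentum f + 2 * h * momentum_form f g + h\<^sup>2 * momentum g"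
    unfolding momentum_def momentum_form_def infsum_cmult_right' ..
  finally show ?thesis .
qed

text \<open>The momentum is a quadratic form bounded by the squared Sobolev norm, so it expands
  exactly at \<open>u t\<close>, and the remainder of the difference quotient enters only through
  its norm \<open>N\<close>.\<close>

lemma momentum_has_derivative:
  assumes s: "s > 1/2" and u: "\<And>t. u t \<in> Hs s" "\<And>t. u t \<in> L2_plus" and v: "v \<in> Hs s" "v \<in> L2_plus"
    and lim: "((\<lambda>h. norm_Hs s (diff_quot u v t h)) \<longlongrightarrow> 0) (at 0)"
  shows "((\<lambda>t. momentum (u t)) has_vector_derivative 2 * momentum_form (u t) v) (at t)"
proof (rule has_vector_derivativeI_quot, rule Lim_null_comparison)
  define N where "N = (\<lambda>h. norm_Hs s (diff_quot u v t h))"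
  have eta: "diff_quot u v t h \<in> Hs s" "diff_quot u v t h \<in> L2_plus" for h
    unfolding diff_quot_def by (intro Hs_diff Hs_scaleC L2_plus_diff L2_plus_scaleC u v)+
  have N0: "N h \<ge> 0" for h unfolding N_def using eta Hs_sum_nonneg by (simp add: norm_Hs_plus)
  note ms = momentum_Hs[OF _ _ s]
  show "\<forall>\<^sub>F h in at 0. norm ((1 / h) *\<^sub>R (momentum (u (t + h)) - momentum (u t)) - 2 * momentum_form (u t) v)
     \<le> (N h + \<bar>h\<bar>) * (momentum (u t) + 1) + \<bar>h\<bar> * (2 * momentum v + 2 * (N h)\<^sup>2)"
    unfolding eventually_at_filter
  proof (intro always_eventually allI impI)
    fix h :: real assume h: "h \<noteq> 0"
    define e where "e = diff_quot u v t h"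
    note eta = eta[of h, folded e_def]
    have L: "u t \<in> L2" "v \<in> L2" "e \<in> L2" using u v eta by (auto simp: L2_plusD)
    have ve: "v + e \<in> Hs s" "v + e \<in> L2_plus" using v eta by (auto intro: Hs_add)
    have "momentum (u (t + h)) = momentum (u t) + 2 * h * momentum_form (u t) (v + e) + h\<^sup>2 * momentum (v + e)"
      unfolding diff_quot_expand[OF h, of u t v, folded e_def]
      using L by (intro momentum_add_scale ms(1) u ve) auto
    moreover have "momentum_form (u t) (v + e) = momentum_form (u t) v + momentum_form (u t) e"
      unfolding momentum_form_def using L momentum_form_summable(1)[OF ms(1)[OF u] ms(1)[OF v], of 1]
        momentum_form_summable(1)[OF ms(1)[OF u] ms(1)[OF eta], of 1]
      by (subst infsum_add[symmetric]) (auto simp: fourier_add algebra_simps)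
    ultimately have eq: "(1 / h) *\<^sub>R (momentum (u (t + h)) - momentum (u t)) - 2 * momentum_form (u t) v
      = 2 * momentum_form (u t) e + h * momentum (v + e)"
      using h by (simp add: field_simps power2_eq_square)
    \<comment> \<open>The weight for the arithmetic-geometric inequality; the summand
      \<open>\<bar>h\<bar>\<close> keeps it positive when \<open>N h = 0\<close>.\<close>
    have p: "N h + \<bar>h\<bar> > 0" using N0[of h] h by linarith
    have me: "momentum e \<le> (N h)\<^sup>2" "0 \<le> momentum e" using ms(2,3)[OF eta] by (simp_all add: N_def e_def)
    have "2 * \<bar>momentum_form (u t) e\<bar> \<le> (N h + \<bar>h\<bar>) * momentum (u t) + momentum e / (N h + \<bar>h\<bar>)"
      by (rule momentum_form_summable(2)[OF ms(1)[OF u] ms(1)[OF eta] p])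
    also have "momentum e / (N h + \<bar>h\<bar>) \<le> N h + \<bar>h\<bar>"
    proof -
      have "(N h)\<^sup>2 \<le> (N h + \<bar>h\<bar>)\<^sup>2" using N0[of h] by (intro power_mono) auto
      with me have "momentum e \<le> (N h + \<bar>h\<bar>) * (N h + \<bar>h\<bar>)" by (simp add: power2_eq_square)
      then show ?thesis using p by (simp add: field_simps)
    qed
    finally have 1: "\<bar>2 * momentum_form (u t) e\<bar> \<le> (N h + \<bar>h\<bar>) * (momentum (u t) + 1)"
      by (simp add: algebra_simps)
    have "momentum (v + of_real 1 *\<^sub>C e) = momentum v + 2 * 1 * momentum_form v e + 1\<^sup>2 * momentum e"
      using L by (intro momentum_add_scale ms(1) v eta) auto
    moreover have "2 * \<bar>momentum_form v e\<bar> \<le> 1 * momentum v + momentum e / 1"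
      by (rule momentum_form_summable(2)[OF ms(1)[OF v] ms(1)[OF eta]]) simp
    ultimately have "momentum (v + e) \<le> 2 * momentum v + 2 * momentum e" by simp
    also have "\<dots> \<le> 2 * momentum v + 2 * (N h)\<^sup>2" using me by simp
    finally have 2: "\<bar>h * momentum (v + e)\<bar> \<le> \<bar>h\<bar> * (2 * momentum v + 2 * (N h)\<^sup>2)"
      using ms(3)[OF ve] by (auto simp: abs_mult intro!: mult_left_mono)
    show "norm ((1 / h) *\<^sub>R (momentum (u (t + h)) - momentum (u t)) - 2 * momentum_form (u t) v)
     \<le> (N h + \<bar>h\<bar>) * (momentum (u t) + 1) + \<bar>h\<bar> * (2 * momentum v + 2 * (N h)\<^sup>2)"
      unfolding eq using 1 2 by simp
  qed
  have "((\<lambda>h. (N h + \<bar>h\<bar>) * (momentum (u t) + 1) + \<bar>h\<bar> * (2 * momentum v + 2 * (N h)\<^sup>2)) \<longlongrightarrow>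
      (0 + \<bar>0\<bar>) * (momentum (u t) + 1) + \<bar>0\<bar> * (2 * momentum v + 2 * 0\<^sup>2)) (at 0)"
    using lim unfolding N_def[symmetric] by (intro tendsto_intros)
  then show "((\<lambda>h. (N h + \<bar>h\<bar>) * (momentum (u t) + 1) + \<bar>h\<bar> * (2 * momentum v + 2 * (N h)\<^sup>2)) \<longlongrightarrow> 0) (at 0)"
    by simp
qed

section \<open>The evolution equations\<close>

lemma fourier_uminus [simp]: "fourier (- f) n = - fourier f n"
  using fourier_scaleC[of "-1" f n] by simp

locale szego_curve =
  fixes u :: "real \<Rightarrow> circ_fun" and s0 :: real
  assumes s0: "s0 > 1/2" and sol: "szego_solution s0 u" and V4: "u t \<in> V_rk 4"
begin

lemma u_Hs: "u t \<in> Hs s0" and u_L2_plus: "u t \<in> L2_plus"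
  using sol by (auto simp: szego_solution_def Hs_plus_def)

lemma u_wiener: "u t \<in> wiener"
  by (rule Hs_wiener(1)[OF u_Hs u_L2_plus s0])

lemma hankel_pair_ex: "\<exists>e1 e2 \<sigma>1 \<sigma>2 s d. hankel_pair (u t) e1 e2 \<sigma>1 \<sigma>2 s d"
  by (rule hankel_pair_exists[OF V4 u_wiener]) blast

definition "J t = szego_J (u t)"
definition "Q t = szego_Q (u t)"
definition "c t = fourier (u t) 0"
definition "w t = szego_proj (u t * circ_cnj (u t))"
definition "h2 t = (norm_L2 (w t))\<^sup>2"
definition "v t = (- \<i>) *\<^sub>C ((2 * J t) *\<^sub>C w t + cnj (J t) *\<^sub>C (u t)\<^sup>2)"

lemma w_wiener: "w t \<in> wiener" and w_L2_plus: "w t \<in> L2_plus"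
  unfolding w_def by (intro szego_proj_wiener wiener_mult wiener_cnj u_wiener)+

lemma v_wiener: "v t \<in> wiener" and v_L2_plus: "v t \<in> L2_plus"
  unfolding v_def power2_eq_square
  by (intro wiener_scaleC wiener_add wiener_mult w_wiener u_wiener
      L2_plus_scaleC L2_plus_add L2_plus_mult w_L2_plus u_L2_plus)+

lemma v_derivative: "v t \<in> Hs s0" "((\<lambda>h. norm_Hs s0 (diff_quot u (v t) t h)) \<longlongrightarrow> 0) (at 0)"
proof -
  obtain v' where v': "has_Hs_derivative s0 u v' t" "\<i> *\<^sub>C v' = (2 * J t) *\<^sub>C w t + cnj (J t) *\<^sub>C (u t)\<^sup>2"
    using sol unfolding szego_solution_def J_def w_def by blast
  have "v' = v t" unfolding v_def v'(2)[symmetric] by simp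
  with v' show "v t \<in> Hs s0" "((\<lambda>h. norm_Hs s0 (diff_quot u (v t) t h)) \<longlongrightarrow> 0) (at 0)"
    by (simp_all add: has_Hs_derivative_def diff_quot_def)
qed

lemma u_derivative: "wiener_derivative u (v t) t"
  unfolding wiener_derivative_def
proof (intro conjI allI v_wiener u_wiener)
  define A where "A = ((\<Sum>\<^sub>\<infinity>n::nat. (1 + (real n)\<^sup>2) powr (- s0)) + 1) / 2"
  have mem: "diff_quot u (v t) t h \<in> Hs s0" "diff_quot u (v t) t h \<in> L2_plus" for h
    unfolding diff_quot_def
    by (intro Hs_diff Hs_scaleC u_Hs v_derivative L2_plus_diff L2_plus_scaleC u_L2_plus v_L2_plus)+
  have le: "wiener_norm (diff_quot u (v t) t h) \<le> norm_Hs s0 (diff_quot u (v t) t h) * A" for h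
    using Hs_wiener(2)[OF mem(1)[of h] mem(2)[of h] s0] by (simp add: A_def)
  have "((\<lambda>h. norm_Hs s0 (diff_quot u (v t) t h) * A) \<longlongrightarrow> 0 * A) (at 0)"
    by (intro tendsto_intros v_derivative)
  then have "((\<lambda>h. norm_Hs s0 (diff_quot u (v t) t h) * A) \<longlongrightarrow> 0) (at 0)" by simp
  then show "((\<lambda>h. wiener_norm (diff_quot u (v t) t h)) \<longlongrightarrow> 0) (at 0)"
    by (rule Lim_null_comparison[rotated]) (use le wiener_norm_nonneg in auto)
qed

lemma fourier_derivative:
  "((\<lambda>t. fourier (u t) n) has_vector_derivative - \<i> * (2 * J t * fourier (w t) n + cnj (J t) * fourier (u t * u t) n)) (at t)"
proof -
  have "fourier (v t) n = - \<i> * (2 * J t * fourier (w t) n + cnj (J t) * fourier (u t * u t) n)"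
    using w_wiener[of t] u_wiener[of t]
    by (simp add: v_def fourier_add wiener_L2 L2_scaleC wiener_mult power2_eq_square)
  then show ?thesis using wiener_derivative_fourier[OF u_derivative[of t], of n] by simp
qed

text \<open>The function on the left is real, so its negative frequencies are conjugate to the
  positive ones; the mean is counted twice in the sum and subtracted once.\<close>

lemma abs_square_eq: "u t * circ_cnj (u t) = w t + circ_cnj (w t) - of_real (Q t) *\<^sub>C 1"
proof (rule L2_eqI)
  let ?p = "u t * circ_cnj (u t)"
  have p: "?p \<in> wiener" using u_wiener by auto
  then show "?p \<in> L2" by (rule wiener_L2)
  have w: "w t \<in> L2" using w_wiener wiener_L2 by blast
  show "w t + circ_cnj (w t) - of_real (Q t) *\<^sub>C 1 \<in> L2"
    using w by (intro L2_diff L2_add L2_scaleC) auto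
  fix n
  have self: "cnj (fourier ?p (- n)) = fourier ?p n" for n
  proof -
    have "circ_cnj ?p = ?p" by (simp add: mult.commute)
    then show ?thesis using fourier_cnj[of ?p n] by (simp only:)
  qed
  have Q: "of_real (Q t) = fourier ?p 0"
    using inner_self[of "u t"] norm_L2_square[of "u t"]
    by (simp add: Q_def szego_Q_def fourier_def inner_circ_def)
  have "fourier (w t + circ_cnj (w t) - of_real (Q t) *\<^sub>C 1) n =
      fourier (w t) n + cnj (fourier (w t) (- n)) - of_real (Q t) * (if n = 0 then 1 else 0)"
    using w by (simp add: fourier_diff fourier_add L2_add L2_scaleC fourier_1)
  also have "\<dots> = fourier ?p n"
    unfolding w_def szego_proj_wiener(3)[OF p] Q using self[of n] self[of 0] by (cases n "0::int" rule: linorder_cases) auto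
  finally show "fourier ?p n = fourier (w t + circ_cnj (w t) - of_real (Q t) *\<^sub>C 1) n" ..
qed

lemma fourier_w_0: "fourier (w t) 0 = Q t"
proof -
  obtain e1 e2 \<sigma>1 \<sigma>2 s d where hp: "hankel_pair (u t) e1 e2 \<sigma>1 \<sigma>2 s d" using hankel_pair_ex by blast
  show ?thesis using hankel_pair.fourier_w_0[OF hp] by (simp add: hankel_pair.w_def[OF hp] w_def Q_def)
qed

definition "I f = circ_integral f"

lemma I_add: "f \<in> wiener \<Longrightarrow> g \<in> wiener \<Longrightarrow> I (f + g) = I f + I g"
  by (simp add: I_def circ_integral_add L2_integrable wiener_L2)

lemma I_diff: "f \<in> wiener \<Longrightarrow> g \<in> wiener \<Longrightarrow> I (f - g) = I f - I g"
  by (simp add: I_def circ_integral_diff L2_integrable wiener_L2)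

lemma I_scaleC: "I (k *\<^sub>C f) = k * I f"
  by (simp add: I_def)

lemma I_cnj: "I (circ_cnj f) = cnj (I f)"
  by (simp add: I_def circ_integral_cnj)

lemma I_hardy: "f \<in> wiener \<Longrightarrow> f \<in> L2_plus \<Longrightarrow> g \<in> L2_plus \<Longrightarrow> I (f * g) = I f * I g"
  by (simp add: I_def circ_integral_fourier fourier_hardy_mult_0)

lemma J_inner: "I (u t * circ_cnj (w t)) = J t"
proof -
  obtain e1 e2 \<sigma>1 \<sigma>2 s d where "hankel_pair (u t) e1 e2 \<sigma>1 \<sigma>2 s d" using hankel_pair_ex by blast
  from hankel_pair.J_inner[OF this] show ?thesis
    by (simp add: I_def inner_circ_def hankel_pair.w_def[OF \<open>hankel_pair (u t) e1 e2 \<sigma>1 \<sigma>2 s d\<close>] J_def flip: w_def)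
qed

lemma I_u: "I (u t) = c t" and I_w: "I (w t) = Q t"
  using fourier_w_0 by (simp_all add: I_def circ_integral_fourier c_def)

lemma I_w_cnj_w: "I (w t * circ_cnj (w t)) = h2 t"
  using inner_self[of "w t"] by (simp add: I_def inner_circ_def h2_def)

text \<open>One factor \<open>u t * circ_cnj (u t)\<close> is replaced by
  \<open>abs_square_eq\<close>; products of Hardy functions then integrate to the product of their
  means, and the remaining terms pair with \<open>w\<close>.\<close>

lemma integrals:
  "I (w t * (u t * circ_cnj (u t))) = h2 t"
  "I ((u t * u t) * (u t * circ_cnj (u t))) = I ((u t * u t) * circ_cnj (w t))"
  "I ((u t * circ_cnj (u t)) * (u t * circ_cnj (u t))) = 2 * h2 t - (Q t)\<^sup>2"
  "I ((u t * circ_cnj (u t)) * u t) = J t"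
proof -
  note W = w_wiener[of t] u_wiener[of t] w_L2_plus[of t] u_L2_plus[of t]
  have uu: "u t * u t \<in> L2_plus" "u t * u t \<in> wiener" by (rule L2_plus_mult[OF W(2,4,2,4)], rule wiener_mult[OF W(2,2)])
  have ww: "I (w t * w t) = (Q t)\<^sup>2" using I_hardy[OF W(1,3,3)] unfolding I_w by (simp add: power2_eq_square)
  define q where "q = of_real (Q t) *\<^sub>C (1::circ_fun)"
  have qI: "q * f = of_real (Q t) *\<^sub>C f" for f by (simp add: q_def)
  have qW: "q * f \<in> wiener" if "f \<in> wiener" for f unfolding qI using that by (rule wiener_scaleC)
  have I2: "I (2 * f) = 2 * I f" "2 * f \<in> wiener" if "f \<in> wiener" for f
  proof -
    show "I (2 * f) = 2 * I f" by (simp only: mult_2[of f] I_add[OF that that]) simp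
    show "2 * f \<in> wiener" unfolding mult_2 using that that by (rule wiener_add)
  qed
  have P: "u t * circ_cnj (u t) = w t + circ_cnj (w t) - q"
    unfolding q_def by (rule abs_square_eq)
  note mem = W(1,2) uu(2) wiener_mult[OF W(1) W(1)] wiener_mult[OF W(1) wiener_cnj[OF W(1)]] wiener_mult[OF uu(2) W(1)]
    wiener_mult[OF uu(2) wiener_cnj[OF W(1)]] wiener_mult[OF wiener_cnj[OF W(1)] wiener_cnj[OF W(1)]] wiener_cnj[OF W(1)]
  have "w t * (u t * circ_cnj (u t)) = w t * w t + w t * circ_cnj (w t) - q * w t"
    unfolding P by (simp only: distrib_left right_diff_distrib mult.commute[of q])
  also have "I \<dots> = (Q t)\<^sup>2 + h2 t - Q t * Q t"
    by (simp only: I_diff I_add mem wiener_add qW ww I_w_cnj_w) (simp only: qI I_scaleC I_w, simp)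
  finally show "I (w t * (u t * circ_cnj (u t))) = h2 t" by (simp add: power2_eq_square)
  have uw: "I ((u t * u t) * w t) = (c t)\<^sup>2 * Q t" and cu: "I (u t * u t) = (c t)\<^sup>2"
    using I_hardy[OF uu(2,1) W(3)] I_hardy[OF W(2,4) W(4)] by (simp_all add: I_w I_u power2_eq_square)
  have "(u t * u t) * (u t * circ_cnj (u t)) = (u t * u t) * w t + (u t * u t) * circ_cnj (w t) - q * (u t * u t)"
    unfolding P by (simp only: distrib_left right_diff_distrib mult.commute[of q])
  also have "I \<dots> = (c t)\<^sup>2 * Q t + I ((u t * u t) * circ_cnj (w t)) - Q t * (c t)\<^sup>2"
    by (simp only: I_diff I_add mem wiener_add qW uw) (simp only: qI I_scaleC cu)
  finally show "I ((u t * u t) * (u t * circ_cnj (u t))) = I ((u t * u t) * circ_cnj (w t))" by simp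
  have cc: "I (circ_cnj (w t) * circ_cnj (w t)) = (Q t)\<^sup>2"
    using I_cnj[of "w t * w t"] ww by simp
  have "(u t * circ_cnj (u t)) * (u t * circ_cnj (u t)) =
     w t * w t + circ_cnj (w t) * circ_cnj (w t) + 2 * (w t * circ_cnj (w t)) + q * (q * 1)
       - 2 * (q * w t) - 2 * (q * circ_cnj (w t))"
    unfolding P by (simp add: algebra_simps)
  also have "I \<dots> = (Q t)\<^sup>2 + (Q t)\<^sup>2 + 2 * h2 t + Q t * (Q t * 1) - 2 * (Q t * Q t) - 2 * (Q t * cnj (Q t))"
    by (simp only: I_diff I_add mem wiener_add wiener_diff qW wiener_1 I2 ww cc I_w_cnj_w)
      (simp only: qI I_scaleC I_w I_cnj, simp add: I_def)
  finally show "I ((u t * circ_cnj (u t)) * (u t * circ_cnj (u t))) = 2 * h2 t - (Q t)\<^sup>2"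
    by (simp add: power2_eq_square)
  show "I ((u t * circ_cnj (u t)) * u t) = J t"
    by (simp add: I_def J_def szego_J_def)
qed

text \<open>The contributions of \<open>B\<close> and \<open>C\<close> cancel by
  \<open>integrals\<close>; what remains is an imaginary multiple of \<open>J\<close>, so that its
  modulus is conserved while its phase rotates.\<close>

lemma J_derivative: "(J has_vector_derivative - \<i> * (2 * h2 t + (Q t)\<^sup>2) * J t) (at t)"
proof -
  note W = w_wiener[of t] u_wiener[of t] w_L2_plus[of t] u_L2_plus[of t] v_wiener[of t]
  have "wiener_derivative (\<lambda>t. (u t * circ_cnj (u t)) * u t) ((v t * circ_cnj (u t) + u t * circ_cnj (v t)) * u t + (u t * circ_cnj (u t)) * v t) t"
    by (intro wiener_derivative_mult wiener_derivative_cnj u_derivative)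
  from wiener_derivative_fourier[OF this, of 0]
  have d: "(J has_vector_derivative I ((v t * circ_cnj (u t) + u t * circ_cnj (v t)) * u t + (u t * circ_cnj (u t)) * v t)) (at t)"
    by (simp add: I_def circ_integral_fourier J_def[abs_def] szego_J_def)
  \<comment> \<open>Scalars become constant functions, so that the expansion is pure commutative
    ring algebra.\<close>
  define i0 j jb where "i0 = \<i> *\<^sub>C (1::circ_fun)" and "j = J t *\<^sub>C (1::circ_fun)" and "jb = cnj (J t) *\<^sub>C (1::circ_fun)"
  have scale2: "(2 * k) *\<^sub>C f = k *\<^sub>C f + k *\<^sub>C f" for k f
    by (simp only: mult_2 circ_fun.scale_left_distrib)
  have cv: "v t = - (i0 * (j * w t + j * w t + jb * (u t * u t)))"
    by (simp only: v_def power2_eq_square i0_def j_def jb_def scale2 scaleC_mult_left mult_1_left scaleC_uminus)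
  have k: "circ_cnj i0 = - i0" "circ_cnj j = jb" "circ_cnj jb = j"
    by (simp_all add: i0_def j_def jb_def)
  have "circ_cnj (v t) = - (circ_cnj i0 * (circ_cnj j * circ_cnj (w t) + circ_cnj j * circ_cnj (w t) + circ_cnj jb * (circ_cnj (u t) * circ_cnj (u t))))"
    unfolding cv by (simp only: circ_cnj_uminus circ_cnj_mult circ_cnj_add)
  then have cv': "circ_cnj (v t) = i0 * (jb * circ_cnj (w t) + jb * circ_cnj (w t) + j * (circ_cnj (u t) * circ_cnj (u t)))"
    unfolding k by simp
  define A B C D where "A = w t * (u t * circ_cnj (u t))" and "B = (u t * u t) * (u t * circ_cnj (u t))"
    and "C = (u t * u t) * circ_cnj (w t)" and "D = (u t * circ_cnj (u t)) * (u t * circ_cnj (u t))"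
  have "(v t * circ_cnj (u t) + u t * circ_cnj (v t)) * u t + (u t * circ_cnj (u t)) * v t
    = i0 * ((jb * C + jb * C + j * D) - (j * A + j * A + j * A + j * A + jb * B + jb * B))"
    unfolding cv' unfolding cv A_def B_def C_def D_def by (simp add: algebra_simps)
  also have "\<dots> = \<i> *\<^sub>C (((2 * cnj (J t)) *\<^sub>C C + J t *\<^sub>C D) - ((4 * J t) *\<^sub>C A + (2 * cnj (J t)) *\<^sub>C B))"
  proof -
    have "(4 * J t) *\<^sub>C A = (2 * (2 * J t)) *\<^sub>C A" by simp
    also have "\<dots> = J t *\<^sub>C A + J t *\<^sub>C A + (J t *\<^sub>C A + J t *\<^sub>C A)" by (simp only: scale2)
    finally show ?thesis by (simp only: i0_def j_def jb_def scale2 scaleC_mult_left mult_1_left add_ac)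
  qed
  finally have "I ((v t * circ_cnj (u t) + u t * circ_cnj (v t)) * u t + (u t * circ_cnj (u t)) * v t)
    = \<i> * ((2 * cnj (J t) * I C + J t * I D) - (4 * J t * I A + 2 * cnj (J t) * I B))"
    using W by (simp add: A_def B_def C_def D_def I_add I_diff I_scaleC wiener_mult wiener_cnj wiener_add wiener_scaleC)
  also have "\<dots> = - \<i> * (2 * h2 t + (Q t)\<^sup>2) * J t"
    unfolding A_def B_def C_def D_def integrals by (simp add: algebra_simps)
  finally show ?thesis using d by simp
qed

text \<open>The inner product of the velocity with \<open>u t\<close> is \<open>- 3 * \<i>\<close>
  times the squared modulus of \<open>J t\<close>, hence imaginary.\<close>

lemma Q_derivative: "(Q has_real_derivative 0) (at t)"
proof -
  note W = w_wiener[of t] u_wiener[of t] w_L2_plus[of t] u_L2_plus[of t] v_wiener[of t]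
  have "wiener_derivative (\<lambda>t. u t * circ_cnj (u t)) (v t * circ_cnj (u t) + u t * circ_cnj (v t)) t"
    by (intro wiener_derivative_mult wiener_derivative_cnj u_derivative)
  from wiener_derivative_fourier[OF this, of 0]
  have d: "((\<lambda>t. I (u t * circ_cnj (u t))) has_vector_derivative I (v t * circ_cnj (u t) + u t * circ_cnj (v t))) (at t)"
    by (simp add: I_def circ_integral_fourier)
  have vu: "I (v t * circ_cnj (u t)) = - \<i> * (3 * of_real ((norm (J t))\<^sup>2))"
  proof -
    have "v t * circ_cnj (u t) = (- \<i>) *\<^sub>C ((2 * J t) *\<^sub>C circ_cnj (u t * circ_cnj (w t)) + cnj (J t) *\<^sub>C ((u t * circ_cnj (u t)) * u t))"
      unfolding v_def power2_eq_square by (simp add: algebra_simps)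
    also have "I \<dots> = (- \<i>) * ((2 * J t) * I (circ_cnj (u t * circ_cnj (w t))) + cnj (J t) * I ((u t * circ_cnj (u t)) * u t))"
      unfolding I_scaleC using W by (subst I_add) (auto simp: I_scaleC simp del: circ_cnj_mult)
    also have "\<dots> = - \<i> * (3 * (J t * cnj (J t)))"
      unfolding I_cnj J_inner integrals by (simp add: algebra_simps)
    finally show ?thesis unfolding complex_norm_square by (simp add: algebra_simps)
  qed
  have "I (v t * circ_cnj (u t) + u t * circ_cnj (v t)) = I (v t * circ_cnj (u t)) + cnj (I (v t * circ_cnj (u t)))"
    using W I_cnj[of "v t * circ_cnj (u t)"] by (simp add: I_add wiener_mult wiener_cnj mult.commute)
  also have "\<dots> = 0" unfolding vu by simp
  finally have "((\<lambda>t. I (u t * circ_cnj (u t))) has_vector_derivative 0) (at t)" using d by simp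
  from bounded_linear.has_vector_derivative[OF bounded_linear_Re this]
  show ?thesis unfolding has_real_derivative_iff_has_vector_derivative Q_def[abs_def] szego_Q_def I_def by simp
qed

lemma Q_const: "Q t = Q 0"
  using DERIV_isconst_all[of Q t 0] Q_derivative by blast

definition "M t = momentum (u t)"

text \<open>By \<open>momentum_square\<close> the pairing of the velocity with \<open>u t\<close> is
  \<open>- 2 * \<i>\<close> times \<open>J t * X\<close> plus its conjugate, hence imaginary; the
  coefficient 2 of the equation matches the 2 of the symmetrization.\<close>

lemma M_const: "M t = M 0"
proof -
  have "(M has_real_derivative 0) (at t)" for t
  proof -
    have d: "(M has_vector_derivative 2 * momentum_form (u t) (v t)) (at t)"
      unfolding M_def[abs_def]
      by (rule momentum_has_derivative[OF s0 u_Hs u_L2_plus v_derivative(1) v_L2_plus v_derivative(2)])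
    obtain e1 e2 \<sigma>1 \<sigma>2 s d where hp: "hankel_pair (u t) e1 e2 \<sigma>1 \<sigma>2 s d" using hankel_pair_ex by blast
    obtain B where B: "\<And>n. real n * norm (fourier (u t) (int n)) \<le> B"
      using hankel_pair.fourier_decay[OF hp] by blast
    obtain X where X': "((\<lambda>n. of_nat n * fourier (szego_proj (u t * circ_cnj (u t))) (int n) * cnj (fourier (u t) (int n))) has_sum X) UNIV"
      "((\<lambda>n. of_nat n * fourier (u t * u t) (int n) * cnj (fourier (u t) (int n))) has_sum 2 * cnj X) UNIV"
      by (rule momentum_square[OF u_wiener u_L2_plus B]) (rule that)
    note X = X'[folded w_def]
    have "((\<lambda>n. - \<i> * (2 * J t) * (of_nat n * fourier (w t) (int n) * cnj (fourier (u t) (int n)))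
         + - \<i> * cnj (J t) * (of_nat n * fourier (u t * u t) (int n) * cnj (fourier (u t) (int n)))) has_sum
         (- \<i> * (2 * J t) * X + - \<i> * cnj (J t) * (2 * cnj X))) UNIV"
      by (intro has_sum_add has_sum_cmult_right X)
    from has_sum_Re[OF this]
    have "((\<lambda>n::nat. real n * Re (fourier (u t) (int n) * cnj (fourier (v t) (int n)))) has_sum
       Re (- \<i> * (2 * J t) * X + - \<i> * cnj (J t) * (2 * cnj X))) UNIV"
    proof (rule has_sum_cong[THEN iffD1, rotated])
      fix n :: nat
      have fv: "fourier (v t) n = - \<i> * (2 * J t * fourier (w t) n + cnj (J t) * fourier (u t * u t) n)" for n
        using w_wiener[of t] u_wiener[of t]
        by (simp add: v_def fourier_add wiener_L2 L2_scaleC wiener_mult power2_eq_square)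
      have "- \<i> * (2 * J t) * (of_nat n * fourier (w t) (int n) * cnj (fourier (u t) (int n)))
         + - \<i> * cnj (J t) * (of_nat n * fourier (u t * u t) (int n) * cnj (fourier (u t) (int n)))
         = of_nat n * (fourier (v t) (int n) * cnj (fourier (u t) (int n)))"
        unfolding fv by (simp add: algebra_simps)
      then show "Re (- \<i> * (2 * J t) * (of_nat n * fourier (w t) (int n) * cnj (fourier (u t) (int n)))
         + - \<i> * cnj (J t) * (of_nat n * fourier (u t * u t) (int n) * cnj (fourier (u t) (int n))))
         = real n * Re (fourier (u t) (int n) * cnj (fourier (v t) (int n)))"
        by (simp only:) (simp add: algebra_simps)
    qed
    then have "momentum_form (u t) (v t) = Re (- \<i> * (2 * J t) * X + - \<i> * cnj (J t) * (2 * cnj X))"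
      unfolding momentum_form_def by (rule infsumI)
    also have "\<dots> = 0" by simp
    finally show ?thesis using d unfolding has_real_derivative_iff_has_vector_derivative by simp
  qed
  then show ?thesis using DERIV_isconst_all[of M t 0] by blast
qed

end

section \<open>Momentum and determinant expressed without eigenvectors\<close>

context hankel_pair
begin

text \<open>Summing the tails counts the \<open>k\<close>-th squared modulus \<open>k\<close> times;
  by \<open>tail_sum\<close> the total is the trace of \<open>K\<close>-squared.\<close>

lemma momentum_has_sum: "((\<lambda>n::nat. real n * (norm (fourier u (int n)))\<^sup>2) has_sum (\<mu>1 + \<mu>2)) UNIV"
proof -
  define f where "f = (\<lambda>k::nat. (norm (fourier u (int k)))\<^sup>2)"
  have inner: "((\<lambda>m. f (Suc n + m)) has_sum tail (Suc n)) UNIV" for n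
    using tail_has_sum[of "Suc n"] by (simp add: f_def)
  have sm: "(\<lambda>(n, m). f (Suc n + m)) summable_on UNIV \<times> UNIV"
  proof (rule summable_on_SigmaI[where g = "\<lambda>n. tail (Suc n)"])
    show "((\<lambda>m. case (n, m) of (n, m) \<Rightarrow> f (Suc n + m)) has_sum tail (Suc n)) UNIV" for n
      using inner[of n] by simp
    show "(\<lambda>n. tail (Suc n)) summable_on UNIV" using tail_sum by (rule has_sum_imp_summable)
  qed (auto simp: f_def)
  define S where "S = infsum (\<lambda>(n, m). f (Suc n + m)) (UNIV \<times> UNIV)"
  have S: "((\<lambda>(n, m). f (Suc n + m)) has_sum S) (UNIV \<times> UNIV)"
    unfolding S_def using sm by (rule has_sum_infsum)
  have "((\<lambda>n. tail (Suc n)) has_sum S) UNIV"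
    by (rule has_sum_SigmaD[OF S]) (use inner in simp)
  then have S_eq: "S = \<mu>1 + \<mu>2" using tail_sum has_sum_unique by blast
  have "((\<lambda>(k, n). f k) has_sum S) (SIGMA k:UNIV. {..<k})"
    using S by (subst has_sum_reindex_bij_witness[of _ "\<lambda>(n, m). (Suc n + m, n)" "\<lambda>(k, n). (n, k - Suc n)" "UNIV \<times> UNIV" "\<lambda>(n, m). f (Suc n + m)"]) auto
  then have "((\<lambda>k. real k * f k) has_sum S) UNIV"
    by (rule has_sum_SigmaD) (auto intro!: has_sum_finiteI)
  then show ?thesis unfolding f_def S_eq .
qed

lemma momentum_eq: "momentum u = \<mu>1 + \<mu>2"
  unfolding momentum_def by (rule infsumI[OF momentum_has_sum])

text \<open>A vanishing minor is a linear relation between the first two pairs of consecutive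
  coefficients; the recurrence propagates it to all of them, which makes \<open>u\<close> and
  \<open>bshift u\<close> dependent.\<close>

lemma minor_nonzero: "fourier u 0 * fourier u 2 - (fourier u 1)\<^sup>2 \<noteq> 0"
proof
  assume 0: "fourier u 0 * fourier u 2 - (fourier u 1)\<^sup>2 = 0"
  obtain x y where xy: "x \<noteq> 0 \<or> y \<noteq> 0" "x * fourier u 0 + y * fourier u 1 = 0" "x * fourier u 1 + y * fourier u 2 = 0"
  proof (cases "fourier u 0 = 0")
    case True
    then show ?thesis using 0 by (intro that[of 1 0]) auto
  next
    case False
    then show ?thesis using 0 by (intro that[of "fourier u 1" "- fourier u 0"]) (auto simp: power2_eq_square)
  qed
  have "x * fourier u (int n) + y * fourier u (int n + 1) = 0 \<and> x * fourier u (int n + 1) + y * fourier u (int n + 2) = 0" for n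
  proof (induction n)
    case (Suc n)
    have r: "fourier u (int n + 2) = s * fourier u (int n + 1) - d * fourier u (int n)"
      "fourier u (int n + 3) = s * fourier u (int n + 2) - d * fourier u (int n + 1)"
      using V_fourier_rec[OF u_V, of "int n"] V_fourier_rec[OF u_V, of "int n + 1"] by (simp_all add: add.assoc)
    have "x * fourier u (int n + 2) + y * fourier u (int n + 3) =
      s * (x * fourier u (int n + 1) + y * fourier u (int n + 2)) - d * (x * fourier u (int n) + y * fourier u (int n + 1))"
      by (subst (1) r(1), subst r(2)) (simp add: algebra_simps)
    also have "\<dots> = 0" using Suc by simp
    finally show ?case using Suc by (simp add: algebra_simps)
  qed (use xy in simp)
  then have z: "x * fourier u n + y * fourier u (n + 1) = 0" if "n \<ge> 0" for n
    using that by (metis nonneg_int_cases)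
  have "x *\<^sub>C u + y *\<^sub>C bshift u = 0"
  proof (rule L2_plus_eqI)
    show "x *\<^sub>C u + y *\<^sub>C bshift u \<in> L2_plus" using u by auto
    show "fourier (x *\<^sub>C u + y *\<^sub>C bshift u) n = fourier 0 n" if "n \<ge> 0" for n
      using z[OF that] that u_L2 by (simp add: fourier_add L2_scaleC bshift_L2 fourier_bshift)
  qed auto
  then have eq: "y *\<^sub>C bshift u = (- x) *\<^sub>C u" by (simp add: add_eq_0_iff2)
  show False
  proof (cases "y = 0")
    case True
    then have "u = 0" using eq xy(1) by simp
    then show False using not_parallel[of 0] by simp
  next
    case False
    have "(1 / y) *\<^sub>C y *\<^sub>C bshift u = (1 / y) *\<^sub>C (- x) *\<^sub>C u" unfolding eq ..
    then have "bshift u = (- x / y) *\<^sub>C u" using False by simp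
    then show False using not_parallel by blast
  qed
qed

text \<open>Solves the first two instances of the recurrence for \<open>d\<close>. Fourier
  coefficients of \<open>u\<close> are differentiable in time, and through this formula so is
  \<open>d\<close>.\<close>

lemma d_quotient: "d = (fourier u 1 * fourier u 3 - (fourier u 2)\<^sup>2) / (fourier u 0 * fourier u 2 - (fourier u 1)\<^sup>2)"
proof -
  have r: "fourier u 2 = s * fourier u 1 - d * fourier u 0" "fourier u 3 = s * fourier u 2 - d * fourier u 1"
    using V_fourier_rec[OF u_V, of 0] V_fourier_rec[OF u_V, of 1] by simp_all
  have "d * (fourier u 0 * fourier u 2 - (fourier u 1)\<^sup>2) = fourier u 1 * fourier u 3 - (fourier u 2)\<^sup>2"
    using r by algebra
  then show ?thesis using minor_nonzero by (simp add: field_simps)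
qed

end

section \<open>Evolution of the invariant quantities and conservation of the eigenvalues\<close>

lemma const_from_derivative:
  fixes f :: "real \<Rightarrow> real"
  assumes "\<And>t. (f has_real_derivative 0) (at t)"
  shows "f t = f 0"
  using DERIV_isconst_all[of f t 0] assms by blast

lemma has_real_derivative_Re:
  "(f has_vector_derivative D) (at t) \<Longrightarrow> ((\<lambda>t. Re (f t)) has_real_derivative Re D) (at t)"
  unfolding has_real_derivative_iff_has_vector_derivative
  using bounded_linear.has_vector_derivative[OF bounded_linear_Re] .

lemma has_real_derivative_Im:
  "(f has_vector_derivative D) (at t) \<Longrightarrow> ((\<lambda>t. Im (f t)) has_real_derivative Im D) (at t)"
  unfolding has_real_derivative_iff_has_vector_derivative
  using bounded_linear.has_vector_derivative[OF bounded_linear_Im] .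

lemma has_real_derivative_norm_square:
  assumes "(f has_vector_derivative D) (at t)"
  shows "((\<lambda>t. (norm (f t))\<^sup>2) has_real_derivative 2 * Re (cnj (f t) * D)) (at t)"
proof -
  have "((\<lambda>t. Re (f t) * Re (f t) + Im (f t) * Im (f t)) has_real_derivative
      Re D * Re (f t) + Re D * Re (f t) + (Im D * Im (f t) + Im D * Im (f t))) (at t)"
    by (intro DERIV_add DERIV_mult has_real_derivative_Re[OF assms] has_real_derivative_Im[OF assms])
  moreover have "(\<lambda>t. (norm (f t))\<^sup>2) = (\<lambda>t. Re (f t) * Re (f t) + Im (f t) * Im (f t))"
    by (simp add: cmod_power2 power2_eq_square[of "Re _"] power2_eq_square[of "Im _"])
  moreover have "2 * Re (cnj (f t) * D) = Re D * Re (f t) + Re D * Re (f t) + (Im D * Im (f t) + Im D * Im (f t))"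
    by (simp add: algebra_simps)
  ultimately show ?thesis by (simp only:)
qed

lemma norm_add_square: "(norm (x + y :: complex))\<^sup>2 = (norm x)\<^sup>2 + (norm y)\<^sup>2 + 2 * Re (x * cnj y)"
proof -
  have "(Re x + Re y)\<^sup>2 + (Im x + Im y)\<^sup>2 = (Re x)\<^sup>2 + (Im x)\<^sup>2 + ((Re y)\<^sup>2 + (Im y)\<^sup>2) + 2 * (Re x * Re y + Im x * Im y)"
    by algebra
  then show ?thesis by (simp add: cmod_power2)
qed

text \<open>The numerator of the derivative of a quotient of minors. The direction \<open>b\<close>
  satisfies the same recurrence as \<open>a\<close> and drops out; only the part coming from the
  square of \<open>u\<close> survives.\<close>

lemma hankel_minor_derivative:
  fixes a0 a1 a2 a3 b0 b1 b2 b3 s d j l v0 v1 v2 v3 :: complex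
  assumes "a2 = s * a1 - d * a0" "a3 = s * a2 - d * a1" "b2 = s * b1 - d * b0" "b3 = s * b2 - d * b1"
    and "v0 = j * b0 + l * a0\<^sup>2" "v1 = j * b1 + l * (2 * a0 * a1)"
    and "v2 = j * b2 + l * (2 * a0 * a2 + a1\<^sup>2)" "v3 = j * b3 + l * (2 * a0 * a3 + 2 * a1 * a2)"
  shows "a1 * v3 + v1 * a3 - (a2 * v2 + v2 * a2) - d * (a0 * v2 + v0 * a2 - (a1 * v1 + v1 * a1)) = l * a0 * d * (a0 * a2 - a1 * a1)"
  unfolding assms by (simp add: algebra_simps power2_eq_square)

text \<open>One choice of spectral data per time, with no regularity in \<open>t\<close>;
  derivatives are taken only of expressions that can be written through \<open>u t\<close>.\<close>

locale szego_data = szego_curve +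
  fixes E1 E2 :: "real \<Rightarrow> circ_fun" and \<sigma>1 \<sigma>2 :: "real \<Rightarrow> real" and s d :: "real \<Rightarrow> complex"
  assumes hp: "hankel_pair (u t) (E1 t) (E2 t) (\<sigma>1 t) (\<sigma>2 t) (s t) (d t)"
begin

definition "A1 t = inner_circ (u t) (E1 t)"
definition "A2 t = inner_circ (u t) (E2 t)"
definition "B1 t = inner_circ 1 (E1 t)"
definition "B2 t = inner_circ 1 (E2 t)"
definition "m1 t = (\<sigma>1 t)\<^sup>2"
definition "m2 t = (\<sigma>2 t)\<^sup>2"
definition "W1 t = m1 t * B1 t + cnj (c t) * A1 t"
definition "W2 t = m2 t * B2 t + cnj (c t) * A2 t"

lemmas hp_defs = hankel_pair.a1_def[OF hp] hankel_pair.a2_def[OF hp] hankel_pair.b1_def[OF hp] hankel_pair.b2_def[OF hp]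
  hankel_pair.c_def[OF hp] hankel_pair.w_def[OF hp]

lemma m_pos: "m1 t \<ge> m2 t" "m2 t > 0"
  using hankel_pair.\<sigma>[OF hp, of t] by (auto simp: m1_def m2_def intro: power_mono)

lemma static:
  "Q t = (norm (A1 t))\<^sup>2 + (norm (A2 t))\<^sup>2"
  "c t = A1 t * cnj (B1 t) + A2 t * cnj (B2 t)"
  "m1 t * (norm (B1 t))\<^sup>2 + m2 t * (norm (B2 t))\<^sup>2 = Q t - (norm (c t))\<^sup>2"
  "h2 t = (Q t)\<^sup>2 + m1 t * (norm (A1 t))\<^sup>2 + m2 t * (norm (A2 t))\<^sup>2"
  "h2 t = (norm (W1 t))\<^sup>2 + (norm (W2 t))\<^sup>2"
  "J t = A1 t * cnj (W1 t) + A2 t * cnj (W2 t)"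
  "m1 t * (norm (W1 t))\<^sup>2 + m2 t * (norm (W2 t))\<^sup>2 + (norm (J t))\<^sup>2
    = (m1 t + Q t)\<^sup>2 * (norm (A1 t))\<^sup>2 + (m2 t + Q t)\<^sup>2 * (norm (A2 t))\<^sup>2"
  "(norm (d t))\<^sup>2 = 1 - (norm (B1 t))\<^sup>2 - (norm (B2 t))\<^sup>2"
  "((norm (B1 t))\<^sup>2 + (norm (B2 t))\<^sup>2) * (m1 t * m2 t + m1 t * (norm (A2 t))\<^sup>2 + m2 t * (norm (A1 t))\<^sup>2)
    = m1 t * (norm (A2 t))\<^sup>2 + m2 t * (norm (A1 t))\<^sup>2"
  "M t = m1 t + m2 t"
  unfolding Q_def c_def h2_def w_def J_def M_def A1_def A2_def B1_def B2_def W1_def W2_def m1_def m2_def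
  using hankel_pair.Q_eq[OF hp, of t] hankel_pair.c_eq[OF hp, of t] hankel_pair.mu_beta[OF hp, of t]
    hankel_pair.h2_eq[OF hp, of t] hankel_pair.w_norm[OF hp, of t] hankel_pair.J_eq[OF hp, of t]
    hankel_pair.mu_w[OF hp, of t] hankel_pair.d_norm[OF hp, of t] hankel_pair.beta_sum[OF hp, of t]
    hankel_pair.momentum_eq[OF hp, of t]
  unfolding hp_defs by simp_all

definition "D t = (norm (d t))\<^sup>2"
definition "p t = m1 t * m2 t"
definition "X t = (norm (c t))\<^sup>2"
text \<open>The derivatives of \<open>D\<close>, \<open>X\<close> and \<open>Re (\<zeta> t)\<close>
  are all multiples of \<open>Im (\<zeta> t)\<close>, a common factor when a relation among them is
  differentiated.\<close>

definition "\<zeta> t = cnj (c t) * J t"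

lemma p_pos: "p t > 0" unfolding p_def using m_pos[of t] by auto

lemma D_pos: "D t > 0" unfolding D_def using hankel_pair.d_nonzero[OF hp, of t] by simp

lemma D_eq: "D t * (p t + (Q t * M t + (Q t)\<^sup>2 - h2 t)) = p t"
proof -
  have "(1 - D t) * (p t + (m1 t * (norm (A2 t))\<^sup>2 + m2 t * (norm (A1 t))\<^sup>2)) = m1 t * (norm (A2 t))\<^sup>2 + m2 t * (norm (A1 t))\<^sup>2"
    using static(8,9)[of t] by (simp add: D_def p_def add.assoc)
  moreover have "m1 t * (norm (A2 t))\<^sup>2 + m2 t * (norm (A1 t))\<^sup>2 = Q t * M t + (Q t)\<^sup>2 - h2 t"
    unfolding static(4,10) using static(1)[of t] by algebra
  ultimately show ?thesis by algebra
qed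

lemma Q_pos: "Q t > 0"
proof -
  have "u t \<noteq> 0" using hankel_pair.not_parallel[OF hp, of t 0] by auto
  then show ?thesis using norm_L2_pos[of "u t"] u_wiener[of t] hankel_pair.Q_norm[OF hp, of t] by (simp add: Q_def wiener_L2)
qed

lemma D_less: "D t < 1"
proof -
  have "m2 t * Q t \<le> m1 t * (norm (A2 t))\<^sup>2 + m2 t * (norm (A1 t))\<^sup>2"
    using m_pos[of t] static(1)[of t] by (simp add: distrib_left mult_right_mono)
  then have "m1 t * (norm (A2 t))\<^sup>2 + m2 t * (norm (A1 t))\<^sup>2 > 0"
    using m_pos[of t] Q_pos[of t] by (smt (verit) mult_pos_pos)
  moreover have "(1 - D t) * (p t + (m1 t * (norm (A2 t))\<^sup>2 + m2 t * (norm (A1 t))\<^sup>2)) = m1 t * (norm (A2 t))\<^sup>2 + m2 t * (norm (A1 t))\<^sup>2"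
    using static(8,9)[of t] by (simp add: D_def p_def add.assoc)
  ultimately have "(1 - D t) * (p t + (m1 t * (norm (A2 t))\<^sup>2 + m2 t * (norm (A1 t))\<^sup>2)) > 0" by simp
  then show ?thesis using p_pos[of t] \<open>m1 t * (norm (A2 t))\<^sup>2 + m2 t * (norm (A1 t))\<^sup>2 > 0\<close>
    by (simp add: zero_less_mult_iff)
qed

text \<open>Expands the coordinates \<open>W1\<close>, \<open>W2\<close> of \<open>w\<close>. The
  mixed terms assemble to \<open>Re (\<zeta> t)\<close>, so this relation ties \<open>h2\<close> to
  quantities with known derivatives.\<close>

lemma h2_zeta: "h2 t = M t * (Q t - X t) - p t * (1 - D t) + 2 * Re (\<zeta> t) - X t * Q t"
proof -
  define T where "T = cnj (c t) * (of_real (m1 t) * (A1 t * cnj (B1 t)) + of_real (m2 t) * (A2 t * cnj (B2 t)))"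
  have T: "T = \<zeta> t - of_real (X t * Q t)"
  proof -
    have "J t = (of_real (m1 t) * (A1 t * cnj (B1 t)) + of_real (m2 t) * (A2 t * cnj (B2 t))) + c t * of_real (Q t)"
      unfolding static(6)[of t] static(1)[of t] of_real_add complex_norm_square by (simp add: W1_def W2_def algebra_simps)
    then have "\<zeta> t = T + of_real (Q t) * (c t * cnj (c t))" unfolding \<zeta>_def T_def by (simp add: algebra_simps)
    then show ?thesis unfolding X_def of_real_mult complex_norm_square by simp
  qed
  have W: "(norm (W1 t))\<^sup>2 = (m1 t)\<^sup>2 * (norm (B1 t))\<^sup>2 + X t * (norm (A1 t))\<^sup>2 + 2 * Re (cnj (c t) * (of_real (m1 t) * (A1 t * cnj (B1 t))))"
    "(norm (W2 t))\<^sup>2 = (m2 t)\<^sup>2 * (norm (B2 t))\<^sup>2 + X t * (norm (A2 t))\<^sup>2 + 2 * Re (cnj (c t) * (of_real (m2 t) * (A2 t * cnj (B2 t))))"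
    unfolding W1_def W2_def X_def add.commute[of "of_real (_ t) * _"] norm_add_square
    by (simp_all add: norm_mult power_mult_distrib mult_ac)
  have 1: "h2 t = (m1 t)\<^sup>2 * (norm (B1 t))\<^sup>2 + (m2 t)\<^sup>2 * (norm (B2 t))\<^sup>2 + X t * Q t + 2 * Re T"
    unfolding static(5)[of t] W static(1)[of t] T_def distrib_left by (simp only: plus_complex.sel) (simp add: algebra_simps)
  \<comment> \<open>Both eigenvalues are roots of \<open>z^2 - M z + p\<close>, which lowers the
    squares to \<open>mu_beta\<close> and the total of the squared moduli of \<open>B1\<close> and
    \<open>B2\<close>.\<close>
  have "(m1 t)\<^sup>2 * (norm (B1 t))\<^sup>2 + (m2 t)\<^sup>2 * (norm (B2 t))\<^sup>2 =
     (m1 t + m2 t) * (m1 t * (norm (B1 t))\<^sup>2 + m2 t * (norm (B2 t))\<^sup>2) - m1 t * m2 t * ((norm (B1 t))\<^sup>2 + (norm (B2 t))\<^sup>2)"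
    by (simp add: algebra_simps power2_eq_square)
  also have "\<dots> = M t * (Q t - X t) - p t * (1 - D t)"
    using static(8)[of t] unfolding static(3) by (simp add: static(10) X_def p_def D_def)
  finally show ?thesis using 1 unfolding T by (simp add: algebra_simps)
qed

text \<open>Elimination of \<open>h2\<close> between \<open>D_eq\<close> and
  \<open>h2_zeta\<close>.\<close>

lemma p_eq: "p t = D t * ((Q t)\<^sup>2 + X t * (Q t + M t) - 2 * Re (\<zeta> t)) / (1 - D t)\<^sup>2"
proof -
  have "p t * (1 - D t)\<^sup>2 = D t * ((Q t)\<^sup>2 + X t * (Q t + M t) - 2 * Re (\<zeta> t))"
  proof -
    define R where "R = M t * (Q t - X t) - p t * (1 - D t) + 2 * Re (\<zeta> t) - X t * Q t"
    have "p t * (1 - D t)\<^sup>2 - D t * ((Q t)\<^sup>2 + X t * (Q t + M t) - 2 * Re (\<zeta> t))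
      = p t - D t * (p t + (Q t * M t + (Q t)\<^sup>2 - R))"
      by (simp add: R_def algebra_simps power2_eq_square)
    then show ?thesis using D_eq[of t] h2_zeta[of t] by (simp add: R_def)
  qed
  then show ?thesis using D_less[of t] by (simp add: field_simps)
qed

lemma c_derivative: "(c has_vector_derivative - \<i> * (2 * J t * Q t + cnj (J t) * (c t)\<^sup>2)) (at t)"
  using fourier_derivative[of 0 t] fourier_square(1)[OF u_wiener u_L2_plus, of t]
  by (simp add: c_def[abs_def] fourier_w_0)

lemma d_derivative: "(d has_vector_derivative - \<i> * cnj (J t) * c t * d t) (at t)"
proof -
  define a where "a = (\<lambda>n t. fourier (u t) n)"
  define b where "b = (\<lambda>n. fourier (w t) n)"
  define v where "v = (\<lambda>n. - \<i> * (2 * J t * b n + cnj (J t) * fourier (u t * u t) n))"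
  have a': "(a n has_vector_derivative v n) (at t)" for n
    using fourier_derivative[of n t] by (simp add: a_def v_def b_def)
  define N0 N1 where "N0 = (\<lambda>t. a 0 t * a 2 t - a 1 t * a 1 t)" and "N1 = (\<lambda>t. a 1 t * a 3 t - a 2 t * a 2 t)"
  have N0: "N0 t \<noteq> 0" for t
    using hankel_pair.minor_nonzero[OF hp, of t] by (simp add: N0_def a_def power2_eq_square)
  have d_eq: "d = (\<lambda>t. N1 t / N0 t)"
    using hankel_pair.d_quotient[OF hp] by (simp add: N0_def N1_def a_def power2_eq_square fun_eq_iff)
  define v0 v1 where "v0 = a 0 t * v 2 + v 0 * a 2 t - (a 1 t * v 1 + v 1 * a 1 t)"
    and "v1 = a 1 t * v 3 + v 1 * a 3 t - (a 2 t * v 2 + v 2 * a 2 t)"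
  have N': "(N0 has_vector_derivative v0) (at t)" "(N1 has_vector_derivative v1) (at t)"
    unfolding N0_def N1_def v0_def v1_def by (intro derivative_intros a')+
  have "((\<lambda>t. N1 t / N0 t) has_derivative (\<lambda>h. - N1 t * (inverse (N0 t) * (h *\<^sub>R v0) * inverse (N0 t)) + (h *\<^sub>R v1) / N0 t)) (at t)"
    using N' N0[of t] unfolding has_vector_derivative_def by (intro has_derivative_divide) auto
  moreover have "- N1 t * (inverse (N0 t) * (h *\<^sub>R v0) * inverse (N0 t)) + (h *\<^sub>R v1) / N0 t = h *\<^sub>R ((v1 - d t * v0) / N0 t)" for h
    using N0[of t] by (simp add: d_eq field_simps scaleR_conv_of_real)
  ultimately have d': "(d has_vector_derivative (v1 - d t * v0) / N0 t) (at t)"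
    unfolding has_vector_derivative_def d_eq[symmetric] by simp
  note hpt = hp[of t]
  have wV: "w t \<in> circ_fun.span {E1 t, E2 t}"
    using hankel_pair.w_V[OF hp, of t] unfolding hankel_pair.w_def[OF hp] w_def .
  have ra: "a 2 t = s t * a 1 t - d t * a 0 t" "a 3 t = s t * a 2 t - d t * a 1 t"
    using hankel_pair.V_fourier_rec[OF hpt hankel_pair.u_V[OF hpt], of 0] hankel_pair.V_fourier_rec[OF hpt hankel_pair.u_V[OF hpt], of 1]
    by (simp_all add: a_def)
  have rb: "b 2 = s t * b 1 - d t * b 0" "b 3 = s t * b 2 - d t * b 1"
    using hankel_pair.V_fourier_rec[OF hpt wV, of 0] hankel_pair.V_fourier_rec[OF hpt wV, of 1] by (simp_all add: b_def)
  define j jb where "j = - \<i> * 2 * J t" and "jb = - \<i> * cnj (J t)"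
  have vv: "v 0 = j * b 0 + jb * (a 0 t)\<^sup>2" "v 1 = j * b 1 + jb * (2 * a 0 t * a 1 t)"
    "v 2 = j * b 2 + jb * (2 * a 0 t * a 2 t + (a 1 t)\<^sup>2)" "v 3 = j * b 3 + jb * (2 * a 0 t * a 3 t + 2 * a 1 t * a 2 t)"
    unfolding v_def fourier_square[OF u_wiener u_L2_plus] by (simp_all add: a_def j_def jb_def algebra_simps)
  have "v1 - d t * v0 = jb * a 0 t * d t * N0 t"
    unfolding v0_def v1_def N0_def by (rule hankel_minor_derivative[OF ra rb vv])
  then have "(v1 - d t * v0) / N0 t = - \<i> * cnj (J t) * c t * d t"
    using N0[of t] by (simp add: jb_def a_def c_def)
  then show ?thesis using d' by simp
qed

definition "K = (norm (J 0))\<^sup>2"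

lemma J_norm: "(norm (J t))\<^sup>2 = K"
proof -
  have "Re (cnj (J t) * (- \<i> * (2 * h2 t + (Q t)\<^sup>2) * J t)) = 0" for t
  proof -
    have "cnj (J t) * (- \<i> * (2 * h2 t + (Q t)\<^sup>2) * J t) = - \<i> * of_real ((2 * h2 t + (Q t)\<^sup>2) * (norm (J t))\<^sup>2)"
      unfolding of_real_mult[of "2 * h2 t + _"] complex_norm_square by simp
    then show ?thesis by simp
  qed
  then have "((\<lambda>t. (norm (J t))\<^sup>2) has_real_derivative 0) (at t)" for t
    using has_real_derivative_norm_square[OF J_derivative[of t]] by simp
  from const_from_derivative[OF this] show ?thesis by (simp add: K_def)
qed

lemma D_derivative: "(D has_real_derivative - 2 * Im (\<zeta> t) * D t) (at t)"
proof -
  have "cnj (d t) * (- \<i> * cnj (J t) * c t * d t) = - \<i> * cnj (\<zeta> t) * of_real (D t)"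
    unfolding D_def complex_norm_square by (simp add: \<zeta>_def)
  then have "(D has_real_derivative 2 * Re (- \<i> * cnj (\<zeta> t) * of_real (D t))) (at t)"
    using has_real_derivative_norm_square[OF d_derivative[of t]] by (simp only: D_def[abs_def])
  then show ?thesis by (simp add: mult.assoc)
qed

lemma X_derivative: "(X has_real_derivative (4 * Q t - 2 * X t) * Im (\<zeta> t)) (at t)"
proof -
  have "cnj (c t) * (- \<i> * (2 * J t * Q t + cnj (J t) * (c t)\<^sup>2)) = - \<i> * (2 * of_real (Q t) * \<zeta> t + of_real (X t) * cnj (\<zeta> t))"
    unfolding X_def complex_norm_square by (simp add: \<zeta>_def algebra_simps power2_eq_square)
  then have "(X has_real_derivative 2 * Re (- \<i> * (2 * of_real (Q t) * \<zeta> t + of_real (X t) * cnj (\<zeta> t)))) (at t)"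
    using has_real_derivative_norm_square[OF c_derivative[of t]] by (simp only: X_def[abs_def])
  then show ?thesis by (simp add: algebra_simps)
qed

lemma zeta_derivative:
  "(\<zeta> has_vector_derivative \<i> * (of_real (2 * Q t * K) + (\<zeta> t)\<^sup>2 - of_real (2 * h2 t + (Q t)\<^sup>2) * \<zeta> t)) (at t)"
proof -
  have c': "((\<lambda>t. cnj (c t)) has_vector_derivative cnj (- \<i> * (2 * J t * Q t + cnj (J t) * (c t)\<^sup>2))) (at t)"
    by (rule bounded_linear.has_vector_derivative[OF bounded_linear_cnj c_derivative])
  have "(\<zeta> has_vector_derivative cnj (c t) * (- \<i> * (2 * h2 t + (Q t)\<^sup>2) * J t) + cnj (- \<i> * (2 * J t * Q t + cnj (J t) * (c t)\<^sup>2)) * J t) (at t)"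
    unfolding \<zeta>_def[abs_def] by (rule has_vector_derivative_mult[OF c' J_derivative])
  moreover have K: "of_real K = J t * cnj (J t)" unfolding J_norm[of t, symmetric] complex_norm_square ..
  have "cnj (c t) * (- \<i> * (2 * h2 t + (Q t)\<^sup>2) * J t) + cnj (- \<i> * (2 * J t * Q t + cnj (J t) * (c t)\<^sup>2)) * J t
    = \<i> * (of_real (2 * Q t) * of_real K + (\<zeta> t)\<^sup>2 - of_real (2 * h2 t + (Q t)\<^sup>2) * \<zeta> t)"
    unfolding K \<zeta>_def by (simp add: algebra_simps power2_eq_square)
  ultimately show ?thesis by simp
qed

lemma zeta_Re_derivative:
  "((\<lambda>t. Re (\<zeta> t)) has_real_derivative (2 * h2 t + (Q t)\<^sup>2 - 2 * Re (\<zeta> t)) * Im (\<zeta> t)) (at t)"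
  using has_real_derivative_Re[OF zeta_derivative[of t]]
  by (simp add: power2_eq_square algebra_simps)

lemma zeta_Im_derivative:
  "((\<lambda>t. Im (\<zeta> t)) has_real_derivative 2 * Q t * K + (Re (\<zeta> t))\<^sup>2 - (Im (\<zeta> t))\<^sup>2 - (2 * h2 t + (Q t)\<^sup>2) * Re (\<zeta> t)) (at t)"
  using has_real_derivative_Im[OF zeta_derivative[of t]]
  by (simp add: power2_eq_square algebra_simps)

text \<open>\<open>p\<close> is a rational function of \<open>D\<close>, \<open>X\<close> and \<open>Re \<zeta>\<close>, whose derivatives are known. No Lax pair is
  needed: \<open>p\<close> and the momentum \<open>M = \<sigma>\<^sub>1\<^sup>2 + \<sigma>\<^sub>2\<^sup>2\<close> determine the eigenvalues.\<close>

lemma p_const: "p t = p 0"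
proof (rule const_from_derivative)
  fix t
  define I where "I = Im (\<zeta> t)"
  define F where "F = (Q t)\<^sup>2 + X t * (Q t + M t) - 2 * Re (\<zeta> t)"
  have eq: "p = (\<lambda>t. D t * ((Q 0)\<^sup>2 + X t * (Q 0 + M 0) - 2 * Re (\<zeta> t)) / (1 - D t)\<^sup>2)"
  proof (rule ext)
    show "p t = D t * ((Q 0)\<^sup>2 + X t * (Q 0 + M 0) - 2 * Re (\<zeta> t)) / (1 - D t)\<^sup>2" for t
      using p_eq[of t] Q_const[of t] M_const[of t] by simp
  qed
  have D1: "1 - D t \<noteq> 0" using D_less[of t] by simp
  have QM: "Q 0 = Q t" "M 0 = M t" using Q_const[of t] M_const[of t] by simp_all
  define F' where "F' = ((4 * Q t - 2 * X t) * I) * (Q t + M t) - 2 * ((2 * h2 t + (Q t)\<^sup>2 - 2 * Re (\<zeta> t)) * I)"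
  have F': "((\<lambda>t. (Q 0)\<^sup>2 + X t * (Q 0 + M 0) - 2 * Re (\<zeta> t)) has_real_derivative F') (at t)"
  proof -
    have "((\<lambda>t. (Q 0)\<^sup>2 + X t * (Q 0 + M 0) - 2 * Re (\<zeta> t)) has_real_derivative
       0 + ((4 * Q t - 2 * X t) * Im (\<zeta> t) * (Q 0 + M 0)) - 2 * ((2 * h2 t + (Q t)\<^sup>2 - 2 * Re (\<zeta> t)) * Im (\<zeta> t))) (at t)"
      by (intro DERIV_diff DERIV_add DERIV_const DERIV_cmult DERIV_cmult_right X_derivative zeta_Re_derivative)
    then show ?thesis by (simp add: F'_def I_def QM)
  qed
  have D2: "((\<lambda>t. (1 - D t)\<^sup>2) has_real_derivative 4 * I * D t * (1 - D t)) (at t)"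
    using DERIV_power[OF DERIV_diff[OF DERIV_const D_derivative[of t]], of 1 2] by (simp add: I_def mult_ac)
  have DF: "((\<lambda>t. D t * ((Q 0)\<^sup>2 + X t * (Q 0 + M 0) - 2 * Re (\<zeta> t))) has_real_derivative (- 2 * I * D t) * F + F' * D t) (at t)"
    using DERIV_mult[OF D_derivative[of t] F'] by (simp add: I_def F_def QM)
  have p': "(p has_real_derivative (((- 2 * I * D t) * F + F' * D t) * (1 - D t)\<^sup>2 - D t * F * (4 * I * D t * (1 - D t))) / ((1 - D t)\<^sup>2 * (1 - D t)\<^sup>2)) (at t)"
    unfolding eq using DERIV_divide[OF DF D2] D1 by (simp add: F_def QM)
  have F_eq: "D t * F = p t * (1 - D t)\<^sup>2" using p_eq[of t] D1 by (simp add: F_def field_simps)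
  have h: "D t * (Q t * M t + (Q t)\<^sup>2 - h2 t) = p t * (1 - D t)" using D_eq[of t] by (simp add: algebra_simps)
  have F'_eq: "F' = I * (- 2 * F + 4 * (Q t * M t + (Q t)\<^sup>2 - h2 t))"
    by (simp add: F'_def F_def algebra_simps power2_eq_square)
  \<comment> \<open>The numerator of the quotient rule; the relations \<open>F_eq\<close> and
    \<open>h\<close> express everything left by \<open>p t\<close> and make it cancel.\<close>
  have "((- 2 * I * D t) * F + F' * D t) * (1 - D t)\<^sup>2 - D t * F * (4 * I * D t * (1 - D t))
    = I * (1 - D t) * ((- 4 * (D t * F) + 4 * (D t * (Q t * M t + (Q t)\<^sup>2 - h2 t))) * (1 - D t) - 4 * D t * (D t * F))"
    unfolding F'_eq by (simp add: algebra_simps power2_eq_square)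
  also have "\<dots> = 0" unfolding F_eq h by (simp add: algebra_simps power2_eq_square)
  finally show "(p has_real_derivative 0) (at t)" using p' by simp
qed

lemma m_const: "m1 t = m1 0" "m2 t = m2 0"
proof -
  have sq: "(m1 t - m2 t)\<^sup>2 = (m1 t + m2 t)\<^sup>2 - 4 * (m1 t * m2 t)" for t
    by (simp add: power2_eq_square algebra_simps)
  have sum: "m1 t + m2 t = m1 0 + m2 0" using M_const[of t] static(10)[of t] static(10)[of 0] by linarith
  have "m1 t * m2 t = m1 0 * m2 0" using p_const[of t] by (simp only: p_def)
  then have "(m1 t - m2 t)\<^sup>2 = (m1 0 - m2 0)\<^sup>2" unfolding sq sum by simp
  then have "m1 t - m2 t = m1 0 - m2 0"
    by (rule power2_eq_imp_eq) (use m_pos(1)[of t] m_pos(1)[of 0] in simp_all)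
  then show "m1 t = m1 0" "m2 t = m2 0" using sum by linarith+
qed

end

section \<open>Sobolev norms and the decay rate\<close>

lemma powr_le_exp:
  assumes "z \<ge> 0" "s > (0::real)"
  shows "z powr (2 * s) \<le> (16 * s) powr (2 * s) * exp (z / 8)"
proof -
  have "z / (16 * s) \<le> exp (z / (16 * s))" using exp_ge_add_one_self[of "z / (16 * s)"] by linarith
  then have "z \<le> 16 * s * exp (z / (16 * s))" using assms by (simp add: field_simps)
  then have "z powr (2 * s) \<le> (16 * s * exp (z / (16 * s))) powr (2 * s)"
    using assms by (intro powr_mono2) auto
  also have "\<dots> = (16 * s) powr (2 * s) * exp (z / 8)"
    using assms by (simp add: powr_mult powr_def[of "exp _"] field_simps)
  finally show ?thesis .
qed

lemma weight_le:
  assumes "n \<ge> (1::nat)" "s > 0"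
  shows "(1 + (real n)\<^sup>2) powr s \<le> 2 powr s * real n powr (2 * s)"
proof -
  have "1 + (real n)\<^sup>2 \<le> 2 * (real n)\<^sup>2" using assms by simp
  then have "(1 + (real n)\<^sup>2) powr s \<le> (2 * (real n)\<^sup>2) powr s" using assms by (intro powr_mono2) auto
  also have "\<dots> = 2 powr s * real n powr (2 * s)"
    using assms by (simp add: powr_mult powr_powr flip: powr_numeral)
  finally show ?thesis .
qed

lemma weight_ge:
  assumes "n \<ge> (1::nat)" "s > 0"
  shows "real n powr (2 * s) \<le> (1 + (real n)\<^sup>2) powr s"
proof -
  have "real n powr (2 * s) = ((real n)\<^sup>2) powr s"
    using assms by (simp add: powr_powr flip: powr_numeral)
  also have "\<dots> \<le> (1 + (real n)\<^sup>2) powr s" using assms by (intro powr_mono2) auto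
  finally show ?thesis .
qed

text \<open>The constant of \<open>Hs_partial_sum\<close>: \<open>2 powr s\<close> from
  \<open>weight_le\<close>, the 1 from low frequencies, 18 = 3 * 6 from bounding
  \<open>exp 1\<close> and from \<open>exp_weighted_sum\<close>, the last power from
  \<open>N \<le> 2 / l\<close>.\<close>

definition Hs_growth :: "real \<Rightarrow> real" where
  "Hs_growth s = 2 powr s * (1 + 18 * (16 * s) powr (2 * s)) * 2 powr (2 * s - 1)"

context hankel_pair
begin

text \<open>Chebyshev's inequality for the momentum: the tails decrease and the first
  \<open>N\<close> of them sum to at most the trace.\<close>

lemma tail_le_div: "real N * tail N \<le> \<mu>1 + \<mu>2"
proof -
  have "tail N \<le> tail (Suc j)" if "j < N" for j
    using lift_Suc_antimono_le[of tail "Suc j" N] tail_antimono that by simp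
  then have "real N * tail N \<le> (\<Sum>j<N. tail (Suc j))"
    using sum_mono[of "{..<N}" "\<lambda>_. tail N" "\<lambda>j. tail (Suc j)"] by simp
  also have "\<dots> \<le> \<mu>1 + \<mu>2"
    by (rule finite_sum_le_has_sum[OF tail_sum]) (auto simp: tail_nonneg)
  finally show ?thesis .
qed

lemma tail_split: "tail n = (norm (fourier u (int n)))\<^sup>2 + tail (Suc n)"
  using bshift_norm[OF V_L2[OF span[of n]]] fourier_bshift_pow[OF u(2), of 0 n] by (simp add: tail_def)

text \<open>Two steps gain \<open>1 - l\<close>, at most \<open>exp (- l)\<close>. An odd leftover
  step costs at most \<open>exp 1\<close>, whence the 3.\<close>

lemma exp_tail:
  assumes l: "0 < l" "l \<le> 1" "l \<le> (norm d)\<^sup>2 * (norm \<kappa>)\<^sup>2 / (2 * \<mu>1 * \<mu>2)"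
  shows "tail (N + m) \<le> 3 * exp (- (l / 2)) ^ m * tail N"
proof -
  define k where "k = m div 2"
  have k: "real m \<le> 2 * real k + 1" unfolding k_def by linarith
  have "tail (N + m) \<le> tail (N + 2 * k)"
    using lift_Suc_antimono_le[of tail "N + 2 * k" "N + m"] tail_antimono by (simp add: k_def)
  also have "\<dots> \<le> (1 - l) ^ k * tail N" by (rule tail_geometric[OF l(3,2)])
  also have "(1 - l) ^ k \<le> exp (- l) ^ k"
    using l exp_ge_add_one_self[of "- l"] by (intro power_mono) auto
  also have "exp (- l) ^ k = exp (- (l * real k))" by (simp flip: exp_of_nat_mult)
  also have "\<dots> \<le> exp (1 + real m * (- (l / 2)))"
  proof -
    have "l * real m \<le> l * (2 * real k + 1)" using k l by (intro mult_left_mono) auto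
    also have "\<dots> \<le> 2 * (l * real k) + 1" using l by (simp add: algebra_simps)
    finally have "- (l * real k) \<le> 1 + real m * (- (l / 2))" by (simp add: mult.commute[of l "real m"])
    then show ?thesis by simp
  qed
  also have "\<dots> = exp 1 * exp (- (l / 2)) ^ m" by (simp only: exp_add exp_of_nat_mult)
  also have "\<dots> \<le> 3 * exp (- (l / 2)) ^ m" using exp_le by (intro mult_right_mono) auto
  finally show ?thesis using tail_nonneg by (simp add: mult_right_mono)
qed

text \<open>The weight grows like \<open>exp (l / 8)\<close>, the tails decay like
  \<open>exp (- l / 2)\<close>. Their product sums to at most \<open>6 / l\<close>, offset by the
  factor \<open>\<theta> - 1 \<le> l / 4\<close> from summation by parts; in total
  \<open>1 + 9 / 2 \<le> 6\<close>.\<close>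

lemma exp_weighted_sum:
  assumes l: "0 < l" "l \<le> 1" "l \<le> (norm d)\<^sup>2 * (norm \<kappa>)\<^sup>2 / (2 * \<mu>1 * \<mu>2)"
  shows "(\<Sum>m<k. exp (l / 8) ^ m * (norm (fourier u (int (N + m))))\<^sup>2) \<le> 6 * tail N"
proof -
  define \<theta> \<rho> where "\<theta> = exp (l / 8)" and "\<rho> = exp (l / 8) * exp (- (l / 2))"
  have l2: "l\<^sup>2 \<le> l" using l mult_left_mono[of l 1 l] by (simp add: power2_eq_square)
  have "exp (l / 8) \<le> 1 + l / 8 + (l / 8)\<^sup>2" using l by (intro exp_bound) auto
  then have \<theta>: "\<theta> \<ge> 1" "\<theta> - 1 \<le> l / 4"
    using l l2 by (simp_all add: \<theta>_def power_divide)
  have \<rho>: "0 < \<rho>" "\<rho> \<le> 1 - l / 6"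
  proof -
    have "\<rho> = 1 / exp (3 * l / 8)" by (simp add: \<rho>_def exp_minus field_simps flip: exp_add)
    also have "\<dots> \<le> 1 / (1 + 3 * l / 8)"
      using l exp_ge_add_one_self[of "3 * l / 8"] by (intro divide_left_mono) (auto intro!: mult_pos_pos)
    also have "\<dots> \<le> 1 - l / 6"
    proof -
      have "1 \<le> (1 - l / 6) * (1 + 3 * l / 8)" 
      proof -
        have "(1 - l / 6) * (1 + 3 * l / 8) = 1 + 5 * l / 24 - l\<^sup>2 / 16" by (simp add: field_simps power2_eq_square)
        then show ?thesis using l l2 by simp
      qed
      then show ?thesis using l by (simp add: pos_divide_le_eq)
    qed
    finally show "\<rho> \<le> 1 - l / 6" .
  qed (simp add: \<rho>_def)
  \<comment> \<open>Summation by parts, a squared coefficient being a difference of consecutive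
    tails.\<close>
  have step: "(\<Sum>m<k. \<theta> ^ m * (norm (fourier u (int (N + m))))\<^sup>2) + \<theta> ^ k * tail (N + k)
    = tail N + (\<theta> - 1) * (\<Sum>m<k. \<theta> ^ m * tail (Suc (N + m)))" for k
  proof (induction k)
    case (Suc k)
    have "\<theta> ^ k * (norm (fourier u (int (N + k))))\<^sup>2 = \<theta> ^ k * tail (N + k) - \<theta> ^ k * tail (Suc (N + k))"
      using tail_split[of "N + k"] by (simp add: algebra_simps)
    with Suc show ?case by (simp add: algebra_simps)
  qed simp
  have "\<theta> ^ m * tail (Suc (N + m)) \<le> 3 * tail N * \<rho> ^ m" for m
  proof -
    have "\<theta> ^ m * tail (Suc (N + m)) \<le> \<theta> ^ m * (3 * exp (- (l / 2)) ^ m * tail N)"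
      using exp_tail[OF l, of N m] tail_antimono[of "N + m"] \<theta> by (intro mult_left_mono) auto
    then show ?thesis by (simp add: \<theta>_def \<rho>_def power_mult_distrib mult_ac)
  qed
  then have "(\<Sum>m<k. \<theta> ^ m * tail (Suc (N + m))) \<le> (\<Sum>m<k. 3 * tail N * \<rho> ^ m)" by (rule sum_mono)
  also have "\<dots> = 3 * tail N * (\<Sum>m<k. \<rho> ^ m)" by (simp add: sum_distrib_left)
  also have "(\<Sum>m<k. \<rho> ^ m) \<le> 6 / l"
  proof -
    have "(\<Sum>m<k. \<rho> ^ m) = (1 - \<rho> ^ k) / (1 - \<rho>)" using \<rho> l sum_gp_strict[of \<rho> k] by simp
    also have "\<dots> \<le> 1 / (1 - \<rho>)" using \<rho> l by (intro divide_right_mono) auto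
    also have "\<dots> \<le> 1 / (l / 6)" using \<rho> l by (intro divide_left_mono) auto
    finally show ?thesis by simp
  qed
  finally have S: "(\<Sum>m<k. \<theta> ^ m * tail (Suc (N + m))) \<le> 3 * tail N * (6 / l)"
    using tail_nonneg by (simp add: mult_left_mono)
  have "(\<theta> - 1) * (\<Sum>m<k. \<theta> ^ m * tail (Suc (N + m))) \<le> (l / 4) * (3 * tail N * (6 / l))"
    using \<theta> l S tail_nonneg by (intro mult_mono sum_nonneg) auto
  also have "\<dots> = 9 / 2 * tail N" using l by simp
  finally have "tail N + (\<theta> - 1) * (\<Sum>m<k. \<theta> ^ m * tail (Suc (N + m))) \<le> 6 * tail N" using tail_nonneg[of N] by linarith
  moreover have "\<theta> ^ k * tail (N + k) \<ge> 0" using \<theta> tail_nonneg by simp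
  ultimately show ?thesis using step[of k] unfolding \<theta>_def by linarith
qed

text \<open>The split is at \<open>N\<close> of order \<open>1 / l\<close>. Below,
  \<open>n powr (2 * r)\<close> is at most \<open>N powr (2 * r - 1) * n\<close> and the momentum
  controls the sum; above, the power is dominated by an exponential and \<open>tail_le_div\<close>
  recovers the factor \<open>1 / N\<close>. The bound depends on the state only through
  \<open>l\<close>, the charge and the eigenvalues.\<close>

lemma Hs_partial_sum:
  assumes l: "0 < l" "l \<le> 1" "l \<le> (norm d)\<^sup>2 * (norm \<kappa>)\<^sup>2 / (2 * \<mu>1 * \<mu>2)" and r: "r > 1/2" and F: "finite F"
  shows "(\<Sum>n\<in>F. (1 + (real n)\<^sup>2) powr r * (norm (fourier u (int n)))\<^sup>2)
    \<le> szego_Q u + Hs_growth r * (\<mu>1 + \<mu>2) * l powr (1 - 2 * r)"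
proof -
  define f where "f = (\<lambda>n. (norm (fourier u (int n)))\<^sup>2)"
  define g where "g = (\<lambda>n. (1 + (real n)\<^sup>2) powr r * f n)"
  define N where "N = nat \<lceil>1 / l\<rceil>"
  have "1 / l \<le> real N" unfolding N_def by linarith
  have N2: "real N \<le> 2 / l"
  proof -
    have "1 / l > 0" using l by simp
    then have "real N \<le> 1 / l + 1" unfolding N_def by linarith
    also have "\<dots> \<le> 2 / l" using l by (simp add: field_simps)
    finally show ?thesis .
  qed
  have N1: "N \<ge> 1" "1 / real N \<le> l"
  proof -
    have "1 / l > 0" using l by simp
    then have "real N > 0" using \<open>1 / l \<le> real N\<close> by linarith
    then show "N \<ge> 1" by simp
    show "1 / real N \<le> l" using \<open>1 / l \<le> real N\<close> \<open>real N > 0\<close> l by (simp add: field_simps)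
  qed
  obtain k where k: "F \<subseteq> {..<k}" using F finite_nat_iff_bounded by blast
  define P where "P = 2 powr r * real N powr (2 * r - 1)"
  have fM: "(\<Sum>n<N. real n * f n) \<le> \<mu>1 + \<mu>2"
    unfolding f_def by (rule finite_sum_le_has_sum[OF momentum_has_sum]) auto
  have low: "g n \<le> (if n = 0 then szego_Q u else 0) + P * (real n * f n)" if "n < N" for n
  proof (cases "n = 0")
    case True
    then show ?thesis using fourier_le_tail[of 0] tail_0 by (simp add: g_def f_def)
  next
    case False
    then have n: "n \<ge> 1" by simp
    have "real n powr (2 * r) = real n powr (2 * r - 1) * real n" using n by (simp add: powr_diff)
    also have "\<dots> \<le> real N powr (2 * r - 1) * real n"
      using that r n by (intro mult_right_mono powr_mono2) auto
    finally have n2: "real n powr (2 * r) \<le> real N powr (2 * r - 1) * real n" .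
    have "(1 + (real n)\<^sup>2) powr r \<le> 2 powr r * (real N powr (2 * r - 1) * real n)"
      by (rule order_trans[OF weight_le[OF n] mult_left_mono[OF n2]]) (use r in auto)
    then have "(1 + (real n)\<^sup>2) powr r * f n \<le> 2 powr r * (real N powr (2 * r - 1) * real n) * f n"
      by (intro mult_right_mono) (auto simp: f_def)
    then show ?thesis using False by (simp add: g_def P_def mult_ac)
  qed
  have "sum g {..<N} \<le> (\<Sum>n<N. (if n = 0 then szego_Q u else 0) + P * (real n * f n))"
    using low by (intro sum_mono) auto
  also have "\<dots> = szego_Q u + P * (\<Sum>n<N. real n * f n)"
    using N1 by (simp add: sum.distrib sum_distrib_left)
  also have "\<dots> \<le> szego_Q u + P * (\<mu>1 + \<mu>2)"
    using fM by (intro add_left_mono mult_left_mono) (auto simp: P_def)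
  finally have L: "sum g {..<N} \<le> szego_Q u + P * (\<mu>1 + \<mu>2)" .
  define R where "R = (16 * r) powr (2 * r)"
  have high: "g (N + m) \<le> P * R * 3 * real N * (exp (l / 8) ^ m * f (N + m))" for m
  proof -
    define n where "n = N + m"
    have n: "n \<ge> 1" using N1 by (simp add: n_def)
    have "real n = real N * (real n / real N)" using N1 by simp
    then have "real n powr (2 * r) = real N powr (2 * r) * (real n / real N) powr (2 * r)"
      using N1 by (metis powr_mult of_nat_0_le_iff divide_nonneg_nonneg)
    also have "(real n / real N) powr (2 * r) \<le> R * exp ((real n / real N) / 8)"
      unfolding R_def using r by (intro powr_le_exp) auto
    also have "exp ((real n / real N) / 8) \<le> 3 * exp (l / 8) ^ m"
    proof -
      have "real n / real N = 1 + real m * (1 / real N)" using N1 by (simp add: n_def field_simps)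
      also have "\<dots> \<le> 1 + real m * l" using N1 by (intro add_left_mono mult_left_mono) auto
      finally have "(real n / real N) / 8 \<le> 1 + real m * (l / 8)" by simp
      then have "exp ((real n / real N) / 8) \<le> exp (1 + real m * (l / 8))" by simp
      also have "\<dots> = exp 1 * exp (l / 8) ^ m" by (simp only: exp_add exp_of_nat_mult)
      also have "\<dots> \<le> 3 * exp (l / 8) ^ m" using exp_le by (intro mult_right_mono) auto
      finally show ?thesis .
    qed
    finally have n2: "real n powr (2 * r) \<le> real N powr (2 * r) * (R * (3 * exp (l / 8) ^ m))"
      by (simp add: R_def mult_left_mono)
    have "(1 + (real n)\<^sup>2) powr r \<le> 2 powr r * (real N powr (2 * r) * (R * (3 * exp (l / 8) ^ m)))"
      by (rule order_trans[OF weight_le[OF n] mult_left_mono[OF n2]]) (use r in auto)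
    also have "real N powr (2 * r) = real N powr (2 * r - 1) * real N" using N1 by (simp add: powr_diff)
    finally have "(1 + (real n)\<^sup>2) powr r * f n \<le> 2 powr r * (real N powr (2 * r - 1) * real N * (R * (3 * exp (l / 8) ^ m))) * f n"
      by (intro mult_right_mono) (auto simp: f_def)
    then show ?thesis by (simp add: g_def P_def n_def mult_ac)
  qed
  have PR: "P * R * 3 * real N \<ge> 0" by (simp add: P_def R_def)
  have "(\<Sum>m<k. g (N + m)) \<le> (\<Sum>m<k. P * R * 3 * real N * (exp (l / 8) ^ m * f (N + m)))"
    using high by (intro sum_mono) auto
  also have "\<dots> = P * R * 3 * real N * (\<Sum>m<k. exp (l / 8) ^ m * f (N + m))" by (simp add: sum_distrib_left)
  also have "\<dots> \<le> P * R * 3 * real N * (6 * tail N)"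
    unfolding f_def by (rule mult_left_mono[OF exp_weighted_sum[OF l] PR])
  also have "\<dots> = 18 * P * R * (real N * tail N)" by simp
  also have "\<dots> \<le> 18 * P * R * (\<mu>1 + \<mu>2)"
    using tail_le_div by (intro mult_left_mono) (auto simp: P_def R_def)
  finally have H: "(\<Sum>m<k. g (N + m)) \<le> 18 * P * R * (\<mu>1 + \<mu>2)" .
  have "sum g F \<le> sum g {..<N + k}" using k by (intro sum_mono2) (auto simp: g_def f_def)
  also have "\<dots> = sum g {..<N} + (\<Sum>m<k. g (N + m))"
    by (induction k) simp_all
  also have "\<dots> \<le> szego_Q u + P * (1 + 18 * R) * (\<mu>1 + \<mu>2)" using L H by (simp add: algebra_simps)
  also have "P * (1 + 18 * R) * (\<mu>1 + \<mu>2) \<le> Hs_growth r * (\<mu>1 + \<mu>2) * l powr (1 - 2 * r)"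
  proof -
    have "real N powr (2 * r - 1) \<le> (2 / l) powr (2 * r - 1)" using N2 r by (intro powr_mono2) auto
    also have "\<dots> = 2 powr (2 * r - 1) * l powr (1 - 2 * r)"
      using l powr_minus_divide[of l "2 * r - 1"] by (simp add: powr_divide)
    finally have "real N powr (2 * r - 1) * (2 powr r * (1 + 18 * R) * (\<mu>1 + \<mu>2)) \<le> 2 powr (2 * r - 1) * l powr (1 - 2 * r) * (2 powr r * (1 + 18 * R) * (\<mu>1 + \<mu>2))"
      by (rule mult_right_mono) (simp add: R_def)
    then show ?thesis unfolding Hs_growth_def P_def R_def[symmetric] by (simp only: mult_ac)
  qed
  finally show ?thesis by (simp add: g_def f_def)
qed

lemma Hs_sum_upper:
  assumes l: "0 < l" "l \<le> 1" "l \<le> (norm d)\<^sup>2 * (norm \<kappa>)\<^sup>2 / (2 * \<mu>1 * \<mu>2)" and r: "r > 1/2"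
  shows "(\<lambda>n::nat. (1 + (real n)\<^sup>2) powr r * (norm (fourier u (int n)))\<^sup>2) summable_on UNIV"
    and "Hs_sum r u \<le> szego_Q u + Hs_growth r * (\<mu>1 + \<mu>2) * l powr (1 - 2 * r)"
proof -
  show 1: "(\<lambda>n::nat. (1 + (real n)\<^sup>2) powr r * (norm (fourier u (int n)))\<^sup>2) summable_on UNIV"
    by (rule nonneg_bdd_above_summable_on) (use Hs_partial_sum[OF l r] in \<open>auto intro!: bdd_aboveI2\<close>)
  show "Hs_sum r u \<le> szego_Q u + Hs_growth r * (\<mu>1 + \<mu>2) * l powr (1 - 2 * r)"
    unfolding Hs_sum_def by (rule infsum_le_finite_sums[OF 1]) (rule Hs_partial_sum[OF l r])
qed

text \<open>If the coefficients of \<open>e1\<close> are so small that the first \<open>N\<close>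
  carry at most half its norm, the first \<open>N\<close> tails sum to at most
  \<open>\<mu>1 / 2 + \<mu>2\<close>. Frequencies beyond \<open>N\<close> then keep momentum at
  least \<open>\<mu>1 / 2\<close> and are weighted by \<open>N powr (2 * r - 1)\<close>
  more.\<close>

lemma Hs_sum_lower:
  assumes r: "r > 1/2" and b: "\<And>n. (norm (fourier e1 (int n)))\<^sup>2 \<le> b" "real N * b \<le> 1/2" and N: "N \<ge> 1"
  shows "real N powr (2 * r - 1) * (\<mu>1 / 2) \<le> Hs_sum r u"
proof -
  define f where "f = (\<lambda>n. (norm (fourier u (int n)))\<^sup>2)"
  define g where "g = (\<lambda>n. real n * f n)"
  \<comment> \<open>Summation by parts: the momentum up to frequency \<open>k\<close> is at most the
    sum of the first \<open>k\<close> shifted tails.\<close>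
  have "(\<Sum>n<Suc k. g n) + real k * tail (Suc k) = (\<Sum>j<k. tail (Suc j))" for k
  proof (induction k)
    case (Suc k)
    then show ?case using tail_split[of "Suc k"] by (simp add: g_def f_def algebra_simps)
  qed (simp add: g_def)
  then have "(\<Sum>n<Suc N. g n) \<le> (\<Sum>j<N. tail (Suc j))"
    using tail_nonneg[of "Suc N"] by (smt (verit) mult_nonneg_nonneg of_nat_0_le_iff)
  also have "\<dots> = \<mu>1 * (\<Sum>j<N. (norm (fourier e1 (int j)))\<^sup>2) + \<mu>2 * (\<Sum>j<N. (norm (fourier e2 (int j)))\<^sup>2)"
    by (simp add: tail_Suc sum.distrib sum_distrib_left)
  also have "\<dots> \<le> \<mu>1 * (1/2) + \<mu>2 * 1"
  proof (intro add_mono mult_left_mono)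
    have "(\<Sum>j<N. (norm (fourier e1 (int j)))\<^sup>2) \<le> (\<Sum>j<N. b)" using b(1) by (intro sum_mono)
    also have "\<dots> \<le> 1/2" using b(2) by simp
    finally show "(\<Sum>j<N. (norm (fourier e1 (int j)))\<^sup>2) \<le> 1/2" .
    show "(\<Sum>j<N. (norm (fourier e2 (int j)))\<^sup>2) \<le> 1"
      by (rule finite_sum_le_has_sum[OF e_has_sum(2)]) auto
  qed auto
  finally have G: "(\<Sum>n<Suc N. g n) \<le> \<mu>1 / 2 + \<mu>2" by simp
  define h where "h = (\<lambda>n. if n < Suc N then g n else 0)"
  have h: "(h has_sum (\<Sum>n<Suc N. g n)) UNIV"
    by (rule has_sum_finite_neutralI[of "{..<Suc N}"]) (auto simp: h_def)
  have h': "((\<lambda>n. - h n) has_sum (- (\<Sum>n<Suc N. g n))) UNIV" using h by (simp only: has_sum_uminus minus_minus)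
  have "(g has_sum (\<mu>1 + \<mu>2)) UNIV" using momentum_has_sum unfolding g_def f_def .
  from has_sum_cmult_right[OF has_sum_add[OF this h'], of "real N powr (2 * r - 1)"]
  have gh: "((\<lambda>n. real N powr (2 * r - 1) * (g n - h n)) has_sum (real N powr (2 * r - 1) * (\<mu>1 + \<mu>2 - (\<Sum>n<Suc N. g n)))) UNIV"
    by (simp only: add_uminus_conv_diff)
  have sm: "(\<lambda>n::nat. (1 + (real n)\<^sup>2) powr r * f n) summable_on UNIV"
    unfolding f_def
    by (rule Hs_sum_upper(1)[of "min 1 ((norm d)\<^sup>2 * (norm \<kappa>)\<^sup>2 / (2 * \<mu>1 * \<mu>2))"]) (use lambda_pos r in auto)
  have le: "real N powr (2 * r - 1) * (g n - h n) \<le> (1 + (real n)\<^sup>2) powr r * f n" for n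
  proof (cases "n < Suc N")
    case False
    then have n: "n \<ge> 1" "real N \<le> real n" by auto
    have "real N powr (2 * r - 1) * real n \<le> real n powr (2 * r - 1) * real n"
      using n r by (intro mult_right_mono powr_mono2) auto
    also have "\<dots> = real n powr (2 * r)" using n by (simp add: powr_diff)
    also have "\<dots> \<le> (1 + (real n)\<^sup>2) powr r" using n r by (intro weight_ge) auto
    finally have "real N powr (2 * r - 1) * real n * f n \<le> (1 + (real n)\<^sup>2) powr r * f n"
      by (rule mult_right_mono) (simp add: f_def)
    then show ?thesis using False by (simp add: h_def g_def mult_ac)
  qed (simp add: h_def f_def)
  have "real N powr (2 * r - 1) * (\<mu>1 / 2) \<le> real N powr (2 * r - 1) * (\<mu>1 + \<mu>2 - (\<Sum>n<Suc N. g n))"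
  proof (rule mult_left_mono)
    show "\<mu>1 / 2 \<le> \<mu>1 + \<mu>2 - (\<Sum>n<Suc N. g n)" using G by linarith
  qed simp
  also have "\<dots> \<le> (\<Sum>\<^sub>\<infinity>n::nat. (1 + (real n)\<^sup>2) powr r * f n)"
    by (rule has_sum_mono[OF gh has_sum_infsum[OF sm]]) (rule le)
  also have "\<dots> = Hs_sum r u" by (simp only: Hs_sum_def f_def)
  finally show ?thesis .
qed

end

section \<open>Algebra of the spectral data at a fixed time\<close>

text \<open>Numbers only, related by closed polynomial conditions, so that the limit of states is a
  state. \<open>C\<close>, \<open>W1\<close>, \<open>W2\<close> and \<open>J\<close> are functions
  of the four coordinates.\<close>

locale szego_state =
  fixes m1 m2 q K :: real and A1 A2 B1 B2 C W1 W2 J :: complex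
  assumes m: "m2 \<le> m1" "0 < m2" and q: "0 < q"
    and C: "C = A1 * cnj B1 + A2 * cnj B2"
    and W1: "W1 = of_real m1 * B1 + cnj C * A1" and W2: "W2 = of_real m2 * B2 + cnj C * A2"
    and J: "J = A1 * cnj W1 + A2 * cnj W2"
    and norm_A: "(norm A1)\<^sup>2 + (norm A2)\<^sup>2 = q"
    and norm_B: "m1 * (norm B1)\<^sup>2 + m2 * (norm B2)\<^sup>2 = q - (norm C)\<^sup>2"
    and sum_B: "((norm B1)\<^sup>2 + (norm B2)\<^sup>2) * (m1 * m2 + m1 * (norm A2)\<^sup>2 + m2 * (norm A1)\<^sup>2)
      = m1 * (norm A2)\<^sup>2 + m2 * (norm A1)\<^sup>2"
    and norm_W: "(norm W1)\<^sup>2 + (norm W2)\<^sup>2 = q\<^sup>2 + m1 * (norm A1)\<^sup>2 + m2 * (norm A2)\<^sup>2"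
    and norm_mW: "m1 * (norm W1)\<^sup>2 + m2 * (norm W2)\<^sup>2 + K = (m1 + q)\<^sup>2 * (norm A1)\<^sup>2 + (m2 + q)\<^sup>2 * (norm A2)\<^sup>2"
    and norm_J: "(norm J)\<^sup>2 = K"
    and re_CJ: "(norm W1)\<^sup>2 + (norm W2)\<^sup>2 = (m1 + m2) * (q - (norm C)\<^sup>2)
      - m1 * m2 * ((norm B1)\<^sup>2 + (norm B2)\<^sup>2) + 2 * Re (cnj C * J) - (norm C)\<^sup>2 * q"
begin

definition "x = (norm A1)\<^sup>2"
definition "E = m1 * m2 + m1 * (norm A2)\<^sup>2 + m2 * (norm A1)\<^sup>2"
definition "R = Re (cnj C * J)"
definition "\<kappa> = of_real (sqrt m1) * cnj B1 * A2 - of_real (sqrt m2) * cnj B2 * A1"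

lemma A2_sq: "(norm A2)\<^sup>2 = q - x"
  using norm_A by (simp add: x_def)

lemma x_bounds: "0 \<le> x" "x \<le> q"
  using A2_sq zero_le_power2[of "norm A2"] by (simp_all add: x_def)

lemma E_eq: "E = m1 * (q + m2) - (m1 - m2) * x"
  unfolding E_def A2_sq by (simp add: x_def algebra_simps)

lemma E_bounds: "m1 * m2 + m2 * q \<le> E" "E \<le> m1 * (q + m2)" "E > 0"
proof -
  have "0 \<le> (m1 - m2) * x" "(m1 - m2) * x \<le> (m1 - m2) * q"
    using m x_bounds by (auto intro: mult_left_mono)
  then show 1: "m1 * m2 + m2 * q \<le> E" "E \<le> m1 * (q + m2)" unfolding E_eq by (simp_all add: algebra_simps)
  have "0 < m1 * m2 + m2 * q" using m q by (simp add: add_pos_pos)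
  with 1 show "E > 0" by linarith
qed

lemma sum_B_eq: "(norm B1)\<^sup>2 + (norm B2)\<^sup>2 = 1 - m1 * m2 / E"
proof -
  have "((norm B1)\<^sup>2 + (norm B2)\<^sup>2) * E = E - m1 * m2" using sum_B by (simp add: E_def)
  then show ?thesis using E_bounds(3) by (simp add: field_simps)
qed

lemma B_le: "(norm B1)\<^sup>2 \<le> 1" "(norm B2)\<^sup>2 \<le> 1"
proof -
  have "m1 * m2 / E \<ge> 0" using m E_bounds(3) by simp
  then show "(norm B1)\<^sup>2 \<le> 1" "(norm B2)\<^sup>2 \<le> 1"
    using sum_B_eq zero_le_power2[of "norm B1"] zero_le_power2[of "norm B2"] by linarith+
qed

text \<open>The brackets are the conserved quantities \<open>ell\<close> of the two eigenvalues.
  \<open>norm_W\<close> and \<open>norm_mW\<close> determine their sum and their sum weighted by the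
  eigenvalues.\<close>

lemma ell_sum:
  "((2 * q + m1) * x - (norm W1)\<^sup>2) + ((2 * q + m2) * (q - x) - (norm W2)\<^sup>2) = q\<^sup>2"
  "m1 * ((2 * q + m1) * x - (norm W1)\<^sup>2) + m2 * ((2 * q + m2) * (q - x) - (norm W2)\<^sup>2) = K - q ^ 3"
  using norm_W norm_mW unfolding A2_sq x_def[symmetric] by algebra+

text \<open>Elimination of the second bracket; this is the stated equivalence, and no evolution
  enters.\<close>

lemma ell_eq: "(m1 - m2) * ((2 * q + m1) * x - (norm W1)\<^sup>2) = K - q\<^sup>2 * (q + m2)"
  using ell_sum by algebra

lemma norm_C_eq:
  "(norm C)\<^sup>2 * (q + m1 + m2) * E = ((m1 + m2) * q - m1 * m2 - (q\<^sup>2 + m1 * x + m2 * (q - x))) * E + (m1 * m2)\<^sup>2 + 2 * (E * R)"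
proof -
  have "(q\<^sup>2 + m1 * x + m2 * (q - x)) * E = ((m1 + m2) * (q - (norm C)\<^sup>2)
      - m1 * m2 * (1 - m1 * m2 / E) + 2 * R - (norm C)\<^sup>2 * q) * E"
    using re_CJ norm_W unfolding sum_B_eq R_def[symmetric] A2_sq x_def[symmetric] by simp
  moreover have "m1 * m2 / E * E = m1 * m2" using E_bounds(3) by simp
  ultimately show ?thesis by algebra
qed

lemma re_J_j:
  "2 * Re (cnj J * (A1 * cnj W1)) = K + x * (norm W1)\<^sup>2 - (q - x) * (norm W2)\<^sup>2"
  "2 * Re (cnj J * (A2 * cnj W2)) = K + (q - x) * (norm W2)\<^sup>2 - x * (norm W1)\<^sup>2"
proof -
  have *: "2 * Re (cnj (a + b) * a) = (norm (a + b))\<^sup>2 + (norm a)\<^sup>2 - (norm b)\<^sup>2" for a b :: complex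
    unfolding norm_add_square unfolding cmod_power2 by (simp add: power2_eq_square algebra_simps)
  show "2 * Re (cnj J * (A1 * cnj W1)) = K + x * (norm W1)\<^sup>2 - (q - x) * (norm W2)\<^sup>2"
    using *[of "A1 * cnj W1" "A2 * cnj W2"] norm_J
    by (simp add: norm_mult power_mult_distrib A2_sq flip: J x_def)
  show "2 * Re (cnj J * (A2 * cnj W2)) = K + (q - x) * (norm W2)\<^sup>2 - x * (norm W1)\<^sup>2"
    using *[of "A2 * cnj W2" "A1 * cnj W1"] norm_J
    by (simp add: norm_mult power_mult_distrib A2_sq add.commute[of "A2 * cnj W2"] flip: J x_def)
qed

text \<open>\<open>C\<close> and \<open>J - q * C\<close> are combinations of
  \<open>A1 * cnj B1\<close> and \<open>A2 * cnj B2\<close> with coefficients 1, 1 and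
  \<open>m1\<close>, \<open>m2\<close>; solving for the first product expresses
  \<open>A1 * cnj W1\<close> by \<open>J\<close>, \<open>C\<close> and \<open>x\<close>.\<close>

lemma m_re_J_j1: "(m1 - m2) * Re (cnj J * (A1 * cnj W1)) = m1 * (K - (q + m2) * R) + (m1 - m2) * x * R"
proof -
  have q: "of_real q = A1 * cnj A1 + A2 * cnj A2" using norm_A by (metis of_real_add complex_norm_square)
  have x: "of_real x = A1 * cnj A1" unfolding x_def by (rule complex_norm_square)
  have "of_real (m1 - m2) * (A1 * cnj W1) = of_real m1 * (J - of_real (q + m2) * C) + of_real (m1 - m2) * of_real x * C"
    unfolding J W1 W2 of_real_add q x unfolding C by (simp add: algebra_simps)
  then have "cnj J * (of_real (m1 - m2) * (A1 * cnj W1)) =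
      cnj J * (of_real m1 * (J - of_real (q + m2) * C) + of_real (m1 - m2) * of_real x * C)"
    by simp
  also have "\<dots> = of_real m1 * (cnj J * J - of_real (q + m2) * (cnj J * C)) + of_real (m1 - m2) * of_real x * (cnj J * C)"
    by (simp add: algebra_simps)
  finally have "cnj J * (of_real (m1 - m2) * (A1 * cnj W1)) =
      of_real m1 * (cnj J * J - of_real (q + m2) * (cnj J * C)) + of_real (m1 - m2) * of_real x * (cnj J * C)" .
  then have "of_real (m1 - m2) * (cnj J * (A1 * cnj W1)) =
      of_real m1 * (of_real K - of_real (q + m2) * (cnj J * C)) + of_real ((m1 - m2) * x) * (cnj J * C)"
    using complex_norm_square[of J] unfolding norm_J by (simp add: mult_ac)
  from arg_cong[OF this, of Re] show ?thesis
    by (simp add: R_def algebra_simps)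
qed

lemma kappa_degenerate: "A1 = 0 \<Longrightarrow> W1 \<noteq> 0 \<or> \<kappa> = 0" "A2 = 0 \<Longrightarrow> W2 \<noteq> 0 \<or> \<kappa> = 0"
  using m unfolding \<kappa>_def W1 W2 by auto

text \<open>If \<open>\<kappa> = 0\<close>, then \<open>cnj B1\<close> and \<open>cnj B2\<close> are
  \<open>r\<close> times \<open>sqrt m2 * A1\<close> and \<open>sqrt m1 * A2\<close>. The
  constraints on \<open>B1\<close>, \<open>B2\<close> fix the modulus of \<open>r\<close> and demand
  \<open>norm T\<close> squared equal to \<open>y * q\<close>, while the triangle inequality keeps
  it below by \<open>x * (q - x) * (sqrt m1 - sqrt m2)^2\<close>.\<close>

lemma kappa_nonzero:
  assumes "m1 \<noteq> m2" "A1 \<noteq> 0" "A2 \<noteq> 0"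
  shows "\<kappa> \<noteq> 0"
proof
  assume k: "\<kappa> = 0"
  define r where "r = cnj B1 / (sqrt m2 * A1)"
  have sq: "sqrt m1 * sqrt m1 = m1" "sqrt m2 * sqrt m2 = m2" "sqrt m2 > 0" "sqrt m1 > 0" using m by simp_all
  have B: "cnj B1 = r * (sqrt m2 * A1)" "cnj B2 = r * (sqrt m1 * A2)"
    using k assms sq(3) unfolding \<kappa>_def r_def by (simp_all add: field_simps)
  have nB: "(norm B1)\<^sup>2 = (norm r)\<^sup>2 * (m2 * x)" "(norm B2)\<^sup>2 = (norm r)\<^sup>2 * (m1 * (q - x))"
    using arg_cong[OF B(1), of norm] arg_cong[OF B(2), of norm] m
    by (simp_all add: norm_mult power_mult_distrib A2_sq flip: x_def)
  have x: "x > 0" "q - x > 0" unfolding A2_sq[symmetric] using assms by (simp_all add: x_def)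
  define y where "y = m2 * x + m1 * (q - x)"
  have y: "y > 0" "E = m1 * m2 + y" using m x unfolding y_def E_def A2_sq by (simp_all add: add_pos_pos x_def)
  have "(norm r)\<^sup>2 * y * E = y" using sum_B unfolding nB E_def[symmetric] y(2) A2_sq x_def[symmetric] y_def by (simp add: algebra_simps)
  then have r: "(norm r)\<^sup>2 * E = 1" using y(1) by simp
  define T where "T = sqrt m2 * A1\<^sup>2 + sqrt m1 * A2\<^sup>2"
  have "C = r * T" unfolding C B T_def by (simp add: power2_eq_square algebra_simps)
  then have nC: "(norm C)\<^sup>2 = (norm r)\<^sup>2 * (norm T)\<^sup>2" by (simp add: norm_mult power_mult_distrib)
  have "(norm r)\<^sup>2 * (m1 * m2 * q) = q - (norm r)\<^sup>2 * (norm T)\<^sup>2"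
    using norm_B unfolding nB nC by (simp add: algebra_simps)
  then have "(norm r)\<^sup>2 * E * (m1 * m2 * q) = E * q - (norm r)\<^sup>2 * E * (norm T)\<^sup>2" by algebra
  then have T: "(norm T)\<^sup>2 = y * q" unfolding r using y(2) by (simp add: algebra_simps)
  have "norm T \<le> sqrt m2 * x + sqrt m1 * (q - x)"
    unfolding T_def using norm_triangle_ineq[of "sqrt m2 * A1\<^sup>2" "sqrt m1 * A2\<^sup>2"] m
    by (simp add: norm_mult norm_power A2_sq flip: x_def)
  then have "(norm T)\<^sup>2 \<le> (sqrt m2 * x + sqrt m1 * (q - x))\<^sup>2" by (intro power_mono) auto
  moreover have "y * q - (sqrt m2 * x + sqrt m1 * (q - x))\<^sup>2 = x * (q - x) * (sqrt m1 - sqrt m2)\<^sup>2"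
  proof -
    have "((b * b) * x + (a * a) * (q - x)) * q - (b * x + a * (q - x))\<^sup>2 = x * (q - x) * (a - b)\<^sup>2" for a b :: real
      by (simp add: algebra_simps power2_eq_square)
    from this[of "sqrt m2" "sqrt m1"] show ?thesis unfolding sq y_def .
  qed
  moreover have "x * (q - x) * (sqrt m1 - sqrt m2)\<^sup>2 > 0" using x assms m by simp
  ultimately show False using T by linarith
qed

lemma ell_2_zero:
  assumes "m1 \<noteq> m2" "K = q\<^sup>2 * (q + m1)"
  shows "(norm W1)\<^sup>2 = (2 * q + m1) * x - q\<^sup>2" "(norm W2)\<^sup>2 = (2 * q + m2) * (q - x)"
proof -
  have "(m1 - m2) * ((2 * q + m1) * x - (norm W1)\<^sup>2 - q\<^sup>2) = 0" using ell_eq unfolding assms(2) by algebra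
  then show 1: "(norm W1)\<^sup>2 = (2 * q + m1) * x - q\<^sup>2" using assms(1) by simp
  show "(norm W2)\<^sup>2 = (2 * q + m2) * (q - x)" using ell_sum(1) unfolding 1 by simp
qed

text \<open>The real part of \<open>cnj J * (A2 * cnj W2)\<close> is at most its modulus. Here both
  carry the factor \<open>q - x\<close>, positive because \<open>\<kappa>\<close> is nonzero;
  dividing it out leaves a condition that persists in the limit \<open>q - x = 0\<close>, where it
  is violated.\<close>

lemma ell_2_zero_ineq:
  assumes "m1 \<noteq> m2" "K = q\<^sup>2 * (q + m1)" "\<kappa> \<noteq> 0"
  shows "(3 * q\<^sup>2 + 2 * q * m1 - (m1 - m2) * (q - x))\<^sup>2 \<le> 4 * K * (2 * q + m2)"
proof -
  note W = ell_2_zero[OF assms(1,2)]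
  define a where "a = q - x"
  have a: "a > 0"
  proof -
    have "A2 \<noteq> 0" using kappa_degenerate(2) W(2) assms(3) A2_sq by auto
    then show ?thesis using A2_sq by (simp add: a_def flip: A2_sq)
  qed
  have nj: "(norm (cnj J * (A2 * cnj W2)))\<^sup>2 = K * (a * ((2 * q + m2) * a))"
    by (simp add: norm_mult power_mult_distrib norm_J A2_sq W(2) a_def)
  have "2 * Re (cnj J * (A2 * cnj W2)) = a * (3 * q\<^sup>2 + 2 * q * m1 - (m1 - m2) * a)"
    unfolding re_J_j(2) W assms(2) a_def by (simp add: algebra_simps power2_eq_square power3_eq_cube)
  then have "(a * (3 * q\<^sup>2 + 2 * q * m1 - (m1 - m2) * a))\<^sup>2 = 4 * (Re (cnj J * (A2 * cnj W2)))\<^sup>2"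
    by (metis power_mult_distrib power2_eq_square four_x_squared)
  also have "\<dots> \<le> 4 * (norm (cnj J * (A2 * cnj W2)))\<^sup>2"
    unfolding cmod_power2 by simp
  also have "\<dots> = a\<^sup>2 * (4 * K * (2 * q + m2))" unfolding nj by (simp add: power2_eq_square)
  finally have "a\<^sup>2 * (3 * q\<^sup>2 + 2 * q * m1 - (m1 - m2) * a)\<^sup>2 \<le> a\<^sup>2 * (4 * K * (2 * q + m2))"
    by (simp only: power_mult_distrib)
  then have "(3 * q\<^sup>2 + 2 * q * m1 - (m1 - m2) * a)\<^sup>2 \<le> 4 * K * (2 * q + m2)"
    by (rule mult_left_le_imp_le) (use a in simp)
  then show ?thesis by (simp only: a_def)
qed

text \<open>By \<open>kappa_nonzero\<close> a zero of \<open>\<kappa>\<close> needs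
  \<open>A1 = 0\<close> or \<open>A2 = 0\<close>. The first makes the \<open>ell\<close> of
  \<open>m1\<close> vanish, the second that of \<open>m2\<close>; in the latter case
  \<open>x = q\<close> and the inequality fails.\<close>

lemma kappa_nonzero_of_ell:
  assumes "m1 \<noteq> m2" "K \<noteq> q\<^sup>2 * (q + m2)"
    and ineq: "K = q\<^sup>2 * (q + m1) \<longrightarrow> (3 * q\<^sup>2 + 2 * q * m1 - (m1 - m2) * (q - x))\<^sup>2 \<le> 4 * K * (2 * q + m2)"
  shows "\<kappa> \<noteq> 0"
proof
  assume k: "\<kappa> = 0"
  have sq: "sqrt m1 > 0" "sqrt m2 > 0" using m by simp_all
  consider "A1 = 0" | "A2 = 0" "A1 \<noteq> 0" using k kappa_nonzero[OF assms(1)] by blast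
  then show False
  proof cases
    case 1
    have "A2 \<noteq> 0" using 1 norm_A q by auto
    then have "B1 = 0" using k 1 sq unfolding \<kappa>_def by simp
    then have "W1 = 0" using 1 by (simp add: W1)
    then show False using ell_eq 1 assms(2) unfolding x_def by simp
  next
    case 2
    then have "B2 = 0" using k sq unfolding \<kappa>_def by simp
    then have "W2 = 0" using 2 by (simp add: W2)
    moreover have qx: "q - x = 0" using 2 A2_sq by simp
    ultimately have "(2 * q + m1) * x - (norm W1)\<^sup>2 = q\<^sup>2" using ell_sum(1) by simp
    then have K: "K = q\<^sup>2 * (q + m1)" using ell_eq by algebra
    have "q\<^sup>2 * (3 * q + 2 * m1)\<^sup>2 \<le> q\<^sup>2 * (4 * (q + m1) * (2 * q + m2))"
      using ineq K qx by (simp add: algebra_simps power2_eq_square)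
    then have "(3 * q + 2 * m1)\<^sup>2 \<le> 4 * (q + m1) * (2 * q + m2)" using q by (simp add: mult_le_cancel_left)
    moreover have "(3 * q + 2 * m1)\<^sup>2 - 4 * (q + m1) * (2 * q + m2) = q\<^sup>2 + 4 * (q * (m1 - m2)) + 4 * (m1 * (m1 - m2))"
      by (simp add: algebra_simps power2_eq_square)
    moreover have "q\<^sup>2 > 0" "q * (m1 - m2) \<ge> 0" "m1 * (m1 - m2) \<ge> 0" using m q by simp_all
    ultimately show False by linarith
  qed
qed

end

text \<open>Compactness: the constraints of \<open>szego_state\<close> define a compact set without zeros of \<open>\<kappa>\<close>. If
  \<open>K = q\<^sup>2 (q + m\<^sub>1)\<close>, that is \<open>\<ell>\<^sub>2 = 0\<close>, the additional inequality keeps the set away from \<open>A2 = 0\<close>.\<close>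

lemma kappa_lower_bound:
  fixes m1 m2 q K :: real
  assumes ne: "m1 \<noteq> m2" "K \<noteq> q\<^sup>2 * (q + m2)"
  obtains k where "k > 0"
    "\<And>A1 A2 B1 B2 C W1 W2 J. szego_state m1 m2 q K A1 A2 B1 B2 C W1 W2 J \<Longrightarrow>
      szego_state.\<kappa> m1 m2 A1 A2 B1 B2 \<noteq> 0 \<Longrightarrow> k \<le> norm (szego_state.\<kappa> m1 m2 A1 A2 B1 B2)"
proof -
  define a1 a2 b1 b2 :: "complex \<times> complex \<times> complex \<times> complex \<Rightarrow> complex"
    where "a1 = fst" and "a2 = (\<lambda>z. fst (snd z))" and "b1 = (\<lambda>z. fst (snd (snd z)))" and "b2 = (\<lambda>z. snd (snd (snd z)))"
  define c where "c = (\<lambda>z. a1 z * cnj (b1 z) + a2 z * cnj (b2 z))"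
  define w1 w2 where "w1 = (\<lambda>z. of_real m1 * b1 z + cnj (c z) * a1 z)" and "w2 = (\<lambda>z. of_real m2 * b2 z + cnj (c z) * a2 z)"
  define j where "j = (\<lambda>z. a1 z * cnj (w1 z) + a2 z * cnj (w2 z))"
  define kap where "kap = (\<lambda>z. of_real (sqrt m1) * cnj (b1 z) * a2 z - of_real (sqrt m2) * cnj (b2 z) * a1 z)"
  \<comment> \<open>Zeros of \<open>\<kappa>\<close> are not removed here, so that \<open>S\<close>
    is closed; \<open>kappa_nonzero_of_ell\<close> rules them out afterwards.\<close>
  define S where "S = {z. szego_state m1 m2 q K (a1 z) (a2 z) (b1 z) (b2 z) (c z) (w1 z) (w2 z) (j z) \<and>
    (K = q\<^sup>2 * (q + m1) \<longrightarrow> (3 * q\<^sup>2 + 2 * q * m1 - (m1 - m2) * (q - (norm (a1 z))\<^sup>2))\<^sup>2 \<le> 4 * K * (2 * q + m2))}"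
  have cont: "continuous_on UNIV a1" "continuous_on UNIV a2" "continuous_on UNIV b1" "continuous_on UNIV b2"
    unfolding a1_def a2_def b1_def b2_def by (intro continuous_intros)+
  have cont_c: "continuous_on UNIV c" unfolding c_def by (intro continuous_intros cont)
  have cont_w: "continuous_on UNIV w1" "continuous_on UNIV w2" unfolding w1_def w2_def by (intro continuous_intros cont cont_c)+
  have cont_j: "continuous_on UNIV j" unfolding j_def by (intro continuous_intros cont cont_w)
  have "closed S"
    unfolding S_def szego_state_def
    by (intro closed_Collect_conj closed_Collect_imp closed_Collect_eq closed_Collect_le closed_Collect_const open_Collect_const continuous_intros cont cont_c cont_w cont_j)
  moreover have "S \<subseteq> cball 0 (sqrt q) \<times> cball 0 (sqrt q) \<times> cball 0 1 \<times> cball 0 1"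
  proof
    fix z assume "z \<in> S"
    then interpret szego_state m1 m2 q K "a1 z" "a2 z" "b1 z" "b2 z" "c z" "w1 z" "w2 z" "j z" by (simp add: S_def)
    have "norm (a1 z) \<le> sqrt q" "norm (a2 z) \<le> sqrt q" using A2_sq x_bounds by (auto simp: x_def intro!: real_le_rsqrt)
    moreover have "norm (b1 z) \<le> 1" "norm (b2 z) \<le> 1"
      using B_le power2_le_imp_le[of "norm (b1 z)" 1] power2_le_imp_le[of "norm (b2 z)" 1] by simp_all
    ultimately show "z \<in> cball 0 (sqrt q) \<times> cball 0 (sqrt q) \<times> cball 0 1 \<times> cball 0 1"
      by (cases z) (simp add: a1_def a2_def b1_def b2_def)
  qed
  ultimately have "compact S"
    by (metis compact_Int_closed compact_Times compact_cball inf.absorb_iff2)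
  have in_S: "(A1, A2, B1, B2) \<in> S" "kap (A1, A2, B1, B2) = szego_state.\<kappa> m1 m2 A1 A2 B1 B2"
    if "szego_state m1 m2 q K A1 A2 B1 B2 C W1 W2 J" "szego_state.\<kappa> m1 m2 A1 A2 B1 B2 \<noteq> 0" for A1 A2 B1 B2 C W1 W2 J
  proof -
    interpret szego_state m1 m2 q K A1 A2 B1 B2 C W1 W2 J by fact
    have "szego_state m1 m2 q K A1 A2 B1 B2 (A1 * cnj B1 + A2 * cnj B2) W1 W2 J"
      using that(1) unfolding C .
    then have "a1 (A1, A2, B1, B2) = A1" "a2 (A1, A2, B1, B2) = A2" "b1 (A1, A2, B1, B2) = B1" "b2 (A1, A2, B1, B2) = B2"
      by (simp_all add: a1_def a2_def b1_def b2_def)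
    note [simp] = this
    have "c (A1, A2, B1, B2) = C" by (simp add: c_def C)
    note [simp] = this
    have "w1 (A1, A2, B1, B2) = W1" "w2 (A1, A2, B1, B2) = W2" by (simp_all add: w1_def w2_def W1 W2)
    note [simp] = this
    have "j (A1, A2, B1, B2) = J" by (simp add: j_def J)
    note [simp] = this
    show "(A1, A2, B1, B2) \<in> S"
      using ell_2_zero_ineq[OF ne(1) _ that(2)] that(1) by (simp add: S_def x_def)
    show "kap (A1, A2, B1, B2) = szego_state.\<kappa> m1 m2 A1 A2 B1 B2" unfolding kap_def szego_state.\<kappa>_def[OF that(1)] by simp
  qed
  show thesis
  proof (cases "S = {}")
    case True
    show thesis
    proof (rule that[of 1])
      fix A1 A2 B1 B2 C W1 W2 J
      assume *: "szego_state m1 m2 q K A1 A2 B1 B2 C W1 W2 J" "szego_state.\<kappa> m1 m2 A1 A2 B1 B2 \<noteq> 0"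
      show "1 \<le> norm (szego_state.\<kappa> m1 m2 A1 A2 B1 B2)" using in_S(1)[OF *] True by blast
    qed simp
  next
    case False
    have "continuous_on S (\<lambda>z. norm (kap z))"
      unfolding kap_def by (intro continuous_intros continuous_on_subset[OF cont(1)] continuous_on_subset[OF cont(2)]
        continuous_on_subset[OF cont(3)] continuous_on_subset[OF cont(4)] subset_UNIV)
    from continuous_attains_inf[OF \<open>compact S\<close> False this]
    obtain z where z: "z \<in> S" "\<And>y. y \<in> S \<Longrightarrow> norm (kap z) \<le> norm (kap y)" by blast
    show thesis
    proof (rule that)
      interpret z: szego_state m1 m2 q K "a1 z" "a2 z" "b1 z" "b2 z" "c z" "w1 z" "w2 z" "j z" using z(1) by (simp add: S_def)
      have "z.\<kappa> \<noteq> 0" using z.kappa_nonzero_of_ell[OF ne] z(1) by (simp add: S_def z.x_def)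
      then show "norm (kap z) > 0" by (simp add: kap_def z.\<kappa>_def)
      fix A1 A2 B1 B2 C W1 W2 J
      assume *: "szego_state m1 m2 q K A1 A2 B1 B2 C W1 W2 J" "szego_state.\<kappa> m1 m2 A1 A2 B1 B2 \<noteq> 0"
      show "norm (kap z) \<le> norm (szego_state.\<kappa> m1 m2 A1 A2 B1 B2)"
        using z(2)[OF in_S(1)[OF *]] unfolding in_S(2)[OF *] .
    qed
  qed
qed

section \<open>States for which the quantity \<open>ell\<close> of the larger eigenvalue
  vanishes\<close>

locale zero_ell_state = szego_state +
  assumes neq: "m1 \<noteq> m2" and K_eq: "K = q\<^sup>2 * (q + m2)"
begin

abbreviation "m \<equiv> m1 - m2"
text \<open>For \<open>z = cnj J * (A1 * cnj W1)\<close> twice the real part is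
  \<open>x * (m * x + n)\<close> and four times the squared modulus is \<open>k0 * x^2\<close>;
  \<open>k0 - (m * x + n)^2\<close> therefore measures the imaginary part.\<close>

abbreviation "n \<equiv> 3 * q\<^sup>2 + 2 * q * m2"
abbreviation "k0 \<equiv> 4 * K * (2 * q + m1)"

lemma m_pos: "m > 0" using m neq by simp

lemma norm_W_eq: "(norm W1)\<^sup>2 = (2 * q + m1) * x" "(norm W2)\<^sup>2 = (2 * q + m2) * (q - x) - q\<^sup>2"
proof -
  have "m * ((2 * q + m1) * x - (norm W1)\<^sup>2) = 0" unfolding ell_eq K_eq by simp
  then show 1: "(norm W1)\<^sup>2 = (2 * q + m1) * x" using m_pos by simp
  show "(norm W2)\<^sup>2 = (2 * q + m2) * (q - x) - q\<^sup>2" using ell_sum(1) unfolding 1 by simp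
qed

text \<open>Equates the values of the real part from \<open>re_J_j\<close> and
  \<open>m_re_J_j1\<close>; the coefficient of \<open>R\<close> in the latter is
  \<open>- E\<close>.\<close>

lemma E_R: "E * R = m1 * K - m * (m * x\<^sup>2 + n * x) / 2"
proof -
  have "2 * Re (cnj J * (A1 * cnj W1)) = K + x * ((2 * q + m1) * x) - (q - x) * ((2 * q + m2) * (q - x) - q\<^sup>2)"
    unfolding re_J_j(1) norm_W_eq ..
  also have "\<dots> = m * x\<^sup>2 + n * x" unfolding K_eq by algebra
  finally have f1: "m * (m * x\<^sup>2 + n * x) = 2 * (m1 * (K - (q + m2) * R) + m * x * R)"
    using m_re_J_j1 by algebra
  have "E * R = m1 * K - (m1 * (K - (q + m2) * R) + m * x * R)"
    unfolding E_eq by (simp add: algebra_simps)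
  moreover have "m * (m * x\<^sup>2 + n * x) / 2 = m1 * (K - (q + m2) * R) + m * x * R"
    unfolding f1 by (rule nonzero_mult_div_cancel_left) simp
  ultimately show ?thesis by (simp only:)
qed

text \<open>As \<open>norm J\<close> squared is \<open>K\<close>, the left side is the square of
  \<open>E * Im (cnj C * J)\<close>, to which the velocity of \<open>x\<close> is proportional. This
  makes \<open>x\<close> satisfy an autonomous first order equation.\<close>

lemma poly_norm: "E\<^sup>2 * ((norm C)\<^sup>2 * K) - (E * R)\<^sup>2 = m\<^sup>2 * x\<^sup>2 * (k0 - (m * x + n)\<^sup>2) / 4"
proof -
  have "(q + m1 + m2) * (E\<^sup>2 * ((norm C)\<^sup>2 * K) - (E * R)\<^sup>2) = E * K * ((norm C)\<^sup>2 * (q + m1 + m2) * E) - (q + m1 + m2) * (E * R)\<^sup>2"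
    by (simp add: algebra_simps power2_eq_square)
  also have "\<dots> = (q + m1 + m2) * (m\<^sup>2 * x\<^sup>2 * (k0 - (m * x + n)\<^sup>2) / 4)"
    unfolding norm_C_eq unfolding E_R unfolding E_eq K_eq by (simp add: field_simps power2_eq_square)
  finally show ?thesis using m q by simp
qed

text \<open>The left side is what differentiating \<open>E * Im (cnj C * J)\<close> along the flow
  produces, see \<open>g_derivative\<close>.\<close>

lemma poly_deriv: "E * ((norm C)\<^sup>2 * K) + 2 * q * K * E - (2 * (q\<^sup>2 + m1 * x + m2 * (q - x)) + q\<^sup>2) * (E * R)
   = - (m / 2) * (k0 * x - x * (m * x + n)\<^sup>2 - m * x\<^sup>2 * (m * x + n))"
proof -
  have nz: "q + m1 + m2 \<noteq> 0" using m q by linarith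
  have "(q + m1 + m2) * (E * ((norm C)\<^sup>2 * K) + 2 * q * K * E - (2 * (q\<^sup>2 + m1 * x + m2 * (q - x)) + q\<^sup>2) * (E * R))
    = K * ((norm C)\<^sup>2 * (q + m1 + m2) * E) + (q + m1 + m2) * (2 * q * K * E - (2 * (q\<^sup>2 + m1 * x + m2 * (q - x)) + q\<^sup>2) * (E * R))"
    by (simp add: algebra_simps)
  also have "\<dots> = (q + m1 + m2) * (- (m / 2) * (k0 * x - x * (m * x + n)\<^sup>2 - m * x\<^sup>2 * (m * x + n)))"
    unfolding norm_C_eq unfolding E_R unfolding E_eq K_eq by (simp add: field_simps power2_eq_square)
  finally show ?thesis by (rule mult_left_cancel[OF nz, THEN iffD1])
qed

lemma norm_B1: "(norm B1)\<^sup>2 = x * (q + m2) / E"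
proof -
  have "m * (norm B1)\<^sup>2 = q - (norm C)\<^sup>2 - m2 * ((norm B1)\<^sup>2 + (norm B2)\<^sup>2)"
    using norm_B by (simp add: algebra_simps)
  then have "m * (norm B1)\<^sup>2 * E = q * E - (norm C)\<^sup>2 * E - m2 * (E - m1 * m2)"
    unfolding sum_B_eq using E_bounds(3) by (simp add: field_simps)
  from arg_cong[OF this, of "\<lambda>z. (q + m1 + m2) * z"]
  have "(q + m1 + m2) * (m * (norm B1)\<^sup>2 * E) = (q + m1 + m2) * (q * E - m2 * (E - m1 * m2)) - (norm C)\<^sup>2 * (q + m1 + m2) * E"
    by (simp add: algebra_simps)
  also have "\<dots> = (q + m1 + m2) * (m * (x * (q + m2)))"
    unfolding norm_C_eq unfolding E_R unfolding E_eq K_eq by (simp add: field_simps power2_eq_square)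
  finally have "(norm B1)\<^sup>2 * E = x * (q + m2)" using m q m_pos by simp
  then show ?thesis using E_bounds(3) by (simp add: field_simps)
qed

lemma norm_B2: "(norm B2)\<^sup>2 = (m1 * q - x * (m1 + q)) / E"
proof -
  have "(norm B2)\<^sup>2 = 1 - m1 * m2 / E - x * (q + m2) / E" using sum_B_eq norm_B1 by simp
  also have "\<dots> = (E - m1 * m2 - x * (q + m2)) / E" using E_bounds(3) by (simp add: diff_divide_distrib)
  also have "E - m1 * m2 - x * (q + m2) = m1 * q - x * (m1 + q)" unfolding E_eq by (simp add: algebra_simps)
  finally show ?thesis .
qed

lemma norm_B1_le: "norm B1 \<le> sqrt x / sqrt m2"
proof -
  have "(norm B1)\<^sup>2 \<le> x / m2"
  proof -
    have "m2 * (q + m2) \<le> m1 * m2 + m2 * q" using m by (simp add: algebra_simps mult_right_mono)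
    then have "m2 * (q + m2) \<le> E" using E_bounds(1) by linarith
    then have "x * (m2 * (q + m2)) \<le> x * E" using x_bounds by (intro mult_left_mono)
    then show ?thesis unfolding norm_B1 using E_bounds(3) m by (simp add: field_simps)
  qed
  then have "norm B1 \<le> sqrt (x / m2)" by (rule real_le_rsqrt)
  then show ?thesis by (simp add: real_sqrt_divide)
qed

lemma norm_A_le: "norm A1 = sqrt x" "norm A2 \<le> sqrt q"
  using A2_sq x_bounds by (auto simp: x_def intro!: real_le_rsqrt)

lemma cross_le: "norm B2 * norm A1 + norm B1 * norm A2 \<le> sqrt x * (1 + sqrt q / sqrt m2)"
proof -
  have "norm B2 \<le> 1" using B_le(2) power2_le_imp_le[of "norm B2" 1] by simp
  then have "norm B2 * norm A1 + norm B1 * norm A2 \<le> 1 * sqrt x + sqrt x / sqrt m2 * sqrt q"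
    using norm_A_le norm_B1_le by (intro add_mono mult_mono) (auto simp: x_bounds less_imp_le[OF m(2)])
  then show ?thesis by (simp add: algebra_simps)
qed

text \<open>\<open>\<kappa> = a - b\<close>. The difference of the squared moduli of
  \<open>a\<close> and \<open>b\<close> is at least of order \<open>x\<close>, the sum of the moduli
  at most of order \<open>sqrt x\<close>; their quotient bounds \<open>norm a - norm b\<close> from
  below by order \<open>sqrt x\<close>.\<close>

lemma kappa_ge: "sqrt x * (m2 * q\<^sup>2 / (m1 * (q + m2) * sqrt m1 * (1 + sqrt q / sqrt m2))) \<le> norm \<kappa>"
proof (cases "x = 0")
  case False
  then have x: "x > 0" using x_bounds by simp
  define S where "S = 1 + sqrt q / sqrt m2"
  have S: "S > 0" unfolding S_def using m q by (intro add_pos_pos) auto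
  define a b where "a = of_real (sqrt m1) * cnj B1 * A2" and "b = of_real (sqrt m2) * cnj B2 * A1"
  have sq: "sqrt m2 \<le> sqrt m1" "sqrt m1 > 0" using m by simp_all
  have "norm a + norm b \<le> sqrt m1 * (norm B2 * norm A1 + norm B1 * norm A2)"
    using m sq by (simp add: a_def b_def norm_mult distrib_left mult_right_mono mult_ac)
  also have "\<dots> \<le> sqrt m1 * (sqrt x * S)" using cross_le m by (intro mult_left_mono) (auto simp: S_def)
  finally have ab: "norm a + norm b \<le> sqrt m1 * (sqrt x * S)" .
  have E: "E > 0" by (rule E_bounds)
  have "(norm a)\<^sup>2 - (norm b)\<^sup>2 = m1 * (norm B1)\<^sup>2 * (q - x) - m2 * (norm B2)\<^sup>2 * x"
    using m by (simp add: a_def b_def norm_mult power_mult_distrib A2_sq flip: x_def)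
  also have "\<dots> = (m1 * (x * (q + m2)) * (q - x) - m2 * (m1 * q - x * (m1 + q)) * x) / E"
    unfolding norm_B1 norm_B2 using E by (simp add: field_simps)
  also have "m1 * (x * (q + m2)) * (q - x) - m2 * (m1 * q - x * (m1 + q)) * x = x * q * (E - m1 * m2)"
    unfolding E_eq by algebra
  finally have diff: "(norm a)\<^sup>2 - (norm b)\<^sup>2 = x * q * (E - m1 * m2) / E" .
  have "x * q * (m2 * q) / (m1 * (q + m2)) \<le> x * q * (E - m1 * m2) / E"
  proof (rule frac_le)
    have "m2 * q \<le> E - m1 * m2" using E_bounds(1) by linarith
    then show "x * q * (m2 * q) \<le> x * q * (E - m1 * m2)" using x q by (intro mult_left_mono) auto
    have "0 \<le> m2 * q" using m q by simp
    then show "0 \<le> x * q * (E - m1 * m2)" using \<open>m2 * q \<le> E - m1 * m2\<close> x q by (intro mult_nonneg_nonneg) auto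
  qed (use E_bounds in auto)
  also have "\<dots> = (norm a - norm b) * (norm a + norm b)" unfolding diff[symmetric] by (simp add: power2_eq_square algebra_simps)
  also have "\<dots> \<le> norm (a - b) * (norm a + norm b)" by (intro mult_right_mono norm_triangle_ineq2) auto
  also have "\<dots> \<le> norm \<kappa> * (sqrt m1 * (sqrt x * S))" unfolding \<kappa>_def a_def[symmetric] b_def[symmetric] using ab by (intro mult_left_mono) auto
  finally have "sqrt x * (sqrt x * (m2 * q\<^sup>2) / (m1 * (q + m2))) \<le> sqrt x * (norm \<kappa> * (sqrt m1 * S))"
    using x by (simp add: power2_eq_square mult_ac) 
  then have "sqrt x * (m2 * q\<^sup>2) / (m1 * (q + m2)) \<le> norm \<kappa> * (sqrt m1 * S)" 
    by (rule mult_left_le_imp_le) (use x in simp)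
  then have "sqrt x * (m2 * q\<^sup>2) / (m1 * (q + m2)) / (sqrt m1 * S) \<le> norm \<kappa>"
    by (subst pos_divide_le_eq) (use sq S in simp_all)
  then show ?thesis unfolding S_def[symmetric] by (simp add: mult.assoc)
qed simp

end

lemma lagrange_identity:
  fixes a a' b b' :: complex
  shows "(norm (a * b' - a' * b))\<^sup>2 + (norm (a * cnj b + a' * cnj b'))\<^sup>2 = ((norm a)\<^sup>2 + (norm a')\<^sup>2) * ((norm b)\<^sup>2 + (norm b')\<^sup>2)"
proof -
  have "of_real ((norm (a * b' - a' * b))\<^sup>2 + (norm (a * cnj b + a' * cnj b'))\<^sup>2)
    = (of_real (((norm a)\<^sup>2 + (norm a')\<^sup>2) * ((norm b)\<^sup>2 + (norm b')\<^sup>2)) :: complex)"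
    unfolding of_real_add of_real_mult complex_norm_square by (simp add: algebra_simps)
  then show ?thesis by (simp only: of_real_eq_iff)
qed

section \<open>Bounded solutions\<close>

context szego_data
begin

lemma state: "szego_state (m1 0) (m2 0) (Q 0) K (A1 t) (A2 t) (B1 t) (B2 t) (c t) (W1 t) (W2 t) (J t)"
proof -
  note st = static[of t, unfolded m_const[of t] Q_const[of t]]
  show ?thesis
  proof
    show "c t = A1 t * cnj (B1 t) + A2 t * cnj (B2 t)" by (rule st(2))
    show "W1 t = of_real (m1 0) * B1 t + cnj (c t) * A1 t" "W2 t = of_real (m2 0) * B2 t + cnj (c t) * A2 t"
      by (simp_all only: W1_def W2_def m_const[of t])
    show "J t = A1 t * cnj (W1 t) + A2 t * cnj (W2 t)" by (rule st(6))
    show "(norm (A1 t))\<^sup>2 + (norm (A2 t))\<^sup>2 = Q 0" using st(1) by simp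
    show "m1 0 * (norm (B1 t))\<^sup>2 + m2 0 * (norm (B2 t))\<^sup>2 = Q 0 - (norm (c t))\<^sup>2" by (rule st(3))
    show "((norm (B1 t))\<^sup>2 + (norm (B2 t))\<^sup>2) * (m1 0 * m2 0 + m1 0 * (norm (A2 t))\<^sup>2 + m2 0 * (norm (A1 t))\<^sup>2)
      = m1 0 * (norm (A2 t))\<^sup>2 + m2 0 * (norm (A1 t))\<^sup>2" by (rule st(9))
    show "(norm (W1 t))\<^sup>2 + (norm (W2 t))\<^sup>2 = (Q 0)\<^sup>2 + m1 0 * (norm (A1 t))\<^sup>2 + m2 0 * (norm (A2 t))\<^sup>2"
      using st(4,5) by simp
    show "m1 0 * (norm (W1 t))\<^sup>2 + m2 0 * (norm (W2 t))\<^sup>2 + K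
      = (m1 0 + Q 0)\<^sup>2 * (norm (A1 t))\<^sup>2 + (m2 0 + Q 0)\<^sup>2 * (norm (A2 t))\<^sup>2"
      using st(7) unfolding J_norm .
    show "(norm (J t))\<^sup>2 = K" by (rule J_norm)
    have D1: "1 - D t = (norm (B1 t))\<^sup>2 + (norm (B2 t))\<^sup>2" using st(8) by (simp add: D_def)
    show "(norm (W1 t))\<^sup>2 + (norm (W2 t))\<^sup>2 = (m1 0 + m2 0) * (Q 0 - (norm (c t))\<^sup>2)
      - m1 0 * m2 0 * ((norm (B1 t))\<^sup>2 + (norm (B2 t))\<^sup>2) + 2 * Re (cnj (c t) * J t) - (norm (c t))\<^sup>2 * Q 0"
      using h2_zeta[of t] unfolding D1 st(5) st(10) X_def \<zeta>_def p_def m_const[of t] Q_const[of t] .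
  qed (use m_pos[of 0] Q_pos[of 0] in auto)
qed

definition "kap t = szego_state.\<kappa> (m1 0) (m2 0) (A1 t) (A2 t) (B1 t) (B2 t)"
definition "Ee t = szego_state.E (m1 0) (m2 0) (A1 t) (A2 t)"

lemma m_sigma: "m1 0 = (\<sigma>1 t)\<^sup>2" "m2 0 = (\<sigma>2 t)\<^sup>2"
  using m_const[of t] by (simp_all only: m1_def m2_def)

lemma sqrt_m: "sqrt (m1 0) = \<sigma>1 t" "sqrt (m2 0) = \<sigma>2 t"
  unfolding m_sigma[of t] using hankel_pair.\<sigma>[OF hp, of t] by simp_all

lemma kap_eq: "kap t = hankel_pair.\<kappa> (u t) (E1 t) (E2 t) (\<sigma>1 t) (\<sigma>2 t)"
  unfolding kap_def szego_state.\<kappa>_def[OF state] hankel_pair.\<kappa>_def[OF hp] hp_defs sqrt_m[of t]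
  by (simp add: A1_def A2_def B1_def B2_def)

lemma kap_nonzero: "kap t \<noteq> 0"
  unfolding kap_eq by (rule hankel_pair.kappa_nonzero[OF hp])

lemma D_Ee: "D t = m1 0 * m2 0 / Ee t"
  using szego_state.sum_B_eq[OF state, of t] static(8)[of t] by (simp add: D_def Ee_def)

text \<open>By \<open>D_Ee\<close> the product of the eigenvalues cancels, so the contraction rate
  is governed by \<open>kap\<close> alone, \<open>Ee\<close> being bounded above and below.\<close>

lemma rate: "(norm (d t))\<^sup>2 * (norm (hankel_pair.\<kappa> (u t) (E1 t) (E2 t) (\<sigma>1 t) (\<sigma>2 t)))\<^sup>2 / (2 * (\<sigma>1 t)\<^sup>2 * (\<sigma>2 t)\<^sup>2)
    = (norm (kap t))\<^sup>2 / (2 * Ee t)"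
proof -
  have "(\<sigma>1 t)\<^sup>2 = m1 0" "(\<sigma>2 t)\<^sup>2 = m2 0" using m_const[of t] by (simp_all add: m1_def m2_def)
  then show ?thesis unfolding kap_eq[symmetric] D_def[symmetric] D_Ee using m_pos[of 0] by simp
qed

lemma Hs_sum_le:
  assumes l: "0 < l" "l \<le> 1" "l \<le> (norm (kap t))\<^sup>2 / (2 * Ee t)" and r: "r > 1/2"
  shows "Hs_sum r (u t) \<le> Q 0 + Hs_growth r * (m1 0 + m2 0) * l powr (1 - 2 * r)"
  using hankel_pair.Hs_sum_upper(2)[OF hp l(1,2) _ r, of t] l(3) Q_const[of t] m_const[of t]
  unfolding rate by (simp add: Q_def m1_def m2_def)

lemma bounded_of_kap:
  assumes k: "k > 0" "\<And>t. k \<le> norm (kap t)" and r: "r > 1/2"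
  shows "bounded (range (\<lambda>t. norm_Hs r (u t)))"
proof (rule boundedI)
  define l where "l = min 1 (k\<^sup>2 / (2 * (m1 0 * (Q 0 + m2 0))))"
  have pos: "m1 0 * (Q 0 + m2 0) > 0" using m_pos[of 0] Q_pos[of 0] by (intro mult_pos_pos) auto
  have l: "0 < l" "l \<le> 1" using k pos by (auto simp: l_def)
  fix y assume "y \<in> range (\<lambda>t. norm_Hs r (u t))"
  then obtain t where t: "y = norm_Hs r (u t)" by blast
  have "l \<le> k\<^sup>2 / (2 * (m1 0 * (Q 0 + m2 0)))" by (simp add: l_def)
  also have "\<dots> \<le> (norm (kap t))\<^sup>2 / (2 * Ee t)"
    using k szego_state.E_bounds[OF state, of t] unfolding Ee_def by (intro frac_le power_mono) auto
  finally have "Hs_sum r (u t) \<le> Q 0 + Hs_growth r * (m1 0 + m2 0) * l powr (1 - 2 * r)"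
    by (intro Hs_sum_le l r)
  then show "norm y \<le> sqrt (Q 0 + Hs_growth r * (m1 0 + m2 0) * l powr (1 - 2 * r))"
    unfolding t norm_Hs_plus[OF u_L2_plus] using Hs_sum_nonneg by simp
qed

lemma bounded_simple:
  assumes "m1 0 \<noteq> m2 0" "K \<noteq> (Q 0)\<^sup>2 * (Q 0 + m2 0)" "r > 1/2"
  shows "bounded (range (\<lambda>t. norm_Hs r (u t)))"
proof -
  obtain k where k: "k > 0" "\<And>A1 A2 B1 B2 C W1 W2 J. szego_state (m1 0) (m2 0) (Q 0) K A1 A2 B1 B2 C W1 W2 J \<Longrightarrow>
      szego_state.\<kappa> (m1 0) (m2 0) A1 A2 B1 B2 \<noteq> 0 \<Longrightarrow> k \<le> norm (szego_state.\<kappa> (m1 0) (m2 0) A1 A2 B1 B2)"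
    by (rule kappa_lower_bound[OF assms(1,2)]) (rule that)
  have "k \<le> norm (kap t)" for t
    unfolding kap_def by (rule k(2)[OF state]) (use kap_nonzero[of t] in \<open>simp add: kap_def\<close>)
  then show ?thesis using bounded_of_kap k(1) assms(3) by blast
qed

text \<open>For a double eigenvalue \<open>(B1, B2)\<close> is a multiple of \<open>(A1, A2)\<close>, by the equality case of
  Cauchy--Schwarz. Hence \<open>\<Pi>(|u|\<^sup>2)\<close> is a multiple of \<open>u\<close>, and \<open>\<kappa>\<close> is controlled by \<open>|u\<^sub>1|\<close>,
  which is then constant.\<close>

lemma bounded_double:
  assumes eq: "m1 0 = m2 0" and r: "r > 1/2"
  shows "bounded (range (\<lambda>t. norm_Hs r (u t)))"
proof -
  define \<mu> q where "\<mu> = m2 0" and "q = Q 0"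
  have pos: "\<mu> > 0" "q > 0" using m_pos[of 0] Q_pos[of 0] by (simp_all add: \<mu>_def q_def)
  define f1 where "f1 = (\<lambda>t. fourier (u t) 1)"
  have main: "(norm (kap t))\<^sup>2 = \<mu> * (q * (q / (\<mu> + q))) - (\<mu> + q) * (norm (f1 t))\<^sup>2
    \<and> (f1 has_vector_derivative - \<i> * of_real (2 * ((\<mu> + q) * q + (\<mu> + q) * X t)) * f1 t) (at t)" for t
  proof -
    interpret S: szego_state \<mu> \<mu> q K "A1 t" "A2 t" "B1 t" "B2 t" "c t" "W1 t" "W2 t" "J t"
      using state[of t] unfolding eq \<mu>_def q_def .
    define \<beta> where "\<beta> = (norm (B1 t))\<^sup>2 + (norm (B2 t))\<^sup>2"
    have "\<beta> * (\<mu> * (\<mu> + q)) = \<mu> * q"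
      using S.sum_B unfolding \<beta>_def S.norm_A[symmetric] by (simp add: algebra_simps)
    then have "\<beta> * (\<mu> + q) = q" using pos by (simp add: mult.left_commute)
    then have \<beta>: "\<beta> = q / (\<mu> + q)" using pos by (simp add: field_simps)
    have "\<mu> * \<beta> = q - X t" using S.norm_B by (simp add: \<beta>_def X_def algebra_simps)
    then have X: "X t = q * \<beta>" using \<open>\<beta> * (\<mu> + q) = q\<close> by (simp add: algebra_simps)
    \<comment> \<open>The constraints give \<open>X t = q * \<beta>\<close>, the equality case of
      Cauchy--Schwarz for the mean; the Lagrange identity turns it into proportionality.\<close>
    have "(norm (A1 t * B2 t - A2 t * B1 t))\<^sup>2 = 0"
      using lagrange_identity[of "A1 t" "B2 t" "A2 t" "B1 t"] X unfolding S.norm_A X_def S.C \<beta>_def by simp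
    then have par: "A1 t * B2 t = A2 t * B1 t" by simp
    have qc: "of_real q = A1 t * cnj (A1 t) + A2 t * cnj (A2 t)" unfolding S.norm_A[symmetric] of_real_add complex_norm_square ..
    have B: "cnj (c t) * A1 t = of_real q * B1 t" "cnj (c t) * A2 t = of_real q * B2 t"
      unfolding qc S.C using par by (simp_all add: algebra_simps)
    then have cB: "c t * cnj (A1 t) = of_real q * cnj (B1 t)" "c t * cnj (A2 t) = of_real q * cnj (B2 t)"
    proof -
      have "c t * cnj (A1 t) = cnj (cnj (c t) * A1 t)" "c t * cnj (A2 t) = cnj (cnj (c t) * A2 t)" by simp_all
      then show "c t * cnj (A1 t) = of_real q * cnj (B1 t)" "c t * cnj (A2 t) = of_real q * cnj (B2 t)"
        unfolding B by simp_all
    qed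
    have "W1 t = of_real (\<mu> + q) * B1 t" "W2 t = of_real (\<mu> + q) * B2 t"
      unfolding S.W1 S.W2 B by (simp_all add: algebra_simps)
    then have J: "J t = of_real (\<mu> + q) * c t" unfolding S.J S.C by (simp add: algebra_simps)
    define g where "g = fourier (w t) 1"
    have "(\<sigma>1 t)\<^sup>2 = (\<sigma>2 t)\<^sup>2" using m_const[of t] eq by (simp add: m1_def m2_def)
    then have \<sigma>: "\<sigma>2 t = \<sigma>1 t" using hankel_pair.\<sigma>[OF hp, of t] by (auto simp: power2_eq_iff)
    have f1: "f1 t = \<sigma>1 t * (cnj (B1 t) * cnj (B1 t) + cnj (B2 t) * cnj (B2 t))"
      using hankel_pair.fourier_u_1[OF hp, of t] unfolding hp_defs \<sigma> by (simp add: f1_def B1_def B2_def power2_eq_square algebra_simps)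
    have g: "g = \<sigma>1 t * (cnj (B1 t) * cnj (A1 t) + cnj (B2 t) * cnj (A2 t))"
      using hankel_pair.fourier_w_1[OF hp, of t] unfolding hp_defs \<sigma> by (simp add: g_def w_def A1_def A2_def B1_def B2_def algebra_simps)
    have "c t * g = \<sigma>1 t * (cnj (B1 t) * (c t * cnj (A1 t)) + cnj (B2 t) * (c t * cnj (A2 t)))"
      unfolding g by (simp add: algebra_simps)
    also have "\<dots> = of_real q * f1 t" unfolding cB f1 by (simp add: algebra_simps)
    finally have cg: "c t * g = of_real q * f1 t" .
    have "X t * (norm g)\<^sup>2 = q\<^sup>2 * (norm (f1 t))\<^sup>2"
      using arg_cong[OF cg, of "\<lambda>z. (norm z)\<^sup>2"] by (simp add: X_def norm_mult power_mult_distrib)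
    then have "q\<^sup>2 * (norm g)\<^sup>2 = q\<^sup>2 * ((\<mu> + q) * (norm (f1 t))\<^sup>2)"
      using pos unfolding X \<beta> by (simp add: field_simps power2_eq_square)
    then have ng: "(norm g)\<^sup>2 = (\<mu> + q) * (norm (f1 t))\<^sup>2" using pos by simp
    have \<mu>: "(\<sigma>1 t)\<^sup>2 = \<mu>" using m_const[of t] eq by (simp add: m1_def \<mu>_def)
    have "kap t = \<sigma>1 t * (cnj (B1 t) * A2 t - cnj (B2 t) * A1 t)"
      unfolding kap_def szego_state.\<kappa>_def[OF state] sqrt_m[of t] \<sigma> by (simp add: algebra_simps)
    \<comment> \<open>The Lagrange identity again: the squared moduli of \<open>kap t\<close> and
      \<open>g\<close> have a constant sum, and the second is a multiple of that of
      \<open>f1 t\<close>.\<close>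
    then have "(norm (kap t))\<^sup>2 + (norm g)\<^sup>2 = \<mu> * ((norm (cnj (B1 t) * A2 t - cnj (B2 t) * A1 t))\<^sup>2
       + (norm (cnj (B1 t) * cnj (A1 t) + cnj (B2 t) * cnj (A2 t)))\<^sup>2)"
      unfolding g by (simp add: norm_mult power_mult_distrib \<mu> distrib_left[of \<mu>])
    also have "\<dots> = \<mu> * (\<beta> * q)" unfolding lagrange_identity S.norm_A by (simp add: \<beta>_def)
    finally have 1: "(norm (kap t))\<^sup>2 = \<mu> * (q * (q / (\<mu> + q))) - (\<mu> + q) * (norm (f1 t))\<^sup>2"
      unfolding ng \<beta> by (simp add: mult.commute)
    have "2 * J t * g + cnj (J t) * (2 * c t * f1 t) = 2 * of_real (\<mu> + q) * (c t * g) + 2 * of_real (\<mu> + q) * (c t * cnj (c t)) * f1 t"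
      unfolding J by (simp add: algebra_simps)
    also have "\<dots> = of_real (2 * ((\<mu> + q) * q + (\<mu> + q) * X t)) * f1 t"
      unfolding cg X_def complex_norm_square[symmetric] by (simp add: algebra_simps)
    finally have "2 * J t * g + cnj (J t) * (2 * c t * f1 t) = of_real (2 * ((\<mu> + q) * q + (\<mu> + q) * X t)) * f1 t" .
    then have 2: "(f1 has_vector_derivative - \<i> * of_real (2 * ((\<mu> + q) * q + (\<mu> + q) * X t)) * f1 t) (at t)"
      using fourier_derivative[of 1 t] fourier_square(2)[OF u_wiener u_L2_plus, of t]
      by (simp add: f1_def g_def c_def mult.assoc)
    from 1 2 show ?thesis by blast
  qed
  have "((\<lambda>t. (norm (f1 t))\<^sup>2) has_real_derivative 0) (at t)" for t
  proof -
    have "cnj (f1 t) * (- \<i> * of_real (2 * ((\<mu> + q) * q + (\<mu> + q) * X t)) * f1 t)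
      = - \<i> * of_real (2 * ((\<mu> + q) * q + (\<mu> + q) * X t) * (norm (f1 t))\<^sup>2)"
      unfolding of_real_mult[of _ "(norm (f1 t))\<^sup>2"] complex_norm_square by simp
    then have "Re (cnj (f1 t) * (- \<i> * of_real (2 * ((\<mu> + q) * q + (\<mu> + q) * X t)) * f1 t)) = 0"
      by (simp only: mult_minus_left uminus_complex.sel Re_i_times Im_complex_of_real)
    then show ?thesis using has_real_derivative_norm_square[OF conjunct2[OF main[of t]]] by simp
  qed
  from const_from_derivative[OF this] have "(norm (kap t))\<^sup>2 = (norm (kap 0))\<^sup>2" for t
    using main[of t] main[of 0] by metis
  then have "norm (kap t) = norm (kap 0)" for t by simp
  then have "norm (kap 0) \<le> norm (kap t)" for t using eq_refl by metis
  then show ?thesis by (rule bounded_of_kap[rotated]) (use kap_nonzero[of 0] r in auto)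
qed

lemma ell_eq:
  assumes "m1 0 \<noteq> m2 0"
  shows "(m1 0 - m2 0) * ell 1 (u t) = K - (Q 0)\<^sup>2 * (Q 0 + m2 0)"
proof -
  have ne: "\<sigma>1 t \<noteq> \<sigma>2 t" using assms unfolding m_sigma[of t] by auto
  have "ell 1 (u t) = (2 * Q t + m1 t) * (norm (A1 t))\<^sup>2 - (norm (W1 t))\<^sup>2"
    using hankel_pair.ell_1[OF hp ne] unfolding hp_defs
    by (simp add: Q_def A1_def W1_def m1_def B1_def c_def)
  then have "ell 1 (u t) = (2 * Q 0 + m1 0) * (norm (A1 t))\<^sup>2 - (norm (W1 t))\<^sup>2"
    by (simp only: Q_const[of t] m_const[of t])
  then show ?thesis using szego_state.ell_eq[OF state, of t] unfolding szego_state.x_def[OF state] by simp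
qed

lemma two_simple: "two_simple_eigenvalues (u t) \<longleftrightarrow> m1 0 \<noteq> m2 0"
  unfolding hankel_pair.two_simple_iff[OF hp, of t] m_sigma[of t]
  using hankel_pair.\<sigma>[OF hp, of t] by (auto simp: power2_eq_iff)

end

section \<open>Exponential growth\<close>

text \<open>The linear equation \<open>Y'' = \<nu> Y - b\<close> together with a first integral; since \<open>a > 0\<close> the latter
  forces both exponential modes to be present.\<close>

lemma exponential_ode:
  fixes Y V :: "real \<Rightarrow> real"
  assumes Y': "\<And>t. (Y has_real_derivative V t) (at t)"
    and V': "\<And>t. (V has_real_derivative \<nu> * Y t - b) (at t)"
    and V2: "\<And>t. (V t)\<^sup>2 = \<nu> * (Y t)\<^sup>2 - 2 * b * Y t - a"
    and pos: "\<And>t. Y t > 0" "a > 0" "b > 0"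
  obtains k c1 c2 where "k > 0" "c1 > 0" "c2 > 0"
    "\<And>t. c1 * exp (k * \<bar>t\<bar>) \<le> Y t" "\<And>t. Y t \<le> c2 * exp (k * \<bar>t\<bar>)"
proof -
  \<comment> \<open>Positivity of \<open>\<nu>\<close> is forced by the first integral at time
    0.\<close>
  have "\<nu> * (Y 0)\<^sup>2 = (V 0)\<^sup>2 + 2 * b * Y 0 + a" using V2[of 0] by simp
  moreover have "\<dots> > 0" using pos by (intro add_nonneg_pos add_nonneg_nonneg) (auto simp: less_imp_le)
  ultimately have "0 < \<nu> * (Y 0)\<^sup>2" by (simp only:)
  then have "\<nu> > 0" by (rule zero_less_mult_pos2) (use pos(1)[of 0] in simp)
  define k where "k = sqrt \<nu>"
  have k: "k > 0" "k * k = \<nu>" using \<open>\<nu> > 0\<close> by (simp_all add: k_def)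
  \<comment> \<open>The deviation from the equilibrium; \<open>k * Z + V\<close> and
    \<open>k * Z - V\<close> are the growing and the decaying mode.\<close>
  define Z where "Z = (\<lambda>t. Y t - b / \<nu>)"
  have kb: "k * (k * (b / \<nu>)) = b" using k \<open>\<nu> > 0\<close> by (simp flip: mult.assoc)
  have kZ: "k * (k * Z t) = \<nu> * Y t - b" for t
    unfolding Z_def right_diff_distrib kb using k(2) by (simp flip: mult.assoc)
  have Z': "(Z has_real_derivative V t) (at t)" for t
    unfolding Z_def using DERIV_diff[OF Y' DERIV_const] by simp
  have p: "((\<lambda>t. exp (- (k * t)) * (k * Z t + V t)) has_real_derivative 0) (at t)" for t
  proof -
    have "((\<lambda>t. exp (- (k * t)) * (k * Z t + V t)) has_real_derivative
       exp (- (k * t)) * (k * V t + (\<nu> * Y t - b)) + exp (- (k * t)) * (- (k * 1)) * (k * Z t + V t)) (at t)"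
      by (intro DERIV_mult' DERIV_add DERIV_cmult Z' V' DERIV_fun_exp DERIV_minus DERIV_ident)
    moreover have "exp (- (k * t)) * (k * V t + (\<nu> * Y t - b)) + exp (- (k * t)) * (- (k * 1)) * (k * Z t + V t) = 0"
      unfolding kZ[symmetric] by (simp add: algebra_simps)
    ultimately show ?thesis by simp
  qed
  have m: "((\<lambda>t. exp (k * t) * (k * Z t - V t)) has_real_derivative 0) (at t)" for t
  proof -
    have "((\<lambda>t. exp (k * t) * (k * Z t - V t)) has_real_derivative
       exp (k * t) * (k * V t - (\<nu> * Y t - b)) + exp (k * t) * (k * 1) * (k * Z t - V t)) (at t)"
      by (intro DERIV_mult' DERIV_diff DERIV_cmult Z' V' DERIV_fun_exp DERIV_ident)
    moreover have "exp (k * t) * (k * V t - (\<nu> * Y t - b)) + exp (k * t) * (k * 1) * (k * Z t - V t) = 0"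
      unfolding kZ[symmetric] by (simp add: algebra_simps)
    ultimately show ?thesis by simp
  qed
  define \<alpha> \<beta> where "\<alpha> = k * Z 0 + V 0" and "\<beta> = k * Z 0 - V 0"
  have pt: "k * Z t + V t = \<alpha> * exp (k * t)" for t
  proof -
    have "exp (- (k * t)) * (k * Z t + V t) = \<alpha>" using const_from_derivative[OF p, of t] by (simp add: \<alpha>_def)
    then show ?thesis by (simp add: exp_minus field_simps)
  qed
  have mt: "k * Z t - V t = \<beta> * exp (- (k * t))" for t
  proof -
    have "exp (k * t) * (k * Z t - V t) = \<beta>" using const_from_derivative[OF m, of t] by (simp add: \<beta>_def)
    then show ?thesis by (simp add: exp_minus field_simps)
  qed
  have Yt: "Y t = b / \<nu> + (\<alpha> * exp (k * t) + \<beta> * exp (- (k * t))) / (2 * k)" for t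
    unfolding pt[symmetric] mt[symmetric] using k by (simp add: Z_def)
  \<comment> \<open>By the first integral the product of the amplitudes is
    \<open>a + b^2 / \<nu>\<close>, so they have the same sign; \<open>Z 0 > 0\<close> below makes
    both positive.\<close>
  have "\<alpha> * \<beta> = k * (k * Z 0) * Z 0 - (V 0)\<^sup>2" unfolding \<alpha>_def \<beta>_def by (simp add: algebra_simps power2_eq_square)
  also have "\<dots> = a + b * (b / \<nu>)"
    unfolding kZ V2 unfolding Z_def using \<open>\<nu> > 0\<close> by (simp add: field_simps power2_eq_square)
  also have "\<dots> > 0" using pos \<open>\<nu> > 0\<close> by (intro add_pos_pos mult_pos_pos) auto
  finally have prod: "\<alpha> * \<beta> > 0" .
  have "\<nu> * Y 0 > b"
  proof -
    have "\<nu> * (Y 0)\<^sup>2 \<ge> 2 * b * Y 0 + a" using V2[of 0] zero_le_power2[of "V 0"] by linarith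
    then have "2 * b * Y 0 < \<nu> * (Y 0)\<^sup>2" using pos(2) by linarith
    then have "2 * b * Y 0 < \<nu> * Y 0 * Y 0" by (simp only: power2_eq_square mult.assoc)
    then have "2 * b < \<nu> * Y 0" by (rule mult_right_less_imp_less) (use pos(1)[of 0] in simp)
    then show ?thesis using pos(3) by linarith
  qed
  then have "Z 0 > 0" unfolding Z_def using \<open>\<nu> > 0\<close> by (simp add: field_simps)
  then have "\<alpha> + \<beta> > 0" using k by (simp add: \<alpha>_def \<beta>_def)
  with prod have ab: "\<alpha> > 0" "\<beta> > 0" by (auto simp: zero_less_mult_iff)
  show thesis
  proof (rule that)
    show "k > 0" by fact
    show "min \<alpha> \<beta> / (2 * k) > 0" using ab k by simp
    show "b / \<nu> + (\<alpha> + \<beta>) / (2 * k) > 0" using ab k pos \<open>\<nu> > 0\<close> by (intro add_pos_pos divide_pos_pos) auto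
    fix t
    have e: "exp (k * \<bar>t\<bar>) = exp (k * t) \<or> exp (k * \<bar>t\<bar>) = exp (- (k * t))" by (cases "t \<ge> 0") auto
    have le: "exp (k * t) \<le> exp (k * \<bar>t\<bar>)" "exp (- (k * t)) \<le> exp (k * \<bar>t\<bar>)" "1 \<le> exp (k * \<bar>t\<bar>)"
      using k by (auto simp: abs_if)
    have "min \<alpha> \<beta> * exp (k * \<bar>t\<bar>) \<le> \<alpha> * exp (k * t) + \<beta> * exp (- (k * t))"
    proof -
      have "min \<alpha> \<beta> * exp (k * t) \<le> \<alpha> * exp (k * t)" "min \<alpha> \<beta> * exp (- (k * t)) \<le> \<beta> * exp (- (k * t))"
        by (intro mult_right_mono; simp)+
      moreover have "\<alpha> * exp (k * t) \<ge> 0" "\<beta> * exp (- (k * t)) \<ge> 0" using ab by simp_all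
      ultimately have "min \<alpha> \<beta> * exp (k * t) \<le> \<alpha> * exp (k * t) + \<beta> * exp (- (k * t))"
        "min \<alpha> \<beta> * exp (- (k * t)) \<le> \<alpha> * exp (k * t) + \<beta> * exp (- (k * t))" by linarith+
      then show ?thesis using e by metis
    qed
    then have "min \<alpha> \<beta> * exp (k * \<bar>t\<bar>) / (2 * k) \<le> (\<alpha> * exp (k * t) + \<beta> * exp (- (k * t))) / (2 * k)"
      using k by (intro divide_right_mono) auto
    moreover have "b / \<nu> \<ge> 0" using pos \<open>\<nu> > 0\<close> by simp
    ultimately show "min \<alpha> \<beta> / (2 * k) * exp (k * \<bar>t\<bar>) \<le> Y t" unfolding Yt[of t] by simp
    have "(\<alpha> * exp (k * t) + \<beta> * exp (- (k * t))) / (2 * k) \<le> (\<alpha> * exp (k * \<bar>t\<bar>) + \<beta> * exp (k * \<bar>t\<bar>)) / (2 * k)"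
      using le ab k by (intro divide_right_mono add_mono mult_left_mono) auto
    moreover have "b / \<nu> * 1 \<le> b / \<nu> * exp (k * \<bar>t\<bar>)" using le pos \<open>\<nu> > 0\<close> by (intro mult_left_mono) auto
    ultimately show "Y t \<le> (b / \<nu> + (\<alpha> + \<beta>) / (2 * k)) * exp (k * \<bar>t\<bar>)"
      unfolding Yt[of t] by (simp add: algebra_simps add_divide_distrib)
  qed
qed

locale zero_ell_data = szego_data +
  assumes m_neq: "m1 0 \<noteq> m2 0" and K_zero_ell: "K = (Q 0)\<^sup>2 * (Q 0 + m2 0)"
begin

lemma zstate: "zero_ell_state (m1 0) (m2 0) (Q 0) K (A1 t) (A2 t) (B1 t) (B2 t) (c t) (W1 t) (W2 t) (J t)"
  by (intro zero_ell_state.intro state zero_ell_state_axioms.intro m_neq K_zero_ell)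

abbreviation "\<mu>1 \<equiv> m1 0"
abbreviation "\<mu>2 \<equiv> m2 0"
abbreviation "q \<equiv> Q 0"
abbreviation "m \<equiv> \<mu>1 - \<mu>2"
abbreviation "n \<equiv> 3 * q\<^sup>2 + 2 * q * \<mu>2"
abbreviation "k0 \<equiv> 4 * K * (2 * q + \<mu>1)"

definition "x t = (norm (A1 t))\<^sup>2"

lemma x_state: "szego_state.x (A1 t) = x t" "szego_state.E \<mu>1 \<mu>2 (A1 t) (A2 t) = Ee t"
  "szego_state.R (c t) (J t) = Re (\<zeta> t)"
  unfolding szego_state.x_def[OF state] Ee_def szego_state.R_def[OF state] by (simp_all add: x_def \<zeta>_def)

lemma mu_pos: "\<mu>2 > 0" "\<mu>1 > 0" "m > 0" "q > 0"
  using m_pos[of 0] m_neq Q_pos[of 0] by simp_all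

lemma n_pos: "n > 0" using mu_pos by (simp add: add_pos_pos)

text \<open>If \<open>A1 t = 0\<close>, the vanishing of \<open>ell\<close> gives
  \<open>W1 t = 0\<close> as well, hence \<open>kap t = 0\<close>, which is excluded at every
  time.\<close>

lemma x_bounds: "x t > 0" "x t \<le> q"
proof -
  have "A1 t \<noteq> 0"
  proof
    assume A: "A1 t = 0"
    then have "W1 t = 0" using zero_ell_state.norm_W_eq(1)[OF zstate, of t] unfolding x_state x_def by simp
    then show False using szego_state.kappa_degenerate(1)[OF state A] kap_nonzero[of t] by (simp add: kap_def A)
  qed
  then show "x t > 0" by (simp add: x_def)
  show "x t \<le> q" using szego_state.x_bounds(2)[OF state, of t] unfolding x_state .
qed

lemma Ee_x: "Ee t = \<mu>1 * (q + \<mu>2) - m * x t"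
  using szego_state.E_eq[OF state, of t] unfolding x_state .

lemma Ee_pos: "Ee t > 0"
  using szego_state.E_bounds(3)[OF state, of t] unfolding x_state .

lemma Ee_derivative: "(Ee has_real_derivative 2 * (Ee t * Im (\<zeta> t))) (at t)"
proof -
  have eq: "Ee = (\<lambda>t. \<mu>1 * \<mu>2 / D t)"
    using D_Ee Ee_pos mu_pos by (auto simp: fun_eq_iff)
  have "((\<lambda>t. \<mu>1 * \<mu>2 / D t) has_real_derivative (0 * D t - \<mu>1 * \<mu>2 * (- 2 * Im (\<zeta> t) * D t)) / (D t * D t)) (at t)"
    using D_pos[of t] by (intro DERIV_divide DERIV_const D_derivative) auto
  then show ?thesis unfolding eq using D_pos[of t] by (simp add: field_simps)
qed

lemma x_derivative: "(x has_real_derivative - (2 / m) * (Ee t * Im (\<zeta> t))) (at t)"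
proof -
  have eq: "x = (\<lambda>t. (\<mu>1 * (q + \<mu>2) - Ee t) / m)"
    using Ee_x mu_pos by (auto simp: fun_eq_iff)
  have "((\<lambda>t. (\<mu>1 * (q + \<mu>2) - Ee t) / m) has_real_derivative (0 - 2 * (Ee t * Im (\<zeta> t))) / m) (at t)"
    by (intro DERIV_cdivide DERIV_diff DERIV_const Ee_derivative)
  then show ?thesis unfolding eq by simp
qed

lemma zeta_norm: "(Re (\<zeta> t))\<^sup>2 + (Im (\<zeta> t))\<^sup>2 = (norm (c t))\<^sup>2 * K"
  unfolding J_norm[of t, symmetric] cmod_power2[symmetric] by (simp add: \<zeta>_def norm_mult power_mult_distrib)

lemma g_square: "(Ee t * Im (\<zeta> t))\<^sup>2 = m\<^sup>2 * (x t)\<^sup>2 * (k0 - (m * x t + n)\<^sup>2) / 4"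
proof -
  have "(Ee t * Im (\<zeta> t))\<^sup>2 = (Ee t)\<^sup>2 * ((norm (c t))\<^sup>2 * K) - (Ee t * Re (\<zeta> t))\<^sup>2"
    unfolding zeta_norm[symmetric] by (simp add: power_mult_distrib algebra_simps)
  then show ?thesis using zero_ell_state.poly_norm[OF zstate, of t] unfolding x_state by simp
qed

lemma g_derivative:
  "((\<lambda>t. Ee t * Im (\<zeta> t)) has_real_derivative
     - (m / 2) * (k0 * x t - x t * (m * x t + n)\<^sup>2 - m * (x t)\<^sup>2 * (m * x t + n))) (at t)"
proof -
  have h: "h2 t = q\<^sup>2 + \<mu>1 * x t + \<mu>2 * (q - x t)"
    using static(4)[of t] szego_state.A2_sq[OF state, of t] m_const[of t] Q_const[of t]
    unfolding x_state by (simp add: x_def)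
  have "((\<lambda>t. Ee t * Im (\<zeta> t)) has_real_derivative
     2 * (Ee t * Im (\<zeta> t)) * Im (\<zeta> t) +
     (2 * Q t * K + (Re (\<zeta> t))\<^sup>2 - (Im (\<zeta> t))\<^sup>2 - (2 * h2 t + (Q t)\<^sup>2) * Re (\<zeta> t)) * Ee t) (at t)"
    by (intro DERIV_mult Ee_derivative zeta_Im_derivative)
  moreover have "2 * (Ee t * Im (\<zeta> t)) * Im (\<zeta> t) +
     (2 * Q t * K + (Re (\<zeta> t))\<^sup>2 - (Im (\<zeta> t))\<^sup>2 - (2 * h2 t + (Q t)\<^sup>2) * Re (\<zeta> t)) * Ee t
    = Ee t * ((norm (c t))\<^sup>2 * K) + 2 * q * K * Ee t - (2 * (q\<^sup>2 + \<mu>1 * x t + \<mu>2 * (q - x t)) + q\<^sup>2) * (Ee t * Re (\<zeta> t))"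
    unfolding zeta_norm[symmetric] h Q_const[of t] by (simp add: algebra_simps power2_eq_square)
  ultimately show ?thesis using zero_ell_state.poly_deriv[OF zstate, of t] unfolding x_state by simp
qed

text \<open>In the variable \<open>1 / x\<close> the autonomous equation for \<open>x\<close> has a
  quadratic right side with constant term \<open>- m^2\<close>, so differentiating once more gives a
  linear equation and \<open>exponential_ode\<close> applies.\<close>

lemma x_asymp:
  obtains k c1 c2 where "k > 0" "c1 > 0" "c2 > 0"
    "\<And>t. c1 * exp (k * \<bar>t\<bar>) \<le> 1 / x t" "\<And>t. 1 / x t \<le> c2 * exp (k * \<bar>t\<bar>)"
proof -
  define g where "g = (\<lambda>t. Ee t * Im (\<zeta> t))"
  define V where "V = (\<lambda>t. (2 / m) * g t / (x t)\<^sup>2)"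
  have g2: "(g t)\<^sup>2 = m\<^sup>2 * (x t)\<^sup>2 * (k0 - (m * x t + n)\<^sup>2) / 4" for t unfolding g_def by (rule g_square)
  have x': "(x has_real_derivative - (2 / m) * g t) (at t)" for t unfolding g_def by (rule x_derivative)
  have Y': "((\<lambda>t. 1 / x t) has_real_derivative V t) (at t)" for t
  proof -
    have "((\<lambda>t. 1 / x t) has_real_derivative (0 * x t - 1 * (- (2 / m) * g t)) / (x t * x t)) (at t)"
      using x_bounds(1)[of t] by (intro DERIV_divide DERIV_const x') auto
    then show ?thesis by (simp add: V_def power2_eq_square)
  qed
  have V2: "(V t)\<^sup>2 = (k0 - n\<^sup>2) * (1 / x t)\<^sup>2 - 2 * (m * n) * (1 / x t) - m\<^sup>2" for t
  proof -
    have "(V t)\<^sup>2 = (4 / m\<^sup>2) * (g t)\<^sup>2 / ((x t)\<^sup>2 * (x t)\<^sup>2)" by (simp add: V_def power_divide power_mult_distrib flip: power_add)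
    also have "\<dots> = (k0 - (m * x t + n)\<^sup>2) / (x t)\<^sup>2" unfolding g2 using mu_pos(3) x_bounds(1)[of t] by (simp add: field_simps)
    also have "\<dots> = (k0 - n\<^sup>2) * (1 / x t)\<^sup>2 - 2 * (m * n) * (1 / x t) - m\<^sup>2"
    proof -
      have "(k0 - (a * y + b)\<^sup>2) / y\<^sup>2 = (k0 - b\<^sup>2) * (1 / y)\<^sup>2 - 2 * (a * b) * (1 / y) - a\<^sup>2" if "y > 0" for a b y :: real
        using that by (simp add: field_simps power2_eq_square)
      from this[OF x_bounds(1)] show ?thesis .
    qed
    finally show ?thesis .
  qed
  have V': "(V has_real_derivative (k0 - n\<^sup>2) * (1 / x t) - m * n) (at t)" for t
  proof -
    define G where "G = - (m / 2) * (k0 * x t - x t * (m * x t + n)\<^sup>2 - m * (x t)\<^sup>2 * (m * x t + n))"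
    have gd: "(g has_real_derivative G) (at t)" unfolding g_def G_def by (rule g_derivative)
    have "((\<lambda>t. (2 / m) * g t / (x t)\<^sup>2) has_real_derivative
      ((2 / m) * G * (x t)\<^sup>2 - (2 / m) * g t * (real 2 * (- (2 / m) * g t * x t ^ (2 - Suc 0)))) / ((x t)\<^sup>2 * (x t)\<^sup>2)) (at t)"
      using x_bounds(1)[of t] by (intro DERIV_divide DERIV_cmult gd DERIV_power x') auto
    moreover have "((2 / m) * G * (x t)\<^sup>2 - (2 / m) * g t * (real 2 * (- (2 / m) * g t * x t ^ (2 - Suc 0)))) / ((x t)\<^sup>2 * (x t)\<^sup>2)
       = (k0 - n\<^sup>2) * (1 / x t) - m * n"
    proof -
      have *: "((2 / a) * (- (a / 2) * (k0 * y - y * (a * y + b)\<^sup>2 - a * y\<^sup>2 * (a * y + b))) * y\<^sup>2 + 8 / a\<^sup>2 * (a\<^sup>2 * y\<^sup>2 * (k0 - (a * y + b)\<^sup>2) / 4) * y) / (y\<^sup>2 * y\<^sup>2)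
        = (k0 - b\<^sup>2) * (1 / y) - a * b" if "y > 0" "a > 0" for a b y :: real
        using that by (simp add: field_simps power2_eq_square)
      have "(2 / m) * g t * (real 2 * (- (2 / m) * g t * x t ^ (2 - Suc 0))) = - (8 / m\<^sup>2 * (g t)\<^sup>2 * x t)"
        by (simp add: power2_eq_square)
      then show ?thesis using *[OF x_bounds(1) mu_pos(3), of t n] unfolding g2[symmetric] G_def by simp
    qed
    ultimately show ?thesis unfolding V_def by simp
  qed
  show thesis
    by (rule exponential_ode[OF Y' V' V2]) (use x_bounds(1) mu_pos n_pos that in auto)
qed

lemma kap_ge:
  obtains \<gamma> where "\<gamma> > 0" "\<And>t. \<gamma> * x t \<le> (norm (kap t))\<^sup>2 / (2 * Ee t)"
proof -
  define \<delta> where "\<delta> = \<mu>2 * q\<^sup>2 / (\<mu>1 * (q + \<mu>2) * sqrt \<mu>1 * (1 + sqrt q / sqrt \<mu>2))"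
  have pos: "\<mu>1 * (q + \<mu>2) > 0" using mu_pos by (intro mult_pos_pos) auto
  have "1 + sqrt q / sqrt \<mu>2 > 0" using mu_pos by (intro add_pos_pos) auto
  then have \<delta>: "\<delta> > 0" unfolding \<delta>_def using mu_pos pos by (intro divide_pos_pos mult_pos_pos) auto
  show thesis
  proof (rule that)
    show "\<delta>\<^sup>2 / (2 * (\<mu>1 * (q + \<mu>2))) > 0" using \<delta> pos by simp
    fix t
    have "sqrt (x t) * \<delta> \<le> norm (kap t)"
      using zero_ell_state.kappa_ge[OF zstate, of t] unfolding x_state kap_def[symmetric] \<delta>_def .
    then have "(sqrt (x t) * \<delta>)\<^sup>2 \<le> (norm (kap t))\<^sup>2" using \<delta> x_bounds(1)[of t] by (intro power_mono) auto
    then have "x t * \<delta>\<^sup>2 \<le> (norm (kap t))\<^sup>2" using x_bounds(1)[of t] by (simp add: power_mult_distrib)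
    then have "x t * \<delta>\<^sup>2 / (2 * (\<mu>1 * (q + \<mu>2))) \<le> (norm (kap t))\<^sup>2 / (2 * Ee t)"
      using szego_state.E_bounds(2)[OF state, of t] Ee_pos[of t] unfolding x_state by (intro frac_le) auto
    then show "\<delta>\<^sup>2 / (2 * (\<mu>1 * (q + \<mu>2))) * x t \<le> (norm (kap t))\<^sup>2 / (2 * Ee t)" by (simp add: mult.commute)
  qed
qed

text \<open>\<open>b1\<close> is of order \<open>sqrt x\<close>, and so is \<open>s21\<close> by
  \<open>s21_eq\<close> and \<open>cross_le\<close>; \<open>s22\<close> stays away from the unit
  circle because \<open>b2\<close> stays away from 0. Then \<open>e1_fourier_bound\<close>
  applies.\<close>

lemma e1_small:
  obtains \<gamma> x0 where "\<gamma> > 0" "x0 > 0" "\<And>t j. x t \<le> x0 \<Longrightarrow> (norm (fourier (E1 t) (int j)))\<^sup>2 \<le> \<gamma> * x t"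
proof -
  \<comment> \<open>Half the value of the squared modulus of \<open>B2\<close> at
    \<open>x = 0\<close>; the threshold for \<open>x\<close> chosen below keeps the numerator in
    \<open>norm_B2\<close> above half of its value there.\<close>
  define \<beta> where "\<beta> = q / (2 * (q + \<mu>2))"
  have \<beta>: "0 < \<beta>" "\<beta> < 1" using mu_pos unfolding \<beta>_def by (auto simp: field_simps add_pos_pos)
  define r where "r = sqrt (1 - \<beta>)"
  have r: "r < 1" "r \<ge> 0" using \<beta> by (simp_all add: r_def)
  define S where "S = sqrt \<mu>2 * (1 + sqrt q / sqrt \<mu>2) / m"
  have S: "S \<ge> 0" using mu_pos by (simp add: S_def)
  define \<gamma> where "\<gamma> = 1 / sqrt \<mu>2 + S / (1 - r)"
  have \<gamma>: "\<gamma> > 0" unfolding \<gamma>_def using mu_pos S r by (intro add_pos_nonneg) auto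
  show thesis
  proof (rule that)
    show "\<gamma>\<^sup>2 > 0" using \<gamma> by simp
    show "\<mu>1 * q / (2 * (\<mu>1 + q)) > 0" using mu_pos by simp
    fix t j assume x: "x t \<le> \<mu>1 * q / (2 * (\<mu>1 + q))"
    interpret h: hankel_pair "u t" "E1 t" "E2 t" "\<sigma>1 t" "\<sigma>2 t" "s t" "d t" by (rule hp)
    have ab: "h.a1 = A1 t" "h.a2 = A2 t" "h.b1 = B1 t" "h.b2 = B2 t"
      by (simp_all add: h.a1_def h.a2_def h.b1_def h.b2_def A1_def A2_def B1_def B2_def)
    have \<sigma>: "(\<sigma>1 t)\<^sup>2 = \<mu>1" "(\<sigma>2 t)\<^sup>2 = \<mu>2" "\<sigma>2 t = sqrt \<mu>2" using m_const[of t] sqrt_m[of t] by (simp_all add: m1_def m2_def)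
    have "norm (cnj h.s21 * (of_real ((\<sigma>2 t)\<^sup>2) - of_real ((\<sigma>1 t)\<^sup>2))) = norm (of_real (\<sigma>2 t) * (B2 t * A1 t - B1 t * A2 t))"
      using arg_cong[OF h.s21_eq, of norm] unfolding ab by simp
    then have "norm h.s21 * m = sqrt \<mu>2 * norm (B2 t * A1 t - B1 t * A2 t)"
      unfolding \<sigma> using mu_pos by (simp add: norm_mult flip: of_real_diff)
    also have "\<dots> \<le> sqrt \<mu>2 * (norm (B2 t) * norm (A1 t) + norm (B1 t) * norm (A2 t))"
      using norm_triangle_ineq4[of "B2 t * A1 t" "B1 t * A2 t"] mu_pos by (intro mult_left_mono) (auto simp: norm_mult)
    also have "\<dots> \<le> sqrt \<mu>2 * (sqrt (x t) * (1 + sqrt q / sqrt \<mu>2))"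
      using zero_ell_state.cross_le[OF zstate, of t] mu_pos unfolding x_state by (intro mult_left_mono) auto
    finally have s21: "norm h.s21 \<le> S * sqrt (x t)"
      using mu_pos by (simp add: S_def pos_le_divide_eq mult_ac)
    have "\<beta> \<le> (norm (B2 t))\<^sup>2"
    proof -
      have "x t * (\<mu>1 + q) \<le> \<mu>1 * q / 2" using x mu_pos by (simp add: field_simps)
      then have "\<mu>1 * q / 2 \<le> \<mu>1 * q - x t * (\<mu>1 + q)" by linarith
      moreover have "0 < \<mu>1 * q" using mu_pos by simp
      ultimately have "(\<mu>1 * q / 2) / (\<mu>1 * (q + \<mu>2)) \<le> (\<mu>1 * q - x t * (\<mu>1 + q)) / Ee t"
        using szego_state.E_bounds(2)[OF state, of t] Ee_pos[of t] mu_pos unfolding x_state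
        by (intro frac_le) linarith+
      also have "\<dots> = (norm (B2 t))\<^sup>2" using zero_ell_state.norm_B2[OF zstate, of t] unfolding x_state by simp
      also have "(\<mu>1 * q / 2) / (\<mu>1 * (q + \<mu>2)) = \<beta>" using mu_pos by (simp add: \<beta>_def)
      finally show ?thesis .
    qed
    then have "(norm h.s22)\<^sup>2 \<le> 1 - \<beta>"
      using h.s_norm(2) zero_le_power2[of "norm h.s12"] unfolding ab by linarith
    then have s22: "norm h.s22 \<le> r" unfolding r_def by (rule real_le_rsqrt)
    have "norm (fourier (E1 t) (int j)) \<le> norm (B1 t) + norm h.s21 / (1 - r)"
      using h.e1_fourier_bound[OF s22 r(1), of j] unfolding ab .
    also have "\<dots> \<le> sqrt (x t) / sqrt \<mu>2 + S * sqrt (x t) / (1 - r)"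
      using zero_ell_state.norm_B1_le[OF zstate, of t] s21 r unfolding x_state by (intro add_mono divide_right_mono) auto
    also have "\<dots> = \<gamma> * sqrt (x t)" by (simp add: \<gamma>_def algebra_simps)
    finally have "(norm (fourier (E1 t) (int j)))\<^sup>2 \<le> (\<gamma> * sqrt (x t))\<^sup>2" by (intro power_mono) auto
    then show "(norm (fourier (E1 t) (int j)))\<^sup>2 \<le> \<gamma>\<^sup>2 * x t" using x_bounds(1)[of t] by (simp add: power_mult_distrib)
  qed
qed

lemma Hs_growth_upper:
  assumes r: "r > 1/2"
  obtains C where "C > 0" "\<And>t. Hs_sum r (u t) \<le> q + C * (1 / x t) powr (2 * r - 1)"
proof -
  obtain \<gamma> where \<gamma>: "\<gamma> > 0" "\<And>t. \<gamma> * x t \<le> (norm (kap t))\<^sup>2 / (2 * Ee t)" by (rule kap_ge) (rule that)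
  \<comment> \<open>The cap \<open>1 / q\<close> ensures \<open>\<delta> * x t \<le> 1\<close>, as
    \<open>Hs_sum_le\<close> requires of the rate.\<close>
  define \<delta> where "\<delta> = min \<gamma> (1 / q)"
  have \<delta>: "\<delta> > 0" using \<gamma> mu_pos by (simp add: \<delta>_def)
  define C where "C = Hs_growth r * (\<mu>1 + \<mu>2) * \<delta> powr (1 - 2 * r)"
  have "Hs_growth r > 0" unfolding Hs_growth_def by (intro mult_pos_pos add_pos_nonneg) auto
  then have C: "C > 0" using \<delta> mu_pos by (simp add: C_def)
  show thesis
  proof (rule that[OF C])
    fix t
    note x = x_bounds[of t]
    have "\<delta> * x t \<le> 1 / q * q" using x \<delta> mu_pos by (intro mult_mono) (auto simp: \<delta>_def)
    then have 1: "\<delta> * x t \<le> 1" using mu_pos by simp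
    have "\<delta> * x t \<le> \<gamma> * x t" using x by (intro mult_right_mono) (auto simp: \<delta>_def)
    then have "\<delta> * x t \<le> (norm (kap t))\<^sup>2 / (2 * Ee t)" using \<gamma>(2)[of t] by linarith
    then have "Hs_sum r (u t) \<le> q + Hs_growth r * (\<mu>1 + \<mu>2) * (\<delta> * x t) powr (1 - 2 * r)"
      using \<delta> x 1 r by (intro Hs_sum_le) auto
    also have "(\<delta> * x t) powr (1 - 2 * r) = \<delta> powr (1 - 2 * r) * (1 / x t) powr (2 * r - 1)"
      using \<delta> x powr_minus_divide[of "x t" "2 * r - 1"] by (simp add: powr_mult powr_divide)
    finally show "Hs_sum r (u t) \<le> q + C * (1 / x t) powr (2 * r - 1)" by (simp add: C_def mult.assoc)
  qed
qed

lemma Hs_growth_lower: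
  assumes r: "r > 1/2"
  obtains C x0 where "C > 0" "x0 > 0" "\<And>t. x t \<le> x0 \<Longrightarrow> C * (1 / x t) powr (2 * r - 1) \<le> Hs_sum r (u t)"
proof -
  obtain \<gamma> x0 where \<gamma>: "\<gamma> > 0" "x0 > 0" "\<And>t j. x t \<le> x0 \<Longrightarrow> (norm (fourier (E1 t) (int j)))\<^sup>2 \<le> \<gamma> * x t"
    by (rule e1_small) (rule that)
  define C where "C = (1 / (4 * \<gamma>)) powr (2 * r - 1) * (\<mu>1 / 2)"
  have C: "C > 0" using \<gamma> mu_pos by (simp add: C_def)
  define x1 where "x1 = min x0 (1 / (2 * \<gamma>))"
  have x1: "x1 > 0" using \<gamma> by (simp add: x1_def)
  show thesis
  proof (rule that[OF C x1])
    fix t assume le: "x t \<le> x1"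
    note x = x_bounds[of t]
    have "x t \<le> 1 / (2 * \<gamma>)" using le by (simp add: x1_def)
    then have y: "1 \<le> 1 / (2 * (\<gamma> * x t))" using \<gamma> x by (simp add: field_simps)
    \<comment> \<open>The largest number of coefficients that together carry at most half of the
      norm of \<open>E1 t\<close>.\<close>
    define N where "N = nat \<lfloor>1 / (2 * (\<gamma> * x t))\<rfloor>"
    have "nat \<lfloor>z\<rfloor> \<ge> 1 \<and> real (nat \<lfloor>z\<rfloor>) \<le> z \<and> z / 2 \<le> real (nat \<lfloor>z\<rfloor>)" if "1 \<le> z" for z :: real
    proof -
      have "1 \<le> \<lfloor>z\<rfloor>" using that by simp
      moreover from this have "1 \<le> nat \<lfloor>z\<rfloor>" by linarith
      moreover have "real (nat \<lfloor>z\<rfloor>) = of_int \<lfloor>z\<rfloor>" using that by simp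
      moreover have "of_int \<lfloor>z\<rfloor> \<le> z" "z < of_int \<lfloor>z\<rfloor> + 1" "1 \<le> real_of_int \<lfloor>z\<rfloor>" using that by simp_all
      ultimately show ?thesis by (intro conjI) linarith+
    qed
    from this[OF y] have N: "N \<ge> 1" "real N \<le> 1 / (2 * (\<gamma> * x t))" "1 / (2 * (\<gamma> * x t)) / 2 \<le> real N"
      unfolding N_def by blast+
    have Nb: "real N * (\<gamma> * x t) \<le> 1 / 2"
    proof -
      have "real N * (\<gamma> * x t) \<le> 1 / (2 * (\<gamma> * x t)) * (\<gamma> * x t)"
        using N(2) \<gamma>(1) x(1) by (intro mult_right_mono) auto
      then show ?thesis using \<gamma>(1) x(1) by simp
    qed
    have "real N powr (2 * r - 1) * ((\<sigma>1 t)\<^sup>2 / 2) \<le> Hs_sum r (u t)"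
      using le \<gamma>(3) by (intro hankel_pair.Hs_sum_lower[OF hp r _ Nb N(1)]) (auto simp: x1_def)
    moreover have "(\<sigma>1 t)\<^sup>2 = \<mu>1" using m_const[of t] by (simp add: m1_def)
    ultimately have 1: "real N powr (2 * r - 1) * (\<mu>1 / 2) \<le> Hs_sum r (u t)" by simp
    have "(1 / (4 * \<gamma>) * (1 / x t)) powr (2 * r - 1) \<le> real N powr (2 * r - 1)"
      using N(3) r \<gamma> x by (intro powr_mono2) (auto simp: mult_ac)
    then have "(1 / (4 * \<gamma>)) powr (2 * r - 1) * (1 / x t) powr (2 * r - 1) * (\<mu>1 / 2) \<le> real N powr (2 * r - 1) * (\<mu>1 / 2)"
      using \<gamma> x mu_pos unfolding powr_mult[symmetric] by (intro mult_right_mono) auto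
    with 1 show "C * (1 / x t) powr (2 * r - 1) \<le> Hs_sum r (u t)" by (simp add: C_def mult_ac)
  qed
qed

lemma norm_growth:
  assumes r: "r > 1/2"
  shows "\<exists>C>0. \<exists>C'>0. \<forall>\<^sub>F t in at_infinity.
      1 / C * exp (C' * \<bar>t\<bar>) \<le> norm_Hs r (u t) \<and> norm_Hs r (u t) \<le> C * exp (C' * \<bar>t\<bar>)"
proof -
  obtain k c1 c2 where k: "k > 0" "c1 > 0" "c2 > 0"
    "\<And>t. c1 * exp (k * \<bar>t\<bar>) \<le> 1 / x t" "\<And>t. 1 / x t \<le> c2 * exp (k * \<bar>t\<bar>)" by (rule x_asymp) (rule that)
  obtain U where U: "U > 0" "\<And>t. Hs_sum r (u t) \<le> q + U * (1 / x t) powr (2 * r - 1)"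
    by (rule Hs_growth_upper[OF r]) (rule that)
  obtain L x0 where L: "L > 0" "x0 > 0" "\<And>t. x t \<le> x0 \<Longrightarrow> L * (1 / x t) powr (2 * r - 1) \<le> Hs_sum r (u t)"
    by (rule Hs_growth_lower[OF r]) (rule that)
  \<comment> \<open>Halved because \<open>Hs_sum\<close> is the square of the norm.\<close>
  define C' where "C' = k * (2 * r - 1) / 2"
  have C': "C' > 0" using k r by (simp add: C'_def)
  have ex: "(a * exp (k * \<bar>t\<bar>)) powr (2 * r - 1) = a powr (2 * r - 1) * (exp (C' * \<bar>t\<bar>))\<^sup>2" if "a > 0" for a t
  proof -
    have "exp (k * \<bar>t\<bar>) powr (2 * r - 1) = exp (2 * (C' * \<bar>t\<bar>))"
      by (simp add: powr_def C'_def field_simps)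
    also have "\<dots> = (exp (C' * \<bar>t\<bar>))\<^sup>2" by (simp add: exp_double)
    finally show ?thesis using that by (simp add: powr_mult)
  qed
  define P where "P = q + U * c2 powr (2 * r - 1)"
  define R where "R = L * c1 powr (2 * r - 1)"
  have PR: "P > 0" "R > 0" using mu_pos U k L by (simp_all add: P_def R_def add_pos_pos)
  have upper: "norm_Hs r (u t) \<le> sqrt P * exp (C' * \<bar>t\<bar>)" for t
  proof -
    have "Hs_sum r (u t) \<le> q + U * (c2 * exp (k * \<bar>t\<bar>)) powr (2 * r - 1)"
    proof -
      have "(1 / x t) powr (2 * r - 1) \<le> (c2 * exp (k * \<bar>t\<bar>)) powr (2 * r - 1)"
        using k(5)[of t] r x_bounds(1)[of t] by (intro powr_mono2) auto
      then show ?thesis using U(2)[of t] U(1) by (meson add_left_mono mult_left_mono less_imp_le order_trans)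
    qed
    also have "\<dots> \<le> q * (exp (C' * \<bar>t\<bar>))\<^sup>2 + U * (c2 powr (2 * r - 1) * (exp (C' * \<bar>t\<bar>))\<^sup>2)"
    proof -
      have "1 \<le> (exp (C' * \<bar>t\<bar>))\<^sup>2" using C' by (intro one_le_power) auto
      then have "q * 1 \<le> q * (exp (C' * \<bar>t\<bar>))\<^sup>2" using mu_pos by (intro mult_left_mono) auto
      then show ?thesis unfolding ex[OF k(3)] by simp
    qed
    also have "\<dots> = P * (exp (C' * \<bar>t\<bar>))\<^sup>2" by (simp add: P_def algebra_simps)
    finally have "sqrt (Hs_sum r (u t)) \<le> sqrt (P * (exp (C' * \<bar>t\<bar>))\<^sup>2)" by simp
    then show ?thesis unfolding norm_Hs_plus[OF u_L2_plus] by (simp add: real_sqrt_mult)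
  qed
  have lower: "sqrt R * exp (C' * \<bar>t\<bar>) \<le> norm_Hs r (u t)" if "x t \<le> x0" for t
  proof -
    have "R * (exp (C' * \<bar>t\<bar>))\<^sup>2 = L * (c1 * exp (k * \<bar>t\<bar>)) powr (2 * r - 1)" unfolding ex[OF k(2)] R_def by simp
    also have "\<dots> \<le> L * (1 / x t) powr (2 * r - 1)"
      using k(4)[of t] k(2) r L(1) by (intro mult_left_mono powr_mono2) auto
    also have "\<dots> \<le> Hs_sum r (u t)" by (rule L(3)[OF that])
    finally have "sqrt (R * (exp (C' * \<bar>t\<bar>))\<^sup>2) \<le> sqrt (Hs_sum r (u t))" by simp
    then show ?thesis unfolding norm_Hs_plus[OF u_L2_plus] by (simp add: real_sqrt_mult)
  qed
  \<comment> \<open>Beyond this time the bound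
    \<open>k * \<bar>t\<bar> \<le> exp (k * \<bar>t\<bar>)\<close> already pushes
    \<open>1 / x t\<close> above \<open>1 / x0\<close>.\<close>
  define T where "T = 1 / (k * c1 * x0)"
  have small: "x t \<le> x0" if "\<bar>t\<bar> \<ge> T" for t
  proof -
    have "1 / x0 = c1 * (k * T)" using k L by (simp add: T_def)
    also have "\<dots> \<le> c1 * (k * \<bar>t\<bar>)" using that k by (intro mult_left_mono) auto
    also have "\<dots> \<le> c1 * exp (k * \<bar>t\<bar>)" using exp_ge_add_one_self[of "k * \<bar>t\<bar>"] k by (intro mult_left_mono) linarith+
    also have "\<dots> \<le> 1 / x t" by (rule k(4))
    finally show ?thesis using x_bounds(1)[of t] L by (simp add: field_simps)
  qed
  define C where "C = max (sqrt P) (1 / sqrt R)"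
  have C: "C > 0" "sqrt P \<le> C" "1 / C \<le> sqrt R"
  proof -
    show "C > 0" "sqrt P \<le> C" using PR by (auto simp: C_def less_max_iff_disj)
    have "1 / sqrt R \<le> C" by (simp add: C_def)
    then show "1 / C \<le> sqrt R" using PR \<open>C > 0\<close> by (simp add: field_simps)
  qed
  show ?thesis
  proof (intro exI conjI)
    show "C > 0" "C' > 0" by fact+
    show "\<forall>\<^sub>F t in at_infinity. 1 / C * exp (C' * \<bar>t\<bar>) \<le> norm_Hs r (u t) \<and> norm_Hs r (u t) \<le> C * exp (C' * \<bar>t\<bar>)"
      unfolding eventually_at_infinity
    proof (intro exI allI impI conjI)
      fix t :: real assume "norm t \<ge> T"
      then have "sqrt R * exp (C' * \<bar>t\<bar>) \<le> norm_Hs r (u t)" by (intro lower small) simp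
      moreover have "1 / C * exp (C' * \<bar>t\<bar>) \<le> sqrt R * exp (C' * \<bar>t\<bar>)" using C by (intro mult_right_mono) auto
      ultimately show "1 / C * exp (C' * \<bar>t\<bar>) \<le> norm_Hs r (u t)" by linarith
      have "sqrt P * exp (C' * \<bar>t\<bar>) \<le> C * exp (C' * \<bar>t\<bar>)" using C by (intro mult_right_mono) auto
      then show "norm_Hs r (u t) \<le> C * exp (C' * \<bar>t\<bar>)" using upper[of t] by linarith
    qed
  qed
qed

lemma unbounded: "unbounded_Hs 1 u"
  unfolding unbounded_Hs_def
proof
  assume "bounded (range (\<lambda>t. norm_Hs 1 (u t)))"
  then obtain B where "\<forall>x\<in>range (\<lambda>t. norm_Hs 1 (u t)). norm x \<le> B" unfolding bounded_iff by blast
  then have B: "norm_Hs 1 (u t) \<le> B" for t by (auto dest: abs_le_D1)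
  have "(1::real) > 1 / 2" by simp
  from norm_growth[OF this] obtain C C' where C: "C > 0" "C' > 0" "\<forall>\<^sub>F t in at_infinity.
      1 / C * exp (C' * \<bar>t\<bar>) \<le> norm_Hs 1 (u t) \<and> norm_Hs 1 (u t) \<le> C * exp (C' * \<bar>t\<bar>)" by blast
  then obtain T where T: "\<And>t::real. \<bar>t\<bar> \<ge> T \<Longrightarrow> 1 / C * exp (C' * \<bar>t\<bar>) \<le> norm_Hs 1 (u t)"
    unfolding eventually_at_infinity real_norm_def by blast
  define t where "t = max \<bar>T\<bar> ((\<bar>B\<bar> * C) / C')"
  have "\<bar>t\<bar> \<ge> T" "t \<ge> 0" by (auto simp: t_def)
  then have "1 / C * exp (C' * t) \<le> B" using T[of t] B[of t] by simp
  moreover have "\<bar>B\<bar> * C + 1 \<le> exp (C' * t)"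
  proof -
    have "\<bar>B\<bar> * C = C' * ((\<bar>B\<bar> * C) / C')" using C by simp
    also have "\<dots> \<le> C' * t" using C by (intro mult_left_mono) (auto simp: t_def)
    finally show ?thesis using exp_ge_add_one_self[of "C' * t"] by linarith
  qed
  ultimately have "\<bar>B\<bar> * C + 1 \<le> B * C" using C by (simp add: field_simps)
  moreover have "B * C \<le> \<bar>B\<bar> * C" using C by (intro mult_right_mono) auto
  ultimately show False by linarith
qed

end

section \<open>The growth dichotomy\<close>

theorem theorem3:
  fixes u :: "real \<Rightarrow> circ_fun" and s0 :: real
  assumes "s0 > 1/2"
    and "szego_solution s0 u"
    and "\<And>t. u t \<in> V_rk 4"
  shows "(\<forall>t. ((\<exists>s>1/2. unbounded_Hs s u) \<longleftrightarrow> two_simple_eigenvalues (u t) \<and> ell 1 (u t) = 0) \<and>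
              (two_simple_eigenvalues (u t) \<longrightarrow>
                 (ell 1 (u t) = 0 \<longleftrightarrow>
                  (cmod (szego_J (u t)))\<^sup>2 = (szego_Q (u t))\<^sup>2 * (szego_Q (u t) + sigma_sq (u t) 2)))) \<and>
         ((\<exists>s>1/2. unbounded_Hs s u) \<longrightarrow>
            (\<forall>s>1/2. \<exists>C>0. \<exists>C'>0. \<forall>\<^sub>F t in at_infinity.
               1 / C * exp (C' * \<bar>t\<bar>) \<le> norm_Hs s (u t) \<and> norm_Hs s (u t) \<le> C * exp (C' * \<bar>t\<bar>)))"
proof -
  interpret szego_curve u s0 using assms by unfold_locales
  obtain E1 E2 \<sigma>1 \<sigma>2 s d where "hankel_pair (u t) (E1 t) (E2 t) (\<sigma>1 t) (\<sigma>2 t) (s t) (d t)" for t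
    using hankel_pair_ex by metis
  then interpret szego_data u s0 E1 E2 \<sigma>1 \<sigma>2 s d
    by (intro szego_data.intro szego_data_axioms.intro szego_curve_axioms)
  have zero: "zero_ell_data u s0 E1 E2 \<sigma>1 \<sigma>2 s d" if "m1 0 \<noteq> m2 0" "K = (Q 0)\<^sup>2 * (Q 0 + m2 0)"
    using that by (intro zero_ell_data.intro zero_ell_data_axioms.intro szego_data_axioms)
  \<comment> \<open>\<open>bounded_double\<close> and \<open>bounded_simple\<close> cover the
    complement of the growth condition; under it, \<open>zero_ell_data.unbounded\<close> exhibits
    growth at exponent 1.\<close>
  have iff: "(\<exists>s>1/2. unbounded_Hs s u) \<longleftrightarrow> m1 0 \<noteq> m2 0 \<and> K = (Q 0)\<^sup>2 * (Q 0 + m2 0)"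
  proof
    assume "\<exists>s>1/2. unbounded_Hs s u"
    then obtain r where r: "r > 1/2" "\<not> bounded (range (\<lambda>t. norm_Hs r (u t)))" by (auto simp: unbounded_Hs_def)
    show "m1 0 \<noteq> m2 0 \<and> K = (Q 0)\<^sup>2 * (Q 0 + m2 0)"
      using bounded_double[OF _ r(1)] bounded_simple[OF _ _ r(1)] r(2) by blast
  next
    assume *: "m1 0 \<noteq> m2 0 \<and> K = (Q 0)\<^sup>2 * (Q 0 + m2 0)"
    have "unbounded_Hs 1 u" by (rule zero_ell_data.unbounded[OF zero]) (use * in blast)+
    then show "\<exists>s>1/2. unbounded_Hs s u" by (intro exI[of _ 1]) simp
  qed
  have ell: "ell 1 (u t) = 0 \<longleftrightarrow> K = (Q 0)\<^sup>2 * (Q 0 + m2 0)" if "m1 0 \<noteq> m2 0" for t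
    using ell_eq[OF that, of t] that by auto
  have sig: "(cmod (szego_J (u t)))\<^sup>2 = (szego_Q (u t))\<^sup>2 * (szego_Q (u t) + sigma_sq (u t) 2) \<longleftrightarrow> K = (Q 0)\<^sup>2 * (Q 0 + m2 0)"
    if "m1 0 \<noteq> m2 0" for t
  proof -
    have "\<sigma>1 t \<noteq> \<sigma>2 t" using that m_const[of t] by (auto simp: m1_def m2_def)
    then have "sigma_sq (u t) 2 = m2 0" using hankel_pair.sigma_sq_simple(2)[OF hp, of t] m_const[of t] by (simp add: m2_def)
    then show ?thesis using J_norm[of t] Q_const[of t] by (simp add: J_def Q_def)
  qed
  show ?thesis
  proof (intro conjI allI impI)
    show "(\<exists>s>1/2. unbounded_Hs s u) \<longleftrightarrow> two_simple_eigenvalues (u t) \<and> ell 1 (u t) = 0" for t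
      unfolding iff two_simple using ell by blast
    show "ell 1 (u t) = 0 \<longleftrightarrow> (cmod (szego_J (u t)))\<^sup>2 = (szego_Q (u t))\<^sup>2 * (szego_Q (u t) + sigma_sq (u t) 2)"
      if "two_simple_eigenvalues (u t)" for t
      using that ell[of t] sig[of t] unfolding two_simple by blast
    show "\<exists>C>0. \<exists>C'>0. \<forall>\<^sub>F t in at_infinity.
               1 / C * exp (C' * \<bar>t\<bar>) \<le> norm_Hs s (u t) \<and> norm_Hs s (u t) \<le> C * exp (C' * \<bar>t\<bar>)"
      if "\<exists>s>1/2. unbounded_Hs s u" "s > 1/2" for s
      by (rule zero_ell_data.norm_growth[OF zero]) (use that iff in blast)+
  qed
qed

end
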